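(* Let $-\infty<\tau<T$ and let $K\subseteq\mathbb R^N$ be compact. There exist a constant $\mu>0$ depending only on $\nu$ (and $B$) and a constant $c>0$ depending on $K,\tau,T$ (and $\nu$, $B$) such that for every $u\in\mathcal S^0(\tau;T)$ with $\mathcal Lu\in\mathcal D(S_T)$, every $1\le i,j\le q$ and every $(x_1,t_1),(x_2,t_2)\in K\times[\tau,T]$, $$|\partial^2_{x_ix_j}u(x_1,t_1)-\partial^2_{x_ix_j}u(x_2,t_2)|\le c\Big\{\mathcal M_{\mathcal Lu,S_T}\big(c(d((x_1,t_1),(x_2,t_2))+|t_1-t_2|^{1/q_N})\big)+\mathcal U^\mu_{\mathcal Lu,S_T}(\sqrt{|t_2-t_1|})\Big\}.$$ In particular, $\partial^2_{x_ix_j}u$ is locally uniformly continuous in the joint variables $(x,t)$.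
   Context: Fix integers $1\le q\le N$ and a constant real $N\times N$ matrix $B$ of the block form: there are integers $m_0=q\ge m_1\ge\cdots\ge m_k\ge1$ with $\sum m_j=N$ such that the only nonzero blocks of $B$ are blocks $B_j$ of size $m_j\times m_{j-1}$ and rank $m_j$ in block-row $j+1$, block-column $j$. $E(t)=\exp(-tB)$, $Y=\sum_{j,k}b_{jk}x_k\partial_{x_j}-\partial_t$. Exponents $(q_1,\dots,q_N)$: $m_0$ ones, then $m_1$ threes, \dots, $m_k$ entries $2k+1$ (so $q_N=2k+1$ is the largest). $\|x\|=\sum_{i=1}^N|x_i|^{1/q_i}$; $d((x,t),(y,s))=\|x-E(t-s)y\|+\sqrt{|t-s|}$. $S_T=\mathbb R^N\times(-\infty,T)$. For $f\in L^\infty(S_T)$, $\omega_{f,S_T}(r)=\sup\{|f(x,t)-f(y,t)|:(x,t),(y,t)\in S_T,\ \|x-y\|\le r\}$; $f\in\mathcal D(S_T)$ if $\int_0^1\frac{\omega_{f,S_T}(r)}{r}dr<\infty$. $\mathcal M_{f,S_T}(r)=\omega_{f,S_T}(r)+\int_0^r\frac{\omega_{f,S_T}(s)}{s}ds+r\int_r^\infty\frac{\omega_{f,S_T}(s)}{s^2}ds$; for $\mu>0$, $\mathcal U^\mu_{f,S_T}(r)=\int_{\mathbb R^N}e^{-\mu|z|^2}\Big(\int_0^{r\|z\|}\frac{\omega_{f,S_T}(s)}{s}ds\Big)dz$. Operator with time-dependent coefficients: $a_{ij}(t)$ ($1\le i,j\le q$) bounded measurable on $\mathbb R$, $A_0(t)=(a_{ij}(t))$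 symmetric with $\nu|\zeta|^2\le\langle A_0(t)\zeta,\zeta\rangle\le\nu^{-1}|\zeta|^2$ for all $\zeta\in\mathbb R^q$ and a.e. $t$, for some $\nu>0$; $\mathcal Lu=\sum_{i,j=1}^qa_{ij}(t)\partial^2_{x_ix_j}u+Yu$. $\mathcal S^0(S_T)$: functions $u:\overline{S_T}\to\mathbb R$ with $u\in C(\overline{S_T})\cap L^\infty(S_T)$ and $\partial_{x_i}u,\partial^2_{x_ix_j}u$ ($1\le i,j\le q$), $Yu$ in $L^\infty(S_T)$ (distributional derivatives). For $\tau<T$, $\mathcal S^0(\tau;T)$ is the set of $u\in\mathcal S^0(S_T)$ with $u(x,t)=0$ for all $t\le\tau$. *)

theory Defs
  imports "HOL-Analysis.Analysis"
begin


text \<open>Coordinates of R^N are indexed by a finite linearly ordered type 'n; the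
  position (0-based) of an index in the order is kpos. The block sizes
  m_0 = q, m_1, ..., m_k are given as the list ms.\<close>

definition kpos :: "'n::{finite,linorder} \<Rightarrow> nat" where
  "kpos i = card {j. j < i}"

definition kblk :: "nat list \<Rightarrow> nat \<Rightarrow> nat" where
  "kblk ms p = (LEAST j. p < sum_list (take (Suc j) ms))"

definition kqexp :: "nat list \<Rightarrow> 'n::{finite,linorder} \<Rightarrow> nat" where
  "kqexp ms i = 2 * kblk ms (kpos i) + 1"

definition kqN :: "nat list \<Rightarrow> nat" where
  "kqN ms = 2 * (length ms - 1) + 1"

definition first_vars :: "nat list \<Rightarrow> 'n::{finite,linorder} set" where
  "first_vars ms = {i. kpos i < ms ! 0}"

definition block_structure :: "nat list \<Rightarrow> ((real, 'n::{finite,linorder}) vec, 'n::{finite,linorder}) vec \<Rightarrow> bool" where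
  "block_structure ms B \<longleftrightarrow>
     ms \<noteq> [] \<and>
     (\<forall>j. Suc j < length ms \<longrightarrow> ms ! (Suc j) \<le> ms ! j) \<and>
     (\<forall>j < length ms. 1 \<le> ms ! j) \<and>
     sum_list ms = CARD('n::{finite,linorder}) \<and>
     (\<forall>i l. kblk ms (kpos i) \<noteq> Suc (kblk ms (kpos l)) \<longrightarrow> B $ i $ l = 0) \<and>
     (\<forall>j. 1 \<le> j \<and> j < length ms \<longrightarrow>
        rank (\<chi> i l. if kblk ms (kpos i) = j then B $ i $ l else 0) = ms ! j)"

fun mpow :: "((real, 'n::{finite,linorder}) vec, 'n::{finite,linorder}) vec \<Rightarrow> nat \<Rightarrow> ((real, 'n::{finite,linorder}) vec, 'n::{finite,linorder}) vec" where
  "mpow A 0 = mat 1"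
| "mpow A (Suc k) = A ** mpow A k"

definition mexp :: "((real, 'n::{finite,linorder}) vec, 'n::{finite,linorder}) vec \<Rightarrow> ((real, 'n::{finite,linorder}) vec, 'n::{finite,linorder}) vec" where
  "mexp A = (\<Sum>k. (1 / fact k) *\<^sub>R mpow A k)"

definition Emat :: "((real, 'n::{finite,linorder}) vec, 'n::{finite,linorder}) vec \<Rightarrow> real \<Rightarrow> ((real, 'n::{finite,linorder}) vec, 'n::{finite,linorder}) vec" where
  "Emat B t = mexp ((- t) *\<^sub>R B)"

definition qnorm :: "nat list \<Rightarrow> (real, 'n::{finite,linorder}) vec \<Rightarrow> real" where
  "qnorm ms x = (\<Sum>i\<in>UNIV. \<bar>x $ i\<bar> powr (1 / real (kqexp ms i)))"

definition qdist :: "nat list \<Rightarrow> ((real, 'n::{finite,linorder}) vec, 'n::{finite,linorder}) vec \<Rightarrow>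
    ((real, 'n::{finite,linorder}) vec) \<times> real \<Rightarrow> ((real, 'n::{finite,linorder}) vec) \<times> real \<Rightarrow> real" where
  "qdist ms B p p' = qnorm ms (fst p - Emat B (snd p - snd p') *v fst p')
                      + sqrt \<bar>snd p - snd p'\<bar>"

definition ST :: "real \<Rightarrow> (((real, 'n::{finite,linorder}) vec) \<times> real) set" where
  "ST T = {p. snd p < T}"

definition omega :: "nat list \<Rightarrow> real \<Rightarrow> (((real, 'n::{finite,linorder}) vec) \<times> real \<Rightarrow> real)
    \<Rightarrow> real \<Rightarrow> real" where
  "omega ms T f r = Sup {\<bar>f (x, t) - f (y, t)\<bar> | x y t. t < T \<and> qnorm ms (x - y) \<le> r}"

text \<open>f in L^infinity(S_T) (a bounded measurable version) with Dini condition\<close>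
definition inD :: "nat list \<Rightarrow> real \<Rightarrow> (((real, 'n::{finite,linorder}) vec) \<times> real \<Rightarrow> real) \<Rightarrow> bool" where
  "inD ms T f \<longleftrightarrow> set_borel_measurable lborel (ST T) f \<and> bounded (f ` ST T) \<and>
     (\<lambda>r. omega ms T f r / r) integrable_on {0..1}"

definition Mfun :: "nat list \<Rightarrow> real \<Rightarrow> (((real, 'n::{finite,linorder}) vec) \<times> real \<Rightarrow> real)
    \<Rightarrow> real \<Rightarrow> real" where
  "Mfun ms T f r = omega ms T f r + integral {0..r} (\<lambda>s. omega ms T f s / s)
      + r * integral {r..} (\<lambda>s. omega ms T f s / s ^ 2)"

definition Ufun :: "nat list \<Rightarrow> real \<Rightarrow> real \<Rightarrow> (((real, 'n::{finite,linorder}) vec) \<times> real \<Rightarrow> real)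
    \<Rightarrow> real \<Rightarrow> real" where
  "Ufun ms T \<mu> f r = integral (UNIV :: ((real, 'n::{finite,linorder}) vec) set)
      (\<lambda>z. exp (- \<mu> * (norm z)\<^sup>2) * integral {0 .. r * qnorm ms z} (\<lambda>s. omega ms T f s / s))"

fun Ck_on :: "nat \<Rightarrow> 'a::euclidean_space set \<Rightarrow> ('a \<Rightarrow> real) \<Rightarrow> bool" where
  "Ck_on 0 S f = continuous_on S f"
| "Ck_on (Suc k) S f = (continuous_on S f \<and> (\<exists>f'. (\<forall>x\<in>S. (f has_derivative f' x) (at x)) \<and>
        (\<forall>v. Ck_on k S (\<lambda>x. f' x v))))"

text \<open>test functions C_c^infinity(Omega), extended by zero to the whole space\<close>
definition test_fun :: "'a::euclidean_space set \<Rightarrow> ('a \<Rightarrow> real) \<Rightarrow> bool" where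
  "test_fun \<Omega> \<phi> \<longleftrightarrow> (\<forall>k. Ck_on k UNIV \<phi>) \<and> compact (closure {p. \<phi> p \<noteq> 0}) \<and>
     closure {p. \<phi> p \<noteq> 0} \<subseteq> \<Omega>"

definition dd :: "'a::real_normed_vector \<Rightarrow> ('a \<Rightarrow> real) \<Rightarrow> 'a \<Rightarrow> real" where
  "dd v \<phi> p = deriv (\<lambda>s. \<phi> (p + s *\<^sub>R v)) 0"

definition xdir :: "'n::{finite,linorder} \<Rightarrow> ((real, 'n::{finite,linorder}) vec) \<times> real" where
  "xdir i = (axis i 1, 0)"

definition tdir :: "((real, 'n::{finite,linorder}) vec) \<times> real" where
  "tdir = (0, 1)"

definition Linf :: "(((real, 'n::{finite,linorder}) vec) \<times> real) set \<Rightarrow> (((real, 'n::{finite,linorder}) vec) \<times> real \<Rightarrow> real) \<Rightarrow> bool" where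
  "Linf \<Omega> g \<longleftrightarrow> set_borel_measurable lborel \<Omega> g \<and>
     (\<exists>C. AE p in lborel. p \<in> \<Omega> \<longrightarrow> \<bar>g p\<bar> \<le> C)"

definition weak_dx :: "(((real, 'n::{finite,linorder}) vec) \<times> real) set \<Rightarrow> (((real, 'n::{finite,linorder}) vec) \<times> real \<Rightarrow> real) \<Rightarrow> 'n::{finite,linorder}
    \<Rightarrow> (((real, 'n::{finite,linorder}) vec) \<times> real \<Rightarrow> real) \<Rightarrow> bool" where
  "weak_dx \<Omega> u i g \<longleftrightarrow> Linf \<Omega> g \<and> (\<forall>\<phi>. test_fun \<Omega> \<phi> \<longrightarrow>
     (LINT p:\<Omega>|lborel. u p * dd (xdir i) \<phi> p) = - (LINT p:\<Omega>|lborel. g p * \<phi> p))"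

definition weak_dxx :: "(((real, 'n::{finite,linorder}) vec) \<times> real) set \<Rightarrow> (((real, 'n::{finite,linorder}) vec) \<times> real \<Rightarrow> real) \<Rightarrow> 'n::{finite,linorder} \<Rightarrow> 'n::{finite,linorder}
    \<Rightarrow> (((real, 'n::{finite,linorder}) vec) \<times> real \<Rightarrow> real) \<Rightarrow> bool" where
  "weak_dxx \<Omega> u i j g \<longleftrightarrow> Linf \<Omega> g \<and> (\<forall>\<phi>. test_fun \<Omega> \<phi> \<longrightarrow>
     (LINT p:\<Omega>|lborel. u p * dd (xdir i) (dd (xdir j) \<phi>) p) = (LINT p:\<Omega>|lborel. g p * \<phi> p))"

text \<open>g is an L^infinity weak (distributional) Y u on Omega,
  Y = sum_{j,k} b_jk x_k d/dx_j - d/dt\<close>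
definition weak_Y :: "((real, 'n::{finite,linorder}) vec, 'n::{finite,linorder}) vec \<Rightarrow> (((real, 'n::{finite,linorder}) vec) \<times> real) set \<Rightarrow> (((real, 'n::{finite,linorder}) vec) \<times> real \<Rightarrow> real)
    \<Rightarrow> (((real, 'n::{finite,linorder}) vec) \<times> real \<Rightarrow> real) \<Rightarrow> bool" where
  "weak_Y B \<Omega> u g \<longleftrightarrow> Linf \<Omega> g \<and> (\<forall>\<phi>. test_fun \<Omega> \<phi> \<longrightarrow>
     (LINT p:\<Omega>|lborel. u p * (- (\<Sum>j\<in>UNIV. dd (xdir j) (\<lambda>p'. (\<Sum>k\<in>UNIV. B $ j $ k * fst p' $ k) * \<phi> p') p)
                              + dd tdir \<phi> p))
     = (LINT p:\<Omega>|lborel. g p * \<phi> p))"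

definition S0 :: "nat list \<Rightarrow> ((real, 'n::{finite,linorder}) vec, 'n::{finite,linorder}) vec \<Rightarrow> real \<Rightarrow> (((real, 'n::{finite,linorder}) vec) \<times> real \<Rightarrow> real) \<Rightarrow> bool" where
  "S0 ms B T u \<longleftrightarrow> continuous_on {p. snd p \<le> T} u \<and> bounded (u ` ST T) \<and>
     (\<forall>i\<in>first_vars ms. \<exists>g. weak_dx (ST T) u i g) \<and>
     (\<forall>i\<in>first_vars ms. \<forall>j\<in>first_vars ms. \<exists>g. weak_dxx (ST T) u i j g) \<and>
     (\<exists>g. weak_Y B (ST T) u g)"

definition S0tau :: "nat list \<Rightarrow> ((real, 'n::{finite,linorder}) vec, 'n::{finite,linorder}) vec \<Rightarrow> real \<Rightarrow> real
    \<Rightarrow> (((real, 'n::{finite,linorder}) vec) \<times> real \<Rightarrow> real) \<Rightarrow> bool" where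
  "S0tau ms B \<tau> T u \<longleftrightarrow> S0 ms B T u \<and> (\<forall>x t. t \<le> \<tau> \<longrightarrow> u (x, t) = 0)"

definition elliptic :: "nat list \<Rightarrow> real \<Rightarrow> (real \<Rightarrow> 'n::{finite,linorder} \<Rightarrow> 'n::{finite,linorder} \<Rightarrow> real) \<Rightarrow> bool" where
  "elliptic ms \<nu> a \<longleftrightarrow>
     (\<forall>i\<in>first_vars ms. \<forall>j\<in>first_vars ms.
        (\<lambda>t. a t i j) \<in> borel_measurable lborel \<and> bounded (range (\<lambda>t. a t i j)) \<and>
        (\<forall>t. a t i j = a t j i)) \<and>
     (AE t in lborel. \<forall>\<zeta>::'n::{finite,linorder} \<Rightarrow> real.
        \<nu> * (\<Sum>i\<in>first_vars ms. (\<zeta> i)\<^sup>2) \<le> (\<Sum>i\<in>first_vars ms. \<Sum>j\<in>first_vars ms. a t i j * \<zeta> i * \<zeta> j) \<and>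
        (\<Sum>i\<in>first_vars ms. \<Sum>j\<in>first_vars ms. a t i j * \<zeta> i * \<zeta> j) \<le> (1 / \<nu>) * (\<Sum>i\<in>first_vars ms. (\<zeta> i)\<^sup>2))"

definition is_Lu :: "nat list \<Rightarrow> ((real, 'n::{finite,linorder}) vec, 'n::{finite,linorder}) vec \<Rightarrow> real \<Rightarrow> (real \<Rightarrow> 'n::{finite,linorder} \<Rightarrow> 'n::{finite,linorder} \<Rightarrow> real)
    \<Rightarrow> (((real, 'n::{finite,linorder}) vec) \<times> real \<Rightarrow> real) \<Rightarrow> (((real, 'n::{finite,linorder}) vec) \<times> real \<Rightarrow> real) \<Rightarrow> bool" where
  "is_Lu ms B T a u f \<longleftrightarrow> (\<exists>g h.
     (\<forall>i\<in>first_vars ms. \<forall>j\<in>first_vars ms. weak_dxx (ST T) u i j (g i j)) \<and>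
     weak_Y B (ST T) u h \<and>
     (AE p in lborel. p \<in> ST T \<longrightarrow>
        f p = (\<Sum>i\<in>first_vars ms. \<Sum>j\<in>first_vars ms. a (snd p) i j * g i j p) + h p))"

end

(*
In coordinates moving with the drift the equation becomes a heat equation in time t with a
degenerate, time dependent diffusion matrix. Averaging u(., s) with the Gaussian of covariance
proportional to the fundamental solution at scale t - s (with the smaller ellipticity constant)
gives a quantity that satisfies a maximum principle: the defect of the diffusion matrices is
positive semidefinite. Applied to iterated differences of u with shifts of anisotropic size rho,
for which the averaged right-hand side at scale R >= rho is of size (rho / R)^3 w(R), it bounds
third differences of u, and single differences in the higher blocks, by a constant times
rho^2 * N(rho), where N(r) = r * integral of w(s) / s^2 over s >= r and w is the modulus of
continuity of Lu in space. A telescoping sum over dyadic r then shows that the second difference quotients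
Q_r converge with error at most a constant times Phi(r) = integral_0^r w(s) / s ds + N(r), and
third differences give the modulus of continuity in space. For the modulus in time the second difference of the equation is
integrated over a time interval of length r^2, and the displacement by the drift costs
only differences in the higher blocks. Since M = w + Phi, the term U and the power of |t1 - t2| only
enlarge the right-hand side, and the constant does not depend on K, tau, T.
*)
theory Submission
  imports Defs
begin

section \<open>The matrix exponential and the anisotropic dilations\<close>

text \<open>The coefficients are only measurable in time, so the equation is used in integrated
  form. The comparison Gaussian belongs to the model with diffusion \<nu> times the projection onto
  the first block; its covariance is explicit because \<open>B\<close> is nilpotent and the entries
  of \<open>E\<close> are monomials. The maximum principle is proved by time steps: a step of length
  \<delta> is an average over shifts of size sqrt \<delta> up to an error \<delta>^(3/2), which
  vanishes in the sum over the steps. Order three is dictated by scaling. The time slab at distance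
  R^2 has length of order R^2, so a gain (rho / R)^3 leaves rho^3 w(R) / R, and the dyadic sum is
  rho^3 times the integral of w(s) / s^2; two differences would leave the sum of w(R), which need
  not stay bounded. A shift in a higher block has size (rho / R)^3 after rescaling, so one such
  shift is enough. As the sum over all scales converges, the time elapsed since \<tau> enters no
  constant. Mollifying in space only, in moving coordinates, makes space derivatives classical,
  while the difference bounds do not depend on the mollifier.\<close>

lemma mpow_commute: "A ** mpow A k = mpow A k ** A"
  by (induction k) (auto simp: matrix_mul_assoc)

lemma mpow_scaleR: "mpow (c *\<^sub>R A) k = c ^ k *\<^sub>R mpow A k"
  by (induction k) (auto simp: vec_eq_iff matrix_matrix_mult_def sum_distrib_left mult_ac)

lemma kpos_less: "kpos (i::'n::{finite,linorder}) < CARD('n)"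
  unfolding kpos_def by (rule psubset_card_mono) auto

lemma inj_kpos: "inj (kpos :: 'n::{finite,linorder} \<Rightarrow> nat)"
proof (rule injI)
  fix i j :: 'n assume e: "kpos i = kpos j"
  have "kpos i < kpos j" if "i < j" for i j :: 'n
    unfolding kpos_def by (rule psubset_card_mono) (use that in \<open>auto dest: less_trans\<close>)
  then show "i = j" using e by (metis less_irrefl neqE)
qed

text \<open>A nontrivial relation expresses row \<open>k\<close> through the other rows indexed by
  \<open>J\<close>, so card J - 1 vectors span the row space. Read contrapositively, this turns the
  rank condition on a block of \<open>B\<close> into linear independence of its rows.\<close>

lemma dim_rows_lt:
  fixes A :: "real^'m^'n"
  assumes z: "\<And>i. i \<notin> J \<Longrightarrow> row i A = 0"
    and lin: "(\<Sum>i\<in>J. \<xi> i *\<^sub>R row i A) = 0" and k: "k \<in> J" "\<xi> k \<noteq> 0"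
  shows "rank A < card (J :: 'n set)"
proof -
  let ?W = "(\<lambda>i. row i A) ` (J - {k})"
  have "\<xi> k *\<^sub>R row k A = - (\<Sum>i\<in>J-{k}. \<xi> i *\<^sub>R row i A)"
    using lin k by (subst (asm) sum.remove[of _ k]) (auto simp: eq_neg_iff_add_eq_0)
  then have "row k A = (- 1 / \<xi> k) *\<^sub>R (\<Sum>i\<in>J-{k}. \<xi> i *\<^sub>R row i A)"
    using k(2) by (simp add: divide_inverse scaleR_scaleR flip: scaleR_minus_right)
      (metis (no_types) left_inverse scaleR_one scaleR_scaleR)
  moreover have "(\<Sum>i\<in>J-{k}. \<xi> i *\<^sub>R row i A) \<in> span ?W"
    by (intro span_sum span_scale span_base) auto
  ultimately have rk: "row k A \<in> span ?W"
    by (simp only: span_scale)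
  have "rows A \<subseteq> span ?W"
  proof
    fix v assume "v \<in> rows A"
    then obtain i where v: "v = row i A" by (auto simp: rows_def)
    show "v \<in> span ?W"
      using z[of i] rk v by (cases "i \<in> J"; cases "i = k") (auto intro: span_base span_zero)
  qed
  then have "dim (rows A) \<le> card ?W" by (rule dim_le_card) auto
  also have "\<dots> \<le> card (J - {k})" by (rule card_image_le) auto
  also have "\<dots> < card J" using k by (intro psubset_card_mono) auto
  finally show ?thesis by (simp add: row_rank_def)
qed

text \<open>Only \<open>ms\<close>, \<open>B\<close> and \<open>\<nu>\<close> are fixed here. Every
  constant defined in this locale is therefore independent of the coefficients, of the solution and
  of the time interval, which is how uniformity of the final constant is ensured.\<close>

locale kolmogorov =
  fixes ms :: "nat list" and B :: "((real, 'n::{finite,linorder}) vec, 'n) vec" and \<nu> :: real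
  assumes blocks: "block_structure ms B" and nu_pos: "\<nu> > 0"
begin

abbreviation b :: "'n \<Rightarrow> nat" where "b i \<equiv> kblk ms (kpos i)"
abbreviation E :: "real \<Rightarrow> ((real, 'n) vec, 'n) vec" where "E \<equiv> Emat B"
abbreviation F :: "'n set" where "F \<equiv> first_vars ms"

lemma ms_ne: "ms \<noteq> []" and ms_pos: "j < length ms \<Longrightarrow> 1 \<le> ms ! j"
  and sum_ms: "sum_list ms = CARD('n)"
  and B_zero: "b i \<noteq> Suc (b l) \<Longrightarrow> B $ i $ l = 0"
  and B_rank: "1 \<le> j \<Longrightarrow> j < length ms \<Longrightarrow>
        rank (\<chi> i l. if b i = j then B $ i $ l else 0) = ms ! j"
  using blocks unfolding block_structure_def by auto

lemma b_bounds:
  shows "sum_list (take (b i) ms) \<le> kpos i" "kpos i < sum_list (take (Suc (b i)) ms)"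
    and b_less: "b i < length ms"
proof -
  \<comment> \<open>The sum over all blocks equals CARD('n), so an index as in \<open>kblk\<close>
    exists and the LEAST is attained.\<close>
  have ex: "kpos i < sum_list (take (Suc (length ms - 1)) ms)"
    using kpos_less[of i] sum_ms ms_ne by simp
  then have le: "b i \<le> length ms - 1" unfolding kblk_def by (rule Least_le)
  then show "b i < length ms" using ms_ne by (cases ms) auto
  show "kpos i < sum_list (take (Suc (b i)) ms)"
    unfolding kblk_def by (rule LeastI) (rule ex)
  show "sum_list (take (b i) ms) \<le> kpos i"
  proof (cases "b i")
    case (Suc m)
    then have "\<not> kpos i < sum_list (take (Suc m) ms)"
      unfolding kblk_def by (metis lessI not_less_Least)
    then show ?thesis using Suc by simp
  qed auto
qed

lemma first_vars_b: "i \<in> F \<longleftrightarrow> b i = 0"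
proof
  assume "i \<in> F"
  then have "kpos i < sum_list (take (Suc 0) ms)"
    using ms_ne by (cases ms) (auto simp: first_vars_def)
  then show "b i = 0" unfolding kblk_def by (metis Least_le le_zero_eq)
next
  assume "b i = 0"
  then show "i \<in> F" using b_bounds(2)[of i] ms_ne by (cases ms) (auto simp: first_vars_def)
qed

text \<open>Positions are injective, and those of block j lie between two consecutive partial sums
  of \<open>ms\<close>, whose gap is \<open>ms ! j\<close>.\<close>

lemma card_block_le: assumes "j < length ms" shows "card {i. b i = j} \<le> ms ! j"
proof -
  have "kpos ` {i. b i = j} \<subseteq> {sum_list (take j ms) ..< sum_list (take (Suc j) ms)}"
    using b_bounds by auto
  then have "card (kpos ` {i. b i = j}) \<le> sum_list (take (Suc j) ms) - sum_list (take j ms)"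
    by (metis card_atLeastLessThan card_mono finite_atLeastLessThan)
  also have "\<dots> = ms ! j" using assms by (simp add: take_Suc_conv_app_nth)
  finally show ?thesis by (subst (asm) card_image) (auto intro: inj_on_subset[OF inj_kpos])
qed

text \<open>The block has rank \<open>ms ! j\<close> and at most that many rows that can be nonzero,
  so none of them can depend on the others.\<close>

lemma block_rows_independent:
  assumes j: "1 \<le> j" "j < length ms"
    and z: "\<And>l. (\<Sum>i\<in>{i. b i = j}. \<xi> i * B $ i $ l) = 0" and k: "b k = j"
  shows "\<xi> k = 0"
proof (rule ccontr)
  assume nz: "\<xi> k \<noteq> 0"
  let ?A = "\<chi> i l. if b i = j then B $ i $ l else 0"
  have "rank ?A < card {i. b i = j}"
  proof (rule dim_rows_lt[where k = k and \<xi> = \<xi>])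
    show "(\<Sum>i\<in>{i. b i = j}. \<xi> i *\<^sub>R row i ?A) = 0"
      using z by (simp add: vec_eq_iff row_def)
  qed (use nz k in \<open>auto simp: row_def vec_eq_iff\<close>)
  then show False using B_rank[OF j] card_block_le[OF j(2)] by simp
qed

text \<open>Each factor \<open>B\<close> raises the block index by exactly one. Hence
  \<open>B\<close> is nilpotent, and each pair of blocks is joined by at most one power.\<close>

lemma mpow_zero: "b i \<noteq> b l + k \<Longrightarrow> mpow B k $ i $ l = 0"
proof (induction k arbitrary: i)
  case 0 then show ?case by (auto simp: mat_def)
next
  case (Suc k)
  have "B $ i $ m * mpow B k $ m $ l = 0" for m
    using Suc.IH[of m] B_zero[of i m] Suc.prems by (cases "b m = b l + k") auto
  then show ?case by (auto simp: matrix_matrix_mult_def intro!: sum.neutral)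
qed

lemma mpow_big: "length ms \<le> k \<Longrightarrow> mpow B k = 0"
  by (auto simp: vec_eq_iff intro!: mpow_zero) (metis b_less add.commute le_add1 not_less order_trans)

text \<open>Nilpotency cuts the exponential series down to a polynomial, so no convergence question
  arises for \<open>E\<close>.\<close>

lemma Emat_sum: "E t = (\<Sum>k<length ms. ((- t) ^ k / fact k) *\<^sub>R mpow B k)"
proof -
  have "E t = (\<Sum>k. ((- t) ^ k / fact k) *\<^sub>R mpow B k)"
    unfolding Emat_def mexp_def mpow_scaleR by simp
  also have "\<dots> = (\<Sum>k<length ms. ((- t) ^ k / fact k) *\<^sub>R mpow B k)"
    by (rule suminf_finite) (auto simp: mpow_big)
  finally show ?thesis .
qed

lemma Emat_component: "E t $ i $ l = (\<Sum>k<length ms. ((- t) ^ k / fact k) * mpow B k $ i $ l)"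
  unfolding Emat_sum by simp

text \<open>Only the power \<open>b i - b l\<close> joins block \<open>b l\<close> to block
  \<open>b i\<close>, so each entry is a single monomial in t. This is the source of all homogeneity
  used later.\<close>

lemma Emat_entry: "E t $ i $ l = (if b l \<le> b i then ((- t) ^ (b i - b l) / fact (b i - b l)) * mpow B (b i - b l) $ i $ l else 0)"
proof -
  have "E t $ i $ l = (\<Sum>k<length ms. if k = b i - b l \<and> b l \<le> b i then ((- t) ^ k / fact k) * mpow B k $ i $ l else 0)"
    unfolding Emat_component by (rule sum.cong) (auto simp: mpow_zero)
  then show ?thesis
    using b_less[of i] by (cases "b l \<le> b i") (auto simp: less_imp_diff_less)
qed

lemma Emat_homogeneous: "E t $ i $ l = (if b l \<le> b i then t ^ (b i - b l) * E 1 $ i $ l else 0)"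
  unfolding Emat_entry[of t] Emat_entry[of 1] by (simp add: power_minus[of t])

lemma Emat_same_block: "b i = b l \<Longrightarrow> E t $ i $ l = (if i = l then 1 else 0)"
  unfolding Emat_entry by (simp add: mat_def)

lemma Emat_0 [simp]: "E 0 = mat 1"
  by (auto simp: vec_eq_iff Emat_entry power_0_left mat_def)

lemma Emat_mult_B: "(E t ** B) $ i $ j = (\<Sum>k<length ms. ((- t) ^ k / fact k) * mpow B (Suc k) $ i $ j)"
proof -
  have "(E t ** B) $ i $ j = (\<Sum>k<length ms. ((- t) ^ k / fact k) * (mpow B k ** B) $ i $ j)"
    unfolding matrix_matrix_mult_def vec_lambda_beta Emat_component
    by (simp only: sum_distrib_right sum_distrib_left mult.assoc) (rule sum.swap)
  then show ?thesis by (simp add: mpow_commute)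
qed

lemma Emat_commute: "E t ** B = B ** E t"
proof -
  have "(B ** E t) $ i $ j = (\<Sum>k<length ms. ((- t) ^ k / fact k) * (B ** mpow B k) $ i $ j)" for i j
    unfolding matrix_matrix_mult_def vec_lambda_beta Emat_component
    by (simp only: sum_distrib_right sum_distrib_left mult_ac) (rule sum.swap)
  then show ?thesis unfolding vec_eq_iff Emat_mult_B by simp
qed

lemma Emat_deriv: "((\<lambda>t. E t $ i $ j) has_real_derivative - ((E t ** B) $ i $ j)) (at t)"
proof -
  obtain L where L: "length ms = Suc L" using ms_ne by (cases ms) auto
  have "((\<lambda>t. \<Sum>k<Suc L. ((- t) ^ k / fact k) * mpow B k $ i $ j) has_real_derivative
      (\<Sum>k<Suc L. (- (real k * (- t) ^ (k - 1)) / fact k) * mpow B k $ i $ j)) (at t)"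
    by (auto intro!: derivative_eq_intros sum.cong)
  moreover have "(\<Sum>k<Suc L. (- (real k * (- t) ^ (k - 1)) / fact k) * mpow B k $ i $ j)
      = (\<Sum>k<L. - ((- t) ^ k / fact k) * mpow B (Suc k) $ i $ j)"
    by (subst sum.lessThan_Suc_shift) (auto simp del: of_nat_Suc intro!: sum.cong)
  \<comment> \<open>The index shift has dropped one term; the term k = L can be added because
    \<open>mpow B (Suc L)\<close> is zero.\<close>
  moreover have "\<dots> = (\<Sum>k<Suc L. - ((- t) ^ k / fact k) * mpow B (Suc k) $ i $ j)"
    using mpow_big[of "Suc L"] L by simp
  moreover have "\<dots> = - ((E t ** B) $ i $ j)"
    unfolding Emat_mult_B L by (simp add: sum_negf)
  ultimately show ?thesis unfolding Emat_component L by (simp only:)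
qed

lemma Emat_continuous [continuous_intros]: "continuous_on S (\<lambda>t. E t $ i $ j)"
  by (rule DERIV_continuous_on) (rule has_field_derivative_at_within[OF Emat_deriv])

text \<open>Since \<open>E\<close> commutes with \<open>B\<close>, the derivative of r \<mapsto> E
  (- r) ** E (r + t) vanishes, so this product keeps its value E t at r = 0.\<close>

lemma Emat_add: "E s ** E t = E (s + t)"
proof -
  have "(E (- r) ** E (r + t)) $ i $ j = (E 0 ** E t) $ i $ j" for r t i j
  proof -
    let ?f = "\<lambda>r. \<Sum>k\<in>UNIV. E (- r) $ i $ k * E (r + t) $ k $ j"
    have "(?f has_real_derivative (\<Sum>k\<in>UNIV. (E (- r) ** B) $ i $ k * E (r + t) $ k $ j
        - E (- r) $ i $ k * (E (r + t) ** B) $ k $ j)) (at r)" for r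
    proof (rule DERIV_sum)
      fix k
      have 1: "((\<lambda>r. E (- r) $ i $ k) has_real_derivative (E (- r) ** B) $ i $ k) (at r)"
        using Emat_deriv[of i k "- r"] by (simp add: DERIV_mirror)
      have 2: "((\<lambda>r. E (r + t) $ k $ j) has_real_derivative - (E (r + t) ** B) $ k $ j) (at r)"
        using Emat_deriv[of k j "r + t"] by (simp add: DERIV_shift)
      show "((\<lambda>r. E (- r) $ i $ k * E (r + t) $ k $ j) has_real_derivative
          (E (- r) ** B) $ i $ k * E (r + t) $ k $ j - E (- r) $ i $ k * (E (r + t) ** B) $ k $ j) (at r)"
        by (rule derivative_eq_intros 1 2)+ (simp add: algebra_simps)
    qed
    moreover have "(\<Sum>k\<in>UNIV. (E (- r) ** B) $ i $ k * E (r + t) $ k $ j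
        - E (- r) $ i $ k * (E (r + t) ** B) $ k $ j) = 0" for r
    proof -
      have "(\<Sum>k\<in>UNIV. (E (- r) ** B) $ i $ k * E (r + t) $ k $ j
          - E (- r) $ i $ k * (E (r + t) ** B) $ k $ j)
        = ((E (- r) ** B) ** E (r + t)) $ i $ j - (E (- r) ** (E (r + t) ** B)) $ i $ j"
        by (simp add: sum_subtractf matrix_matrix_mult_def[of "E (- r) ** B"] matrix_matrix_mult_def[of "E (- r)" "E (r + t) ** B"])
      then show ?thesis by (simp add: Emat_commute[of "r + t"] matrix_mul_assoc)
    qed
    ultimately have "(?f has_real_derivative 0) (at r)" for r by simp
    then have "?f r = ?f 0" by (rule DERIV_isconst_all[rule_format])
    then show ?thesis by (simp add: matrix_matrix_mult_def)
  qed
  then have "E (- r) ** E (r + t) = E t" for r t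
    by (simp add: vec_eq_iff)
  from this[of "- s" "s + t"] show ?thesis by simp
qed

lemma Emat_inv [simp]: "E t ** E (- t) = mat 1" "E (- t) ** E t = mat 1"
  by (simp_all add: Emat_add)

lemma Emat_mv: "E s *v (E t *v x) = E (s + t) *v x"
  by (simp add: matrix_vector_mul_assoc Emat_add)

text \<open>The anisotropic dilation by \<^term>\<open>r\<close>, for which \<^term>\<open>E (r\<^sup>2 * t)\<close> is conjugate to \<^term>\<open>E t\<close>.\<close>

definition dil :: "real \<Rightarrow> (real, 'n) vec \<Rightarrow> (real, 'n) vec" where
  "dil r z = (\<chi> i. r ^ (2 * b i + 1) * z $ i)"

lemma dil_nth [simp]: "dil r z $ i = r ^ (2 * b i + 1) * z $ i"
  by (simp add: dil_def)

text \<open>The degree \<open>b i - b j\<close> in r^2 of each entry is exactly half the difference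
  of the dilation exponents 2 b + 1. Estimates for times of order r^2 are thereby reduced to times
  of order one.\<close>

lemma Emat_dil: "E (r\<^sup>2 * t) *v dil r z = dil r (E t *v z)"
proof -
  have "E (r\<^sup>2 * t) $ i $ j * (r ^ (2 * b j + 1) * z $ j) = r ^ (2 * b i + 1) * (E t $ i $ j * z $ j)" for i j
  proof (cases "b j \<le> b i")
    case True
    then have "r ^ (2 * b i + 1) = (r\<^sup>2) ^ (b i - b j) * r ^ (2 * b j + 1)"
      by (simp flip: power_mult power_add) (simp add: diff_mult_distrib2)
    with True show ?thesis
      by (simp add: Emat_homogeneous[of "r\<^sup>2 * t"] Emat_homogeneous[of t] power_mult_distrib) metis
  qed (simp add: Emat_homogeneous[of "r\<^sup>2 * t"] Emat_homogeneous[of t])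
  then show ?thesis
    by (simp only: vec_eq_iff matrix_vector_mult_def sum_distrib_left vec_lambda_beta dil_nth simp_thms)
qed

section \<open>The covariance matrix\<close>

text \<open>Four times the integral over [0, 1] of \<nu> E(s) P E(s)^T, with P the projection onto
  \<open>F\<close>. The integral is explicit because the (i, k) entry of \<open>E s\<close> is s^(b
  i) times that of \<open>E 1\<close> for k in \<open>F\<close>. The normalised Gaussian whose
  quadratic form is the inverse of \<open>Smat\<close> is the unit-time kernel of the model with
  diffusion \<nu> P.\<close>

definition Smat :: "((real, 'n) vec, 'n) vec" where
  "Smat = (\<chi> i l. 4 * \<nu> * (\<Sum>k\<in>F. E 1 $ i $ k * E 1 $ l $ k) / (b i + b l + 1))"

lemma Smat_sym: "Smat $ i $ l = Smat $ l $ i"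
  by (simp add: Smat_def mult.commute add.commute)

text \<open>Nonzero blocks of the columns of \<^term>\<open>E 1\<close> indexed by \<^term>\<open>F\<close> are, up to a factor, products \<open>B\<^sub>j \<dots> B\<^sub>1\<close>.\<close>

lemma block_products_independent:
  "j < length ms \<Longrightarrow> (\<And>k. k \<in> F \<Longrightarrow> (\<Sum>i\<in>{i. b i = j}. \<xi> i * mpow B j $ i $ k) = 0) \<Longrightarrow> b i = j \<Longrightarrow> \<xi> i = 0"
proof (induction j arbitrary: \<xi> i)
  case 0
  have "(\<Sum>i'\<in>{i. b i = 0}. \<xi> i' * (if i' = i then 1 else 0)) = 0"
    using 0(2)[of i] 0(3) by (simp add: first_vars_b mat_def)
  then show ?case using 0(3) by (simp add: if_distrib cong: if_cong)
next
  case (Suc j)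
  \<comment> \<open>The vector \<open>\<xi>\<close> multiplied by block Suc j of \<open>B\<close> is
    tested against the shorter products: the induction hypothesis gives \<eta> = 0, and the
    independence of the rows of that block gives \<xi> = 0.\<close>
  define \<eta> where "\<eta> l = (\<Sum>i\<in>{i. b i = Suc j}. \<xi> i * B $ i $ l)" for l
  have "(\<Sum>l\<in>{l. b l = j}. \<eta> l * mpow B j $ l $ k) = 0" if k: "k \<in> F" for k
  proof -
    have "(\<Sum>l\<in>{l. b l = j}. \<eta> l * mpow B j $ l $ k) = (\<Sum>l\<in>UNIV. \<eta> l * mpow B j $ l $ k)"
      using k by (intro sum.mono_neutral_left) (auto simp: first_vars_b mpow_zero)
    also have "\<dots> = (\<Sum>i\<in>{i. b i = Suc j}. \<xi> i * mpow B (Suc j) $ i $ k)"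
      unfolding \<eta>_def mpow.simps matrix_matrix_mult_def vec_lambda_beta sum_distrib_right sum_distrib_left mult.assoc
      by (rule sum.swap)
    finally show ?thesis using Suc.prems(2)[OF k] by simp
  qed
  then have "\<eta> l = 0" if "b l = j" for l
    using Suc.IH[of \<eta> l] Suc.prems(1) that by simp
  moreover have "\<eta> l = 0" if "b l \<noteq> j" for l
    unfolding \<eta>_def by (rule sum.neutral) (use that in \<open>auto simp: B_zero\<close>)
  ultimately have "\<eta> l = 0" for l by blast
  then show ?case
    using block_rows_independent[of "Suc j" \<xi> i] Suc.prems unfolding \<eta>_def by simp
qed

text \<open>Writing the form as the integral of a sum of squares of polynomials in s shows
  nonnegativity and leaves only the vanishing of these polynomials to be examined.\<close>

lemma Smat_form: "((\<lambda>s. 4 * \<nu> * (\<Sum>k\<in>F. (\<Sum>i\<in>UNIV. \<xi> $ i * (s ^ b i * E 1 $ i $ k))\<^sup>2)) has_integral (\<xi> \<bullet> (Smat *v \<xi>))) {0..1}"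
proof -
  have p: "((\<lambda>s::real. s ^ n) has_integral (1 / real (n + 1))) {0..1}" for n
  proof -
    have "((\<lambda>s::real. s ^ n) has_integral (1 ^ (n + 1) / real (n + 1) - 0 ^ (n + 1) / real (n + 1))) {0..1}"
    proof (rule fundamental_theorem_of_calculus)
      fix x :: real
      have "((\<lambda>s. s ^ (n + 1) / real (n + 1)) has_real_derivative x ^ n) (at x)"
        using DERIV_cdivide[OF DERIV_pow[of "Suc n" x], of "real (Suc n)"] by (simp del: of_nat_Suc)
      then show "((\<lambda>s. s ^ (n + 1) / real (n + 1)) has_vector_derivative x ^ n) (at x within {0..1})"
        by (auto simp: has_real_derivative_iff_has_vector_derivative intro: has_vector_derivative_at_within)
    qed simp
    then show ?thesis by simp
  qed
  have "((\<lambda>s. \<Sum>k\<in>F. \<Sum>i\<in>UNIV. \<Sum>l\<in>UNIV. (4 * \<nu> * \<xi> $ i * \<xi> $ l * E 1 $ i $ k * E 1 $ l $ k) * s ^ (b i + b l)) has_integral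
      (\<Sum>k\<in>F. \<Sum>i\<in>UNIV. \<Sum>l\<in>UNIV. (4 * \<nu> * \<xi> $ i * \<xi> $ l * E 1 $ i $ k * E 1 $ l $ k) * (1 / real (b i + b l + 1)))) {0..1}"
    by (intro has_integral_sum has_integral_mult_right p) auto
  moreover have "(\<Sum>k\<in>F. \<Sum>i\<in>UNIV. \<Sum>l\<in>UNIV. (4 * \<nu> * \<xi> $ i * \<xi> $ l * E 1 $ i $ k * E 1 $ l $ k) * (1 / real (b i + b l + 1)))
      = \<xi> \<bullet> (Smat *v \<xi>)"
  proof -
    have "\<xi> \<bullet> (Smat *v \<xi>) = (\<Sum>i\<in>UNIV. \<Sum>l\<in>UNIV. \<Sum>k\<in>F. (4 * \<nu> * \<xi> $ i * \<xi> $ l * E 1 $ i $ k * E 1 $ l $ k) * (1 / real (b i + b l + 1)))"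
      by (simp add: inner_vec_def matrix_vector_mult_def Smat_def sum_distrib_left sum_distrib_right
          sum_divide_distrib mult_ac)
    then show ?thesis by (simp add: sum.swap[of _ F])
  qed
  moreover have "4 * \<nu> * (\<Sum>k\<in>F. (\<Sum>i\<in>UNIV. \<xi> $ i * (s ^ b i * E 1 $ i $ k))\<^sup>2)
     = (\<Sum>k\<in>F. \<Sum>i\<in>UNIV. \<Sum>l\<in>UNIV. (4 * \<nu> * \<xi> $ i * \<xi> $ l * E 1 $ i $ k * E 1 $ l $ k) * s ^ (b i + b l))" for s
    by (simp add: power2_eq_square sum_product sum_distrib_left power_add mult_ac)
  ultimately show ?thesis by simp
qed

text \<open>This is the controllability (Kalman) condition. If the form vanishes, the polynomial
  with terms \<xi>_i s^(b i) E(1)_ik vanishes on [0, 1] for every k in \<open>F\<close>; its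
  coefficients separate the blocks, and in each block the products B_j ... B_1 have independent
  rows.\<close>

lemma Smat_pos: assumes "\<xi> \<noteq> 0" shows "\<xi> \<bullet> (Smat *v \<xi>) > 0"
proof -
  let ?f = "\<lambda>s. 4 * \<nu> * (\<Sum>k\<in>F. (\<Sum>i\<in>UNIV. \<xi> $ i * (s ^ b i * E 1 $ i $ k))\<^sup>2)"
  have I: "integral {0..1} ?f = \<xi> \<bullet> (Smat *v \<xi>)" using Smat_form by (rule integral_unique)
  have nn: "?f s \<ge> 0" for s using nu_pos by (auto intro!: mult_nonneg_nonneg sum_nonneg)
  have ge: "\<xi> \<bullet> (Smat *v \<xi>) \<ge> 0" using has_integral_nonneg[OF Smat_form] nn by blast
  have "\<xi> \<bullet> (Smat *v \<xi>) \<noteq> 0"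
  proof
    assume "\<xi> \<bullet> (Smat *v \<xi>) = 0"
    moreover have "continuous_on {0..1} ?f" by (intro continuous_intros)
    ultimately have "\<forall>s\<in>{0..1}. ?f s = 0"
      using integral_eq_0_iff[THEN iffD1, of 0 1 ?f, OF _ zero_less_one nn] unfolding I by blast
    then have z: "(\<Sum>i\<in>UNIV. \<xi> $ i * (s ^ b i * E 1 $ i $ k)) = 0" if "s \<in> {0..1}" "k \<in> F" for s k
      using that nu_pos by (force simp: sum_nonneg_eq_0_iff)
    have co: "(\<Sum>i\<in>{i. b i = j}. \<xi> $ i * E 1 $ i $ k) = 0" if j: "j < length ms" and k: "k \<in> F" for j k
    proof (rule ccontr)
      define c where "c j = (\<Sum>i\<in>{i. b i = j}. \<xi> $ i * E 1 $ i $ k)" for j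
      assume "(\<Sum>i\<in>{i. b i = j}. \<xi> $ i * E 1 $ i $ k) \<noteq> 0"
      then have "finite {s. (\<Sum>j\<le>length ms. c j * s ^ j) = 0}"
        unfolding polyfun_finite_roots using j by (auto simp: c_def intro!: exI[of _ j])
      moreover have "(\<Sum>j\<le>length ms. c j * s ^ j) = (\<Sum>i\<in>UNIV. \<xi> $ i * (s ^ b i * E 1 $ i $ k))" for s
      proof -
        have "(\<Sum>i\<in>UNIV. \<xi> $ i * (s ^ b i * E 1 $ i $ k)) = (\<Sum>j\<le>length ms. \<Sum>i\<in>{i\<in>UNIV. b i = j}. \<xi> $ i * (s ^ b i * E 1 $ i $ k))"
          by (rule sum.group[symmetric]) (auto intro: less_imp_le b_less)
        then show ?thesis by (auto simp: c_def sum_distrib_left mult_ac intro!: sum.cong)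
      qed
      then have "{0..1} \<subseteq> {s. (\<Sum>j\<le>length ms. c j * s ^ j) = 0}" using z k by auto
      ultimately show False by (metis finite_subset infinite_Icc zero_less_one)
    qed
    have "\<xi> $ i = 0" for i
    proof (rule block_products_independent[OF b_less[of i], where \<xi> = "\<lambda>i. \<xi> $ i"])
      fix k assume k: "k \<in> F"
      have "(\<Sum>l\<in>{l. b l = b i}. \<xi> $ l * E 1 $ l $ k) = (\<Sum>l\<in>{l. b l = b i}. ((- 1) ^ b i / fact (b i)) * (\<xi> $ l * mpow B (b i) $ l $ k))"
        by (rule sum.cong) (use k in \<open>auto simp: Emat_entry first_vars_b\<close>)
      then have "((- 1) ^ b i / fact (b i)) * (\<Sum>l\<in>{l. b l = b i}. \<xi> $ l * mpow B (b i) $ l $ k) = 0"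
        using co[OF b_less k, of i] by (simp add: sum_distrib_left)
      then show "(\<Sum>l\<in>{l. b l = b i}. \<xi> $ l * mpow B (b i) $ l $ k) = 0" by simp
    qed simp
    then show False using assms by (simp add: vec_eq_iff)
  qed
  then show ?thesis using ge by simp
qed

end

lemma positive_definite_lower_bound:
  fixes A :: "real^'n^'n"
  assumes "\<And>x. x \<noteq> 0 \<Longrightarrow> x \<bullet> (A *v x) > 0"
  shows "\<exists>c>0. \<forall>x. c * (norm x)\<^sup>2 \<le> x \<bullet> (A *v x)"
proof -
  have "\<exists>y\<in>sphere (0::real^'n) 1. \<forall>x\<in>sphere 0 1. y \<bullet> (A *v y) \<le> x \<bullet> (A *v x)"
    by (rule continuous_attains_inf) (auto intro!: continuous_intros matrix_vector_mult_linear_continuous_on)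
  then obtain y where y: "norm y = 1" "\<And>x. norm x = 1 \<Longrightarrow> y \<bullet> (A *v y) \<le> x \<bullet> (A *v x)"
    by (auto simp: dist_norm)
  have "(y \<bullet> (A *v y)) * (norm x)\<^sup>2 \<le> x \<bullet> (A *v x)" for x
  proof (cases "x = 0")
    case False
    have "y \<bullet> (A *v y) \<le> (x /\<^sub>R norm x) \<bullet> (A *v (x /\<^sub>R norm x))"
      using False by (intro y) auto
    then show ?thesis
      using False by (simp add: matrix_vector_mult_scaleR power2_eq_square field_simps)
  qed simp
  moreover have "y \<noteq> 0" using y(1) by auto
  ultimately show ?thesis using assms by (intro exI[of _ "y \<bullet> (A *v y)"]) auto
qed

context kolmogorov
begin

text \<open>Positivity makes the kernel trivial, so an inverse exists; positivity passes to it
  through z = Smat (Q z), and compactness of the sphere makes it uniform.\<close>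

lemma ex_inverse_Smat:
  "\<exists>Q :: ((real, 'n) vec, 'n) vec. \<exists>c>0. Smat ** Q = mat 1 \<and> (\<forall>z. c * (norm z)\<^sup>2 \<le> z \<bullet> (Q *v z)) \<and> (\<forall>i j. Q $ i $ j = Q $ j $ i)"
proof -
  have tS: "transpose Smat = Smat" by (simp add: transpose_def vec_eq_iff Smat_sym)
  have "\<forall>x. Smat *v x = 0 \<longrightarrow> x = 0" using Smat_pos by (metis inner_zero_right less_irrefl)
  then obtain Q where Q: "Q ** Smat = mat 1" using matrix_left_invertible_ker by blast
  then have Q': "Smat ** Q = mat 1" by (simp add: matrix_left_right_inverse)
  have "transpose Q = Q"
    by (metis Q Q' matrix_mul_assoc matrix_mul_lid matrix_mul_rid matrix_transpose_mul tS transpose_mat)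
  then have sym: "Q $ i $ j = Q $ j $ i" for i j by (metis transpose_def vec_lambda_beta)
  have "z \<bullet> (Q *v z) > 0" if z: "z \<noteq> 0" for z
  proof -
    have e: "z = Smat *v (Q *v z)" by (simp add: matrix_vector_mul_assoc Q')
    then have "Q *v z \<noteq> 0" using z by (metis matrix_vector_mult_0_right)
    from Smat_pos[OF this] show ?thesis using e by (simp add: inner_commute)
  qed
  from positive_definite_lower_bound[OF this] Q' sym show ?thesis by blast
qed

end

section \<open>Weighted differentiability classes and differences\<close>

text \<open>\<open>dd\<close> is defined through the total function \<open>deriv\<close>; this is
  the bridge to Frechet derivatives by which directional derivatives are evaluated
  throughout.\<close>

lemma dd_eq: "(f has_derivative f') (at p) \<Longrightarrow> dd v f p = f' v"
proof -
  assume f: "(f has_derivative f') (at p)"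
  then have l: "linear f'" by (simp add: has_derivative_bounded_linear bounded_linear.linear)
  have "((\<lambda>s. f (p + s *\<^sub>R v)) has_derivative (\<lambda>s. f' (s *\<^sub>R v))) (at 0)"
    by (rule has_derivative_compose[of "\<lambda>s. p + s *\<^sub>R v", where g = f, simplified])
       (auto intro!: derivative_eq_intros f)
  then have "((\<lambda>s. f (p + s *\<^sub>R v)) has_real_derivative f' v) (at 0)"
    by (simp add: has_field_derivative_def linear_scale[OF l] mult.commute[of _ "f' v"])
  then show ?thesis unfolding dd_def by (rule DERIV_imp_deriv)
qed

lemma dd_has_derivative: "f differentiable (at p) \<Longrightarrow> (f has_derivative (\<lambda>v. dd v f p)) (at p)"
  by (metis (no_types, lifting) ext dd_eq differentiable_def)

lemma dd_line:
  assumes "\<And>x. f differentiable (at x)"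
  shows "((\<lambda>s. f (x + s *\<^sub>R v)) has_real_derivative dd v f (x + s *\<^sub>R v)) (at s)"
proof -
  let ?D = "\<lambda>w. dd w f (x + s *\<^sub>R v)"
  have f: "(f has_derivative ?D) (at (x + s *\<^sub>R v))" using assms by (rule dd_has_derivative)
  then have l: "linear ?D" using has_derivative_bounded_linear bounded_linear.linear by blast
  have "((\<lambda>s. f (x + s *\<^sub>R v)) has_derivative (\<lambda>s. ?D (s *\<^sub>R v))) (at s)"
    by (rule has_derivative_compose[of "\<lambda>s. x + s *\<^sub>R v", OF _ f]) (auto intro!: derivative_eq_intros)
  then show ?thesis
    using linear_scale[OF l, of _ v] by (simp add: has_field_derivative_def mult.commute[of _ "dd v f _"])
qed

lemma dd_scaleR: "f differentiable (at p) \<Longrightarrow> dd (c *\<^sub>R v) f p = c * dd v f p"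
  using linear_scale[OF bounded_linear.linear[OF has_derivative_bounded_linear[OF dd_has_derivative]], of f p c v] by simp

lemma dd_basis_sum:
  fixes f :: "'a::euclidean_space \<Rightarrow> real"
  assumes "f differentiable (at p)"
  shows "dd v f p = (\<Sum>e\<in>Basis. (v \<bullet> e) * dd e f p)"
proof -
  have l: "linear (\<lambda>v. dd v f p)"
    using has_derivative_bounded_linear[OF dd_has_derivative[OF assms]] by (rule bounded_linear.linear)
  have "dd v f p = dd (\<Sum>e\<in>Basis. (v \<bullet> e) *\<^sub>R e) f p" by (simp add: euclidean_representation)
  also have "\<dots> = (\<Sum>e\<in>Basis. (v \<bullet> e) * dd e f p)"
    using linear_sum[OF l, of "\<lambda>e. (v \<bullet> e) *\<^sub>R e" Basis] linear_scale[OF l] by simp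
  finally show ?thesis .
qed

text \<open>\<open>bdk n w f\<close>: all derivatives of \<open>f\<close> of order at most \<open>n\<close> along unit vectors are bounded by the weight \<open>w\<close>.\<close>

fun bdk :: "nat \<Rightarrow> ('a::euclidean_space \<Rightarrow> real) \<Rightarrow> ('a \<Rightarrow> real) \<Rightarrow> bool" where
  "bdk 0 w f = (continuous_on UNIV f \<and> (\<forall>x. \<bar>f x\<bar> \<le> w x))"
| "bdk (Suc n) w f = ((\<forall>x. \<bar>f x\<bar> \<le> w x) \<and> (\<forall>x. f differentiable (at x)) \<and>
     (\<forall>v. norm v \<le> 1 \<longrightarrow> bdk n w (dd v f)))"

lemma bdk_le: "bdk n w f \<Longrightarrow> \<bar>f x\<bar> \<le> w x"
  by (cases n) auto

lemma bdk_diff: "bdk (Suc n) w f \<Longrightarrow> f differentiable (at x)"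
  by simp

lemma bdk_cont: "bdk n w f \<Longrightarrow> continuous_on S f"
  by (cases n) (auto intro: continuous_on_subset continuous_at_imp_continuous_on differentiable_imp_continuous_within)

lemma bdk_borel: "bdk n w f \<Longrightarrow> f \<in> borel_measurable borel"
  using borel_measurable_continuous_onI bdk_cont by blast

lemma bdk_Suc: "bdk (Suc n) w f \<Longrightarrow> bdk n w f"
proof (induction n arbitrary: f)
  case 0 then show ?case by (auto intro: bdk_cont[OF 0])
qed simp

lemma bdk_antimono: "bdk n w f \<Longrightarrow> m \<le> n \<Longrightarrow> bdk m w f"
proof (induction n)
  case (Suc n) then show ?case by (cases "m = Suc n") (auto intro: bdk_Suc simp del: bdk.simps)
qed simp

lemma bdk_weight: "bdk n w f \<Longrightarrow> (\<And>x. w x \<le> w' x) \<Longrightarrow> bdk n w' f"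
  by (induction n arbitrary: f) (auto intro: order_trans)

lemma bdk_scale: "bdk n w f \<Longrightarrow> bdk n (\<lambda>x. \<bar>c\<bar> * w x) (\<lambda>x. c * f x)"
proof (induction n arbitrary: f)
  case (Suc n)
  have "dd v (\<lambda>x. c * f x) = (\<lambda>x. c * dd v f x)" for v
    using Suc.prems by (auto intro!: dd_eq has_derivative_mult_right dd_has_derivative)
  then show ?case using Suc by (auto simp: abs_mult mult_left_mono)
qed (auto simp: abs_mult mult_left_mono intro: continuous_intros)

lemma dd_add: "f differentiable (at x) \<Longrightarrow> g differentiable (at x) \<Longrightarrow> dd v (\<lambda>x. f x + g x) x = dd v f x + dd v g x"
  by (auto intro!: dd_eq derivative_eq_intros dd_has_derivative)

lemma dd_diff: "f differentiable (at x) \<Longrightarrow> g differentiable (at x) \<Longrightarrow> dd v (\<lambda>x. f x - g x) x = dd v f x - dd v g x"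
  by (auto intro!: dd_eq derivative_eq_intros dd_has_derivative)

lemma dd_sum: "finite I \<Longrightarrow> (\<And>i. i \<in> I \<Longrightarrow> f i differentiable (at x)) \<Longrightarrow> dd v (\<lambda>x. \<Sum>i\<in>I. c i * f i x) x = (\<Sum>i\<in>I. c i * dd v (f i) x)"
  by (rule dd_eq) (auto intro!: has_derivative_sum has_derivative_mult_right dd_has_derivative)

lemma bdk_add: "bdk n w f \<Longrightarrow> bdk n w' g \<Longrightarrow> bdk n (\<lambda>x. w x + w' x) (\<lambda>x. f x + g x)"
proof (induction n arbitrary: f g)
  case (Suc n)
  have "dd v (\<lambda>x. f x + g x) = (\<lambda>x. dd v f x + dd v g x)" for v
    using Suc.prems by (auto intro!: dd_add)
  moreover have "\<bar>f x + g x\<bar> \<le> w x + w' x" for x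
    using bdk_le[OF Suc.prems(1), of x] bdk_le[OF Suc.prems(2), of x] by linarith
  ultimately show ?case using Suc by auto
next
  case 0
  have "\<bar>f x + g x\<bar> \<le> w x + w' x" for x
    using bdk_le[OF 0(1), of x] bdk_le[OF 0(2), of x] by linarith
  then show ?case using 0 by (auto intro: continuous_intros)
qed

lemma bdk_const: "\<bar>c\<bar> \<le> C \<Longrightarrow> bdk n (\<lambda>_. C) (\<lambda>_. c)"
proof (induction n arbitrary: c)
  case (Suc n)
  have "dd v (\<lambda>_::'a. c) = (\<lambda>_. 0)" for v by (rule ext, rule dd_eq) auto
  then show ?case using Suc by auto
qed auto

lemma bdk_sum:
  assumes "finite I" "\<And>i. i \<in> I \<Longrightarrow> bdk n (w i) (f i)"
  shows "bdk n (\<lambda>x. \<Sum>i\<in>I. w i x) (\<lambda>x. \<Sum>i\<in>I. f i x)"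
  using assms by (induction I rule: finite_induct) (auto intro: bdk_add bdk_const)

lemma bdk_dd:
  assumes "bdk (Suc n) w f" shows "bdk n (\<lambda>x. norm v * w x) (dd v f)"
proof (cases "v = 0")
  case True
  have "dd v f = (\<lambda>x. 0)" using True dd_scaleR[of f _ 0 v] assms by auto
  then show ?thesis using True by (simp add: bdk_const)
next
  case False
  have "dd v f = (\<lambda>x. norm v * dd (v /\<^sub>R norm v) f x)"
    using dd_scaleR[of f _ "norm v" "v /\<^sub>R norm v"] assms False by auto
  moreover have "bdk n w (dd (v /\<^sub>R norm v) f)" using assms False by simp
  ultimately show ?thesis using bdk_scale[of n w _ "norm v"] by simp
qed

lemma bdk_dd_le: "bdk (Suc n) w f \<Longrightarrow> \<bar>dd v f x\<bar> \<le> norm v * w x"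
  using bdk_le[OF bdk_dd] by blast

lemma dd_shift: "f differentiable (at (x + h)) \<Longrightarrow> dd v (\<lambda>x. f (x + h)) x = dd v f (x + h)"
  by (rule dd_eq, rule has_derivative_compose[of "\<lambda>x. x + h", where f' = "\<lambda>x. x"])
     (auto intro!: derivative_eq_intros dd_has_derivative)

lemma differentiable_shift: "f differentiable (at (x + h)) \<Longrightarrow> (\<lambda>x. f (x + h)) differentiable (at x)"
  by (rule differentiable_compose[of f "\<lambda>x. x + h"]) auto

definition dif :: "'a::ab_group_add \<Rightarrow> ('a \<Rightarrow> real) \<Rightarrow> 'a \<Rightarrow> real" where
  "dif h f x = f (x + h) - f x"

lemma mvt_dif:
  fixes f :: "'a::euclidean_space \<Rightarrow> real"
  assumes "\<And>x. f differentiable (at x)"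
  shows "\<exists>s. 0 < s \<and> s < 1 \<and> dif h f x = dd h f (x + s *\<^sub>R h)"
proof -
  have "\<exists>z. 0 < z \<and> z < 1 \<and> f (x + 1 *\<^sub>R h) - f (x + 0 *\<^sub>R h) = (1 - 0) * dd h f (x + z *\<^sub>R h)"
    by (rule MVT2) (auto intro: dd_line assms)
  then show ?thesis by (simp add: dif_def)
qed

text \<open>A difference costs one derivative and gains a factor \<open>norm h\<close>; the factor
  \<open>exp (norm h)\<close> is the price of shifting the weight. Exponential decay is chosen
  because, unlike Gaussian decay, it changes only by a constant factor under a shift.\<close>

lemma bdk_dif:
  fixes f :: "'a::euclidean_space \<Rightarrow> real"
  shows "bdk (Suc n) (\<lambda>x. C * exp (- norm x)) f \<Longrightarrow> bdk n (\<lambda>x. (C * norm h * exp (norm h)) * exp (- norm x)) (dif h f)"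
proof (induction n arbitrary: f)
  have le: "\<bar>dif h f x\<bar> \<le> (C * norm h * exp (norm h)) * exp (- norm x)" if f: "bdk (Suc n) (\<lambda>x. C * exp (- norm x)) f" for f :: "'a \<Rightarrow> real" and n x
  proof -
    obtain s where s: "0 < s" "s < 1" "dif h f x = dd h f (x + s *\<^sub>R h)"
      using mvt_dif[of f h x] f by auto
    have C: "C \<ge> 0" using bdk_le[OF f, of 0] by simp
    have "norm x \<le> norm (x + s *\<^sub>R h) + norm (s *\<^sub>R h)" by (metis add_diff_cancel_right' norm_triangle_ineq4)
    also have "norm (s *\<^sub>R h) \<le> norm h" using s by (simp add: mult_left_le_one_le)
    finally have "exp (- norm (x + s *\<^sub>R h)) \<le> exp (norm h) * exp (- norm x)" by (simp flip: exp_add)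
    then have "norm h * (C * exp (- norm (x + s *\<^sub>R h))) \<le> norm h * (C * (exp (norm h) * exp (- norm x)))"
      using C by (intro mult_left_mono) auto
    then show ?thesis using bdk_dd_le[OF f, of h "x + s *\<^sub>R h"] s by (simp add: mult_ac)
  qed
  { case 0
    then show ?case using le[OF 0] bdk_cont[OF 0]
      by (auto simp: dif_def[abs_def] intro!: continuous_intros intro: continuous_on_compose2[of UNIV])
  }
  case (Suc n)
  have d: "(\<lambda>x. f (x + h)) differentiable (at x)" "f differentiable (at x)" for x
    using Suc.prems by (auto intro: differentiable_shift)
  have "dd v (dif h f) = dif h (dd v f)" for v
    unfolding dif_def[abs_def] using d Suc.prems by (auto simp: dd_diff dd_shift)
  moreover have "dif h f differentiable (at x)" for x unfolding dif_def[abs_def] using d by (intro differentiable_diff)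
  ultimately show ?case using Suc le[OF Suc.prems] by auto
qed

lemma exp_norm_shift: "exp (- norm (x + h)) \<le> exp (norm h) * exp (- norm (x :: 'a::real_normed_vector))"
  using norm_triangle_ineq4[of "x + h" h] by (simp flip: exp_add)

text \<open>The first-order Taylor terms at h and - h cancel. With h of size sqrt \<delta> the cubic
  remainder is \<delta>^(3/2), small enough to be summed over 1 / \<delta> time steps.\<close>

lemma bdk_second_difference:
  fixes f :: "'a::euclidean_space \<Rightarrow> real"
  assumes f: "bdk 3 (\<lambda>_. C) f"
  shows "\<bar>f (x + h) + f (x - h) - 2 * f x - dd h (dd h f) x\<bar> \<le> C * norm h ^ 3"
proof -
  let ?d = "\<lambda>m s. ((dd h ^^ m) f) (x + s *\<^sub>R h)"
  have b1: "bdk 2 (\<lambda>_. norm h * C) (dd h f)" using bdk_dd[of 2] f by (simp add: numeral_3_eq_3 numeral_2_eq_2 del: bdk.simps)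
  have b2: "bdk 1 (\<lambda>_. norm h * (norm h * C)) (dd h (dd h f))" using bdk_dd[of 1] b1 by (simp add: numeral_2_eq_2 del: bdk.simps)
  have b3: "\<bar>dd h (dd h (dd h f)) y\<bar> \<le> norm h * (norm h * (norm h * C))" for y
    using bdk_dd_le[of 0] b2 by (simp del: bdk.simps)
  have diffs: "f differentiable (at y)" "dd h f differentiable (at y)" "dd h (dd h f) differentiable (at y)" for y
    using f b1 b2 by (simp_all add: numeral_3_eq_3 numeral_2_eq_2)
  have der: "DERIV (?d m) t :> ?d (Suc m) t" if "m < 3" for m t
  proof -
    have "m = 0 \<or> m = 1 \<or> m = 2" using that by auto
    then have "(dd h ^^ m) f differentiable (at y)" for y
      using diffs by (elim disjE) (simp_all add: numeral_2_eq_2 del: bdk.simps)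
    from dd_line[OF this] show ?thesis by simp
  qed
  have T: "\<exists>t. \<bar>t\<bar> \<le> \<bar>s\<bar> \<and> f (x + s *\<^sub>R h) = (\<Sum>m<3. ?d m 0 / fact m * s ^ m) + ?d 3 t / fact 3 * s ^ 3" for s
  proof (rule Maclaurin_bi_le)
    show "\<forall>m t. m < 3 \<and> \<bar>t\<bar> \<le> \<bar>s\<bar> \<longrightarrow> DERIV (?d m) t :> ?d (Suc m) t" using der by blast
  qed simp
  obtain t1 where t1: "f (x + h) = f x + dd h f x + dd h (dd h f) x / 2 + ?d 3 t1 / 6"
    using T[of 1] by (auto simp: numeral_3_eq_3 fact_reduce)
  obtain t2 where t2: "f (x - h) = f x - dd h f x + dd h (dd h f) x / 2 - ?d 3 t2 / 6"
    using T[of "-1"] by (auto simp: numeral_3_eq_3 fact_reduce)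
  have "\<bar>?d 3 t\<bar> \<le> C * norm h ^ 3" for t using b3 by (simp add: numeral_3_eq_3 mult_ac)
  from this[of t1] this[of t2] show ?thesis unfolding t1 t2 by linarith
qed

text \<open>Cholesky decomposition by induction on the index set: split off one pivot and pass to
  the Schur complement; a vanishing pivot forces its whole row to vanish.\<close>

lemma psd_decomposition:
  fixes M :: "'i \<Rightarrow> 'i \<Rightarrow> real"
  assumes "finite I" "\<And>k l. M k l = M l k" "\<And>k l. k \<notin> I \<Longrightarrow> M k l = 0"
    "\<And>\<xi>. 0 \<le> (\<Sum>k\<in>I. \<Sum>l\<in>I. \<xi> k * \<xi> l * M k l)"
  shows "\<exists>r. \<forall>k l. M k l = (\<Sum>m\<in>I. r m k * r m l)"
  using assms
proof (induction I arbitrary: M rule: finite_induct)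
  case empty then show ?case by auto
next
  case (insert i I)
  note sym = insert.prems(1) and supp = insert.prems(2)
  define Q where "Q \<eta> = (\<Sum>k\<in>I. \<Sum>l\<in>I. \<eta> k * \<eta> l * M k l)" for \<eta>
  define c where "c \<eta> = (\<Sum>l\<in>I. \<eta> l * M i l)" for \<eta>
  \<comment> \<open>The form with value t at the pivot index and \<eta> elsewhere, as a quadratic
    polynomial in t; both cases below use its nonnegativity at a suitable t.\<close>
  have pos: "0 \<le> t\<^sup>2 * M i i + 2 * t * c \<eta> + Q \<eta>" for t \<eta>
  proof -
    define \<zeta> where "\<zeta> = \<eta>(i := t)"
    have I: "\<zeta> i = t" "k \<in> I \<Longrightarrow> \<zeta> k = \<eta> k" for k using insert.hyps by (auto simp: \<zeta>_def)
    have inn: "(\<Sum>l\<in>insert i I. \<zeta> k * \<zeta> l * M k l) = \<zeta> k * t * M k i + (\<Sum>l\<in>I. \<zeta> k * \<eta> l * M k l)" for k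
      unfolding sum.insert[OF insert.hyps] by (simp add: I cong: sum.cong)
    have "(\<Sum>k\<in>insert i I. \<Sum>l\<in>insert i I. \<zeta> k * \<zeta> l * M k l)
      = t * t * M i i + (\<Sum>l\<in>I. t * \<eta> l * M i l) + (\<Sum>k\<in>I. \<eta> k * t * M k i + (\<Sum>l\<in>I. \<eta> k * \<eta> l * M k l))"
      unfolding inn unfolding sum.insert[OF insert.hyps] by (simp add: I cong: sum.cong)
    also have "\<dots> = t\<^sup>2 * M i i + 2 * t * c \<eta> + Q \<eta>"
    proof -
      have 1: "(\<Sum>k\<in>I. \<eta> k * t * M k i) = t * c \<eta>"
        unfolding c_def sum_distrib_left by (rule sum.cong) (use sym[of i] in \<open>auto simp: mult_ac\<close>)
      have 2: "(\<Sum>l\<in>I. t * \<eta> l * M i l) = t * c \<eta>"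
        unfolding c_def sum_distrib_left by (rule sum.cong) (auto simp: mult_ac)
      show ?thesis unfolding sum.distrib 1 2 Q_def by (simp add: power2_eq_square)
    qed
    finally show ?thesis using insert.prems(3)[of \<zeta>] by simp
  qed
  have ii: "M i i \<ge> 0" using pos[of 1 "\<lambda>_. 0"] by (simp add: c_def Q_def)
  show ?case
  proof (cases "M i i = 0")
    case True
    have c0: "c \<eta> = 0" for \<eta>
    proof (rule ccontr)
      assume n: "c \<eta> \<noteq> 0"
      \<comment> \<open>With zero pivot the polynomial is affine in t, and at this t it would take
        the value - 1.\<close>
      have "2 * (- (Q \<eta> + 1) / (2 * c \<eta>)) * c \<eta> = - (Q \<eta> + 1)" using n by (simp add: field_simps)
      then show False using pos[of "- (Q \<eta> + 1) / (2 * c \<eta>)" \<eta>] True by simp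
    qed
    have row: "M i l = 0" for l
    proof (cases "l \<in> I")
      case l: True
      have "c (\<lambda>k. if k = l then 1 else 0) = M i l"
        using l insert.hyps by (simp add: c_def if_distrib[of "\<lambda>x. x * _"] cong: if_cong)
      then show ?thesis using c0 by simp
    next
      case False then show ?thesis using True supp[of l i] sym[of i l] by (cases "l = i") auto
    qed
    have "\<exists>r. \<forall>k l. M k l = (\<Sum>m\<in>I. r m k * r m l)"
    proof (rule insert.IH[OF sym])
      show "M k l = 0" if "k \<notin> I" for k l using supp[of k l] row[of l] that by (cases "k = i") auto
      show "0 \<le> (\<Sum>k\<in>I. \<Sum>l\<in>I. \<xi> k * \<xi> l * M k l)" for \<xi>
        using pos[of 0 \<xi>] by (simp add: Q_def)
    qed
    then obtain r where "\<forall>k l. M k l = (\<Sum>m\<in>I. r m k * r m l)" by blast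
    then show ?thesis using insert.hyps
      by (intro exI[of _ "r(i := \<lambda>_. 0)"]) (auto intro!: sum.cong)
  next
    case False
    \<comment> \<open>The Schur complement of the pivot. Its form at \<xi> is the minimum over t of
      the full form, attained at t = - c \<xi> / M i i.\<close>
    define M' where "M' k l = M k l - M i k * M i l / M i i" for k l
    have "\<exists>r. \<forall>k l. M' k l = (\<Sum>m\<in>I. r m k * r m l)"
    proof (rule insert.IH)
      show "M' k l = M' l k" for k l by (simp add: M'_def sym[of k l] mult.commute)
      show "M' k l = 0" if "k \<notin> I" for k l
        using supp[of k l] supp[of k i] sym[of i k] that False by (cases "k = i") (auto simp: M'_def)
      show "0 \<le> (\<Sum>k\<in>I. \<Sum>l\<in>I. \<xi> k * \<xi> l * M' k l)" for \<xi>
      proof -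
        have "(\<Sum>k\<in>I. \<Sum>l\<in>I. \<xi> k * \<xi> l * M' k l) = Q \<xi> - (c \<xi>)\<^sup>2 / M i i"
        proof -
          have "(c \<xi>)\<^sup>2 / M i i = (\<Sum>k\<in>I. \<Sum>l\<in>I. \<xi> k * \<xi> l * (M i k * M i l / M i i))"
            unfolding c_def power2_eq_square sum_product sum_divide_distrib by (simp add: mult_ac)
          then show ?thesis
            unfolding M'_def Q_def right_diff_distrib sum_subtractf by simp
        qed
        also have "\<dots> = (- c \<xi> / M i i)\<^sup>2 * M i i + 2 * (- c \<xi> / M i i) * c \<xi> + Q \<xi>"
          using False by (simp add: power2_eq_square field_simps)
        finally show ?thesis using pos[of "- c \<xi> / M i i" \<xi>] by simp
      qed
    qed
    then obtain r where r: "\<And>k l. M' k l = (\<Sum>m\<in>I. r m k * r m l)" by blast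
    have "M k l = (\<Sum>m\<in>insert i I. (r(i := \<lambda>k. M i k / sqrt (M i i))) m k * (r(i := \<lambda>k. M i k / sqrt (M i i))) m l)" for k l
    proof -
      have "(\<Sum>m\<in>I. (r(i := \<lambda>k. M i k / sqrt (M i i))) m k * (r(i := \<lambda>k. M i k / sqrt (M i i))) m l) = M' k l"
        unfolding r using insert.hyps by (intro sum.cong) auto
      then show ?thesis using insert.hyps ii by (simp add: M'_def)
    qed
    then show ?thesis by blast
  qed
qed

section \<open>Smooth functions and mollifiers\<close>

definition smooth :: "('a::euclidean_space \<Rightarrow> real) \<Rightarrow> bool" where
  "smooth f \<longleftrightarrow> (\<forall>k. Ck_on k UNIV f)"

lemma Ck_SucI:
  assumes "\<And>x. (f has_derivative f' x) (at x)" "\<And>v. Ck_on k UNIV (\<lambda>x. f' x v)"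
  shows "Ck_on (Suc k) UNIV f"
proof -
  have "continuous_on UNIV f"
    using assms(1) by (auto intro!: continuous_at_imp_continuous_on has_derivative_continuous)
  then show ?thesis using assms by auto
qed

lemma Ck_SucD:
  assumes "Ck_on (Suc k) UNIV f"
  shows "(f has_derivative (\<lambda>v. dd v f x)) (at x)" "Ck_on k UNIV (dd v f)"
proof -
  obtain f' where f': "\<And>x. (f has_derivative f' x) (at x)" "\<And>v. Ck_on k UNIV (\<lambda>x. f' x v)"
    using assms by auto
  have e: "dd v f x = f' x v" for v x using dd_eq[OF f'(1)] .
  show "(f has_derivative (\<lambda>v. dd v f x)) (at x)" using f'(1) by (simp add: e)
  show "Ck_on k UNIV (dd v f)" using f'(2)[of v] by (simp add: e[abs_def])
qed

lemma Ck_cont: "Ck_on k S f \<Longrightarrow> continuous_on S f"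
  by (cases k) auto

lemma smooth_cont: "smooth f \<Longrightarrow> continuous_on S f"
  using Ck_cont[of 0 UNIV f] by (auto simp: smooth_def intro: continuous_on_subset)

lemma smooth_has_derivative: "smooth f \<Longrightarrow> (f has_derivative (\<lambda>v. dd v f x)) (at x)"
  and smooth_dd: "smooth f \<Longrightarrow> smooth (dd v f)"
  unfolding smooth_def using Ck_SucD by blast+

lemma smooth_differentiable: "smooth f \<Longrightarrow> f differentiable (at x)"
  using smooth_has_derivative differentiable_def by blast

lemma smooth_borel: "smooth f \<Longrightarrow> f \<in> borel_measurable borel"
  using smooth_cont borel_measurable_continuous_onI by blast

lemma smoothI:
  assumes "\<And>x. (f has_derivative f' x) (at x)" "\<And>v. smooth (\<lambda>x. f' x v)"
  shows "smooth f"
  unfolding smooth_def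
proof
  fix k show "Ck_on k UNIV f"
    using assms by (cases k) (auto simp: smooth_def intro!: Ck_SucI[of f f'] continuous_at_imp_continuous_on has_derivative_continuous simp del: Ck_on.simps(2))
qed

lemma Ck_const: "Ck_on k UNIV (\<lambda>_. c)"
  by (induction k arbitrary: c) (auto intro!: Ck_SucI[where f' = "\<lambda>_ _. 0"] simp del: Ck_on.simps(2))

lemma smooth_const [simp]: "smooth (\<lambda>_. c)"
  by (simp add: smooth_def Ck_const)

lemma smooth_linear: "bounded_linear f \<Longrightarrow> smooth f"
  by (rule smoothI[where f' = "\<lambda>_. f"]) (auto intro: bounded_linear_imp_has_derivative)

lemma Ck_add: "Ck_on k UNIV f \<Longrightarrow> Ck_on k UNIV g \<Longrightarrow> Ck_on k UNIV (\<lambda>x. f x + g x)"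
proof (induction k arbitrary: f g)
  case (Suc k)
  show ?case
    by (rule Ck_SucI[OF has_derivative_add[OF Ck_SucD(1)[OF Suc.prems(1)] Ck_SucD(1)[OF Suc.prems(2)]]])
       (intro Suc.IH Ck_SucD(2) Suc.prems)
qed (auto intro: continuous_intros)

lemma Ck_Suc_imp: "Ck_on (Suc k) UNIV f \<Longrightarrow> Ck_on k UNIV f"
proof (induction k arbitrary: f)
  case (Suc k)
  show ?case by (rule Ck_SucI[OF Ck_SucD(1)[OF Suc.prems]]) (intro Suc.IH Ck_SucD(2) Suc.prems)
qed auto

lemma Ck_mult: "Ck_on k UNIV f \<Longrightarrow> Ck_on k UNIV g \<Longrightarrow> Ck_on k UNIV (\<lambda>x. f x * g x)"
proof (induction k arbitrary: f g)
  case (Suc k)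
  show ?case
    by (rule Ck_SucI[OF has_derivative_mult[OF Ck_SucD(1)[OF Suc.prems(1)] Ck_SucD(1)[OF Suc.prems(2)]]])
       (rule Ck_add[OF Suc.IH[OF Ck_Suc_imp[OF Suc.prems(1)] Ck_SucD(2)[OF Suc.prems(2)]]
          Suc.IH[OF Ck_SucD(2)[OF Suc.prems(1)] Ck_Suc_imp[OF Suc.prems(2)]]])
qed (auto intro: continuous_intros)

lemma smooth_add: "smooth f \<Longrightarrow> smooth g \<Longrightarrow> smooth (\<lambda>x. f x + g x)"
  and smooth_mult: "smooth f \<Longrightarrow> smooth g \<Longrightarrow> smooth (\<lambda>x. f x * g x)"
  by (auto simp: smooth_def Ck_add Ck_mult)

lemma smooth_cmult: "smooth f \<Longrightarrow> smooth (\<lambda>x. c * f x)"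
  by (rule smooth_mult) auto

lemma smooth_diff: "smooth f \<Longrightarrow> smooth g \<Longrightarrow> smooth (\<lambda>x. f x - g x)"
  using smooth_add[of f "\<lambda>x. (-1) * g x"] smooth_cmult[of g "-1"] by simp

lemma smooth_sum: "(\<And>i. i \<in> I \<Longrightarrow> smooth (f i)) \<Longrightarrow> smooth (\<lambda>x. \<Sum>i\<in>I. f i x)"
  by (induction I rule: infinite_finite_induct) (auto intro: smooth_add)

lemma smooth_prod: "(\<And>i. i \<in> I \<Longrightarrow> smooth (f i)) \<Longrightarrow> smooth (\<lambda>x. \<Prod>i\<in>I. f i x)"
  by (induction I rule: infinite_finite_induct) (auto intro: smooth_mult)

lemma smooth_power: "smooth f \<Longrightarrow> smooth (\<lambda>x. f x ^ n)"
  by (induction n) (auto intro: smooth_mult)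

text \<open>The chain rule writes a derivative of f o p as a sum of products of derivatives of the
  components of p with (dd e f) o p. The induction on k must therefore run over all smooth f at
  once.\<close>

lemma smooth_compose:
  fixes p :: "'b::euclidean_space \<Rightarrow> 'a::euclidean_space"
  assumes f: "smooth f" and p: "\<And>e. e \<in> Basis \<Longrightarrow> smooth (\<lambda>x. p x \<bullet> e)"
  shows "smooth (\<lambda>x. f (p x))"
proof -
  define p' where "p' x v = (\<Sum>e\<in>Basis. dd v (\<lambda>x. p x \<bullet> e) x *\<^sub>R e)" for x v
  have pd: "(p has_derivative p' x) (at x)" for x
    unfolding has_derivative_componentwise_within[of p _ x UNIV]
    using smooth_has_derivative[OF p] by (auto simp: p'_def inner_sum_left inner_Basis if_distrib cong: if_cong)
  have pc: "continuous_on UNIV p"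
    using pd by (auto intro!: continuous_at_imp_continuous_on has_derivative_continuous)
  have "Ck_on k UNIV (\<lambda>x. f (p x))" if "smooth f" for k f
    using that
  proof (induction k arbitrary: f)
    case 0 then show ?case
      using continuous_on_compose2[OF smooth_cont[OF 0, of UNIV] pc] by simp
  next
    case (Suc k)
    have "Ck_on k UNIV (\<lambda>x. dd (p' x v) f (p x))" for v
    proof -
      have "dd (p' x v) f (p x) = (\<Sum>e\<in>Basis. dd v (\<lambda>x. p x \<bullet> e) x * dd e f (p x))" for x
        by (subst dd_basis_sum[OF smooth_differentiable[OF Suc.prems]])
           (simp add: p'_def inner_sum_left inner_Basis if_distrib cong: if_cong)
      moreover have "Ck_on k UNIV (\<lambda>x. \<Sum>e\<in>A. dd v (\<lambda>x. p x \<bullet> e) x * dd e f (p x))" if "finite A" "A \<subseteq> Basis" for A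
        using that
      proof (induction A rule: finite_induct)
        case (insert e A)
        have "Ck_on k UNIV (dd v (\<lambda>x. p x \<bullet> e))" using smooth_dd[OF p, of e v] insert.prems by (auto simp: smooth_def)
        then show ?case using insert by (auto intro!: Ck_add Ck_mult Suc.IH smooth_dd Suc.prems)
      qed (simp add: Ck_const)
      ultimately show ?thesis by simp
    qed
    then show ?case
      by (intro Ck_SucI[OF has_derivative_compose[OF pd smooth_has_derivative[OF Suc.prems]]])
  qed
  then show ?thesis using f by (simp add: smooth_def)
qed

lemma smooth_real_compose: "smooth (f :: real \<Rightarrow> real) \<Longrightarrow> smooth p \<Longrightarrow> smooth (\<lambda>x. f (p x))"
  by (rule smooth_compose) auto

text \<open>A polynomial factor in 1 / x is included because the family of functions p(1 / x) exp(-
  1 / x), extended by 0, is closed under differentiation; smoothness then follows by one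
  induction.\<close>

definition flat :: "real poly \<Rightarrow> real \<Rightarrow> real" where
  "flat p x = (if x > 0 then poly p (1 / x) * exp (- 1 / x) else 0)"

lemma poly_exp_tendsto: "((\<lambda>y. poly p y * exp (- y)) \<longlongrightarrow> (0::real)) at_top"
proof -
  have "((\<lambda>y. \<Sum>i\<le>degree p. coeff p i * (y ^ i / exp y)) \<longlongrightarrow> (\<Sum>i\<le>degree p. coeff p i * 0)) at_top"
    by (intro tendsto_sum tendsto_mult tendsto_const tendsto_power_div_exp_0)
  then show ?thesis by (simp add: poly_altdef sum_distrib_right exp_minus divide_inverse mult.assoc)
qed

lemma flat_deriv: "(flat p has_real_derivative flat ([:0, 0, 1:] * (p - pderiv p)) x) (at x)"
proof -
  consider "x > 0" | "x < 0" | "x = 0" by linarith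
  then show ?thesis
  proof cases
    case 1
    have "((\<lambda>x. poly p (1 / x) * exp (- 1 / x)) has_real_derivative
        poly p (1 / x) * (exp (- 1 / x) * (1 / x\<^sup>2)) + (poly (pderiv p) (1 / x) * (- 1 / x\<^sup>2)) * exp (- 1 / x)) (at x)"
      using 1 by (auto intro!: derivative_eq_intros DERIV_chain2[OF poly_DERIV] simp: power2_eq_square field_simps)
    then have "((\<lambda>x. poly p (1 / x) * exp (- 1 / x)) has_real_derivative flat ([:0, 0, 1:] * (p - pderiv p)) x) (at x)"
      using 1 by (simp add: flat_def power2_eq_square field_simps)
    then show ?thesis
    proof (rule has_field_derivative_transform_within_open)
      show "open {0::real<..}" "x \<in> {0<..}" using 1 by auto
    qed (auto simp: flat_def)
  next
    case 2
    have "((\<lambda>x. 0) has_real_derivative flat ([:0, 0, 1:] * (p - pderiv p)) x) (at x)"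
      using 2 by (simp add: flat_def)
    then show ?thesis
    proof (rule has_field_derivative_transform_within_open)
      show "open {..<0::real}" "x \<in> {..<0}" using 2 by auto
    qed (auto simp: flat_def)
  next
    case 3
    have r: "((\<lambda>y. flat p y / y) \<longlongrightarrow> 0) (at_right 0)"
    proof -
      have "((\<lambda>y. poly (pCons 0 p) (inverse y) * exp (- inverse y)) \<longlongrightarrow> (0::real)) (at_right 0)"
        using filterlim_compose[OF poly_exp_tendsto filterlim_inverse_at_top_right] .
      then show ?thesis
        by (rule Lim_transform_eventually)
           (use eventually_at_right_less[of "0::real"] in eventually_elim, simp add: flat_def divide_inverse mult_ac)
    qed
    have l: "((\<lambda>y. flat p y / y) \<longlongrightarrow> 0) (at_left 0)"
      by (rule tendsto_eventually) (auto simp: eventually_at_filter flat_def)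
    have "((\<lambda>y. flat p y / y) \<longlongrightarrow> 0) (at 0)" using r l by (simp add: filterlim_split_at)
    then show ?thesis using 3 by (simp add: has_field_derivative_iff flat_def)
  qed
qed

lemma smooth_flat: "smooth (flat p)"
proof -
  have "Ck_on k UNIV (flat p)" for k p
  proof (induction k arbitrary: p)
    case 0 show ?case using DERIV_continuous_on[of UNIV "flat p", OF has_field_derivative_at_within[OF flat_deriv]] by simp
  next
    case (Suc k)
    show ?case
      by (rule Ck_SucI[OF flat_deriv[unfolded has_field_derivative_def]]) (intro Ck_mult Suc.IH Ck_const)
  qed
  then show ?thesis by (simp add: smooth_def)
qed

text \<open>The bump serves as an approximate identity and its primitive as a smooth step. Scaled
  together they give smoothed indicators of intervals whose derivatives are differences of
  approximate point masses.\<close>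

lemma bump_and_step:
  obtains \<beta> st :: "real \<Rightarrow> real" where "smooth \<beta>" "smooth st" "\<And>x. (st has_real_derivative \<beta> x) (at x)"
    "\<And>x. \<beta> x \<ge> 0" "\<And>x. \<bar>x\<bar> \<ge> 1 \<Longrightarrow> \<beta> x = 0" "\<And>x. x \<le> -1 \<Longrightarrow> st x = 0" "\<And>x. x \<ge> 1 \<Longrightarrow> st x = 1"
    "integrable lborel \<beta>" "(\<integral>x. \<beta> x \<partial>lborel) = 1"
proof -
  define \<beta>0 where "\<beta>0 x = flat 1 (1 + x) * flat 1 (1 - x)" for x :: real
  have sb: "smooth \<beta>0"
    unfolding \<beta>0_def by (intro smooth_mult smooth_real_compose[OF smooth_flat] smooth_add smooth_diff smooth_const smooth_linear bounded_linear_ident)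
  have nn: "\<beta>0 x \<ge> 0" for x by (auto simp: \<beta>0_def flat_def)
  have z: "\<beta>0 x = 0" if "\<bar>x\<bar> \<ge> 1" for x using that by (auto simp: \<beta>0_def flat_def)
  \<comment> \<open>The primitive is taken from -1, the left end of the support, so that it is 0 to
    the left of it and constant to the right of 1.\<close>
  define s0 where "s0 x = (LBINT y=ereal (-1)..x. \<beta>0 y)" for x :: real
  have sd: "(s0 has_real_derivative \<beta>0 x) (at x)" for x
  proof -
    define a where "a = - 2 - \<bar>x\<bar>"
    define b where "b = 2 + \<bar>x\<bar>"
    have "((\<lambda>u. LBINT y=ereal (-1)..u. \<beta>0 y) has_vector_derivative \<beta>0 x) (at x within {a..b})"
      using interval_integral_FTC2[of a "-1" b \<beta>0 x] smooth_cont[OF sb] by (auto simp: a_def b_def)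
    moreover have "at x within {a..b} = at x" by (rule at_within_interior) (auto simp: a_def b_def)
    ultimately show ?thesis by (simp add: s0_def[abs_def] has_real_derivative_iff_has_vector_derivative)
  qed
  have s_left: "s0 x = 0" if "x \<le> -1" for x
  proof (cases "x = -1")
    case False
    have "\<exists>z. x < z \<and> z < -1 \<and> s0 (-1) - s0 x = (-1 - x) * \<beta>0 z"
      using False that by (intro MVT2 sd) auto
    moreover have "s0 (-1) = 0" by (simp add: s0_def)
    ultimately show ?thesis using z by auto
  qed (simp add: s0_def)
  have s_right: "s0 x = s0 1" if "x \<ge> 1" for x
  proof (cases "x = 1")
    case False
    have "\<exists>z. 1 < z \<and> z < x \<and> s0 x - s0 1 = (x - 1) * \<beta>0 z"
      using False that by (intro MVT2 sd) auto
    then show ?thesis using z by auto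
  qed simp
  define c where "c = s0 1"
  have c: "c > 0"
  proof -
    have "\<exists>z. -1 < z \<and> z < 1 \<and> s0 1 - s0 (-1) = (1 - (-1)) * \<beta>0 z"
      by (intro MVT2 sd) auto
    moreover have "\<beta>0 z > 0" if "-1 < z" "z < 1" for z using that by (auto simp: \<beta>0_def flat_def)
    ultimately show ?thesis using s_left[of "-1"] by (auto simp: c_def)
  qed
  let ?\<beta> = "\<lambda>x. (1 / c) * \<beta>0 x" and ?st = "\<lambda>x. (1 / c) * s0 x"
  have ss: "smooth s0"
  proof (rule smoothI)
    show "(s0 has_derivative (\<lambda>v. \<beta>0 x * v)) (at x)" for x using sd by (simp add: has_field_derivative_def)
    show "smooth (\<lambda>x. \<beta>0 x * v)" for v by (intro smooth_mult sb smooth_const)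
  qed
  have "has_bochner_integral lborel (\<lambda>x. ?\<beta> x * indicator {-1..1} x) (?st 1 - ?st (-1))"
  proof (rule has_bochner_integral_FTC_Icc_real)
    show "(?st has_real_derivative ?\<beta> x) (at x)" for x by (rule DERIV_cmult[OF sd])
    show "isCont ?\<beta> x" for x
      using smooth_cont[OF sb, of UNIV] by (intro continuous_intros) (simp add: continuous_on_eq_continuous_at)
  qed simp
  moreover have "(\<lambda>x. ?\<beta> x * indicator {-1..1} x) = ?\<beta>"
  proof
    fix x show "?\<beta> x * indicator {-1..1} x = ?\<beta> x"
      using z[of x] by (cases "\<bar>x\<bar> \<ge> 1") (auto simp: indicator_def)
  qed
  ultimately have I: "has_bochner_integral lborel ?\<beta> 1" using c s_left[of "-1"] by (simp add: c_def)
  show ?thesis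
  proof (rule that[of ?\<beta> ?st])
    show "smooth ?\<beta>" "smooth ?st" by (intro smooth_cmult sb ss)+
    show "(?st has_real_derivative ?\<beta> x) (at x)" for x by (rule DERIV_cmult[OF sd])
    show "?\<beta> x \<ge> 0" for x using c nn[of x] by simp
    show "\<bar>x\<bar> \<ge> 1 \<Longrightarrow> ?\<beta> x = 0" for x using z[of x] by simp
    show "x \<le> -1 \<Longrightarrow> ?st x = 0" for x using s_left[of x] by simp
    show "x \<ge> 1 \<Longrightarrow> ?st x = 1" for x using s_right[of x] c by (simp add: c_def)
    show "integrable lborel ?\<beta>" "(\<integral>x. ?\<beta> x \<partial>lborel) = 1"
      using I by (auto simp: has_bochner_integral_iff)
  qed
qed

definition bumpy :: "('a::euclidean_space \<Rightarrow> real) \<Rightarrow> bool" where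
  "bumpy \<eta> \<longleftrightarrow> smooth \<eta> \<and> (\<exists>R. \<forall>x. norm x > R \<longrightarrow> \<eta> x = 0)"

lemma bumpy_dd: assumes "bumpy \<eta>" shows "bumpy (dd v \<eta>)"
proof -
  obtain R where R: "\<And>x. norm x > R \<Longrightarrow> \<eta> x = 0" and s: "smooth \<eta>" using assms by (auto simp: bumpy_def)
  have "dd v \<eta> x = 0" if "norm x > R" for x
  proof (rule dd_eq[where f' = "\<lambda>_. 0"])
    show "(\<eta> has_derivative (\<lambda>_. 0)) (at x)"
    proof (rule has_derivative_transform_within_open[OF has_derivative_const])
      show "open {x. R < norm x}" by (intro open_Collect_less continuous_intros)
    qed (use that R in auto)
  qed
  then show ?thesis using smooth_dd[OF s] by (auto simp: bumpy_def)
qed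

text \<open>Compact support admits any positive continuous weight. The bounds for the finitely many
  basis directions give the bound for all unit vectors by linearity of \<open>dd\<close> in the
  direction.\<close>

lemma bumpy_bdk: "bumpy (\<eta> :: 'a::euclidean_space \<Rightarrow> real) \<Longrightarrow> \<exists>C\<ge>0. bdk n (\<lambda>x. C * exp (- norm x)) \<eta>"
proof (induction n arbitrary: \<eta>)
  have bd: "\<exists>C\<ge>0. \<forall>x. \<bar>\<eta> x\<bar> \<le> C * exp (- norm x)" if bu: "bumpy \<eta>" for \<eta> :: "'a \<Rightarrow> real"
  proof -
    obtain R where R: "\<And>x. norm x > R \<Longrightarrow> \<eta> x = 0" and s: "smooth \<eta>" using bu by (auto simp: bumpy_def)
    have "compact ((\<lambda>x. \<eta> x * exp (norm x)) ` cball 0 R)"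
      by (intro compact_continuous_image continuous_intros smooth_cont[OF s]) auto
    then have "bounded ((\<lambda>x. \<eta> x * exp (norm x)) ` cball 0 R)" by (rule compact_imp_bounded)
    then obtain C where C: "C > 0" "\<And>x. norm x \<le> R \<Longrightarrow> \<bar>\<eta> x * exp (norm x)\<bar> \<le> C"
      unfolding bounded_pos by auto
    have "\<bar>\<eta> x\<bar> \<le> C * exp (- norm x)" for x
    proof (cases "norm x \<le> R")
      case True then show ?thesis using C(2)[of x] by (simp add: abs_mult exp_minus field_simps)
    qed (use R C in auto)
    then show ?thesis using C(1) by (intro exI[of _ C]) auto
  qed
  { case 0 then show ?case using bd[OF 0] by (auto simp: bumpy_def smooth_cont) }
  case (Suc n)
  have "\<forall>e. \<exists>C\<ge>0. bdk n (\<lambda>x. C * exp (- norm x)) (dd e \<eta>)" using Suc.IH bumpy_dd[OF Suc.prems] by blast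
  then obtain C where C: "\<And>e. C e \<ge> 0" "\<And>e. bdk n (\<lambda>x. C e * exp (- norm x)) (dd e \<eta>)" by metis
  obtain C0 where C0: "C0 \<ge> 0" "\<And>x. \<bar>\<eta> x\<bar> \<le> C0 * exp (- norm x)" using bd[OF Suc.prems] by auto
  let ?C = "C0 + (\<Sum>e\<in>Basis. C e)"
  have d: "\<eta> differentiable (at x)" for x using Suc.prems by (simp add: bumpy_def smooth_differentiable)
  have "bdk n (\<lambda>x. ?C * exp (- norm x)) (dd v \<eta>)" if v: "norm v \<le> 1" for v
  proof -
    have "bdk n (\<lambda>x. \<Sum>e\<in>Basis. \<bar>v \<bullet> e\<bar> * (C e * exp (- norm x))) (\<lambda>x. \<Sum>e\<in>Basis. (v \<bullet> e) * dd e \<eta> x)"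
      by (intro bdk_sum bdk_scale C) auto
    moreover have "dd v \<eta> = (\<lambda>x. \<Sum>e\<in>Basis. (v \<bullet> e) * dd e \<eta> x)" by (rule ext) (rule dd_basis_sum[OF d])
    moreover have "(\<Sum>e\<in>Basis. \<bar>v \<bullet> e\<bar> * (C e * exp (- norm x))) \<le> ?C * exp (- norm x)" for x :: 'a
    proof -
      have "(\<Sum>e\<in>Basis. \<bar>v \<bullet> e\<bar> * (C e * exp (- norm x))) \<le> (\<Sum>e\<in>Basis. 1 * (C e * exp (- norm x)))"
        using v C(1) by (intro sum_mono mult_right_mono) (auto intro: order_trans[OF Basis_le_norm])
      also have "\<dots> \<le> ?C * exp (- norm x)"
        using C0(1) by (simp add: sum_distrib_right distrib_right)
      finally show ?thesis .
    qed
    ultimately show ?thesis by (auto intro: bdk_weight)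
  qed
  moreover have "\<bar>\<eta> x\<bar> \<le> ?C * exp (- norm x)" for x
  proof -
    have "C0 * exp (- norm x) \<le> ?C * exp (- norm x)" using C(1) by (intro mult_right_mono) (auto intro: sum_nonneg)
    then show ?thesis using C0(2)[of x] by linarith
  qed
  ultimately have "?C \<ge> 0 \<and> bdk (Suc n) (\<lambda>x. ?C * exp (- norm x)) \<eta>"
    using d C0(1) C(1) by (auto intro!: add_nonneg_nonneg sum_nonneg)
  then show ?case by blast
qed

lemma ex_mollifier:
  assumes "\<delta> > 0"
  shows "\<exists>\<eta> :: 'a::euclidean_space \<Rightarrow> real. smooth \<eta> \<and> (\<forall>x. norm x \<ge> \<delta> \<longrightarrow> \<eta> x = 0) \<and> (\<forall>x. \<eta> x \<ge> 0) \<and>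
    integrable lborel \<eta> \<and> (\<integral>x. \<eta> x \<partial>lborel) = 1"
proof -
  obtain \<beta> st :: "real \<Rightarrow> real" where b: "smooth \<beta>" "\<And>x. \<beta> x \<ge> 0" "\<And>x. \<bar>x\<bar> \<ge> 1 \<Longrightarrow> \<beta> x = 0"
    "integrable lborel \<beta>" "(\<integral>x. \<beta> x \<partial>lborel) = 1"
    by (rule bump_and_step) blast
  \<comment> \<open>If the norm is at least \<delta>, so is the sum of the absolute coordinates, and
    one of them is at least \<delta> / DIM('a), where the one-dimensional factor vanishes.\<close>
  define d where "d = \<delta> / real DIM('a)"
  have d: "d > 0" using assms by (simp add: d_def)
  define g where "g x = (1 / d) * \<beta> ((1 / d) * x)" for x
  define \<eta> where "\<eta> x = (\<Prod>e\<in>Basis. g (x \<bullet> e))" for x :: 'a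
  have sg: "smooth g"
    unfolding g_def by (intro smooth_cmult smooth_real_compose[OF b(1)] smooth_linear bounded_linear_ident)
  have s: "smooth \<eta>"
    unfolding \<eta>_def by (intro smooth_prod smooth_real_compose[OF sg] smooth_linear bounded_linear_inner_left)
  have nn: "\<eta> x \<ge> 0" for x using b(2) d by (auto simp: \<eta>_def g_def intro!: prod_nonneg)
  have z: "\<eta> x = 0" if x: "norm x \<ge> \<delta>" for x
  proof -
    have "\<exists>e\<in>Basis. \<bar>x \<bullet> e\<bar> \<ge> d"
    proof (rule ccontr)
      assume "\<not> ?thesis"
      then have "(\<Sum>e\<in>Basis. \<bar>x \<bullet> e\<bar>) < (\<Sum>e\<in>(Basis::'a set). d)" by (intro sum_strict_mono) auto
      then show False using norm_le_l1[of x] x by (simp add: d_def)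
    qed
    then obtain e where e: "e \<in> Basis" "\<bar>x \<bullet> e\<bar> \<ge> d" by blast
    then have "g (x \<bullet> e) = 0" using b(3)[of "(1 / d) * (x \<bullet> e)"] d by (simp add: g_def abs_mult field_simps)
    then show ?thesis using e by (auto simp: \<eta>_def)
  qed
  have I1: "(\<integral>x. \<beta> ((1 / d) * x) \<partial>lborel) = d" "integrable lborel g"
    using lborel_integral_real_affine[of "1 / d" \<beta> 0] lborel_integrable_real_affine[OF b(4), of "1 / d" 0] d b(5)
    by (auto simp: g_def[abs_def] field_simps)
  have I2: "(\<integral>x. g x \<partial>lborel) = (1 / d) * (\<integral>x. \<beta> ((1 / d) * x) \<partial>lborel)"
    unfolding g_def by (rule integral_mult_right_zero)
  have "(\<integral>x. g x \<partial>lborel) = 1" unfolding I2 I1 using d by simp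
  moreover have "g x \<ge> 0" for x using b(2) d by (simp add: g_def)
  ultimately have g1: "(\<integral>\<^sup>+x. g x \<partial>lborel) = 1"
    using I1(2) by (subst nn_integral_eq_integral) auto
  have "(\<integral>\<^sup>+x. ennreal (\<eta> x) \<partial>lborel) = (\<integral>\<^sup>+x. (\<Prod>e\<in>Basis. ennreal (g (x \<bullet> e))) \<partial>(lborel::'a measure))"
    using b(2) d by (intro nn_integral_cong) (auto simp: \<eta>_def g_def prod_ennreal)
  also have "\<dots> = (\<Prod>e\<in>(Basis::'a set). (\<integral>\<^sup>+x. g x \<partial>lborel))"
    using smooth_borel[OF sg] by (intro nn_integral_lborel_prod) auto
  also have "\<dots> = 1" using g1 by simp
  finally have n: "(\<integral>\<^sup>+x. ennreal (\<eta> x) \<partial>lborel) = 1" .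
  have "integrable lborel \<eta>" using smooth_borel[OF s] n nn by (intro integrableI_nonneg) auto
  moreover have "(\<integral>x. \<eta> x \<partial>lborel) = 1" using n nn smooth_borel[OF s] by (simp add: integral_eq_nn_integral)
  ultimately show ?thesis using s z nn by blast
qed

section \<open>Differentiation of convolutions and averages\<close>

lemma differentiable_diff_le:
  fixes f :: "'a::euclidean_space \<Rightarrow> real"
  assumes d: "\<And>x. f differentiable (at x)" and b: "\<And>y. norm (y - x) \<le> norm h \<Longrightarrow> \<bar>dd h f y\<bar> \<le> B"
  shows "\<bar>f (x + h) - f x\<bar> \<le> B"
proof -
  obtain s where s: "0 < s" "s < 1" "dif h f x = dd h f (x + s *\<^sub>R h)" using mvt_dif[OF d] by blast
  have "norm (s *\<^sub>R h) \<le> norm h" using s by (simp add: mult_left_le_one_le)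
  then show ?thesis using b[of "x + s *\<^sub>R h"] s by (simp add: dif_def)
qed

text \<open>Dominated convergence for the difference quotients: the mean value theorem bounds the
  normalised remainder by twice \<open>D\<close>. Domination is asked for only within distance 1 of
  the base point, as weights such as \<open>expn\<close> allow.\<close>

lemma has_derivative_lebesgue_integral:
  fixes g :: "'b \<Rightarrow> 'a::euclidean_space \<Rightarrow> real"
  assumes d: "\<And>z x. g z differentiable (at x)"
    and int: "\<And>x. integrable M (\<lambda>z. g z x)"
    and meas: "\<And>v x. (\<lambda>z. dd v (g z) x) \<in> borel_measurable M"
    and D: "integrable M D" and dom: "\<And>z x' v. norm (x' - x) \<le> 1 \<Longrightarrow> \<bar>dd v (g z) x'\<bar> \<le> norm v * D z"
  shows "((\<lambda>x. \<integral>z. g z x \<partial>M) has_derivative (\<lambda>v. \<integral>z. dd v (g z) x \<partial>M)) (at x)"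
proof -
  let ?D = "\<lambda>v. \<integral>z. dd v (g z) x \<partial>M"
  have il: "integrable M (\<lambda>z. dd v (g z) x)" for v
    by (rule Bochner_Integration.integrable_bound[OF integrable_mult_right[OF D, of "norm v"]])
       (use meas dom[of x v] in \<open>auto intro!: AE_I2 order_trans[OF dom abs_ge_self]\<close>)
  have lin: "linear (\<lambda>v. dd v (g z) x)" for z
    using has_derivative_bounded_linear[OF dd_has_derivative[OF d]] by (rule bounded_linear.linear)
  have bl: "bounded_linear ?D"
  proof (rule bounded_linear_intro)
    show "?D (u + v) = ?D u + ?D v" for u v
      by (simp add: linear_add[OF lin] Bochner_Integration.integral_add[OF il il])
    show "?D (r *\<^sub>R v) = r *\<^sub>R ?D v" for r v by (simp add: linear_scale[OF lin])
    show "norm (?D v) \<le> norm v * (\<integral>z. D z \<partial>M)" for v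
    proof -
      have "norm (?D v) \<le> (\<integral>z. \<bar>dd v (g z) x\<bar> \<partial>M)" using integral_norm_bound[of M "\<lambda>z. dd v (g z) x"] by simp
      also have "\<dots> \<le> (\<integral>z. norm v * D z \<partial>M)"
        by (rule integral_mono) (use il D dom in auto)
      finally show ?thesis by simp
    qed
  qed
  let ?R = "\<lambda>h z. (g z (x + h) - g z x - dd h (g z) x) / norm h"
  let ?F = "\<lambda>h. norm ((\<integral>z. g z (x + h) \<partial>M) - (\<integral>z. g z x \<partial>M) - ?D h) / norm h"
  have "(?F \<longlongrightarrow> 0) (at 0)"
    unfolding tendsto_at_iff_sequentially comp_def
  proof (intro allI impI)
    fix X :: "nat \<Rightarrow> 'a" assume X0: "\<forall>i. X i \<in> UNIV - {0}" and X: "X \<longlonglongrightarrow> 0"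
    obtain N where N: "\<And>n. n \<ge> N \<Longrightarrow> norm (X n) < 1"
      using LIMSEQ_D[OF X, of 1] by auto
    \<comment> \<open>Dropping an initial segment keeps all increments within the unit ball in which
      \<open>D\<close> dominates.\<close>
    define Y where "Y n = X (n + N)" for n
    have Y1: "Y \<longlonglongrightarrow> 0" unfolding Y_def by (rule LIMSEQ_ignore_initial_segment[OF X])
    have Y: "Y \<longlonglongrightarrow> 0" "Y n \<noteq> 0" "norm (Y n) \<le> 1" for n
      using Y1 X0 N[of "n + N"] by (auto simp: Y_def)
    have "(\<lambda>n. \<integral>z. ?R (Y n) z \<partial>M) \<longlonglongrightarrow> (\<integral>z. 0 \<partial>M)"
    proof (rule integral_dominated_convergence[where w = "\<lambda>z. 2 * D z"])
      show "integrable M (\<lambda>z. 2 * D z)" using D by simp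
      show "(\<lambda>z. ?R (Y n) z) \<in> borel_measurable M" for n
        using int il by (intro borel_measurable_divide borel_measurable_diff) auto
      show "AE z in M. (\<lambda>n. ?R (Y n) z) \<longlonglongrightarrow> 0"
      proof (rule AE_I2)
        fix z
        have "((\<lambda>h. norm (g z (x + h) - g z x - dd h (g z) x) / norm h) \<longlongrightarrow> 0) (at 0)"
          using dd_has_derivative[OF d] by (simp add: has_derivative_at)
        then have "(\<lambda>n. norm (?R (Y n) z)) \<longlonglongrightarrow> 0"
          using Y unfolding tendsto_at_iff_sequentially comp_def by auto
        then show "(\<lambda>n. ?R (Y n) z) \<longlonglongrightarrow> 0" by (rule tendsto_norm_zero_cancel)
      qed
      show "AE z in M. norm (?R (Y n) z) \<le> 2 * D z" for n
      proof (rule AE_I2)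
        fix z
        have "\<bar>g z (x + Y n) - g z x\<bar> \<le> norm (Y n) * D z"
          by (rule differentiable_diff_le[OF d]) (rule dom, use Y(3)[of n] in linarith)
        moreover have "\<bar>dd (Y n) (g z) x\<bar> \<le> norm (Y n) * D z" by (rule dom) simp
        ultimately have "\<bar>g z (x + Y n) - g z x - dd (Y n) (g z) x\<bar> \<le> norm (Y n) * (2 * D z)" by linarith
        then show "norm (?R (Y n) z) \<le> 2 * D z" using Y(2)[of n] by (simp add: field_simps)
      qed
    qed simp
    moreover have "(\<integral>z. ?R h z \<partial>M) = ((\<integral>z. g z (x + h) \<partial>M) - (\<integral>z. g z x \<partial>M) - ?D h) / norm h" for h
      using int il by simp
    ultimately have "(\<lambda>n. ((\<integral>z. g z (x + Y n) \<partial>M) - (\<integral>z. g z x \<partial>M) - ?D (Y n)) / norm (Y n)) \<longlonglongrightarrow> 0"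
      by (simp only: Bochner_Integration.integral_zero)
    then have "(\<lambda>n. norm (((\<integral>z. g z (x + Y n) \<partial>M) - (\<integral>z. g z x \<partial>M) - ?D (Y n)) / norm (Y n))) \<longlonglongrightarrow> 0"
      by (rule tendsto_norm_zero)
    then have "(\<lambda>n. ?F (X (n + N))) \<longlonglongrightarrow> 0" by (simp add: Y_def)
    then show "(\<lambda>n. ?F (X n)) \<longlonglongrightarrow> 0" by (rule LIMSEQ_offset)
  qed
  then show ?thesis using bl by (simp add: has_derivative_at)
qed

section \<open>Lebesgue measure under reflection and translation; exponential weights\<close>

lemma distr_reflect: "distr lborel borel (\<lambda>z. x - z) = (lborel :: 'a::euclidean_space measure)"
  by (subst (2) lborel_affine[of "-1" x]) (auto simp: density_1)

lemma integral_reflect: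
  fixes f :: "'a::euclidean_space \<Rightarrow> real"
  assumes "f \<in> borel_measurable borel"
  shows "(\<integral>z. f (x - z) \<partial>lborel) = (\<integral>z. f z \<partial>lborel)"
    and "integrable lborel (\<lambda>z. f (x - z)) \<longleftrightarrow> integrable lborel f"
  using integral_distr[of "\<lambda>z. x - z" lborel borel f] integrable_distr_eq[of "\<lambda>z. x - z" lborel borel f] assms
  by (simp_all add: distr_reflect)

lemma integral_translate:
  fixes f :: "'a::euclidean_space \<Rightarrow> real"
  assumes "f \<in> borel_measurable borel"
  shows "(\<integral>z. f (x + z) \<partial>lborel) = (\<integral>z. f z \<partial>lborel)"
    and "integrable lborel (\<lambda>z. f (x + z)) \<longleftrightarrow> integrable lborel f"
  using integral_distr[of "\<lambda>z. x + z" lborel borel f] integrable_distr_eq[of "\<lambda>z. x + z" lborel borel f] assms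
  by (simp_all add: lborel_distr_plus)

lemma integrable_exp_abs: assumes "c > 0" shows "integrable lborel (\<lambda>x::real. exp (- c * \<bar>x\<bar>))"
proof -
  have "set_integrable lebesgue {0..} (\<lambda>x::real. exp (- c * x))"
    using assms integrable_on_exp_minus_to_infinity[of c 0]
    by (intro nonnegative_absolutely_integrable_1) auto
  then have "set_integrable lborel {0..} (\<lambda>x::real. exp (- c * x))"
    unfolding set_integrable_def by (subst (asm) integrable_completion) auto
  then have 1: "integrable lborel (\<lambda>x::real. indicator {0..} x * exp (- c * x))" by (simp add: set_integrable_def)
  have 2: "integrable lborel (\<lambda>x::real. indicator {0..} (0 - x) * exp (- c * (0 - x)))"
    by (subst integral_reflect(2)[of "\<lambda>x. indicator {0..} x * exp (- c * x)"]) (use 1 in auto)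
  show ?thesis
    by (rule Bochner_Integration.integrable_bound[OF Bochner_Integration.integrable_add[OF 1 2]])
       (auto simp: indicator_def)
qed

text \<open>The norm dominates the mean of the absolute coordinates, so the weight lies below a
  product of one-dimensional exponentials.\<close>

lemma integrable_exp_norm: assumes "c > 0" shows "integrable lborel (\<lambda>x::'a::euclidean_space. exp (- c * norm x))"
proof -
  define d where "d = c / real DIM('a)"
  have d: "d > 0" using assms by (simp add: d_def)
  have le: "exp (- c * norm x) \<le> (\<Prod>e\<in>Basis. exp (- d * \<bar>x \<bullet> e\<bar>))" for x :: 'a
  proof -
    have "(\<Sum>e\<in>Basis. d * \<bar>x \<bullet> e\<bar>) \<le> (\<Sum>e\<in>(Basis::'a set). d * norm x)"
      using d by (intro sum_mono mult_left_mono Basis_le_norm) auto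
    also have "\<dots> = c * norm x" by (simp add: d_def)
    finally show ?thesis by (simp add: sum_negf flip: exp_sum)
  qed
  have f: "(\<integral>\<^sup>+x. ennreal (exp (- d * \<bar>x\<bar>)) \<partial>lborel) < \<infinity>"
    using integrable_exp_abs[OF d] by (auto simp: integrable_iff_bounded)
  have "(\<integral>\<^sup>+x. ennreal (exp (- c * norm x)) \<partial>(lborel::'a measure)) \<le> (\<integral>\<^sup>+x. (\<Prod>e\<in>Basis. ennreal (exp (- d * \<bar>x \<bullet> e\<bar>))) \<partial>(lborel::'a measure))"
    using le by (intro nn_integral_mono) (simp add: prod_ennreal ennreal_leI)
  also have "\<dots> = (\<Prod>e\<in>(Basis::'a set). (\<integral>\<^sup>+x. ennreal (exp (- d * \<bar>x\<bar>)) \<partial>lborel))"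
    by (rule nn_integral_lborel_prod) auto
  also have "\<dots> < \<infinity>" using f by (simp add: power_less_top_ennreal)
  finally show ?thesis by (intro integrableI_bounded) auto
qed

definition cv :: "('a::euclidean_space \<Rightarrow> real) \<Rightarrow> ('a \<Rightarrow> real) \<Rightarrow> 'a \<Rightarrow> real" where
  "cv U \<eta> x = (\<integral>z. U z * \<eta> (x - z) \<partial>lborel)"

abbreviation expn :: "'a::euclidean_space \<Rightarrow> real" where "expn x \<equiv> exp (- norm x)"

lemma integrable_expn: "integrable lborel (expn :: 'a::euclidean_space \<Rightarrow> real)"
  using integrable_exp_norm[of 1] by simp

lemma dd_reflect: "f differentiable (at (x - z)) \<Longrightarrow> dd v (\<lambda>x. u * f (x - z)) x = u * dd v f (x - z)"
  using dd_shift[of f x "- z" v] dd_eq[OF has_derivative_mult_right[OF dd_has_derivative[OF differentiable_shift[of f x "- z"]]]]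
  by simp

context
  fixes U :: "'a::euclidean_space \<Rightarrow> real" and M :: real
  assumes U: "U \<in> borel_measurable borel" "\<And>z. \<bar>U z\<bar> \<le> M"
begin

lemma abs_U_mult: "\<bar>t\<bar> \<le> w \<Longrightarrow> \<bar>U z * t\<bar> \<le> M * w"
  unfolding abs_mult using U(2)[of z] by (intro mult_mono) auto

lemma cv_integrable:
  assumes \<eta>: "bdk n (\<lambda>x. C * expn x) \<eta>"
  shows "integrable lborel (\<lambda>z. U z * \<eta> (x - z))"
proof (rule Bochner_Integration.integrable_bound)
  show "integrable lborel (\<lambda>z. M * (C * expn (x - z)))"
    using integrable_expn by (subst integral_reflect(2)[of "\<lambda>y. M * (C * expn y)"]) auto
  show "AE z in lborel. norm (U z * \<eta> (x - z)) \<le> norm (M * (C * expn (x - z)))"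
    using abs_U_mult[OF bdk_le[OF \<eta>]] by (intro AE_I2) (auto intro!: order_trans[OF _ abs_ge_self])
qed (use U bdk_borel[OF \<eta>] in measurable)

lemma cv_le:
  assumes \<eta>: "bdk n (\<lambda>x. C * expn x) \<eta>"
  shows "\<bar>cv U \<eta> x\<bar> \<le> C * M * (\<integral>z. expn (z::'a) \<partial>lborel)"
proof -
  have i: "integrable lborel (\<lambda>z. M * (C * expn (x - z)))"
    using integrable_expn by (subst integral_reflect(2)[of "\<lambda>y. M * (C * expn y)"]) auto
  have "\<bar>cv U \<eta> x\<bar> \<le> (\<integral>z. \<bar>U z * \<eta> (x - z)\<bar> \<partial>lborel)" unfolding cv_def by (rule integral_abs_bound)
  also have "\<dots> \<le> (\<integral>z. M * (C * expn (x - z)) \<partial>lborel)"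
    by (rule integral_mono[OF integrable_abs[OF cv_integrable[OF \<eta>]] i]) (rule abs_U_mult[OF bdk_le[OF \<eta>]])
  also have "\<dots> = (\<integral>z. M * (C * expn (z::'a)) \<partial>lborel)"
    by (rule integral_reflect(1)[of "\<lambda>y. M * (C * expn y)"]) auto
  finally show ?thesis by (simp add: mult_ac)
qed

text \<open>All derivatives fall on \<eta>, since \<open>U\<close> is only bounded and measurable;
  shifts by at most 1 cost the factor \<open>exp 1\<close> in the weight.\<close>

lemma cv_has_derivative:
  assumes \<eta>: "bdk (Suc n) (\<lambda>x. C * expn x) \<eta>"
  shows "(cv U \<eta> has_derivative (\<lambda>v. cv U (dd v \<eta>) x)) (at x)"
proof -
  have M: "M \<ge> 0" using U(2)[of 0] by linarith
  have C: "C \<ge> 0" using bdk_le[OF \<eta>, of 0] by simp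
  have b0: "dd v \<eta> \<in> borel_measurable borel" for v using bdk_borel[OF bdk_dd[OF \<eta>]] .
  have e: "dd v (\<lambda>x. U z * \<eta> (x - z)) y = U z * dd v \<eta> (y - z)" for v z y
    using \<eta> by (intro dd_reflect) auto
  have "((\<lambda>x. \<integral>z. U z * \<eta> (x - z) \<partial>lborel) has_derivative (\<lambda>v. \<integral>z. dd v (\<lambda>x. U z * \<eta> (x - z)) x \<partial>lborel)) (at x)"
  proof (rule has_derivative_lebesgue_integral[where D = "\<lambda>z. M * (C * (exp 1 * expn (x - z)))"])
    show "(\<lambda>x. U z * \<eta> (x - z)) differentiable (at y)" for z y
      using differentiable_shift[of \<eta> y "- z"] \<eta> by (auto intro!: differentiable_mult)
    show "integrable lborel (\<lambda>z. U z * \<eta> (y - z))" for y by (rule cv_integrable[OF \<eta>])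
    show "(\<lambda>z. dd v (\<lambda>x. U z * \<eta> (x - z)) y) \<in> borel_measurable lborel" for v y
      unfolding e using U b0[of v] by measurable
    show "integrable lborel (\<lambda>z. M * (C * (exp 1 * expn (x - z))))"
      using integrable_expn by (subst integral_reflect(2)[of "\<lambda>y. M * (C * (exp 1 * expn y))"]) auto
    fix z x' v assume x': "norm (x' - x) \<le> 1"
    have "expn (x' - z) \<le> exp (norm (x' - x)) * expn (x - z)"
      using exp_norm_shift[of "x - z" "x' - x"] by simp
    also have "\<dots> \<le> exp 1 * expn (x - z)" using x' by simp
    finally have 1: "expn (x' - z) \<le> exp 1 * expn (x - z)" .
    have "\<bar>U z\<bar> * \<bar>dd v \<eta> (x' - z)\<bar> \<le> M * (norm v * (C * expn (x' - z)))"
      using U(2) bdk_dd_le[OF \<eta>] M by (intro mult_mono) auto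
    also have "\<dots> \<le> M * (norm v * (C * (exp 1 * expn (x - z))))"
      using 1 M C by (intro mult_left_mono) auto
    finally show "\<bar>dd v (\<lambda>x. U z * \<eta> (x - z)) x'\<bar> \<le> norm v * (M * (C * (exp 1 * expn (x - z))))"
      unfolding e by (simp add: abs_mult mult_ac)
  qed
  then show ?thesis unfolding e cv_def[abs_def] .
qed

lemma dd_cv: "bdk (Suc n) (\<lambda>x. C * expn x) \<eta> \<Longrightarrow> dd v (cv U \<eta>) = cv U (dd v \<eta>)"
  using dd_eq[OF cv_has_derivative] by blast

lemma bdk_cv: "bdk (Suc n) (\<lambda>x. C * expn x) \<eta> \<Longrightarrow> bdk n (\<lambda>_. C * M * (\<integral>z. expn (z::'a) \<partial>lborel)) (cv U \<eta>)"
proof (induction n arbitrary: \<eta>)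
  case 0
  then show ?case using cv_le[OF 0] has_derivative_continuous[OF cv_has_derivative[OF 0]]
    by (auto intro!: continuous_at_imp_continuous_on)
next
  case (Suc n)
  have "cv U \<eta> differentiable (at x)" for x using cv_has_derivative[OF Suc.prems] differentiable_def by blast
  moreover have "bdk n (\<lambda>_. C * M * (\<integral>z. expn (z::'a) \<partial>lborel)) (dd v (cv U \<eta>))" if "norm v \<le> 1" for v
    unfolding dd_cv[OF Suc.prems] using Suc.prems that by (intro Suc.IH) simp
  ultimately show ?case using cv_le[OF Suc.prems] by auto
qed

end

text \<open>The kernel stays fixed and the argument is rescaled by \<open>m\<close>. Dilating inside
  \<open>G\<close> instead of changing variables in \<open>K\<close> avoids Jacobians, and for m = 0
  and a kernel of mass 1 the average is \<open>G\<close> itself.\<close>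

definition av :: "('a::euclidean_space \<Rightarrow> real) \<Rightarrow> ('a \<Rightarrow> 'a) \<Rightarrow> ('a \<Rightarrow> real) \<Rightarrow> 'a \<Rightarrow> real" where
  "av K m G x = (\<integral>z. K z * G (x - m z) \<partial>lborel)"

context
  fixes K :: "'a::euclidean_space \<Rightarrow> real" and m :: "'a \<Rightarrow> 'a"
  assumes K: "integrable lborel K" and K_nonneg: "\<And>z. K z \<ge> 0" and K_one: "(\<integral>z. K z \<partial>lborel) = 1"
    and m: "m \<in> borel_measurable borel"
begin

lemma av_integrable:
  assumes G: "G \<in> borel_measurable borel" "\<And>x. \<bar>G x\<bar> \<le> C"
  shows "integrable lborel (\<lambda>z. K z * G (x - m z))"
proof (rule Bochner_Integration.integrable_bound)
  show "integrable lborel (\<lambda>z. C * K z)" using K by simp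
  show "AE z in lborel. norm (K z * G (x - m z)) \<le> norm (C * K z)"
    using G(2) K_nonneg by (intro AE_I2) (auto simp: abs_mult mult.commute[of C] intro!: mult_left_mono order_trans[OF _ abs_ge_self])
  have "K \<in> borel_measurable lborel" using K by auto
  then show "(\<lambda>z. K z * G (x - m z)) \<in> borel_measurable lborel" using G m by measurable
qed

lemma av_le:
  assumes G: "G \<in> borel_measurable borel" "\<And>x. \<bar>G x\<bar> \<le> C"
  shows "\<bar>av K m G x\<bar> \<le> C"
proof -
  have "\<bar>av K m G x\<bar> \<le> (\<integral>z. \<bar>K z * G (x - m z)\<bar> \<partial>lborel)" unfolding av_def by (rule integral_abs_bound)
  also have "\<dots> \<le> (\<integral>z. C * K z \<partial>lborel)"
    using G(2) K_nonneg K
    by (intro integral_mono[OF integrable_abs[OF av_integrable[OF G]]]) (auto simp: abs_mult mult.commute[of C] intro!: mult_left_mono)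
  finally show ?thesis by (simp add: K_one)
qed

text \<open>Here derivatives fall on \<open>G\<close> and the kernel provides the integrable bound,
  so averaging does not increase the bounds on derivatives.\<close>

lemma av_has_derivative:
  assumes G: "bdk (Suc n) (\<lambda>_. C) G"
  shows "(av K m G has_derivative (\<lambda>v. av K m (dd v G) x)) (at x)"
proof -
  have e: "dd v (\<lambda>x. K z * G (x - m z)) y = K z * dd v G (y - m z)" for v z y
    using G by (intro dd_reflect) auto
  have Km: "K \<in> borel_measurable lborel" using K by auto
  have "((\<lambda>x. \<integral>z. K z * G (x - m z) \<partial>lborel) has_derivative (\<lambda>v. \<integral>z. dd v (\<lambda>x. K z * G (x - m z)) x \<partial>lborel)) (at x)"
  proof (rule has_derivative_lebesgue_integral[where D = "\<lambda>z. C * K z"])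
    show "(\<lambda>x. K z * G (x - m z)) differentiable (at y)" for z y
      using differentiable_shift[of G y "- m z"] G by (auto intro!: differentiable_mult)
    show "integrable lborel (\<lambda>z. K z * G (y - m z))" for y
      by (rule av_integrable[OF bdk_borel[OF G] bdk_le[OF G]])
    show "(\<lambda>z. dd v (\<lambda>x. K z * G (x - m z)) y) \<in> borel_measurable lborel" for v y
      unfolding e using Km bdk_borel[OF bdk_dd[OF G, of v]] m by measurable
    show "integrable lborel (\<lambda>z. C * K z)" using K by simp
    show "\<bar>dd v (\<lambda>x. K z * G (x - m z)) x'\<bar> \<le> norm v * (C * K z)" for z x' v
      unfolding e using mult_left_mono[OF bdk_dd_le[OF G, of v "x' - m z"] K_nonneg[of z]] K_nonneg[of z]
      by (simp add: abs_mult mult_ac)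
  qed
  then show ?thesis unfolding e av_def[abs_def] .
qed

lemma dd_av: "bdk (Suc n) (\<lambda>_. C) G \<Longrightarrow> dd v (av K m G) = av K m (dd v G)"
  using dd_eq[OF av_has_derivative] by blast

lemma bdk_av: "bdk (Suc n) (\<lambda>_. C) G \<Longrightarrow> bdk n (\<lambda>_. C) (av K m G)"
proof (induction n arbitrary: G)
  case 0
  then show ?case using av_le[OF bdk_borel[OF 0] bdk_le[OF 0]] has_derivative_continuous[OF av_has_derivative[OF 0]]
    by (auto intro!: continuous_at_imp_continuous_on)
next
  case (Suc n)
  have "av K m G differentiable (at x)" for x using av_has_derivative[OF Suc.prems] differentiable_def by blast
  moreover have "bdk n (\<lambda>_. C) (dd v (av K m G))" if "norm v \<le> 1" for v
    unfolding dd_av[OF Suc.prems] using Suc.prems that by (intro Suc.IH) simp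
  ultimately show ?case using av_le[OF bdk_borel[OF Suc.prems] bdk_le[OF Suc.prems]] by auto
qed

end

text \<open>Uniqueness of Haar measure: the double integral of f(x) g(x + y) over \<open>M\<close>
  and Lebesgue measure, evaluated in both orders, gives the two sides.\<close>

lemma translation_invariant_proportional:
  fixes M :: "'a::euclidean_space measure" and f g :: "'a \<Rightarrow> ennreal"
  assumes M: "sets M = sets borel" "sigma_finite_measure M" "\<And>a. distr M borel ((+) a) = M"
    and f: "f \<in> borel_measurable borel" and g: "g \<in> borel_measurable borel"
  shows "(\<integral>\<^sup>+x. f x \<partial>M) * (\<integral>\<^sup>+x. g x \<partial>lborel) = (\<integral>\<^sup>+x. g x \<partial>M) * (\<integral>\<^sup>+x. f x \<partial>lborel)"
proof -
  interpret M: sigma_finite_measure M by fact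
  interpret pair_sigma_finite M "lborel :: 'a measure" ..
  note [measurable] = f g and [measurable_cong] = M(1)
  have tr: "(\<integral>\<^sup>+x. h (a + x) \<partial>M) = (\<integral>\<^sup>+x. h x \<partial>M)" if [measurable]: "h \<in> borel_measurable borel" for h a
  proof -
    have "(\<integral>\<^sup>+x. h x \<partial>M) = (\<integral>\<^sup>+x. h x \<partial>distr M borel ((+) a))" by (simp add: M(3))
    also have "\<dots> = (\<integral>\<^sup>+x. h (a + x) \<partial>M)" by (rule nn_integral_distr) auto
    finally show ?thesis by simp
  qed
  have trl: "(\<integral>\<^sup>+x. h (a + x) \<partial>lborel) = (\<integral>\<^sup>+x. h x \<partial>lborel)" if [measurable]: "h \<in> borel_measurable borel" for h and a :: 'a
    using nn_integral_distr[of "(+) a" lborel borel h] that by (simp add: lborel_distr_plus)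
  have rfl: "(\<integral>\<^sup>+x. h (a - x) \<partial>lborel) = (\<integral>\<^sup>+x. h x \<partial>lborel)" if [measurable]: "h \<in> borel_measurable borel" for h and a :: 'a
    using nn_integral_distr[of "\<lambda>x. a - x" lborel borel h] that by (simp add: distr_reflect)
  have "(\<integral>\<^sup>+x. f x \<partial>M) * (\<integral>\<^sup>+x. g x \<partial>lborel) = (\<integral>\<^sup>+x. f x * (\<integral>\<^sup>+y. g (x + y) \<partial>lborel) \<partial>M)"
    by (subst trl) (auto simp: nn_integral_multc)
  also have "\<dots> = (\<integral>\<^sup>+x. (\<integral>\<^sup>+y. f x * g (x + y) \<partial>lborel) \<partial>M)"
    by (intro nn_integral_cong) (simp add: nn_integral_cmult)
  also have "\<dots> = (\<integral>\<^sup>+y. (\<integral>\<^sup>+x. f x * g (x + y) \<partial>M) \<partial>lborel)"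
    by (rule Fubini'[symmetric]) measurable
  also have "\<dots> = (\<integral>\<^sup>+y. (\<integral>\<^sup>+x. f (x - y) * g x \<partial>M) \<partial>lborel)"
  proof (rule nn_integral_cong)
    fix y
    show "(\<integral>\<^sup>+x. f x * g (x + y) \<partial>M) = (\<integral>\<^sup>+x. f (x - y) * g x \<partial>M)"
      using tr[of "\<lambda>x. f (x - y) * g x" y] by (simp add: add.commute)
  qed
  also have "\<dots> = (\<integral>\<^sup>+x. (\<integral>\<^sup>+y. f (x - y) * g x \<partial>lborel) \<partial>M)"
    by (rule Fubini') measurable
  also have "\<dots> = (\<integral>\<^sup>+x. (\<integral>\<^sup>+y. f y \<partial>lborel) * g x \<partial>M)"
    by (intro nn_integral_cong) (simp add: nn_integral_multc rfl)
  finally show ?thesis by (simp add: nn_integral_cmult nn_integral_multc mult.commute)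
qed

lemma emeasure_unit_cball_nonzero: "emeasure lborel (cball (0::'a::euclidean_space) 1) \<noteq> 0"
proof -
  have "real DIM('a) / 2 + 1 > 0" by (simp add: add_nonneg_pos)
  from Gamma_real_pos[OF this] have "Gamma (real DIM('a) / 2 + 1) \<noteq> 0" by (metis less_irrefl)
  then show ?thesis by (auto simp: emeasure_cball unit_ball_vol_def)
qed

text \<open>The image of Lebesgue measure under \<open>L\<close> is again translation invariant,
  hence a multiple of it. The existence of the factor is the input of the scaling argument that
  determines it for \<open>E\<close>.\<close>

lemma linear_bij_scales_lborel:
  fixes L L' :: "'a::euclidean_space \<Rightarrow> 'a"
  assumes L: "bounded_linear L" "bounded_linear L'" and inv: "\<And>x. L (L' x) = x" "\<And>x. L' (L x) = x"
  shows "\<exists>c>0. \<forall>A\<in>sets borel. emeasure lborel (L -` A) = ennreal c * emeasure lborel A"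
proof -
  have cont: "continuous_on UNIV L" "continuous_on UNIV L'"
    using L by (auto intro: linear_continuous_on)
  have [measurable]: "L \<in> borel_measurable borel" using cont(1) by (rule borel_measurable_continuous_onI)
  define M where "M = distr lborel borel L"
  have sM: "sets M = sets borel" by (simp add: M_def)
  have eM: "emeasure M A = emeasure lborel (L -` A)" if "A \<in> sets borel" for A
    using that by (simp add: M_def emeasure_distr)
  have bd: "emeasure M (cball 0 r) < \<infinity>" for r
  proof -
    have "L -` S = L' ` S" for S
    proof (intro set_eqI iffI)
      fix x assume "x \<in> L -` S"
      then show "x \<in> L' ` S" using inv(2)[of x] by (intro image_eqI[of _ _ "L x"]) auto
    qed (auto simp: inv)
    then have "L -` cball 0 r = L' ` cball 0 r" .
    then have "bounded (L -` cball 0 r)" using L(2) by (simp add: bounded_linear_image)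
    from emeasure_bounded_finite[OF this] show ?thesis by (simp add: eM)
  qed
  have "sigma_finite_measure M"
  proof
    show "\<exists>A. countable A \<and> A \<subseteq> sets M \<and> \<Union>A = space M \<and> (\<forall>a\<in>A. emeasure M a \<noteq> \<infinity>)"
    proof (intro exI[of _ "range (\<lambda>n. cball 0 (real n))"] conjI ballI)
      show "\<Union> (range (\<lambda>n. cball 0 (real n))) = space M" by (auto simp: M_def dist_norm intro: real_arch_simple)
    qed (use bd in \<open>auto simp: sM less_top\<close>)
  qed
  moreover have "distr M borel ((+) a) = M" for a
  proof -
    have "distr M borel ((+) a) = distr lborel borel (\<lambda>x. a + L x)" unfolding M_def by (subst distr_distr) (auto simp: comp_def)
    also have "\<dots> = distr lborel borel (\<lambda>x. L (L' a + x))"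
      using inv L(1) by (simp add: linear_add[OF bounded_linear.linear])
    also have "\<dots> = distr (distr lborel borel ((+) (L' a))) borel L" by (subst distr_distr) (auto simp: comp_def)
    finally show ?thesis by (simp add: lborel_distr_plus M_def)
  qed
  ultimately have pr: "emeasure M A * emeasure lborel C = emeasure M C * emeasure lborel A"
    if "A \<in> sets borel" "C \<in> sets borel" for A C
    using translation_invariant_proportional[of M "indicator A" "indicator C"] that by (simp add: sM)
  let ?B = "cball (0::'a) 1"
  have B: "emeasure lborel ?B \<noteq> 0" "emeasure lborel ?B \<noteq> \<infinity>"
    using emeasure_unit_cball_nonzero emeasure_bounded_finite[of ?B] by auto
  have MB: "emeasure M ?B \<noteq> 0"
  proof
    assume "emeasure M ?B = 0"
    then have "emeasure M A * emeasure lborel ?B = 0" if "A \<in> sets borel" for A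
      using pr[OF that, of ?B] by simp
    then have "emeasure M UNIV = 0" using B by auto
    then show False by (simp add: eM)
  qed
  define c where "c = enn2real (emeasure M ?B / emeasure lborel ?B)"
  have q: "emeasure M ?B / emeasure lborel ?B < \<infinity>"
  proof -
    have "emeasure M ?B \<noteq> top" using bd[of 1] by (simp add: less_top)
    then have "\<not> emeasure M ?B / emeasure lborel ?B = top" using B by (auto simp: ennreal_divide_eq_top_iff)
    then show ?thesis by (simp add: less_top)
  qed
  have "emeasure lborel (L -` A) = ennreal c * emeasure lborel A" if A: "A \<in> sets borel" for A
  proof -
    have "emeasure M A = emeasure M A * emeasure lborel ?B / emeasure lborel ?B"
      by (subst ennreal_mult_divide_eq) (use B in auto)
    also have "\<dots> = emeasure M ?B * emeasure lborel A / emeasure lborel ?B" using pr[OF A, of ?B] by simp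
    also have "\<dots> = (emeasure M ?B / emeasure lborel ?B) * emeasure lborel A"
      by (simp only: ennreal_divide_times ennreal_times_divide)
    also have "emeasure M ?B / emeasure lborel ?B = ennreal c"
      using q by (simp add: c_def)
    finally show ?thesis using eM[OF A] by simp
  qed
  moreover have "c > 0" using q MB B unfolding c_def by (simp add: enn2real_positive_iff ennreal_zero_less_divide less_top zero_less_iff_neq_zero)
  ultimately show ?thesis by blast
qed

text \<open>The mixed difference is symmetric in the two shifts, and two mean value steps identify
  the limit of its quotient with the mixed derivative in either order.\<close>

lemma dd_commute:
  fixes f :: "'a::euclidean_space \<Rightarrow> real"
  assumes f: "bdk 2 w f"
  shows "dd u (dd v f) x = dd v (dd u f) x"
proof -
  have f2: "bdk (Suc (Suc 0)) w f" using f by (simp add: numeral_2_eq_2 del: bdk.simps)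
  have d: "f differentiable (at y)" "dd v f differentiable (at y)" for v y
    using f2 bdk_dd[OF f2, of v] by auto
  have c: "continuous_on UNIV (dd u (dd v f))" for u v
    using bdk_cont[OF bdk_dd[OF bdk_dd[OF f2]]] .
  have com: "dif h (dif k f) = dif k (dif h f)" for h k by (auto simp: dif_def add_ac)
  have key: "\<exists>a b. \<bar>a\<bar> \<le> s \<and> \<bar>b\<bar> \<le> s \<and> dif (s *\<^sub>R u) (dif (s *\<^sub>R v) f) x = s\<^sup>2 * dd v (dd u f) (x + a *\<^sub>R u + b *\<^sub>R v)"
    if s: "s > 0" for s u v
  proof -
    have dk: "dif (s *\<^sub>R v) f differentiable (at y)" for y
      unfolding dif_def[abs_def] using d(1) by (intro differentiable_diff differentiable_shift)
    obtain t where t: "0 < t" "t < 1" "dif (s *\<^sub>R u) (dif (s *\<^sub>R v) f) x = dd (s *\<^sub>R u) (dif (s *\<^sub>R v) f) (x + t *\<^sub>R (s *\<^sub>R u))"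
      using mvt_dif[OF dk] by blast
    have "dd (s *\<^sub>R u) (dif (s *\<^sub>R v) f) y = s * dif (s *\<^sub>R v) (dd u f) y" for y
      unfolding dif_def[abs_def] using d(1)
      by (simp add: dd_diff dd_shift differentiable_shift dd_scaleR right_diff_distrib)
    moreover obtain t' where "0 < t'" "t' < 1" "dif (s *\<^sub>R v) (dd u f) (x + t *\<^sub>R (s *\<^sub>R u)) = dd (s *\<^sub>R v) (dd u f) (x + t *\<^sub>R (s *\<^sub>R u) + t' *\<^sub>R (s *\<^sub>R v))"
      using mvt_dif[OF d(2)] by blast
    ultimately show ?thesis using t s d(2)
      by (intro exI[of _ "t * s"] exI[of _ "t' * s"]) (auto simp: dd_scaleR power2_eq_square mult_left_le_one_le)
  qed
  define s where "s n = 1 / real (Suc n)" for n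
  have s: "s n > 0" for n by (simp add: s_def)
  have s0: "s \<longlonglongrightarrow> 0" unfolding s_def using LIMSEQ_inverse_real_of_nat by (simp add: inverse_eq_divide)
  have lim: "(\<lambda>n. dif (s n *\<^sub>R u) (dif (s n *\<^sub>R v) f) x / (s n)\<^sup>2) \<longlonglongrightarrow> dd v (dd u f) x" for u v
  proof -
    have "\<forall>n. \<exists>a b. \<bar>a\<bar> \<le> s n \<and> \<bar>b\<bar> \<le> s n \<and>
        dif (s n *\<^sub>R u) (dif (s n *\<^sub>R v) f) x = (s n)\<^sup>2 * dd v (dd u f) (x + a *\<^sub>R u + b *\<^sub>R v)"
      using key[OF s] by blast
    from choice[OF this] obtain a where "\<forall>n. \<exists>b. \<bar>a n\<bar> \<le> s n \<and> \<bar>b\<bar> \<le> s n \<and>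
        dif (s n *\<^sub>R u) (dif (s n *\<^sub>R v) f) x = (s n)\<^sup>2 * dd v (dd u f) (x + a n *\<^sub>R u + b *\<^sub>R v)" ..
    from choice[OF this] obtain b where ab: "\<And>n. \<bar>a n\<bar> \<le> s n" "\<And>n. \<bar>b n\<bar> \<le> s n"
      "\<And>n. dif (s n *\<^sub>R u) (dif (s n *\<^sub>R v) f) x = (s n)\<^sup>2 * dd v (dd u f) (x + a n *\<^sub>R u + b n *\<^sub>R v)"
      by blast
    have "a \<longlonglongrightarrow> 0" "b \<longlonglongrightarrow> 0"
      using ab by (auto intro!: Lim_null_comparison[OF _ s0])
    then have "(\<lambda>n. x + a n *\<^sub>R u + b n *\<^sub>R v) \<longlonglongrightarrow> x + 0 *\<^sub>R u + 0 *\<^sub>R v"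
      by (intro tendsto_intros)
    then have "(\<lambda>n. dd v (dd u f) (x + a n *\<^sub>R u + b n *\<^sub>R v)) \<longlonglongrightarrow> dd v (dd u f) x"
      using continuous_on_tendsto_compose[OF c[of v u]] by simp
    then show ?thesis using s ab(3) by (simp add: less_imp_neq[symmetric] s_def)
  qed
  show ?thesis
    using LIMSEQ_unique[OF lim[of v u]] lim[of u v] unfolding com[of "s _ *\<^sub>R u" "s _ *\<^sub>R v"] by auto
qed

definition scales :: "('a::euclidean_space \<Rightarrow> 'a) \<Rightarrow> real \<Rightarrow> bool" where
  "scales L c \<longleftrightarrow> c > 0 \<and> L \<in> borel_measurable borel \<and> (\<forall>A\<in>sets borel. emeasure lborel (L -` A) = ennreal c * emeasure lborel A)"

lemma scales_unique: assumes "scales L c" "scales L c'" shows "c = c'"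
proof -
  have "emeasure lborel (cball (0::'a) 1) \<noteq> 0" by (rule emeasure_unit_cball_nonzero)
  then have "0 < measure lborel (cball (0::'a) 1)"
    using emeasure_bounded_finite[of "cball (0::'a) 1"] by (simp add: measure_def enn2real_positive_iff less_top zero_less_iff_neq_zero)
  moreover have "emeasure lborel (cball (0::'a) 1) = ennreal (measure lborel (cball (0::'a) 1))"
    using emeasure_bounded_finite[of "cball (0::'a) 1"] by (intro emeasure_eq_ennreal_measure) auto
  moreover have "ennreal c * emeasure lborel (cball (0::'a) 1) = ennreal c' * emeasure lborel (cball (0::'a) 1)"
  proof -
    have "emeasure lborel (L -` cball 0 1) = ennreal c * emeasure lborel (cball (0::'a) 1)"
      using assms(1) by (simp add: scales_def)
    moreover have "emeasure lborel (L -` cball 0 1) = ennreal c' * emeasure lborel (cball (0::'a) 1)"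
      using assms(2) by (simp add: scales_def)
    ultimately show ?thesis by (simp only:)
  qed
  ultimately show ?thesis using assms by (simp add: scales_def flip: ennreal_mult)
qed

lemma scales_compose: assumes "scales L c" "scales M d" shows "scales (\<lambda>x. L (M x)) (c * d)"
proof -
  have [measurable]: "L \<in> borel_measurable borel" "M \<in> borel_measurable borel" using assms by (auto simp: scales_def)
  have "emeasure lborel ((\<lambda>x. L (M x)) -` A) = ennreal (c * d) * emeasure lborel A" if A: "A \<in> sets borel" for A
  proof -
    have "L -` A \<in> sets borel" using measurable_sets_borel[of L borel A] A by simp
    then have "emeasure lborel (M -` (L -` A)) = ennreal d * (ennreal c * emeasure lborel A)"
      using assms A by (simp add: scales_def)
    moreover have "(\<lambda>x. L (M x)) -` A = M -` (L -` A)" by auto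
    ultimately show ?thesis using assms by (simp add: scales_def ennreal_mult mult_ac)
  qed
  then show ?thesis using assms by (simp add: scales_def)
qed

lemma linear_bij_scales:
  assumes "bounded_linear L" "bounded_linear L'" "\<And>x. L (L' x) = x" "\<And>x. L' (L x) = x"
  shows "\<exists>c. scales L c"
  using linear_bij_scales_lborel[OF assms] borel_measurable_continuous_onI[OF linear_continuous_on[OF assms(1)]]
  by (auto simp: scales_def)

section \<open>Dilations, and invariance of Lebesgue measure under the drift\<close>

context kolmogorov
begin

lemma bounded_linear_dil: "bounded_linear (dil r)"
  by (rule linear_conv_bounded_linear[THEN iffD1], rule linearI) (auto simp: vec_eq_iff algebra_simps)

lemma dil_mult: "dil r (dil s z) = dil (r * s) z"
  by (simp add: vec_eq_iff power_mult_distrib)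

lemma dil_1 [simp]: "dil 1 z = z" by (simp add: vec_eq_iff)

lemma dil_inverse: "r \<noteq> 0 \<Longrightarrow> dil r (dil (1 / r) z) = z" "r \<noteq> 0 \<Longrightarrow> dil (1 / r) (dil r z) = z"
  by (simp_all add: dil_mult)

text \<open>Instead of computing the determinant: \<^term>\<open>E (4 * t)\<close> is on the one hand the fourth power of
  \<^term>\<open>E t\<close> and on the other hand conjugate to it, so that the scaling factor \<open>c\<close> satisfies \<open>c ^ 4 = c\<close>.\<close>

lemma Emat_scales: "scales (\<lambda>x. E t *v x) 1"
proof -
  have bl: "bounded_linear (\<lambda>x. E t *v x)" for t by (rule matrix_vector_mul_bounded_linear)
  obtain c where c: "scales (\<lambda>x. E t *v x) c"
    using linear_bij_scales[OF bl[of t] bl[of "- t"]] by (auto simp: Emat_mv)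
  obtain d where d: "scales (dil 2) d"
    using linear_bij_scales[OF bounded_linear_dil[of 2] bounded_linear_dil[of "1 / 2"]] dil_inverse[of 2] by auto
  have "scales (\<lambda>x. E t *v (E t *v (E t *v (E t *v x)))) (c * (c * (c * c)))"
    by (intro scales_compose c)
  then have c4: "scales (\<lambda>x. E (4 * t) *v x) (c * (c * (c * c)))" by (simp add: Emat_mv)
  from scales_compose[OF this d] have "scales (\<lambda>x. dil 2 (E t *v x)) ((c * (c * (c * c))) * d)"
    using Emat_dil[of 2 t] by simp
  from scales_unique[OF this scales_compose[OF d c]]
  have "c * (c * (c * c)) * d = d * c" .
  then have "c * (c * c) = 1" using c d by (auto simp: scales_def)
  then have "c ^ 3 = 1 ^ 3" by (simp add: power3_eq_cube)
  then have "c = 1" using c by (subst (asm) power_eq_iff_eq_base) (auto simp: scales_def)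
  then show ?thesis using c by simp
qed

lemma Emat_borel [measurable]: "(\<lambda>x. E t *v x) \<in> borel_measurable borel"
  using Emat_scales by (simp add: scales_def)

lemma distr_Emat: "distr lborel borel (\<lambda>x. E t *v x) = lborel"
proof (rule measure_eqI)
  fix A assume "A \<in> sets (distr lborel borel (\<lambda>x. E t *v x))"
  then show "emeasure (distr lborel borel (\<lambda>x. E t *v x)) A = emeasure lborel A"
    using Emat_scales[of t] by (subst emeasure_distr) (auto simp: scales_def)
qed simp

lemma integral_Emat:
  fixes f :: "(real, 'n) vec \<Rightarrow> real"
  assumes "f \<in> borel_measurable borel"
  shows "(\<integral>z. f (E t *v z) \<partial>lborel) = (\<integral>z. f z \<partial>lborel)"
    and "integrable lborel (\<lambda>z. f (E t *v z)) \<longleftrightarrow> integrable lborel f"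
  using integral_distr[of "\<lambda>z. E t *v z" lborel borel f] integrable_distr_eq[of "\<lambda>z. E t *v z" lborel borel f] assms
  by (simp_all add: distr_Emat)

end

text \<open>Derivatives of order up to three bring cubic polynomial factors; Gaussian decay absorbs
  them (by completing the square in r - 1 / c) and still leaves the exponential weight of
  \<open>bdk\<close>.\<close>

lemma exp_gauss_le:
  assumes "c > 0" "r \<ge> (0::real)"
  shows "(1 + r) ^ 3 * exp (- c * r\<^sup>2) \<le> 27 * exp (1 + 1 / c) * exp (- r)"
proof -
  have "(1 + r) / 3 \<le> exp ((1 + r) / 3)" using exp_ge_add_one_self[of "(1 + r) / 3"] by linarith
  then have "((1 + r) / 3) ^ 3 \<le> exp ((1 + r) / 3) ^ 3" using assms by (intro power_mono) auto
  also have "\<dots> = exp (1 + r)" by (simp flip: exp_of_nat_mult)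
  finally have 1: "(1 + r) ^ 3 \<le> 27 * exp (1 + r)" by (simp add: power_divide)
  have "0 \<le> c * (r - 1 / c)\<^sup>2" using assms by simp
  also have "\<dots> = c * r\<^sup>2 - 2 * r + 1 / c" using assms by (simp add: power2_eq_square field_simps)
  finally have 2: "1 + r + - c * r\<^sup>2 \<le> (1 + 1 / c) + - r" by simp
  have "(1 + r) ^ 3 * exp (- c * r\<^sup>2) \<le> 27 * exp (1 + r) * exp (- c * r\<^sup>2)" using 1 by (intro mult_right_mono) auto
  also have "\<dots> = 27 * exp (1 + r + - c * r\<^sup>2)" by (simp only: exp_add mult.assoc)
  also have "\<dots> \<le> 27 * exp ((1 + 1 / c) + - r)" using 2 by simp
  finally show ?thesis by (simp only: exp_add mult.assoc)
qed

lemma power_exp_le: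
  assumes "r \<ge> (0::real)"
  shows "(1 + r) ^ p \<le> (2 * real (Suc p)) ^ p * exp ((1 + r) / 2)"
proof -
  let ?y = "(1 + r) / (2 * real (Suc p))"
  have "?y \<le> exp ?y" using exp_ge_add_one_self[of ?y] by linarith
  then have "?y ^ p \<le> exp ?y ^ p" using assms by (intro power_mono) auto
  also have "\<dots> = exp (real p * ?y)" by (simp flip: exp_of_nat_mult)
  also have "\<dots> \<le> exp ((1 + r) / 2)" using assms by (simp add: field_simps)
  finally show ?thesis by (simp add: power_divide field_simps del: of_nat_Suc)
qed

lemma integrable_power_expn: "integrable lborel (\<lambda>z::'a::euclidean_space. (1 + norm z) ^ p * expn z)"
proof (rule Bochner_Integration.integrable_bound)
  show "integrable lborel (\<lambda>z::'a. ((2 * real (Suc p)) ^ p * exp (1 / 2)) * exp (- (1 / 2) * norm z))"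
    using integrable_exp_norm[of "1 / 2"] by (intro integrable_mult_right) auto
  have "(1 + norm z) ^ p * expn z \<le> ((2 * real (Suc p)) ^ p * exp (1 / 2)) * exp (- (1 / 2) * norm z)" for z :: 'a
  proof -
    have e: "exp ((1 + norm z) / 2) * expn z = exp (1 / 2) * exp (- (1 / 2) * norm z)"
      by (simp add: add_divide_distrib flip: exp_add)
    have "(1 + norm z) ^ p * expn z \<le> ((2 * real (Suc p)) ^ p * exp ((1 + norm z) / 2)) * expn z"
      by (intro mult_right_mono power_exp_le) auto
    then show ?thesis by (simp only: mult.assoc e)
  qed
  then show "AE z::'a in lborel. norm ((1 + norm z) ^ p * expn z) \<le> norm (((2 * real (Suc p)) ^ p * exp (1 / 2)) * exp (- (1 / 2) * norm z))"
    by (intro AE_I2) (simp add: abs_mult)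
qed auto

text \<open>Convolving h with the constant 1 gives a constant function, whose derivative is the
  convolution with \<open>dd v h\<close>. This serves as integration by parts without boundary
  terms.\<close>

lemma integral_dd_zero:
  fixes h :: "'a::euclidean_space \<Rightarrow> real"
  assumes h: "bdk (Suc n) (\<lambda>x. C * expn x) h"
  shows "(\<integral>z. dd v h z \<partial>lborel) = 0"
proof -
  have d: "(cv (\<lambda>_. 1) h has_derivative (\<lambda>v. cv (\<lambda>_. 1) (dd v h) 0)) (at 0)"
    by (rule cv_has_derivative[where M = 1, OF _ _ h]) auto
  have "cv (\<lambda>_. 1) h = (\<lambda>x. \<integral>z. h z \<partial>lborel)"
    using integral_reflect(1)[OF bdk_borel[OF h]] by (auto simp: cv_def)
  then have "cv (\<lambda>_. 1) (dd v h) 0 = 0"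
    using has_derivative_unique[OF d] has_derivative_const[of "\<integral>z. h z \<partial>lborel" "at (0::'a)"] by metis
  then show ?thesis
    using integral_reflect(1)[OF bdk_borel[OF bdk_dd[OF h]], of v 0] by (simp add: cv_def)
qed

definition gauss :: "real^'n^'n \<Rightarrow> real^'n \<Rightarrow> real" where
  "gauss Q z = exp (- (z \<bullet> (Q *v z)))"

text \<open>The derivatives of a Gaussian are products of linear forms \<open>\<ell> v z = - 2 v \<bullet> Q z\<close> with the Gaussian.\<close>

lemma bdk_gauss:
  fixes Q :: "real^'n^'n"
  assumes c: "c > 0" "\<And>z. c * (norm z)\<^sup>2 \<le> z \<bullet> (Q *v z)" and sym: "\<And>i j. Q $ i $ j = Q $ j $ i"
  shows "\<exists>C\<ge>0. bdk 3 (\<lambda>x. C * expn x) (gauss Q)"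
    and "dd v (gauss Q) z = - 2 * (v \<bullet> (Q *v z)) * gauss Q z"
proof -
  let ?G = "gauss Q"
  define l where "l v z = - 2 * (v \<bullet> (Q *v z))" for v z
  have tr: "x \<bullet> (Q *v y) = y \<bullet> (Q *v x)" for x y
  proof -
    have "transpose Q = Q" using sym by (auto simp: transpose_def vec_eq_iff)
    then show ?thesis by (metis dot_lmul_matrix transpose_matrix_vector inner_commute)
  qed
  have lin: "((\<lambda>z. Q *v z) has_derivative (\<lambda>v. Q *v v)) (at z)" for z
    by (rule bounded_linear_imp_has_derivative[OF matrix_vector_mul_bounded_linear])
  have dl: "(l v has_derivative (\<lambda>u. l v u)) (at z)" for v z
    unfolding l_def[abs_def] by (rule derivative_eq_intros lin refl)+ simp
  have dG: "(?G has_derivative (\<lambda>u. l u z * ?G z)) (at z)" for z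
  proof -
    have "((\<lambda>z. z \<bullet> (Q *v z)) has_derivative (\<lambda>u. z \<bullet> (Q *v u) + u \<bullet> (Q *v z))) (at z)"
      by (rule has_derivative_inner[OF has_derivative_ident lin])
    from has_derivative_exp[OF has_derivative_minus[OF this]] show ?thesis
      unfolding gauss_def[abs_def] by (rule has_derivative_eq_rhs, intro ext, rename_tac u, cut_tac x = z and y = u in tr, simp add: l_def)
  qed
  have d1: "dd u ?G = (\<lambda>z. l u z * ?G z)" for u by (rule ext, rule dd_eq[OF dG])
  then show "dd v ?G z = - 2 * (v \<bullet> (Q *v z)) * ?G z" by (simp add: l_def)
  have D1: "((\<lambda>z. l u z * ?G z) has_derivative (\<lambda>v. (l u v + l u z * l v z) * ?G z)) (at z)" for u z
    by (rule has_derivative_eq_rhs[OF has_derivative_mult[OF dl dG]]) (auto simp: algebra_simps)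
  have d2: "dd v (dd u ?G) = (\<lambda>z. (l u v + l u z * l v z) * ?G z)" for u v
    unfolding d1 by (rule ext, rule dd_eq[OF D1])
  have D2: "((\<lambda>z. (l u v + l u z * l v z) * ?G z) has_derivative
      (\<lambda>w. (l u w * l v z + l u z * l v w + (l u v + l u z * l v z) * l w z) * ?G z)) (at z)" for u v z
    by (rule has_derivative_eq_rhs[OF has_derivative_mult[OF has_derivative_add[OF has_derivative_const has_derivative_mult[OF dl dl]] dG]])
       (auto simp: algebra_simps)
  have d3: "dd w (dd v (dd u ?G)) = (\<lambda>z. (l u w * l v z + l u z * l v w + (l u v + l u z * l v z) * l w z) * ?G z)" for u v w
    unfolding d2 by (rule ext, rule dd_eq[OF D2])
  \<comment> \<open>Chosen so that |l v z| is at most A (1 + |z|) for unit v. The number 30 below is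
    a generous bound for the coefficients that arise in derivatives up to order three.\<close>
  define A where "A = 1 + 2 * onorm (\<lambda>z. Q *v z)"
  have o: "onorm (\<lambda>z. Q *v z) \<ge> 0" by (rule onorm_pos_le[OF matrix_vector_mul_bounded_linear])
  then have A: "A \<ge> 1" by (simp add: A_def)
  have lb: "\<bar>l v z\<bar> \<le> A * (1 + norm z)" if "norm v \<le> 1" for v z
  proof -
    have "\<bar>v \<bullet> (Q *v z)\<bar> \<le> norm v * norm (Q *v z)" by (rule Cauchy_Schwarz_ineq2)
    also have "\<dots> \<le> 1 * (onorm (\<lambda>z. Q *v z) * norm z)"
      using that o by (intro mult_mono onorm[OF matrix_vector_mul_bounded_linear]) auto
    finally have "\<bar>l v z\<bar> \<le> 2 * onorm (\<lambda>z. Q *v z) * norm z" by (simp add: l_def abs_mult)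
    also have "\<dots> \<le> A * (1 + norm z)" using o by (simp add: A_def algebra_simps)
    finally show ?thesis .
  qed
  have lb': "\<bar>l v u\<bar> \<le> 2 * A" if "norm v \<le> 1" "norm u \<le> 1" for v u
    using lb[OF that(1), of u] mult_left_mono[of "1 + norm u" 2 A] that(2) A by linarith
  define C where "C = 30 * A ^ 3 * (27 * exp (1 + 1 / c))"
  have C0: "C \<ge> 0" using A by (simp add: C_def)
  have bound: "\<bar>p * ?G z\<bar> \<le> C * expn z" if p: "\<bar>p\<bar> \<le> 30 * (A * (1 + norm z)) ^ 3" for p z
  proof -
    have "?G z \<le> exp (- c * (norm z)\<^sup>2)" using c(2)[of z] by (simp add: gauss_def)
    then have "\<bar>p\<bar> * ?G z \<le> (30 * (A * (1 + norm z)) ^ 3) * exp (- c * (norm z)\<^sup>2)"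
      using p A by (intro mult_mono) (auto simp: gauss_def)
    also have "\<dots> = 30 * A ^ 3 * ((1 + norm z) ^ 3 * exp (- c * (norm z)\<^sup>2))" by (simp only: power_mult_distrib mult.assoc)
    also have "\<dots> \<le> 30 * A ^ 3 * (27 * exp (1 + 1 / c) * exp (- norm z))"
      using A c(1) by (intro mult_left_mono exp_gauss_le) auto
    finally show ?thesis by (simp add: C_def abs_mult gauss_def)
  qed
  define s where "s z = A * (1 + norm z)" for z :: "real^'n"
  have s1: "s z \<ge> 1" for z using A mult_mono[of 1 A 1 "1 + norm z"] by (simp add: s_def)
  have sA: "A \<le> s z" for z using A by (simp add: s_def)
  have p3: "s z \<le> s z ^ 3" "s z * s z \<le> s z ^ 3" "1 \<le> s z ^ 3" for z
    using s1[of z] power_increasing[of 1 3 "s z"] power_increasing[of 2 3 "s z"] power_increasing[of 0 3 "s z"]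
    by (auto simp: power2_eq_square)
  have m2: "\<bar>x * y\<bar> \<le> a * a'" if "\<bar>x\<bar> \<le> a" "\<bar>y\<bar> \<le> a'" for x y a a' :: real
    unfolding abs_mult using that by (intro mult_mono) auto
  have P0: "\<bar>?G z\<bar> \<le> C * expn z" for z using bound[of 1 z] p3(3)[of z] by (simp add: s_def)
  have P1: "\<bar>l u z * ?G z\<bar> \<le> C * expn z" if "norm u \<le> 1" for u z
    by (rule bound) (use lb[OF that, of z] p3(1)[of z] s1[of z] in \<open>simp add: s_def\<close>)
  have P2: "\<bar>(l u v + l u z * l v z) * ?G z\<bar> \<le> C * expn z" if "norm u \<le> 1" "norm v \<le> 1" for u v z
  proof (rule bound)
    have "\<bar>l u z * l v z\<bar> \<le> s z * s z" unfolding s_def by (intro m2 lb that)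
    then show "\<bar>l u v + l u z * l v z\<bar> \<le> 30 * (A * (1 + norm z)) ^ 3"
      using lb'[OF that] p3[of z] sA[of z] unfolding s_def[symmetric] by linarith
  qed
  have P3: "\<bar>(l u w * l v z + l u z * l v w + (l u v + l u z * l v z) * l w z) * ?G z\<bar> \<le> C * expn z"
    if n: "norm u \<le> 1" "norm v \<le> 1" "norm w \<le> 1" for u v w z
  proof (rule bound)
    have l: "\<bar>l u z\<bar> \<le> s z" "\<bar>l v z\<bar> \<le> s z" "\<bar>l w z\<bar> \<le> s z" unfolding s_def by (intro lb n)+
    have l': "\<bar>l u w\<bar> \<le> 2 * s z" "\<bar>l v w\<bar> \<le> 2 * s z" "\<bar>l u v\<bar> \<le> 2 * s z"
      using lb'[OF n(1,3)] lb'[OF n(2,3)] lb'[OF n(1,2)] sA[of z] by linarith+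
    have "\<bar>l u w * l v z\<bar> \<le> 2 * s z * s z" "\<bar>l u z * l v w\<bar> \<le> s z * (2 * s z)" "\<bar>l u v * l w z\<bar> \<le> 2 * s z * s z"
      "\<bar>l u z * l v z * l w z\<bar> \<le> s z * s z * s z"
      by (intro m2 l l')+
    moreover have "(l u v + l u z * l v z) * l w z = l u v * l w z + l u z * l v z * l w z" by (rule distrib_right)
    moreover have "s z * s z * s z = s z ^ 3" by (simp add: power3_eq_cube)
    ultimately show "\<bar>l u w * l v z + l u z * l v w + (l u v + l u z * l v z) * l w z\<bar> \<le> 30 * (A * (1 + norm z)) ^ 3"
      using p3[of z] unfolding s_def[symmetric] by linarith
  qed
  have c3: "continuous_on UNIV (\<lambda>z. (l u w * l v z + l u z * l v w + (l u v + l u z * l v z) * l w z) * ?G z)" for u v w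
    unfolding l_def gauss_def by (intro continuous_intros matrix_vector_mult_linear_continuous_on)
  have b0: "bdk 0 (\<lambda>x. C * expn x) (dd w (dd v (dd u ?G)))" if "norm u \<le> 1" "norm v \<le> 1" "norm w \<le> 1" for u v w
    unfolding d3 bdk.simps using c3 P3[OF that] by blast
  have b1: "bdk (Suc 0) (\<lambda>x. C * expn x) (dd v (dd u ?G))" if "norm u \<le> 1" "norm v \<le> 1" for u v
  proof (unfold bdk.simps(2), intro conjI allI impI)
    show "\<bar>dd v (dd u ?G) x\<bar> \<le> C * expn x" for x unfolding d2 by (rule P2[OF that])
    show "dd v (dd u ?G) differentiable (at x)" for x unfolding d2 using D2 differentiable_def by blast
  qed (rule b0[OF that])
  have b2: "bdk (Suc (Suc 0)) (\<lambda>x. C * expn x) (dd u ?G)" if "norm u \<le> 1" for u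
  proof (unfold bdk.simps(2)[of "Suc 0"], intro conjI allI impI)
    show "\<bar>dd u ?G x\<bar> \<le> C * expn x" for x unfolding d1 by (rule P1[OF that])
    show "dd u ?G differentiable (at x)" for x unfolding d1 using D1 differentiable_def by blast
  qed (rule b1[OF that])
  have "bdk (Suc (Suc (Suc 0))) (\<lambda>x. C * expn x) ?G"
  proof (unfold bdk.simps(2)[of "Suc (Suc 0)"], intro conjI allI impI)
    show "\<bar>?G x\<bar> \<le> C * expn x" for x by (rule P0)
    show "?G differentiable (at x)" for x using dG differentiable_def by blast
  qed (rule b2)
  then show "\<exists>C\<ge>0. bdk 3 (\<lambda>x. C * expn x) ?G" using C0 by (auto simp: numeral_3_eq_3 simp del: bdk.simps)
qed

section \<open>The Gaussian kernel\<close>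

lemma dd_axis_sum:
  fixes f :: "real^'n \<Rightarrow> real"
  assumes "f differentiable (at p)"
  shows "dd v f p = (\<Sum>k\<in>UNIV. v $ k * dd (axis k 1) f p)"
proof -
  have l: "linear (\<lambda>v. dd v f p)"
    using has_derivative_bounded_linear[OF dd_has_derivative[OF assms]] by (rule bounded_linear.linear)
  have v: "v = (\<Sum>k\<in>UNIV. v $ k *\<^sub>R axis k 1)"
    by (simp add: vec_eq_iff axis_def if_distrib cong: if_cong)
  have "dd (\<Sum>k\<in>UNIV. v $ k *\<^sub>R axis k 1) f p = (\<Sum>k\<in>UNIV. v $ k * dd (axis k 1) f p)"
    using linear_sum[OF l, of "\<lambda>k. v $ k *\<^sub>R axis k 1" UNIV] linear_scale[OF l] by simp
  then show ?thesis using v by simp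
qed

text \<open>Summation by parts through a translation of z by h'. No sign appears because
  \<open>G\<close> is evaluated at x - m z: shifting z back by h' moves this point forward by
  h.\<close>

lemma integral_dif_transfer:
  fixes \<kappa> :: "'a::euclidean_space \<Rightarrow> real" and m :: "'a \<Rightarrow> 'a"
  assumes m: "bounded_linear m" "m h' = h" and \<kappa>: "\<kappa> \<in> borel_measurable borel" "integrable lborel \<kappa>"
    and G: "G \<in> borel_measurable borel" "\<And>x. \<bar>G x\<bar> \<le> C"
  shows "(\<integral>z. \<kappa> z * dif h G (x - m z) \<partial>lborel) = (\<integral>z. dif h' \<kappa> z * G (x - m z) \<partial>lborel)"
proof -
  have [measurable]: "m \<in> borel_measurable borel"
    using m(1) by (intro borel_measurable_continuous_onI linear_continuous_on)
  note [measurable] = \<kappa>(1) G(1)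
  have GC: "\<bar>G y\<bar> \<le> \<bar>C\<bar>" for y using G(2)[of y] by linarith
  have i: "integrable lborel (\<lambda>z. k z * G (y - m z))" if k: "k \<in> borel_measurable borel" "integrable lborel k" for k y
  proof (rule Bochner_Integration.integrable_bound)
    show "integrable lborel (\<lambda>z. C * k z)" using k by simp
    show "AE z in lborel. norm (k z * G (y - m z)) \<le> norm (C * k z)"
      by (intro AE_I2) (simp add: abs_mult mult.commute[of "\<bar>C\<bar>"] mult_left_mono[OF GC])
    show "(\<lambda>z. k z * G (y - m z)) \<in> borel_measurable lborel" using k(1) by measurable
  qed
  let ?k = "\<lambda>z. \<kappa> (h' + z)"
  have k: "?k \<in> borel_measurable borel" "integrable lborel ?k"
    using integral_translate(2)[OF \<kappa>(1), of h'] \<kappa>(2) by auto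
  have "(\<integral>z. ?k z * G (x - m z) \<partial>lborel) = (\<integral>z. (\<lambda>z. \<kappa> z * G (x + h - m z)) (h' + z) \<partial>lborel)"
    using m by (simp add: linear_add[OF bounded_linear.linear] algebra_simps)
  also have "\<dots> = (\<integral>z. \<kappa> z * G (x + h - m z) \<partial>lborel)"
    by (rule integral_translate) measurable
  finally have e: "(\<integral>z. ?k z * G (x - m z) \<partial>lborel) = (\<integral>z. \<kappa> z * G (x + h - m z) \<partial>lborel)" .
  have "(\<integral>z. \<kappa> z * dif h G (x - m z) \<partial>lborel) = (\<integral>z. \<kappa> z * G (x + h - m z) - \<kappa> z * G (x - m z) \<partial>lborel)"
    by (simp add: dif_def algebra_simps)
  also have "\<dots> = (\<integral>z. \<kappa> z * G (x + h - m z) \<partial>lborel) - (\<integral>z. \<kappa> z * G (x - m z) \<partial>lborel)"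
    by (intro Bochner_Integration.integral_diff i \<kappa>)
  also have "\<dots> = (\<integral>z. ?k z * G (x - m z) - \<kappa> z * G (x - m z) \<partial>lborel)"
    unfolding e[symmetric] by (intro Bochner_Integration.integral_diff[symmetric] i \<kappa> k)
  finally show ?thesis by (simp add: dif_def algebra_simps)
qed

section \<open>The unit Gaussian of the model diffusion and its averages over scales\<close>

context kolmogorov
begin

text \<open>A fixed choice of the inverse of \<open>Smat\<close>, made once in terms of
  \<open>B\<close> and \<nu>; the kernel and its constants inherit this dependence.\<close>

definition Qmat :: "((real, 'n) vec, 'n) vec" where
  "Qmat = (SOME Q. Smat ** Q = mat 1 \<and> (\<exists>c>0. \<forall>z. c * (norm z)\<^sup>2 \<le> z \<bullet> (Q *v z)) \<and> (\<forall>i j. Q $ i $ j = Q $ j $ i))"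

lemma Qmat: "Smat ** Qmat = mat 1" "\<exists>c>0. \<forall>z. c * (norm z)\<^sup>2 \<le> z \<bullet> (Qmat *v z)" "Qmat $ i $ j = Qmat $ j $ i"
proof -
  have "\<exists>Q :: ((real, 'n) vec, 'n) vec. Smat ** Q = mat 1 \<and> (\<exists>c>0. \<forall>z. c * (norm z)\<^sup>2 \<le> z \<bullet> (Q *v z)) \<and> (\<forall>i j. Q $ i $ j = Q $ j $ i)"
    using ex_inverse_Smat by blast
  from someI_ex[OF this, folded Qmat_def]
  show "Smat ** Qmat = mat 1" "\<exists>c>0. \<forall>z. c * (norm z)\<^sup>2 \<le> z \<bullet> (Qmat *v z)" "Qmat $ i $ j = Qmat $ j $ i" by blast+
qed

definition ker :: "(real, 'n) vec \<Rightarrow> real" where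
  "ker z = (1 / (\<integral>y. gauss Qmat y \<partial>lborel)) * gauss Qmat z"

lemma gauss_bdk: "\<exists>C\<ge>0. bdk 3 (\<lambda>x. C * expn x) (gauss Qmat)"
  and dd_gauss: "dd v (gauss Qmat) z = - 2 * (v \<bullet> (Qmat *v z)) * gauss Qmat z"
  using Qmat(2) bdk_gauss[OF _ _ Qmat(3)] by blast+

lemma gauss_integrable: "integrable lborel (gauss Qmat)"
proof -
  obtain C where C: "bdk 3 (\<lambda>x. C * expn x) (gauss Qmat)" using gauss_bdk by blast
  show ?thesis
    by (rule Bochner_Integration.integrable_bound[OF integrable_mult_right[OF integrable_expn, of C]])
       (use bdk_le[OF C] bdk_borel[OF C] in \<open>auto intro!: AE_I2 order_trans[OF _ abs_ge_self]\<close>)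
qed

lemma gauss_integral_pos: "(\<integral>y. gauss Qmat y \<partial>lborel) > 0"
proof -
  have p: "gauss Qmat z > 0" for z by (simp add: gauss_def)
  have "(\<integral>y. gauss Qmat y \<partial>lborel) \<noteq> 0"
  proof
    assume "(\<integral>y. gauss Qmat y \<partial>lborel) = 0"
    then have "AE y in lborel. gauss Qmat y = 0"
      using integral_nonneg_eq_0_iff_AE[OF gauss_integrable] p by (simp add: less_imp_le)
    then have "AE y in (lborel :: (real, 'n) vec measure). False"
      by eventually_elim (use p in \<open>auto simp: less_imp_neq[symmetric]\<close>)
    then have "emeasure (lborel :: (real, 'n) vec measure) UNIV = 0" by (simp add: AE_iff_null null_sets_def)
    then show False by simp
  qed
  moreover have "(\<integral>y. gauss Qmat y \<partial>lborel) \<ge> 0" using p by (intro Bochner_Integration.integral_nonneg) (auto simp: less_imp_le)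
  ultimately show ?thesis by simp
qed

lemma ker_nonneg: "ker z \<ge> 0"
  using gauss_integral_pos by (simp add: ker_def gauss_def)

lemma ker_integrable: "integrable lborel ker"
  unfolding ker_def[abs_def] by (intro integrable_mult_right gauss_integrable)

lemma ker_one: "(\<integral>z. ker z \<partial>lborel) = 1"
  unfolding ker_def integral_mult_right_zero using gauss_integral_pos by simp

definition CK :: real where "CK = (SOME C. C \<ge> 0 \<and> bdk 3 (\<lambda>x. C * expn x) ker)"

lemma CK: "CK \<ge> 0" "bdk 3 (\<lambda>x. CK * expn x) ker"
proof -
  obtain C where C: "C \<ge> 0" "bdk 3 (\<lambda>x. C * expn x) (gauss Qmat)" using gauss_bdk by blast
  let ?c = "1 / (\<integral>y. gauss Qmat y \<partial>lborel)"
  have "bdk 3 (\<lambda>x. (\<bar>?c\<bar> * C) * expn x) ker"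
    using bdk_scale[OF C(2), of ?c] by (simp add: ker_def[abs_def] mult.assoc)
  then have "\<exists>C. C \<ge> 0 \<and> bdk 3 (\<lambda>x. C * expn x) ker" using C by (intro exI[of _ "\<bar>?c\<bar> * C"]) auto
  from someI_ex[OF this, folded CK_def] show "CK \<ge> 0" "bdk 3 (\<lambda>x. CK * expn x) ker" by auto
qed

lemma CK': "bdk (Suc (Suc (Suc 0))) (\<lambda>x. CK * expn x) ker"
  using CK(2) by (simp add: numeral_3_eq_3 del: bdk.simps)

lemma ker_diff: "ker differentiable (at x)" using CK' by simp

lemma ker_borel: "ker \<in> borel_measurable borel" using bdk_borel[OF CK(2)] .

lemma dd_ker: "dd v ker z = - 2 * (v \<bullet> (Qmat *v z)) * ker z"
proof -
  have d: "gauss Qmat differentiable (at z)" using gauss_bdk by (auto simp: numeral_3_eq_3)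
  have "dd v ker z = (1 / (\<integral>y. gauss Qmat y \<partial>lborel)) * dd v (gauss Qmat) z"
    unfolding ker_def[abs_def] by (rule dd_eq) (intro has_derivative_mult_right dd_has_derivative d)
  then show ?thesis by (simp add: dd_gauss ker_def)
qed

lemma ker_le: "ker z \<le> CK * expn z" using bdk_le[OF CK(2), of z] by simp

lemma norm_ker_integrable: "integrable lborel (\<lambda>z. norm z * ker z)"
proof (rule Bochner_Integration.integrable_bound)
  show "integrable lborel (\<lambda>z::(real, 'n) vec. CK * ((1 + norm z) ^ 1 * expn z))"
    by (intro integrable_mult_right integrable_power_expn)
  have "norm z * ker z \<le> CK * ((1 + norm z) ^ 1 * expn z)" for z :: "(real, 'n) vec"
    using mult_mono[OF _ ker_le[of z], of "norm z" "1 + norm z"] ker_nonneg[of z] by (simp add: mult_ac)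
  then show "AE z in lborel. norm (norm z * ker z) \<le> norm (CK * ((1 + norm (z::(real, 'n) vec)) ^ 1 * expn z))"
    using ker_nonneg CK(1) by (intro AE_I2) (auto simp: abs_mult)
qed (use ker_borel in measurable)

text \<open>In the direction Smat e_k the derivative of \<open>ker\<close> is - 2 z_k
  \<open>ker\<close>, because \<open>Qmat\<close> inverts \<open>Smat\<close>. Since the derivative
  of the product of \<open>ker\<close> with the translated \<open>G\<close> integrates to zero, the
  first moment turns into a derivative of \<open>G\<close>.\<close>

lemma ker_ibp:
  fixes m :: "(real, 'n) vec \<Rightarrow> (real, 'n) vec"
  assumes G: "bdk (Suc (Suc 0)) (\<lambda>_. C) G" and m: "bounded_linear m"
  shows "(\<integral>z. z $ k * (ker z * G (x - m z)) \<partial>lborel) = - (1 / 2) * (\<integral>z. ker z * dd (m (Smat *v axis k 1)) G (x - m z) \<partial>lborel)"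
proof -
  have C: "C \<ge> 0" using bdk_le[OF G, of 0] by simp
  have lm: "linear m" using m by (rule bounded_linear.linear)
  have mc: "continuous_on UNIV m" using m by (rule linear_continuous_on)
  have [measurable]: "m \<in> borel_measurable borel" using mc by (rule borel_measurable_continuous_onI)
  have dG: "G differentiable (at y)" for y using G by simp
  let ?h = "\<lambda>z. ker z * G (x - m z)"
  have hd: "(?h has_derivative (\<lambda>v. ker z * (- dd (m v) G (x - m z)) + dd v ker z * G (x - m z))) (at z)" for z
  proof (rule has_derivative_mult[OF dd_has_derivative[OF ker_diff]])
    have 1: "((\<lambda>z. x - m z) has_derivative (\<lambda>v. - m v)) (at z)"
      using has_derivative_diff[OF has_derivative_const bounded_linear_imp_has_derivative[OF m]] by simp
    have "((\<lambda>z. G (x - m z)) has_derivative (\<lambda>v. dd (- m v) G (x - m z))) (at z)"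
      by (rule has_derivative_compose[OF 1 dd_has_derivative[OF dG]])
    moreover have "dd (- m v) G (x - m z) = - dd (m v) G (x - m z)" for v
      using dd_scaleR[OF dG, of "-1" "m v"] by simp
    ultimately show "((\<lambda>z. G (x - m z)) has_derivative (\<lambda>v. - dd (m v) G (x - m z))) (at z)" by simp
  qed
  have ddh: "dd v ?h = (\<lambda>z. ker z * (- dd (m v) G (x - m z)) + dd v ker z * G (x - m z))" for v
    by (rule ext, rule dd_eq[OF hd])
  define C' where "C' = CK * (onorm m * C) + CK * C"
  have onn: "onorm m \<ge> 0" using m by (rule onorm_pos_le)
  have "bdk (Suc 0) (\<lambda>z. C' * expn z) ?h"
  proof (unfold bdk.simps, intro conjI allI impI)
    fix z
    have "\<bar>?h z\<bar> \<le> CK * expn z * C"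
      unfolding abs_mult using bdk_le[OF CK(2), of z] bdk_le[OF G] by (intro mult_mono) (auto simp: CK(1))
    also have "\<dots> \<le> C' * expn z" using onn C CK(1) by (simp add: C'_def algebra_simps)
    finally show "\<bar>?h z\<bar> \<le> C' * expn z" .
    show "?h differentiable (at z)" using hd differentiable_def by blast
  next
    fix v :: "(real, 'n) vec" and z assume v: "norm v \<le> 1"
    have cG: "continuous_on UNIV G" and cG': "continuous_on UNIV (dd (m v) G)"
      and ck: "continuous_on UNIV ker" "continuous_on UNIV (dd v ker)"
      using bdk_cont[OF G] bdk_cont[OF bdk_dd[OF G]] bdk_cont[OF CK'] bdk_cont[OF bdk_dd[OF CK']] by auto
    have cx: "continuous_on UNIV (\<lambda>z. x - m z)" by (intro continuous_intros mc)
    show "continuous_on UNIV (dd v ?h)"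
      unfolding ddh by (intro continuous_intros ck continuous_on_compose2[OF cG cx] continuous_on_compose2[OF cG' cx]) auto
    have 1: "\<bar>ker z * (- dd (m v) G (x - m z))\<bar> \<le> CK * expn z * (onorm m * C)"
    proof -
      have "\<bar>dd (m v) G (x - m z)\<bar> \<le> norm (m v) * C" using bdk_dd_le[OF G] .
      also have "norm (m v) \<le> onorm m * 1" using onorm[OF m, of v] v onn by (meson mult_left_mono order_trans)
      finally have "\<bar>dd (m v) G (x - m z)\<bar> \<le> onorm m * C" using C by (simp add: mult_right_mono)
      then show ?thesis
        unfolding abs_mult using bdk_le[OF CK(2), of z] CK(1) by (intro mult_mono) auto
    qed
    have 2: "\<bar>dd v ker z * G (x - m z)\<bar> \<le> CK * expn z * C"
    proof -
      have "\<bar>dd v ker z\<bar> \<le> norm v * (CK * expn z)" using bdk_dd_le[OF CK'] .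
      also have "\<dots> \<le> 1 * (CK * expn z)" using v CK(1) by (intro mult_right_mono) auto
      finally show ?thesis unfolding abs_mult using bdk_le[OF G] CK(1) by (intro mult_mono) auto
    qed
    show "\<bar>dd v ?h z\<bar> \<le> C' * expn z" unfolding ddh using 1 2 by (simp add: C'_def algebra_simps)
  qed
  from integral_dd_zero[OF this, of "Smat *v axis k 1"]
  have z: "(\<integral>z. ker z * (- dd (m (Smat *v axis k 1)) G (x - m z)) + dd (Smat *v axis k 1) ker z * G (x - m z) \<partial>lborel) = 0"
    unfolding ddh .
  have Sk: "(Smat *v axis k 1) \<bullet> (Qmat *v z) = z $ k" for z
  proof -
    have "transpose Smat = Smat" by (simp add: transpose_def vec_eq_iff Smat_sym)
    then have "(Smat *v axis k 1) \<bullet> (Qmat *v z) = axis k 1 \<bullet> (Smat *v (Qmat *v z))"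
      by (metis dot_lmul_matrix transpose_matrix_vector)
    also have "\<dots> = z $ k" by (simp add: matrix_vector_mul_assoc Qmat(1) inner_axis')
    finally show ?thesis .
  qed
  have i1: "integrable lborel (\<lambda>z. ker z * dd v G (x - m z))" for v
    by (rule av_integrable[where m = m and G = "dd v G", OF ker_integrable ker_nonneg ker_one _
          bdk_borel[OF bdk_dd[OF G]] bdk_le[OF bdk_dd[OF G]]]) measurable
  have i2: "integrable lborel (\<lambda>z. z $ k * (ker z * G (x - m z)))"
  proof (rule Bochner_Integration.integrable_bound[OF integrable_mult_right[OF norm_ker_integrable, of C]])
    have "\<bar>z $ k * (ker z * G (x - m z))\<bar> \<le> \<bar>C * (norm z * ker z)\<bar>" for z
    proof -
      have "\<bar>z $ k * (ker z * G (x - m z))\<bar> \<le> norm z * (ker z * C)"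
        unfolding abs_mult using component_le_norm_cart[of z k] bdk_le[OF G] ker_nonneg[of z]
        by (intro mult_mono) auto
      also have "\<dots> = \<bar>C * (norm z * ker z)\<bar>" using C ker_nonneg[of z] by (simp add: abs_mult)
      finally show ?thesis .
    qed
    then show "AE z in lborel. norm (z $ k * (ker z * G (x - m z))) \<le> norm (C * (norm z * ker z))" by (intro AE_I2) simp
  qed (use ker_borel bdk_borel[OF G] in measurable)
  have "(\<integral>z. - (ker z * dd (m (Smat *v axis k 1)) G (x - m z)) - 2 * (z $ k * (ker z * G (x - m z))) \<partial>lborel) = 0"
    using z unfolding dd_ker Sk by (simp add: mult_ac)
  then have "- (\<integral>z. ker z * dd (m (Smat *v axis k 1)) G (x - m z) \<partial>lborel) - 2 * (\<integral>z. z $ k * (ker z * G (x - m z)) \<partial>lborel) = 0"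
    using i1 i2 by (subst (asm) Bochner_Integration.integral_diff) auto
  then show ?thesis by simp
qed

definition Sig :: "'n \<Rightarrow> 'n \<Rightarrow> real" where "Sig k l = (\<Sum>m\<in>F. E 1 $ k $ m * E 1 $ l $ m)"

lemma Smat_Sig: "Smat $ k $ l = 4 * \<nu> * Sig k l / (b k + b l + 1)"
  by (simp add: Smat_def Sig_def)

lemma Sig_sym: "Sig k l = Sig l k" by (simp add: Sig_def mult.commute)

lemma dil_borel [measurable]: "dil r \<in> borel_measurable borel"
  by (intro borel_measurable_continuous_onI linear_continuous_on bounded_linear_dil)

text \<open>With \<sigma> = r^2 this is the heat equation of the model, with diffusion matrix \<nu>
  Sig_kl \<sigma>^(b k + b l) at time \<sigma>; the factor 2 r is the chain rule. Differentiating
  the dilation produces first moments, which \<open>ker_ibp\<close> converts into second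
  derivatives.\<close>

lemma av_dil_deriv:
  assumes G: "bdk (Suc (Suc (Suc 0))) (\<lambda>_. C) G"
  shows "((\<lambda>r. av ker (dil r) G x) has_real_derivative
    (2 * r * (\<Sum>k\<in>UNIV. \<Sum>l\<in>UNIV. \<nu> * Sig k l * r ^ (2 * (b k + b l)) * av ker (dil r) (dd (axis k 1) (dd (axis l 1) G)) x))) (at r)"
proof -
  have C: "C \<ge> 0" using bdk_le[OF G, of 0] by simp
  have dG: "G differentiable (at y)" for y using G by simp
  \<comment> \<open>This is d/dr of \<open>dil r z\<close>; the constant A bounds it for all r'
    within 1 of r, as differentiation under the integral requires.\<close>
  define dl where "dl r z = (\<chi> i. real (2 * b i + 1) * r ^ (2 * b i) * z $ i)" for r and z :: "(real, 'n) vec"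
  define A where "A = (\<Sum>i\<in>UNIV. real (2 * b i + 1) * (1 + \<bar>r\<bar>) ^ (2 * b i))"
  have dl_le: "norm (dl r' z) \<le> A * norm z" if "\<bar>r' - r\<bar> \<le> 1" for r' z
  proof -
    have r': "\<bar>r'\<bar> \<le> 1 + \<bar>r\<bar>" using that by linarith
    have "norm (dl r' z) \<le> (\<Sum>i\<in>UNIV. \<bar>dl r' z $ i\<bar>)" by (rule norm_le_l1_cart)
    also have "\<dots> \<le> (\<Sum>i\<in>UNIV. real (2 * b i + 1) * (1 + \<bar>r\<bar>) ^ (2 * b i) * norm z)"
      unfolding dl_def vec_lambda_beta abs_mult
      by (intro sum_mono mult_mono component_le_norm_cart) (auto simp: power_abs intro!: power_mono r')
    finally show ?thesis by (simp add: A_def sum_distrib_right)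
  qed
  have gd: "((\<lambda>r. ker z * G (x - dil r z)) has_real_derivative - (ker z * dd (dl r z) G (x - dil r z))) (at r)" for z r
  proof -
    have c: "((\<lambda>r. r ^ (2 * b i + 1) * z $ i) has_real_derivative dl r z $ i) (at r)" for i r
      unfolding dl_def by (rule derivative_eq_intros refl | simp)+
    have 1: "((\<lambda>r. dil r z) has_derivative (\<lambda>v. v *\<^sub>R dl r z)) (at r)" for r
    proof (subst has_derivative_componentwise_within, intro ballI)
      fix e :: "(real, 'n) vec" assume "e \<in> Basis"
      then obtain i where e: "e = axis i 1" by (auto simp: Basis_vec_def)
      have "((\<lambda>r. dil r z $ i) has_derivative (\<lambda>v. v * dl r z $ i)) (at r)"
        by (rule has_derivative_eq_rhs[OF c[of i r, unfolded has_field_derivative_def, folded dil_nth]]) (simp add: fun_eq_iff)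
      then show "((\<lambda>r. dil r z \<bullet> e) has_derivative (\<lambda>v. v *\<^sub>R dl r z \<bullet> e)) (at r)"
        by (simp add: e inner_axis)
    qed
    have 2: "((\<lambda>r. x - dil r z) has_derivative (\<lambda>v. - (v *\<^sub>R dl r z))) (at r)"
      using has_derivative_diff[OF has_derivative_const 1] by simp
    have h: "((\<lambda>r. ker z * G (x - dil r z)) has_derivative (\<lambda>v. ker z * dd (- (v *\<^sub>R dl r z)) G (x - dil r z))) (at r)"
      by (intro has_derivative_mult_right has_derivative_compose[OF 2 dd_has_derivative[OF dG]])
    have "dd (- (v *\<^sub>R dl r z)) G y = - v * dd (dl r z) G y" for v y
      using dd_scaleR[OF dG, of "- v" "dl r z"] by simp
    then show ?thesis unfolding has_field_derivative_def
      by (intro has_derivative_eq_rhs[OF h]) (simp add: fun_eq_iff)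
  qed
  have e: "dd v (\<lambda>r. ker z * G (x - dil r z)) r = - (ker z * dd (dl r z) G (x - dil r z)) * v" for v z r
    using dd_eq[OF gd[unfolded has_field_derivative_def]] .
  have iG: "integrable lborel (\<lambda>z. ker z * g (x - dil r z))" if "bdk n (\<lambda>_. C') g" for n C' g r
    by (rule av_integrable[OF ker_integrable ker_nonneg ker_one dil_borel bdk_borel[OF that] bdk_le[OF that]])
  have ddl: "dd (dl r z) G y = (\<Sum>k\<in>UNIV. (real (2 * b k + 1) * r ^ (2 * b k)) * (z $ k * dd (axis k 1) G y))" for r z y
    by (subst dd_axis_sum[OF dG]) (simp add: dl_def mult_ac)
  have bor: "(\<lambda>z. ker z * dd (dl r z) G (x - dil r z)) \<in> borel_measurable borel" for r
    unfolding ddl using ker_borel bdk_borel[OF bdk_dd[OF G]] by measurable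
  have hD: "((\<lambda>r. \<integral>z. ker z * G (x - dil r z) \<partial>lborel) has_derivative (\<lambda>v. \<integral>z. dd v (\<lambda>r. ker z * G (x - dil r z)) r \<partial>lborel)) (at r)"
  proof (rule has_derivative_lebesgue_integral[where D = "\<lambda>z. A * C * (norm z * ker z)"])
    show "(\<lambda>r. ker z * G (x - dil r z)) differentiable (at r)" for z r
      using gd real_differentiable_def by blast
    show "integrable lborel (\<lambda>z. ker z * G (x - dil r z))" for r by (rule iG[OF G])
    show "(\<lambda>z. dd v (\<lambda>r. ker z * G (x - dil r z)) r) \<in> borel_measurable lborel" for v r
      unfolding e using bor[of r] by measurable
    show "integrable lborel (\<lambda>z. A * C * (norm z * ker z))" using norm_ker_integrable by simp
    fix z r' v assume "norm (r' - r) \<le> 1"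
    then have n: "norm (dl r' z) \<le> A * norm z" using dl_le by simp
    have "\<bar>dd (dl r' z) G (x - dil r' z)\<bar> \<le> norm (dl r' z) * C" by (rule bdk_dd_le[OF G])
    also have "\<dots> \<le> (A * norm z) * C" using n C by (rule mult_right_mono)
    finally have "ker z * \<bar>dd (dl r' z) G (x - dil r' z)\<bar> \<le> ker z * (A * norm z * C)"
      using ker_nonneg by (rule mult_left_mono)
    then have "ker z * \<bar>dd (dl r' z) G (x - dil r' z)\<bar> * \<bar>v\<bar> \<le> ker z * (A * norm z * C) * \<bar>v\<bar>"
      by (rule mult_right_mono) simp
    then show "\<bar>dd v (\<lambda>r. ker z * G (x - dil r z)) r'\<bar> \<le> norm v * (A * C * (norm z * ker z))"
      unfolding e using ker_nonneg[of z] by (simp add: abs_mult mult_ac)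
  qed
  have D: "((\<lambda>r. av ker (dil r) G x) has_real_derivative (- (\<integral>z. ker z * dd (dl r z) G (x - dil r z) \<partial>lborel))) (at r)"
    unfolding has_field_derivative_def av_def by (rule has_derivative_eq_rhs[OF hD]) (simp add: e fun_eq_iff)
  define J where "J k l = av ker (dil r) (dd (axis k 1) (dd (axis l 1) G)) x" for k l
  have J_sym: "J k l = J l k" for k l
  proof -
    have "dd (axis k 1) (dd (axis l 1) G) = dd (axis l 1) (dd (axis k 1) G)"
      using bdk_Suc[OF G] by (intro ext dd_commute[where w = "\<lambda>_. C"]) (simp add: numeral_2_eq_2 del: bdk.simps)
    then show ?thesis by (simp add: J_def)
  qed
  have ik: "integrable lborel (\<lambda>z. z $ k * (ker z * dd (axis k 1) G (x - dil r z)))" for k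
  proof (rule Bochner_Integration.integrable_bound[OF integrable_mult_right[OF norm_ker_integrable, of C]])
    have "\<bar>z $ k * (ker z * dd (axis k 1) G (x - dil r z))\<bar> \<le> \<bar>C * (norm z * ker z)\<bar>" for z
    proof -
      have "\<bar>dd (axis k 1) G (x - dil r z)\<bar> \<le> C" using bdk_dd_le[OF G, of "axis k 1"] by simp
      then have "\<bar>z $ k * (ker z * dd (axis k 1) G (x - dil r z))\<bar> \<le> norm z * (ker z * C)"
        unfolding abs_mult using component_le_norm_cart[of z k] ker_nonneg[of z]
        by (intro mult_mono) auto
      also have "\<dots> = \<bar>C * (norm z * ker z)\<bar>" using C ker_nonneg[of z] by (simp add: abs_mult)
      finally show ?thesis .
    qed
    then show "AE z in lborel. norm (z $ k * (ker z * dd (axis k 1) G (x - dil r z))) \<le> norm (C * (norm z * ker z))" by (intro AE_I2) simp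
  qed (use ker_borel bdk_borel[OF bdk_dd[OF G]] in measurable)
  have "(\<integral>z. ker z * dd (dl r z) G (x - dil r z) \<partial>lborel)
      = (\<integral>z. (\<Sum>k\<in>UNIV. (real (2 * b k + 1) * r ^ (2 * b k)) * (z $ k * (ker z * dd (axis k 1) G (x - dil r z)))) \<partial>lborel)"
    unfolding ddl sum_distrib_left by (simp add: mult_ac)
  also have "\<dots> = (\<Sum>k\<in>UNIV. (real (2 * b k + 1) * r ^ (2 * b k)) * (\<integral>z. z $ k * (ker z * dd (axis k 1) G (x - dil r z)) \<partial>lborel))"
    using ik by simp
  also have "\<dots> = (\<Sum>k\<in>UNIV. (real (2 * b k + 1) * r ^ (2 * b k)) * (- (1 / 2) * (\<Sum>l\<in>UNIV. r ^ (2 * b l + 1) * Smat $ l $ k * J l k)))"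
  proof (intro sum.cong arg_cong2[of _ _ _ _ "(*)"] refl)
    fix k
    have bk: "bdk (Suc (Suc 0)) (\<lambda>_. C) (dd (axis k 1) G)" using bdk_dd[OF G, of "axis k 1"] by simp
    have c: "dil r (Smat *v axis k 1) $ l = r ^ (2 * b l + 1) * Smat $ l $ k" for l
      by (simp add: matrix_vector_mult_def axis_def if_distrib cong: if_cong)
    have dk: "dd (axis k 1) G differentiable (at y)" for y using bk by simp
    have ek: "dd (dil r (Smat *v axis k 1)) (dd (axis k 1) G) y = (\<Sum>l\<in>UNIV. (r ^ (2 * b l + 1) * Smat $ l $ k) * dd (axis l 1) (dd (axis k 1) G) y)" for y
      by (subst dd_axis_sum[OF dk]) (simp only: c)
    have "(\<integral>z. ker z * dd (dil r (Smat *v axis k 1)) (dd (axis k 1) G) (x - dil r z) \<partial>lborel)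
       = (\<integral>z. (\<Sum>l\<in>UNIV. (r ^ (2 * b l + 1) * Smat $ l $ k) * (ker z * dd (axis l 1) (dd (axis k 1) G) (x - dil r z))) \<partial>lborel)"
      unfolding ek sum_distrib_left by (simp add: mult_ac)
    also have "\<dots> = (\<Sum>l\<in>UNIV. r ^ (2 * b l + 1) * Smat $ l $ k * J l k)"
      using iG[OF bdk_dd[OF bk]] by (simp add: J_def av_def)
    finally show "(\<integral>z. z $ k * (ker z * dd (axis k 1) G (x - dil r z)) \<partial>lborel) = - (1 / 2) * (\<Sum>l\<in>UNIV. r ^ (2 * b l + 1) * Smat $ l $ k * J l k)"
      using ker_ibp[OF bk bounded_linear_dil, of k x r] by simp
  qed
  also have "\<dots> = - (\<Sum>k\<in>UNIV. \<Sum>l\<in>UNIV. (real (2 * b k + 1) / 2) * (r ^ (2 * b k + 2 * b l + 1) * Smat $ k $ l * J k l))"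
    unfolding sum_distrib_left sum_negf[symmetric]
  proof (intro sum.cong refl)
    fix k l
    show "real (2 * b k + 1) * r ^ (2 * b k) * (- (1 / 2) * (r ^ (2 * b l + 1) * Smat $ l $ k * J l k))
      = - (real (2 * b k + 1) / 2 * (r ^ (2 * b k + 2 * b l + 1) * Smat $ k $ l * J k l))"
      unfolding J_sym[of l k] Smat_sym[of l k] by (simp add: power_add mult_ac)
  qed
  finally have 1: "- (\<integral>z. ker z * dd (dl r z) G (x - dil r z) \<partial>lborel) = (\<Sum>k\<in>UNIV. \<Sum>l\<in>UNIV. (real (2 * b k + 1) / 2) * (r ^ (2 * b k + 2 * b l + 1) * Smat $ k $ l * J k l))"
    by simp
  \<comment> \<open>The factor (2 b k + 1) / 2 is replaced by its symmetrisation (b k + b l + 1) /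
    2, legitimate since X is symmetric. It cancels the denominator b k + b l + 1 in
    \<open>Smat\<close>.\<close>
  define X where "X k l = r ^ (2 * b k + 2 * b l + 1) * Smat $ k $ l * J k l" for k l
  have Xs: "X k l = X l k" for k l
    unfolding X_def using J_sym[of k l] Smat_sym[of k l] by (simp add: add.commute)
  have sw: "(\<Sum>k\<in>UNIV. \<Sum>l\<in>UNIV. (real (2 * b k + 1) / 2) * X k l) = (\<Sum>k\<in>UNIV. \<Sum>l\<in>UNIV. (real (2 * b l + 1) / 2) * X k l)"
    by (subst sum.swap) (subst Xs, rule refl)
  have "(\<Sum>k\<in>UNIV. \<Sum>l\<in>UNIV. (real (2 * b k + 1) / 2) * X k l) = (\<Sum>k\<in>UNIV. \<Sum>l\<in>UNIV. (real (b k + b l + 1) / 2) * X k l)"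
  proof -
    have "2 * (\<Sum>k\<in>UNIV. \<Sum>l\<in>UNIV. (real (2 * b k + 1) / 2) * X k l)
      = (\<Sum>k\<in>UNIV. \<Sum>l\<in>UNIV. (real (2 * b k + 1) / 2) * X k l) + (\<Sum>k\<in>UNIV. \<Sum>l\<in>UNIV. (real (2 * b l + 1) / 2) * X k l)"
      using sw by simp
    also have "\<dots> = 2 * (\<Sum>k\<in>UNIV. \<Sum>l\<in>UNIV. (real (b k + b l + 1) / 2) * X k l)"
      unfolding sum.distrib[symmetric] sum_distrib_left by (intro sum.cong refl) (simp add: field_simps)
    finally show ?thesis by simp
  qed
  also have "\<dots> = 2 * r * (\<Sum>k\<in>UNIV. \<Sum>l\<in>UNIV. \<nu> * Sig k l * r ^ (2 * (b k + b l)) * J k l)"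
    unfolding sum_distrib_left
  proof (intro sum.cong refl)
    fix k l
    define n where "n = real (b k + b l + 1)"
    have S: "Smat $ k $ l = 4 * \<nu> * Sig k l / n" by (simp add: Smat_Sig n_def)
    have P: "r ^ (2 * b k + 2 * b l + 1) = r * r ^ (2 * (b k + b l))" by (simp add: distrib_left)
    have alg: "n / 2 * (r * p * (4 * \<nu> * s / n) * j) = 2 * r * (\<nu> * s * p * j)" if "n \<noteq> 0" for n p s j :: real
      using that by (simp add: field_simps)
    show "real (b k + b l + 1) / 2 * X k l = 2 * r * (\<nu> * Sig k l * r ^ (2 * (b k + b l)) * J k l)"
      unfolding X_def S P n_def[symmetric] by (rule alg) (simp add: n_def)
  qed
  finally have fin: "(\<Sum>k\<in>UNIV. \<Sum>l\<in>UNIV. (real (2 * b k + 1) / 2) * X k l)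
    = 2 * r * (\<Sum>k\<in>UNIV. \<Sum>l\<in>UNIV. \<nu> * Sig k l * r ^ (2 * (b k + b l)) * J k l)" .
  show ?thesis using D unfolding 1 unfolding X_def[symmetric] unfolding fin unfolding J_def .
qed

end

section \<open>Weak derivatives on the line\<close>

text \<open>The hypothesis \<open>eq\<close> is the weak form of w' = - H. Tested with a smoothed
  indicator of [a, b], its left side tends to w a - w b and its right side to the integral of
  \<open>H\<close>.\<close>

lemma du_bois_reymond:
  fixes w H :: "real \<Rightarrow> real"
  assumes w: "w \<in> borel_measurable borel" "\<And>s. \<bar>w s\<bar> \<le> C" "continuous_on {..<T} w"
    and H: "H \<in> borel_measurable borel" "\<And>s. s \<in> {a - 1..b + 1} \<Longrightarrow> \<bar>H s\<bar> \<le> C'"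
    and eq: "\<And>\<theta> \<theta>' c d. smooth \<theta> \<Longrightarrow> (\<And>s. (\<theta> has_real_derivative \<theta>' s) (at s)) \<Longrightarrow> d < T \<Longrightarrow>
      (\<And>s. s \<notin> {c..d} \<Longrightarrow> \<theta> s = 0) \<Longrightarrow> (\<integral>s. \<theta>' s * w s \<partial>lborel) = (\<integral>s. \<theta> s * H s \<partial>lborel)"
    and ab: "a < b" "b < T"
  shows "w b - w a = - (\<integral>s. indicator {a..b} s * H s \<partial>lborel)"
proof -
  obtain \<beta> st :: "real \<Rightarrow> real" where \<beta>: "smooth \<beta>" "smooth st" "\<And>x. (st has_real_derivative \<beta> x) (at x)"
    "\<And>x. \<beta> x \<ge> 0" "\<And>x. \<bar>x\<bar> \<ge> 1 \<Longrightarrow> \<beta> x = 0" "\<And>x. x \<le> -1 \<Longrightarrow> st x = 0" "\<And>x. x \<ge> 1 \<Longrightarrow> st x = 1"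
    "integrable lborel \<beta>" "(\<integral>x. \<beta> x \<partial>lborel) = 1"
    using bump_and_step by metis
  have mono: "st x \<le> st y" if "x \<le> y" for x y
    using that \<beta>(3,4) by (intro DERIV_nonneg_imp_nondecreasing[of x y st]) blast+
  have st01: "0 \<le> st x" "st x \<le> 1" for x
    using mono[of "min x (-1)" x] mono[of x "max x 1"] \<beta>(6)[of "min x (-1)"] \<beta>(7)[of "max x 1"] by auto
  note [measurable] = smooth_borel[OF \<beta>(1)] smooth_borel[OF \<beta>(2)] w(1) H(1)
  \<comment> \<open>Keeps the widened supports strictly below T and within the interval on which
    \<open>H\<close> is bounded.\<close>
  define \<delta> where "\<delta> = min 1 ((T - b) / 2)"
  define \<epsilon> where "\<epsilon> n = \<delta> / real (Suc n)" for n
  have \<delta>: "\<delta> > 0" "\<delta> \<le> 1" "b + \<delta> < T" using ab by (auto simp: \<delta>_def min_def field_simps)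
  have \<epsilon>: "\<epsilon> n > 0" "\<epsilon> n \<le> \<delta>" for n using \<delta> by (auto simp: \<epsilon>_def field_simps)
  have \<epsilon>0: "\<epsilon> \<longlonglongrightarrow> 0"
    unfolding \<epsilon>_def using tendsto_mult_right_zero[OF LIMSEQ_inverse_real_of_nat, of \<delta>] by (simp add: divide_inverse)
  define \<theta> where "\<theta> n s = st ((1 / \<epsilon> n) * s + (- a / \<epsilon> n)) - st ((1 / \<epsilon> n) * s + (- b / \<epsilon> n))" for n s
  define \<theta>' where "\<theta>' n s = (1 / \<epsilon> n) * \<beta> ((1 / \<epsilon> n) * s + (- a / \<epsilon> n)) - (1 / \<epsilon> n) * \<beta> ((1 / \<epsilon> n) * s + (- b / \<epsilon> n))" for n s
  have arg: "(1 / \<epsilon> n) * s + (- c / \<epsilon> n) = (s - c) / \<epsilon> n" for n s c by (simp add: diff_divide_distrib)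
  have eqn: "(\<integral>s. \<theta>' n s * w s \<partial>lborel) = (\<integral>s. \<theta> n s * H s \<partial>lborel)" for n
  proof (rule eq[of "\<theta> n" "\<theta>' n" "b + \<epsilon> n" "a - \<epsilon> n"])
    show "smooth (\<theta> n)"
      unfolding \<theta>_def by (intro smooth_diff smooth_real_compose[OF \<beta>(2)] smooth_add smooth_const smooth_cmult smooth_linear bounded_linear_ident)
    show "(\<theta> n has_real_derivative \<theta>' n s) (at s)" for s
    proof -
      have "((\<lambda>s. st ((1 / \<epsilon> n) * s + c)) has_real_derivative \<beta> ((1 / \<epsilon> n) * s + c) * (1 / \<epsilon> n)) (at s)" for c
        by (rule DERIV_chain2[OF \<beta>(3)]) (use \<epsilon>(1)[of n] in \<open>auto intro!: derivative_eq_intros\<close>)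
      from DERIV_diff[OF this[of "- a / \<epsilon> n"] this[of "- b / \<epsilon> n"]] show ?thesis
        unfolding \<theta>_def[abs_def] \<theta>'_def by (simp add: mult.commute)
    qed
    show "b + \<epsilon> n < T" using \<epsilon>(2)[of n] \<delta> by linarith
    show "\<theta> n s = 0" if "s \<notin> {a - \<epsilon> n..b + \<epsilon> n}" for s
    proof -
      have "s < a - \<epsilon> n \<or> s > b + \<epsilon> n" using that by auto
      then show ?thesis
      proof
        assume "s < a - \<epsilon> n"
        then have "(s - a) / \<epsilon> n \<le> -1" "(s - b) / \<epsilon> n \<le> -1" using \<epsilon>(1)[of n] ab by (simp_all add: field_simps)
        then show ?thesis unfolding \<theta>_def arg using \<beta>(6) by simp
      next
        assume "s > b + \<epsilon> n"
        then have "(s - a) / \<epsilon> n \<ge> 1" "(s - b) / \<epsilon> n \<ge> 1" using \<epsilon>(1)[of n] ab by (simp_all add: field_simps)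
        then show ?thesis unfolding \<theta>_def arg using \<beta>(7) by simp
      qed
    qed
  qed
  have L: "(\<lambda>n. \<integral>s. (1 / \<epsilon> n) * \<beta> ((1 / \<epsilon> n) * s + (- c / \<epsilon> n)) * w s \<partial>lborel) \<longlonglongrightarrow> w c"
    and Li: "integrable lborel (\<lambda>s. (1 / \<epsilon> n) * \<beta> ((1 / \<epsilon> n) * s + (- c / \<epsilon> n)) * w s)" if c: "c < T" for c n
  proof -
    have i: "integrable lborel (\<lambda>x. \<beta> x * w (c + \<epsilon> n * x))" for n
    proof (rule Bochner_Integration.integrable_bound[OF integrable_mult_right[OF \<beta>(8), of C]])
      show "AE x in lborel. norm (\<beta> x * w (c + \<epsilon> n * x)) \<le> norm (C * \<beta> x)"
        using w(2) \<beta>(4) by (intro AE_I2) (auto simp: abs_mult mult.commute[of "\<bar>C\<bar>"] intro!: mult_left_mono order_trans[OF w(2) abs_ge_self])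
    qed measurable
    have sub: "(\<lambda>x. (1 / \<epsilon> n) * \<beta> ((1 / \<epsilon> n) * (c + \<epsilon> n * x) + (- c / \<epsilon> n)) * w (c + \<epsilon> n * x)) = (\<lambda>x. (1 / \<epsilon> n) * (\<beta> x * w (c + \<epsilon> n * x)))" for n
      using \<epsilon>(1)[of n] by (auto simp: field_simps)
    show "integrable lborel (\<lambda>s. (1 / \<epsilon> n) * \<beta> ((1 / \<epsilon> n) * s + (- c / \<epsilon> n)) * w s)"
    proof (rule iffD1[OF lborel_integrable_real_affine_iff[of "\<epsilon> n" "\<lambda>s. (1 / \<epsilon> n) * \<beta> ((1 / \<epsilon> n) * s + (- c / \<epsilon> n)) * w s" c]])
      show "integrable lborel (\<lambda>x. (1 / \<epsilon> n) * \<beta> ((1 / \<epsilon> n) * (c + \<epsilon> n * x) + (- c / \<epsilon> n)) * w (c + \<epsilon> n * x))"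
        unfolding sub using i[of n] by (rule integrable_mult_right)
    qed (use \<epsilon>(1)[of n] in simp)
    have e: "(\<integral>s. (1 / \<epsilon> n) * \<beta> ((1 / \<epsilon> n) * s + (- c / \<epsilon> n)) * w s \<partial>lborel) = (\<integral>x. \<beta> x * w (c + \<epsilon> n * x) \<partial>lborel)" for n
    proof -
      have "(\<integral>s. (1 / \<epsilon> n) * \<beta> ((1 / \<epsilon> n) * s + (- c / \<epsilon> n)) * w s \<partial>lborel)
        = \<bar>\<epsilon> n\<bar> *\<^sub>R (\<integral>x. (1 / \<epsilon> n) * \<beta> ((1 / \<epsilon> n) * (c + \<epsilon> n * x) + (- c / \<epsilon> n)) * w (c + \<epsilon> n * x) \<partial>lborel)"
        using \<epsilon>(1)[of n] by (intro lborel_integral_real_affine) auto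
      also have "\<dots> = (\<integral>x. \<beta> x * w (c + \<epsilon> n * x) \<partial>lborel)"
        unfolding sub integral_mult_right_zero using \<epsilon>(1)[of n] by simp
      finally show ?thesis .
    qed
    have "(\<lambda>n. \<integral>x. \<beta> x * w (c + \<epsilon> n * x) \<partial>lborel) \<longlonglongrightarrow> (\<integral>x. \<beta> x * w c \<partial>lborel)"
    proof (rule integral_dominated_convergence[where w = "\<lambda>x. C * \<beta> x"])
      show "AE x in lborel. (\<lambda>n. \<beta> x * w (c + \<epsilon> n * x)) \<longlonglongrightarrow> \<beta> x * w c"
      proof (intro AE_I2 tendsto_mult tendsto_const)
        fix x
        have "(\<lambda>n. c + \<epsilon> n * x) \<longlonglongrightarrow> c + 0 * x" by (intro tendsto_intros \<epsilon>0)
        moreover have "isCont w c" using w(3) c by (simp add: continuous_on_eq_continuous_at)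
        ultimately show "(\<lambda>n. w (c + \<epsilon> n * x)) \<longlonglongrightarrow> w c"
          by (intro isCont_tendsto_compose[of c w]) auto
      qed
      show "AE x in lborel. norm (\<beta> x * w (c + \<epsilon> n * x)) \<le> C * \<beta> x" for n
        using w(2) \<beta>(4) by (intro AE_I2) (auto simp: abs_mult mult.commute[of C] intro!: mult_left_mono)
    qed (use \<beta>(8) in auto)
    then show "(\<lambda>n. \<integral>s. (1 / \<epsilon> n) * \<beta> ((1 / \<epsilon> n) * s + (- c / \<epsilon> n)) * w s \<partial>lborel) \<longlonglongrightarrow> w c"
      unfolding e using \<beta>(8,9) by simp
  qed
  have aT: "a < T" using ab by linarith
  have "(\<lambda>n. \<integral>s. \<theta>' n s * w s \<partial>lborel) \<longlonglongrightarrow> w a - w b"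
  proof -
    have "(\<integral>s. \<theta>' n s * w s \<partial>lborel) = (\<integral>s. (1 / \<epsilon> n) * \<beta> ((1 / \<epsilon> n) * s + (- a / \<epsilon> n)) * w s \<partial>lborel)
        - (\<integral>s. (1 / \<epsilon> n) * \<beta> ((1 / \<epsilon> n) * s + (- b / \<epsilon> n)) * w s \<partial>lborel)" for n
      unfolding \<theta>'_def left_diff_distrib by (rule Bochner_Integration.integral_diff[OF Li[OF aT] Li[OF ab(2)]])
    then show ?thesis using tendsto_diff[OF L[OF aT] L[OF ab(2)]] by simp
  qed
  moreover have "(\<lambda>n. \<integral>s. \<theta> n s * H s \<partial>lborel) \<longlonglongrightarrow> (\<integral>s. indicator {a..b} s * H s \<partial>lborel)"
  proof (rule integral_dominated_convergence[where w = "\<lambda>s. C' * indicator {a - 1..b + 1} s"])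
    show "integrable lborel (\<lambda>s. C' * indicator {a - 1..b + 1} s :: real)"
      by (intro integrable_mult_right integrable_real_indicator) (use ab in auto)
    show "AE s in lborel. (\<lambda>n. \<theta> n s * H s) \<longlonglongrightarrow> indicator {a..b} s * H s"
    proof -
      \<comment> \<open>At an end point the step is evaluated at 0, where its value is not
        prescribed; the two end points form a null set.\<close>
      have "AE s in lborel. s \<noteq> a \<and> s \<noteq> b"
        by (intro AE_conjI AE_lborel_singleton)
      then show ?thesis
      proof (rule AE_mp, intro AE_I2 impI tendsto_mult tendsto_const)
        fix s assume s: "s \<noteq> a \<and> s \<noteq> b"
        have lim: "(\<lambda>n. st ((s - c) / \<epsilon> n)) \<longlonglongrightarrow> (if c < s then 1 else 0)" if "s \<noteq> c" for c
        proof (rule tendsto_eventually)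
          have "\<forall>\<^sub>F n in sequentially. \<epsilon> n < \<bar>s - c\<bar>"
            using that by (intro order_tendstoD(2)[OF \<epsilon>0]) auto
          then show "\<forall>\<^sub>F n in sequentially. st ((s - c) / \<epsilon> n) = (if c < s then 1 else 0)"
          proof eventually_elim
            case (elim n)
            show ?case
            proof (cases "c < s")
              case True
              then have "(s - c) / \<epsilon> n \<ge> 1" using elim \<epsilon>(1)[of n] by (simp add: field_simps)
              then show ?thesis using True \<beta>(7) by simp
            next
              case False
              then have "(s - c) / \<epsilon> n \<le> -1" using elim \<epsilon>(1)[of n] by (simp add: field_simps)
              then show ?thesis using False \<beta>(6) by simp
            qed
          qed
        qed
        have "(\<lambda>n. \<theta> n s) \<longlonglongrightarrow> (if a < s then 1 else 0) - (if b < s then 1 else 0)"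
          unfolding \<theta>_def arg using s by (intro tendsto_diff lim) auto
        moreover have "(if a < s then 1 else 0) - (if b < s then 1 else 0) = (indicator {a..b} s :: real)"
          using s ab by (auto simp: indicator_def)
        ultimately show "(\<lambda>n. \<theta> n s) \<longlonglongrightarrow> indicator {a..b} s" by simp
      qed
    qed
    show "AE s in lborel. norm (\<theta> n s * H s) \<le> C' * indicator {a - 1..b + 1} s" for n
    proof (rule AE_I2)
      fix s
      show "norm (\<theta> n s * H s) \<le> C' * indicator {a - 1..b + 1} s"
      proof (cases "s \<in> {a - 1..b + 1}")
        case True
        have "\<bar>\<theta> n s\<bar> \<le> 1" using st01[of "(1 / \<epsilon> n) * s + (- a / \<epsilon> n)"] st01[of "(1 / \<epsilon> n) * s + (- b / \<epsilon> n)"] unfolding \<theta>_def by linarith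
        then have "\<bar>\<theta> n s\<bar> * \<bar>H s\<bar> \<le> 1 * C'" using H(2)[OF True] by (intro mult_mono) auto
        then show ?thesis using True by (simp add: abs_mult)
      next
        case False
        then have "s < a - 1 \<or> s > b + 1" by auto
        then have "\<theta> n s = 0"
        proof
          assume "s < a - 1"
          then have "(s - a) / \<epsilon> n \<le> -1" "(s - b) / \<epsilon> n \<le> -1" using \<epsilon>[of n] \<delta> ab by (simp_all add: field_simps)
          then show ?thesis unfolding \<theta>_def arg using \<beta>(6) by simp
        next
          assume "s > b + 1"
          then have "(s - a) / \<epsilon> n \<ge> 1" "(s - b) / \<epsilon> n \<ge> 1" using \<epsilon>[of n] \<delta> ab by (simp_all add: field_simps)
          then show ?thesis unfolding \<theta>_def arg using \<beta>(7) by simp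
        qed
        then show ?thesis using False by simp
      qed
    qed
  qed (simp_all add: \<theta>_def)
  ultimately have "w a - w b = (\<integral>s. indicator {a..b} s * H s \<partial>lborel)"
    unfolding eqn by (rule LIMSEQ_unique)
  then show ?thesis by simp
qed

text \<open>The positive and negative parts of \<open>D\<close> on [a, b], taken as densities,
  define finite measures that agree on all half-lines and hence coincide; then so do the densities
  almost everywhere.\<close>

lemma AE_zero_from_intervals:
  fixes D :: "real \<Rightarrow> real"
  assumes D: "D \<in> borel_measurable borel" "\<And>s. s \<in> {a..b} \<Longrightarrow> \<bar>D s\<bar> \<le> C"
    and z: "\<And>a b. a < b \<Longrightarrow> b < T \<Longrightarrow> (\<integral>s. indicator {a..b} s * D s \<partial>lborel) = 0"
    and ab: "a < b" "b < T"
  shows "AE s in lborel. s \<in> {a..b} \<longrightarrow> D s = 0"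
proof -
  note [measurable] = D(1)
  define p where "p s = indicator {a..b} s * max 0 (D s)" for s
  define m where "m s = indicator {a..b} s * max 0 (- D s)" for s
  have [measurable]: "p \<in> borel_measurable borel" "m \<in> borel_measurable borel" by (auto simp: p_def[abs_def] m_def[abs_def])
  have i: "integrable lborel (\<lambda>s. indicator A s * p s)" "integrable lborel (\<lambda>s. indicator A s * m s)" if "A \<in> sets borel" for A
  proof -
    have C: "C \<ge> 0" using D(2)[of a] ab by auto
    have C': "integrable lborel (\<lambda>s. C * indicator {a..b} s :: real)"
      by (intro integrable_mult_right integrable_real_indicator) (use ab in auto)
    show "integrable lborel (\<lambda>s. indicator A s * p s)" "integrable lborel (\<lambda>s. indicator A s * m s)"
      using that C D(2)[unfolded abs_le_iff] by (auto intro!: Bochner_Integration.integrable_bound[OF C'] AE_I2 simp: p_def m_def indicator_def)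
  qed
  have nn: "p s \<ge> 0" "m s \<ge> 0" for s by (auto simp: p_def m_def)
  have em: "emeasure (density lborel (\<lambda>s. ennreal (g s))) A = ennreal (\<integral>s. indicator A s * g s \<partial>lborel)"
    if "A \<in> sets borel" "g \<in> borel_measurable borel" "integrable lborel (\<lambda>s. indicator A s * g s)" "\<And>s. g s \<ge> 0" for A g
  proof -
    have "emeasure (density lborel (\<lambda>s. ennreal (g s))) A = (\<integral>\<^sup>+s. ennreal (indicator A s * g s) \<partial>lborel)"
      using that by (subst emeasure_density) (auto intro!: nn_integral_cong simp: indicator_def)
    then show ?thesis using that by (subst (asm) nn_integral_eq_integral) auto
  qed
  have eq: "(\<integral>s. indicator {x<..} s * p s \<partial>lborel) = (\<integral>s. indicator {x<..} s * m s \<partial>lborel)" for x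
  proof -
    have "(\<integral>s. indicator {x<..} s * p s \<partial>lborel) - (\<integral>s. indicator {x<..} s * m s \<partial>lborel) = (\<integral>s. indicator {x<..} s * p s - indicator {x<..} s * m s \<partial>lborel)"
      using i by (intro Bochner_Integration.integral_diff[symmetric]) auto
    also have "\<dots> = (\<integral>s. indicator {max a x..b} s * D s \<partial>lborel)"
    proof (rule integral_cong_AE)
      have "AE s in lborel. s \<noteq> x" by (rule AE_lborel_singleton)
      then show "AE s in lborel. indicator {x<..} s * p s - indicator {x<..} s * m s = indicator {max a x..b} s * D s"
        by eventually_elim (auto simp: p_def m_def indicator_def)
    qed auto
    also have "\<dots> = 0"
    proof (cases "max a x < b")
      case True then show ?thesis using z ab by blast
    next
      case False
      have "AE s in lborel. s \<noteq> b" by (rule AE_lborel_singleton)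
      then have "AE s in lborel. indicator {max a x..b} s * D s = 0"
        by eventually_elim (use False in \<open>auto simp: indicator_def\<close>)
      then have "(\<integral>s. indicator {max a x..b} s * D s \<partial>lborel) = (\<integral>s. 0 \<partial>(lborel::real measure))"
        by (intro integral_cong_AE) auto
      then show ?thesis by simp
    qed
    finally show ?thesis by simp
  qed
  have "density lborel (\<lambda>s. ennreal (p s)) = density lborel (\<lambda>s. ennreal (m s))"
  proof (rule measure_eqI_lessThan)
    fix x
    have e: "emeasure (density lborel (\<lambda>s. ennreal (p s))) {x<..} = ennreal (\<integral>s. indicator {x<..} s * p s \<partial>lborel)"
      "emeasure (density lborel (\<lambda>s. ennreal (m s))) {x<..} = ennreal (\<integral>s. indicator {x<..} s * m s \<partial>lborel)"
      by (rule em; use i nn in simp)+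
    show "emeasure (density lborel (\<lambda>s. ennreal (p s))) {x<..} < \<infinity>" unfolding e by simp
    show "emeasure (density lborel (\<lambda>s. ennreal (p s))) {x<..} = emeasure (density lborel (\<lambda>s. ennreal (m s))) {x<..}"
      unfolding e eq ..
  qed auto
  then have "AE s in lborel. ennreal (p s) = ennreal (m s)"
    by (intro sigma_finite_measure.density_unique[OF sigma_finite_lborel]) auto
  then show ?thesis
  proof eventually_elim
    case (elim s)
    then have "p s = m s" using nn by simp
    then show ?case by (auto simp: p_def m_def indicator_def max_def split: if_splits)
  qed
qed

section \<open>The equation in coordinates moving with the drift\<close>

text \<open>Weak derivatives are bounded only almost everywhere. Truncation at the essential bound
  gives a Borel version bounded at every point, as the slicing lemmas require.\<close>

definition trunc :: "real \<Rightarrow> ('a \<Rightarrow> real) \<Rightarrow> 'a set \<Rightarrow> 'a \<Rightarrow> real" where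
  "trunc C g \<Omega> p = max (- C) (min C (indicator \<Omega> p * g p))"

lemma Linf_trunc:
  assumes "Linf \<Omega> g"
  shows "\<exists>C\<ge>0. trunc C g \<Omega> \<in> borel_measurable borel \<and> (\<forall>p. \<bar>trunc C g \<Omega> p\<bar> \<le> C) \<and>
    (AE p in lborel. p \<in> \<Omega> \<longrightarrow> trunc C g \<Omega> p = g p)"
proof -
  obtain C0 where C0: "AE p in lborel. p \<in> \<Omega> \<longrightarrow> \<bar>g p\<bar> \<le> C0" using assms by (auto simp: Linf_def)
  define C where "C = max 0 C0"
  have "(\<lambda>p. indicator \<Omega> p * g p) \<in> borel_measurable borel"
    using assms by (simp add: Linf_def set_borel_measurable_def)
  then have "trunc C g \<Omega> \<in> borel_measurable borel" unfolding trunc_def[abs_def] by measurable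
  moreover have "AE p in lborel. p \<in> \<Omega> \<longrightarrow> trunc C g \<Omega> p = g p"
    using C0 by eventually_elim (auto simp: trunc_def C_def)
  moreover have "\<forall>p. \<bar>trunc C g \<Omega> p\<bar> \<le> C" by (auto simp: trunc_def C_def)
  ultimately show ?thesis by (intro exI[of _ C]) (auto simp: C_def)
qed

section \<open>Slices and test functions carried along the drift\<close>

context kolmogorov
begin

text \<open>Spatial mollification of \<open>g\<close> at time s in the coordinate z with x = E(s -
  t) z, in which the drift term disappears. At s = t it is ordinary mollification.\<close>

definition slc :: "((real, 'n) vec \<times> real \<Rightarrow> real) \<Rightarrow> ((real, 'n) vec \<Rightarrow> real) \<Rightarrow> real \<Rightarrow> real \<Rightarrow> (real, 'n) vec \<Rightarrow> real" where
  "slc g \<eta> t s = cv (\<lambda>z. g (E (s - t) *v z, s)) \<eta>"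

definition ptst :: "(real \<Rightarrow> real) \<Rightarrow> ((real, 'n) vec \<Rightarrow> real) \<Rightarrow> real \<Rightarrow> (real, 'n) vec \<Rightarrow> (real, 'n) vec \<times> real \<Rightarrow> real" where
  "ptst \<theta> \<eta> t x p = \<theta> (snd p) * \<eta> (x - E (t - snd p) *v fst p)"

lemma E_pair_cont: "continuous_on UNIV (\<lambda>p. E (t - snd p) *v fst p)" (is "continuous_on _ ?f")
proof -
  have "continuous_on UNIV (\<lambda>p::(real, 'n) vec \<times> real. \<chi> i. \<Sum>j\<in>UNIV. E (t - snd p) $ i $ j * fst p $ j)"
    by (intro continuous_intros continuous_on_compose2[OF Emat_continuous[of UNIV]]) auto
  then show ?thesis by (simp add: matrix_vector_mult_def)
qed

lemma E_pair_cont': "continuous_on UNIV (\<lambda>p. E (snd p - t) *v fst p)" (is "continuous_on _ ?f")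
proof -
  have "continuous_on UNIV (\<lambda>p::(real, 'n) vec \<times> real. \<chi> i. \<Sum>j\<in>UNIV. E (snd p - t) $ i $ j * fst p $ j)"
    by (intro continuous_intros continuous_on_compose2[OF Emat_continuous[of UNIV]]) auto
  then show ?thesis by (simp add: matrix_vector_mult_def)
qed

lemma slc_borel:
  assumes g: "g \<in> borel_measurable borel" and \<eta>: "\<eta> \<in> borel_measurable borel"
  shows "(\<lambda>s. slc g \<eta> t s x) \<in> borel_measurable borel"
    and "(\<lambda>q. slc g \<eta> t (fst q) (snd q)) \<in> borel_measurable borel"
proof -
  note [measurable] = g \<eta>
  have ss: "sets (borel \<Otimes>\<^sub>M lborel :: ((real \<times> (real, 'n) vec) \<times> (real, 'n) vec) measure) = sets borel"
    by (metis sets_pair_measure_cong borel_prod sets_lborel)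
  have 1: "(\<lambda>(q, z). g (E (fst q - t) *v z, fst q) * \<eta> (snd q - z)) \<in> borel_measurable (borel \<Otimes>\<^sub>M lborel)"
  proof -
    have "continuous_on UNIV (\<lambda>r::(real \<times> (real, 'n) vec) \<times> (real, 'n) vec. (snd r, fst (fst r)))"
      by (intro continuous_intros)
    from continuous_on_compose2[OF E_pair_cont'[of t] this]
    have "continuous_on UNIV (\<lambda>r::(real \<times> (real, 'n) vec) \<times> (real, 'n) vec. (E (fst (fst r) - t) *v snd r, fst (fst r)))"
      by (intro continuous_intros) auto
    from measurable_compose[OF borel_measurable_continuous_onI[OF this] g]
    have [measurable]: "(\<lambda>r::(real \<times> (real, 'n) vec) \<times> (real, 'n) vec. g (E (fst (fst r) - t) *v snd r, fst (fst r))) \<in> borel_measurable borel" .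
    have "continuous_on UNIV (\<lambda>r::(real \<times> (real, 'n) vec) \<times> (real, 'n) vec. snd (fst r) - snd r)"
      by (intro continuous_intros)
    from measurable_compose[OF borel_measurable_continuous_onI[OF this] \<eta>]
    have [measurable]: "(\<lambda>r::(real \<times> (real, 'n) vec) \<times> (real, 'n) vec. \<eta> (snd (fst r) - snd r)) \<in> borel_measurable borel" .
    have "(\<lambda>r::(real \<times> (real, 'n) vec) \<times> (real, 'n) vec. g (E (fst (fst r) - t) *v snd r, fst (fst r)) * \<eta> (snd (fst r) - snd r)) \<in> borel_measurable borel"
      by measurable
    then show ?thesis by (simp add: case_prod_beta measurable_cong_sets[OF ss refl])
  qed
  have "(\<lambda>q. \<integral>z. g (E (fst q - t) *v z, fst q) * \<eta> (snd q - z) \<partial>lborel) \<in> borel_measurable borel"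
    by (rule lborel.borel_measurable_lebesgue_integral[OF 1])
  then show 2: "(\<lambda>q. slc g \<eta> t (fst q) (snd q)) \<in> borel_measurable borel" by (simp add: slc_def cv_def)
  have "(\<lambda>s::real. (s, x)) \<in> borel_measurable borel" by (intro borel_measurable_continuous_onI continuous_intros)
  from measurable_compose[OF this 2] show "(\<lambda>s. slc g \<eta> t s x) \<in> borel_measurable borel" by simp
qed

context
  fixes g :: "(real, 'n) vec \<times> real \<Rightarrow> real" and M
  assumes g: "g \<in> borel_measurable borel" "\<And>p. \<bar>g p\<bar> \<le> M"
begin

lemma slice_borel: "(\<lambda>z. g (E (s - t) *v z, s)) \<in> borel_measurable borel"
proof -
  have "(\<lambda>z. (E (s - t) *v z, s)) \<in> borel_measurable borel"
    by (intro borel_measurable_continuous_onI continuous_intros matrix_vector_mult_linear_continuous_on)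
  then show ?thesis using measurable_compose[OF _ g(1)] by blast
qed

text \<open>Volume preservation by \<open>E\<close> moves the flow from \<open>g\<close> to the
  mollifier, giving the form in which the slice occurs in the weak equations.\<close>

lemma slc_alt: "\<eta> \<in> borel_measurable borel \<Longrightarrow> slc g \<eta> t s x = (\<integral>y. g (y, s) * \<eta> (x - E (t - s) *v y) \<partial>lborel)"
proof -
  assume [measurable]: "\<eta> \<in> borel_measurable borel"
  have "(\<lambda>y. (y, s)) \<in> borel_measurable borel" by (intro borel_measurable_continuous_onI continuous_intros)
  from measurable_compose[OF this g(1)] have [measurable]: "(\<lambda>y. g (y, s)) \<in> borel_measurable borel" .
  have "(\<integral>y. g (y, s) * \<eta> (x - E (t - s) *v y) \<partial>lborel) = (\<integral>z. (\<lambda>y. g (y, s) * \<eta> (x - E (t - s) *v y)) (E (s - t) *v z) \<partial>lborel)"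
    by (rule integral_Emat(1)[symmetric]) measurable
  also have "\<dots> = slc g \<eta> t s x" by (simp add: slc_def cv_def Emat_mv)
  finally show ?thesis by simp
qed

lemma slc_le: "bdk n (\<lambda>x. C * expn x) \<eta> \<Longrightarrow> \<bar>slc g \<eta> t s x\<bar> \<le> C * M * (\<integral>z. expn (z::(real, 'n) vec) \<partial>lborel)"
  unfolding slc_def by (rule cv_le[OF slice_borel g(2)])

lemma bdk_slc: "bdk (Suc n) (\<lambda>x. C * expn x) \<eta> \<Longrightarrow> bdk n (\<lambda>_. C * M * (\<integral>z. expn (z::(real, 'n) vec) \<partial>lborel)) (slc g \<eta> t s)"
  unfolding slc_def by (rule bdk_cv[OF slice_borel g(2)])

lemma dd_slc: "bdk (Suc n) (\<lambda>x. C * expn x) \<eta> \<Longrightarrow> dd v (slc g \<eta> t s) = slc g (dd v \<eta>) t s"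
  unfolding slc_def by (rule dd_cv[OF slice_borel g(2)])

text \<open>Fubini in time and space. The factor \<theta> is only assumed measurable, so that
  coefficients such as \<open>a s i j\<close> and products of entries of \<open>E\<close> can be
  absorbed into it.\<close>

lemma slice_integral:
  assumes \<theta>: "\<theta> \<in> borel_measurable borel" "\<And>s. \<bar>\<theta> s\<bar> \<le> C" "\<And>s. s \<notin> {c..d} \<Longrightarrow> \<theta> s = 0" and \<eta>: "bumpy \<eta>"
  shows "integrable lborel (\<lambda>p. g p * ptst \<theta> \<eta> t x p)"
    and "(\<integral>p. g p * ptst \<theta> \<eta> t x p \<partial>lborel) = (\<integral>s. \<theta> s * slc g \<eta> t s x \<partial>lborel)"
    and "integrable lborel (\<lambda>s. \<theta> s * slc g \<eta> t s x)"
proof -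
  obtain R where R: "\<And>x. norm x > R \<Longrightarrow> \<eta> x = 0" and s\<eta>: "smooth \<eta>" using \<eta> by (auto simp: bumpy_def)
  obtain C1 where C1: "C1 \<ge> 0" "bdk 0 (\<lambda>x. C1 * expn x) \<eta>" using bumpy_bdk[OF \<eta>] by blast
  have \<eta>1: "\<bar>\<eta> y\<bar> \<le> C1" for y using bdk_le[OF C1(2), of y] C1(1) mult_left_mono[of "expn y" 1 C1] by simp
  note [measurable] = g(1) \<theta>(1) smooth_borel[OF s\<eta>]
  \<comment> \<open>A compact set outside of which the product vanishes: the image under the flow of
    a ball containing the support of \<eta>, times [c, d].\<close>
  define K where "K = (\<lambda>q. (E (snd q - t) *v (x - fst q), snd q)) ` (cball 0 R \<times> {c..d})"
  have "continuous_on UNIV (\<lambda>q. E (snd q - t) *v (x - fst q))"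
  proof -
    have "continuous_on UNIV (\<lambda>q::(real, 'n) vec \<times> real. (x - fst q, snd q))" by (intro continuous_intros)
    from continuous_on_compose2[OF E_pair_cont'[of t] this] show ?thesis by simp
  qed
  then have K: "compact K"
    unfolding K_def by (intro compact_continuous_image compact_Times continuous_intros) (auto intro: continuous_on_subset)
  have out: "ptst \<theta> \<eta> t x p = 0" if "p \<notin> K" for p
  proof (rule ccontr)
    assume nz: "ptst \<theta> \<eta> t x p \<noteq> 0"
    then have "snd p \<in> {c..d}" "norm (x - E (t - snd p) *v fst p) \<le> R"
      using \<theta>(3) R unfolding ptst_def by (metis mult_zero_left, metis mult_zero_right not_le)
    moreover have "p = (E (snd p - t) *v (x - (x - E (t - snd p) *v fst p)), snd p)" by (simp add: Emat_mv)
    ultimately have "p \<in> K" unfolding K_def by (intro image_eqI[of _ _ "(x - E (t - snd p) *v fst p, snd p)"]) auto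
    then show False using that by simp
  qed
  have [measurable]: "(\<lambda>p. E (t - snd p) *v fst p) \<in> borel_measurable borel"
    by (intro borel_measurable_continuous_onI E_pair_cont)
  have pm: "(\<lambda>p. g p * ptst \<theta> \<eta> t x p) \<in> borel_measurable borel"
  proof -
    have "(\<lambda>p::(real, 'n) vec \<times> real. \<theta> (snd p)) \<in> borel_measurable borel"
      using measurable_compose[OF borel_measurable_continuous_onI[OF continuous_on_snd[OF continuous_on_id]] \<theta>(1)] by simp
    then show ?thesis unfolding ptst_def by measurable
  qed
  show int: "integrable lborel (\<lambda>p. g p * ptst \<theta> \<eta> t x p)"
  proof (rule Bochner_Integration.integrable_bound)
    show "integrable lborel (\<lambda>p. (M * (C * C1)) * indicator K p :: real)"
      using K emeasure_bounded_finite[OF compact_imp_bounded[OF K]]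
      by (intro integrable_mult_right integrable_real_indicator) (auto dest: compact_imp_closed)
    show "AE p in lborel. norm (g p * ptst \<theta> \<eta> t x p) \<le> norm ((M * (C * C1)) * indicator K p :: real)"
    proof (rule AE_I2)
      fix p
      show "norm (g p * ptst \<theta> \<eta> t x p) \<le> norm ((M * (C * C1)) * indicator K p :: real)"
      proof (cases "p \<in> K")
        case True
        have "\<bar>g p\<bar> * (\<bar>\<theta> (snd p)\<bar> * \<bar>\<eta> (x - E (t - snd p) *v fst p)\<bar>) \<le> M * (C * C1)"
          using g(2)[of p] \<theta>(2)[of "snd p"] \<eta>1 by (intro mult_mono) auto
        then have "norm (g p * ptst \<theta> \<eta> t x p) \<le> M * (C * C1)" by (simp add: ptst_def abs_mult)
        then show ?thesis using True abs_ge_self[of "M * (C * C1)"] by simp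
      qed (simp add: out)
    qed
  qed (use pm in simp)
  have pr: "(\<lambda>(y, s). g (y, s) * ptst \<theta> \<eta> t x (y, s)) = (\<lambda>p. g p * ptst \<theta> \<eta> t x p)"
    by (auto simp: fun_eq_iff)
  have inner: "(\<integral>y. g (y, s) * ptst \<theta> \<eta> t x (y, s) \<partial>lborel) = \<theta> s * slc g \<eta> t s x" for s
    unfolding slc_alt[OF smooth_borel[OF s\<eta>]] integral_mult_right_zero[symmetric] by (simp add: ptst_def mult_ac)
  show "(\<integral>p. g p * ptst \<theta> \<eta> t x p \<partial>lborel) = (\<integral>s. \<theta> s * slc g \<eta> t s x \<partial>lborel)"
    using lborel_pair.integral_snd[of "\<lambda>y s. g (y, s) * ptst \<theta> \<eta> t x (y, s)", unfolded lborel_prod pr, OF int]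
    unfolding inner by simp
  show "integrable lborel (\<lambda>s. \<theta> s * slc g \<eta> t s x)"
    using lborel_pair.integrable_snd[of "\<lambda>y s. g (y, s) * ptst \<theta> \<eta> t x (y, s)", unfolded lborel_prod pr, OF int]
    unfolding inner .
qed

end

lemma smooth_Emat: "smooth (\<lambda>p::(real, 'n) vec \<times> real. E (t - snd p) $ i $ j)" for i j :: 'n
proof -
  have s: "smooth (\<lambda>p::(real, 'n) vec \<times> real. t - snd p)"
    by (intro smooth_diff smooth_const smooth_linear bounded_linear_snd)
  show ?thesis
  proof (cases "b j \<le> b i")
    case True
    have "smooth (\<lambda>p::(real, 'n) vec \<times> real. (- 1 * (t - snd p)) ^ n * c)" for n c
      by (intro smooth_mult[OF smooth_power[OF smooth_cmult[OF s]]] smooth_const)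
    from this[of "b i - b j" "mpow B (b i - b j) $ i $ j / fact (b i - b j)"]
    show ?thesis unfolding Emat_entry using True by simp
  qed (simp add: Emat_entry)
qed

lemma ptst_test:
  assumes \<theta>: "smooth \<theta>" "\<And>s. s \<notin> {c..d} \<Longrightarrow> \<theta> s = 0" "d < T" and \<eta>: "bumpy \<eta>"
  shows "test_fun (ST T) (ptst \<theta> \<eta> t x)"
proof -
  obtain R where R: "\<And>x. norm x > R \<Longrightarrow> \<eta> x = 0" and s\<eta>: "smooth \<eta>" using \<eta> by (auto simp: bumpy_def)
  define K where "K = (\<lambda>q. (E (snd q - t) *v (x - fst q), snd q)) ` (cball 0 R \<times> {c..d})"
  have "continuous_on UNIV (\<lambda>q. E (snd q - t) *v (x - fst q))"
  proof -
    have "continuous_on UNIV (\<lambda>q::(real, 'n) vec \<times> real. (x - fst q, snd q))" by (intro continuous_intros)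
    from continuous_on_compose2[OF E_pair_cont'[of t] this] show ?thesis by simp
  qed
  then have K: "compact K"
    unfolding K_def by (intro compact_continuous_image compact_Times continuous_intros) (auto intro: continuous_on_subset)
  have out: "{p. ptst \<theta> \<eta> t x p \<noteq> 0} \<subseteq> K"
  proof safe
    fix y s
    assume nz: "ptst \<theta> \<eta> t x (y, s) \<noteq> 0"
    then have "s \<in> {c..d}" "norm (x - E (t - s) *v y) \<le> R"
      using \<theta>(2)[of s] R[of "x - E (t - s) *v y"] by (auto simp: ptst_def not_le[symmetric])
    then show "(y, s) \<in> K" unfolding K_def
      by (intro image_eqI[of _ _ "(x - E (t - s) *v y, s)"]) (auto simp: Emat_mv)
  qed
  then have cl: "closure {p. ptst \<theta> \<eta> t x p \<noteq> 0} \<subseteq> K"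
    using K by (intro closure_minimal compact_imp_closed)
  have "smooth (ptst \<theta> \<eta> t x)"
    unfolding ptst_def[abs_def]
  proof (intro smooth_mult)
    show "smooth (\<lambda>p::(real, 'n) vec \<times> real. \<theta> (snd p))"
      by (rule smooth_real_compose[OF \<theta>(1)]) (intro smooth_linear bounded_linear_snd)
    show "smooth (\<lambda>p. \<eta> (x - E (t - snd p) *v fst p))"
    proof (rule smooth_compose[OF s\<eta>])
      fix e :: "(real, 'n) vec" assume "e \<in> Basis"
      then obtain i where e: "e = axis i 1" by (auto simp: Basis_vec_def)
      have "smooth (\<lambda>p::(real, 'n) vec \<times> real. x $ i - (\<Sum>j\<in>UNIV. E (t - snd p) $ i $ j * fst p $ j))"
        by (intro smooth_diff smooth_const smooth_sum smooth_mult smooth_Emat smooth_linear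
            bounded_linear_compose[OF bounded_linear_vec_nth bounded_linear_fst])
      then show "smooth (\<lambda>p. (x - E (t - snd p) *v fst p) \<bullet> e)"
        by (simp add: e inner_axis matrix_vector_mult_def)
    qed
  qed
  moreover have "compact (closure {p. ptst \<theta> \<eta> t x p \<noteq> 0})"
    using cl K by (metis closed_closure compact_Int_closed inf.absorb_iff2 inf_commute)
  moreover have "K \<subseteq> ST T" using \<theta>(3) by (auto simp: K_def ST_def)
  ultimately show ?thesis using cl unfolding test_fun_def smooth_def by blast
qed

text \<open>Stated for finite sums with different time factors so that, once the direction has been
  expanded into coordinate directions, it applies again to its own result and yields second
  derivatives.\<close>

lemma dd_xdir_ptst:
  assumes \<eta>: "\<And>k. k \<in> A \<Longrightarrow> smooth (\<eta> k)" and A: "finite A"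
  shows "dd (xdir i) (\<lambda>p. \<Sum>k\<in>A. ptst (\<theta> k) (\<eta> k) t x p) p
    = (\<Sum>k\<in>A. - ptst (\<theta> k) (dd (E (t - snd p) *v axis i 1) (\<eta> k)) t x p)"
proof -
  let ?v = "- (E (t - snd p) *v axis i 1)"
  have l: "x - E (t - snd p) *v (fst p + r *\<^sub>R axis i 1) = (x - E (t - snd p) *v fst p) + r *\<^sub>R ?v" for r
    by (simp add: matrix_vector_right_distrib matrix_vector_mult_scaleR)
  have "((\<lambda>r. \<Sum>k\<in>A. \<theta> k (snd p) * \<eta> k ((x - E (t - snd p) *v fst p) + r *\<^sub>R ?v)) has_real_derivative
      (\<Sum>k\<in>A. \<theta> k (snd p) * dd ?v (\<eta> k) ((x - E (t - snd p) *v fst p) + 0 *\<^sub>R ?v))) (at 0)"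
    by (intro DERIV_sum DERIV_cmult dd_line smooth_differentiable \<eta>)
  moreover have "dd ?v (\<eta> k) y = - dd (E (t - snd p) *v axis i 1) (\<eta> k) y" if "k \<in> A" for k y
    using dd_scaleR[OF smooth_differentiable[OF \<eta>[OF that]], of "-1" "E (t - snd p) *v axis i 1" y] by simp
  ultimately have "((\<lambda>r. \<Sum>k\<in>A. \<theta> k (snd p) * \<eta> k ((x - E (t - snd p) *v fst p) + r *\<^sub>R ?v)) has_real_derivative
      (\<Sum>k\<in>A. - ptst (\<theta> k) (dd (E (t - snd p) *v axis i 1) (\<eta> k)) t x p)) (at 0)"
    by (simp add: ptst_def cong: sum.cong)
  then show ?thesis
    unfolding dd_def[of "xdir i"] by (intro DERIV_imp_deriv) (simp add: ptst_def xdir_def l)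
qed

lemma dd_xdir_ptst1: "smooth \<eta> \<Longrightarrow> dd (xdir i) (ptst \<theta> \<eta> t x) p = - ptst \<theta> (dd (E (t - snd p) *v axis i 1) \<eta>) t x p"
  using dd_xdir_ptst[of "{0::nat}" "\<lambda>_. \<eta>" i "\<lambda>_. \<theta>"] by simp

lemma dd_xdir2_ptst:
  assumes \<eta>: "smooth \<eta>"
  shows "dd (xdir i) (dd (xdir j) (ptst \<theta> \<eta> t x)) p
    = (\<Sum>k\<in>UNIV. \<Sum>l\<in>UNIV. ptst (\<lambda>s. \<theta> s * (E (t - s) $ k $ j * E (t - s) $ l $ i)) (dd (axis l 1) (dd (axis k 1) \<eta>)) t x p)"
proof -
  have c: "(E s *v axis i 1) $ k = E s $ k $ i" for s i k
    by (simp add: matrix_vector_mult_def axis_def if_distrib cong: if_cong)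
  have 1: "dd (xdir j) (ptst \<theta> \<eta> t x) = (\<lambda>p. \<Sum>k\<in>UNIV. ptst (\<lambda>s. - (\<theta> s * E (t - s) $ k $ j)) (dd (axis k 1) \<eta>) t x p)"
  proof
    fix p
    show "dd (xdir j) (ptst \<theta> \<eta> t x) p = (\<Sum>k\<in>UNIV. ptst (\<lambda>s. - (\<theta> s * E (t - s) $ k $ j)) (dd (axis k 1) \<eta>) t x p)"
      unfolding dd_xdir_ptst1[OF \<eta>] ptst_def
      by (subst dd_axis_sum[OF smooth_differentiable[OF \<eta>]]) (simp add: c sum_distrib_left sum_negf mult_ac)
  qed
  show ?thesis
    unfolding 1
  proof (subst dd_xdir_ptst, goal_cases)
    case 3
    show ?case
    proof (rule sum.cong[OF refl])
      fix k
      show "- ptst (\<lambda>s. - (\<theta> s * E (t - s) $ k $ j)) (dd (E (t - snd p) *v axis i 1) (dd (axis k 1) \<eta>)) t x p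
        = (\<Sum>l\<in>UNIV. ptst (\<lambda>s. \<theta> s * (E (t - s) $ k $ j * E (t - s) $ l $ i)) (dd (axis l 1) (dd (axis k 1) \<eta>)) t x p)"
        unfolding ptst_def
        by (subst dd_axis_sum[OF smooth_differentiable[OF smooth_dd[OF \<eta>]]]) (simp add: c sum_distrib_left sum_negf mult_ac)
    qed
  qed (auto intro: smooth_dd \<eta>)
qed

text \<open>The profile \<eta>(x - E(t - s) y) is constant along the characteristics of
  \<open>Y\<close>, so the formal adjoint of \<open>Y\<close> differentiates only \<theta>.\<close>

lemma drift_ptst:
  assumes \<eta>: "smooth \<eta>" and \<theta>: "\<And>s. (\<theta> has_real_derivative \<theta>' s) (at s)"
  shows "- (\<Sum>j\<in>UNIV. dd (xdir j) (\<lambda>p'. (\<Sum>k\<in>UNIV. B $ j $ k * fst p' $ k) * ptst \<theta> \<eta> t x p') p) + dd tdir (ptst \<theta> \<eta> t x) p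
    = ptst \<theta>' \<eta> t x p"
proof -
  have d: "\<eta> differentiable (at y)" for y using \<eta> by (rule smooth_differentiable)
  let ?E = "E (t - snd p)"
  have 1: "dd (xdir j) (\<lambda>p'. (\<Sum>k\<in>UNIV. B $ j $ k * fst p' $ k) * ptst \<theta> \<eta> t x p') p = (B *v fst p) $ j * - ptst \<theta> (dd (?E *v axis j 1) \<eta>) t x p" for j
  proof -
    \<comment> \<open>The coefficient (B x)_j does not vary in direction j since the diagonal of
      \<open>B\<close> is zero, so it can be pulled out of the derivative.\<close>
    have "(\<Sum>k\<in>UNIV. B $ j $ k * (fst p + r *\<^sub>R axis j 1) $ k) = (B *v fst p) $ j" for r
      unfolding matrix_vector_mult_def vec_lambda_beta by (rule sum.cong) (auto simp: axis_def B_zero)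
    then have "dd (xdir j) (\<lambda>p'. (\<Sum>k\<in>UNIV. B $ j $ k * fst p' $ k) * ptst \<theta> \<eta> t x p') p = deriv (\<lambda>r. (B *v fst p) $ j * ptst \<theta> \<eta> t x (p + r *\<^sub>R xdir j)) 0"
      unfolding dd_def[of "xdir j"] by (simp add: xdir_def)
    also have "\<dots> = (B *v fst p) $ j * - ptst \<theta> (dd (?E *v axis j 1) \<eta>) t x p"
    proof (rule DERIV_imp_deriv, rule DERIV_cmult)
      let ?v = "- (?E *v axis j 1)"
      have l: "x - ?E *v (fst p + r *\<^sub>R axis j 1) = (x - ?E *v fst p) + r *\<^sub>R ?v" for r
        by (simp add: matrix_vector_right_distrib matrix_vector_mult_scaleR)
      have "((\<lambda>r. \<theta> (snd p) * \<eta> ((x - ?E *v fst p) + r *\<^sub>R ?v)) has_real_derivative \<theta> (snd p) * dd ?v \<eta> ((x - ?E *v fst p) + 0 *\<^sub>R ?v)) (at 0)"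
        by (intro DERIV_cmult dd_line d)
      then show "((\<lambda>r. ptst \<theta> \<eta> t x (p + r *\<^sub>R xdir j)) has_real_derivative - ptst \<theta> (dd (?E *v axis j 1) \<eta>) t x p) (at 0)"
        using dd_scaleR[OF d, of "-1" "?E *v axis j 1"] by (simp add: ptst_def xdir_def l)
    qed
    finally show ?thesis .
  qed
  have "(\<Sum>j\<in>UNIV. (B *v fst p) $ j * dd (?E *v axis j 1) \<eta> y) = dd (?E *v (B *v fst p)) \<eta> y" for y
  proof -
    have li: "linear (\<lambda>v. dd v \<eta> y)"
      using has_derivative_bounded_linear[OF dd_has_derivative[OF d]] by (rule bounded_linear.linear)
    have v: "B *v fst p = (\<Sum>j\<in>UNIV. (B *v fst p) $ j *\<^sub>R axis j 1)"
      by (simp add: vec_eq_iff axis_def if_distrib cong: if_cong)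
    have "?E *v (\<Sum>j\<in>UNIV. (B *v fst p) $ j *\<^sub>R axis j 1) = (\<Sum>j\<in>UNIV. (B *v fst p) $ j *\<^sub>R (?E *v axis j 1))"
      using matrix_vector_mul_linear[of ?E] by (simp add: linear_sum linear_scale)
    then have "?E *v (B *v fst p) = (\<Sum>j\<in>UNIV. (B *v fst p) $ j *\<^sub>R (?E *v axis j 1))" using v by simp
    then show ?thesis by (simp only: linear_sum[OF li] linear_scale[OF li] real_scaleR_def)
  qed
  then have S: "(\<Sum>j\<in>UNIV. dd (xdir j) (\<lambda>p'. (\<Sum>k\<in>UNIV. B $ j $ k * fst p' $ k) * ptst \<theta> \<eta> t x p') p) = - ptst \<theta> (dd (?E *v (B *v fst p)) \<eta>) t x p"
    unfolding 1 by (simp add: ptst_def sum_negf sum_distrib_left[symmetric] mult.left_commute[of _ "\<theta> _"])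
  have T: "dd tdir (ptst \<theta> \<eta> t x) p = ptst \<theta>' \<eta> t x p - ptst \<theta> (dd (?E *v (B *v fst p)) \<eta>) t x p"
  proof -
    let ?y = "fst p" and ?s = "snd p"
    have e: "((\<lambda>r. E (t - ?s - r) *v ?y) has_derivative (\<lambda>h. h *\<^sub>R (?E *v (B *v ?y)))) (at 0)"
    proof (subst has_derivative_componentwise_within, intro ballI)
      fix e :: "(real, 'n) vec" assume "e \<in> Basis"
      then obtain i where e: "e = axis i 1" by (auto simp: Basis_vec_def)
      have "((\<lambda>r. \<Sum>j\<in>UNIV. E (t - ?s - r) $ i $ j * ?y $ j) has_real_derivative (\<Sum>j\<in>UNIV. (?E ** B) $ i $ j * ?y $ j)) (at 0)"
      proof (intro DERIV_sum DERIV_cmult_right)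
        fix j
        have "((\<lambda>r. E (t - ?s - r) $ i $ j) has_real_derivative - ((E (t - ?s - 0) ** B) $ i $ j) * (- 1)) (at 0)"
          by (rule DERIV_chain2[OF Emat_deriv]) (auto intro!: derivative_eq_intros)
        then show "((\<lambda>r. E (t - ?s - r) $ i $ j) has_real_derivative (?E ** B) $ i $ j) (at 0)" by simp
      qed
      then show "((\<lambda>r. (E (t - ?s - r) *v ?y) \<bullet> e) has_derivative (\<lambda>h. h *\<^sub>R (?E *v (B *v ?y)) \<bullet> e)) (at 0)"
        unfolding matrix_vector_mul_assoc
        by (simp add: e inner_axis matrix_vector_mult_def[of "E _"] matrix_vector_mult_def[of "?E ** B"] has_field_derivative_def mult.commute[of _ "\<Sum>j\<in>UNIV. _ j"])
    qed
    have "((\<lambda>r. x - E (t - ?s - r) *v ?y) has_derivative (\<lambda>h. - (h *\<^sub>R (?E *v (B *v ?y))))) (at 0)"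
      using has_derivative_diff[OF has_derivative_const e] by simp
    moreover have "(\<eta> has_derivative (\<lambda>v. dd v \<eta> (x - ?E *v ?y))) (at (x - E (t - ?s - 0) *v ?y))"
      using dd_has_derivative[OF d] by simp
    ultimately have hd: "((\<lambda>r. \<eta> (x - E (t - ?s - r) *v ?y)) has_derivative (\<lambda>h. dd (- (h *\<^sub>R (?E *v (B *v ?y)))) \<eta> (x - ?E *v ?y))) (at 0)"
      by (rule has_derivative_compose)
    have "dd (- (h *\<^sub>R v)) \<eta> y = (- dd v \<eta> y) * h" for h v y
      using dd_scaleR[OF d, of "- h" v y] by simp
    then have 2: "((\<lambda>r. \<eta> (x - E (t - ?s - r) *v ?y)) has_real_derivative - dd (?E *v (B *v ?y)) \<eta> (x - ?E *v ?y)) (at 0)"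
      unfolding has_field_derivative_def by (intro has_derivative_eq_rhs[OF hd]) (simp add: fun_eq_iff)
    have "((\<lambda>r. \<theta> (?s + r)) has_real_derivative \<theta>' ?s) (at 0)"
      using \<theta>[of ?s] DERIV_shift[of \<theta> "\<theta>' ?s" 0 ?s] by (simp add: add.commute)
    from DERIV_mult[OF this 2]
    have "((\<lambda>r. \<theta> (?s + r) * \<eta> (x - E (t - ?s - r) *v ?y)) has_real_derivative
        ptst \<theta>' \<eta> t x p - ptst \<theta> (dd (?E *v (B *v ?y)) \<eta>) t x p) (at 0)"
      by (simp add: ptst_def mult.commute)
    then show ?thesis
      unfolding dd_def[of tdir] by (intro DERIV_imp_deriv) (simp add: ptst_def tdir_def diff_diff_eq)
  qed
  show ?thesis using S T by simp
qed

end

lemma sum_swap4: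
  fixes X :: "'a \<Rightarrow> 'b \<Rightarrow> 'c \<Rightarrow> 'd \<Rightarrow> real"
  shows "(\<Sum>i\<in>A. \<Sum>j\<in>A'. \<Sum>k\<in>C. \<Sum>l\<in>D. X i j k l) = (\<Sum>k\<in>C. \<Sum>l\<in>D. \<Sum>i\<in>A. \<Sum>j\<in>A'. X i j k l)"
proof -
  have "(\<Sum>i\<in>A. \<Sum>j\<in>A'. \<Sum>k\<in>C. \<Sum>l\<in>D. X i j k l) = (\<Sum>i\<in>A. \<Sum>k\<in>C. \<Sum>j\<in>A'. \<Sum>l\<in>D. X i j k l)"
    by (rule sum.cong[OF refl], rule sum.swap)
  also have "\<dots> = (\<Sum>i\<in>A. \<Sum>k\<in>C. \<Sum>l\<in>D. \<Sum>j\<in>A'. X i j k l)"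
    by (rule sum.cong[OF refl], rule sum.cong[OF refl], rule sum.swap)
  also have "\<dots> = (\<Sum>k\<in>C. \<Sum>i\<in>A. \<Sum>l\<in>D. \<Sum>j\<in>A'. X i j k l)" by (rule sum.swap)
  also have "\<dots> = (\<Sum>k\<in>C. \<Sum>l\<in>D. \<Sum>i\<in>A. \<Sum>j\<in>A'. X i j k l)"
    by (rule sum.cong[OF refl], rule sum.swap)
  finally show ?thesis .
qed

section \<open>A solution and its equation integrated in time\<close>

locale kolmogorov_solution = kolmogorov ms B \<nu>
  for ms and B :: "((real, 'n::{finite,linorder}) vec, 'n) vec" and \<nu> +
  fixes \<tau> T :: real and a :: "real \<Rightarrow> 'n \<Rightarrow> 'n \<Rightarrow> real" and u f :: "(real, 'n) vec \<times> real \<Rightarrow> real"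
  assumes \<tau>T: "\<tau> < T" and ell: "elliptic ms \<nu> a" and S0: "S0tau ms B \<tau> T u"
    and Lu: "is_Lu ms B T a u f" and Df: "inD ms T f"
begin

lemma u_cont: "continuous_on {p. snd p \<le> T} u"
  using S0 by (auto simp: S0tau_def S0_def)

text \<open>Boundedness is assumed only for t < T; continuity up to T extends the bound to the final
  time, at which the estimate is also claimed.\<close>

lemma u_bounded: "\<exists>M. \<forall>p. snd p \<le> T \<longrightarrow> \<bar>u p\<bar> \<le> M"
proof -
  have "bounded (u ` ST T)" using S0 by (simp add: S0tau_def S0_def)
  then obtain M where "\<forall>v\<in>u ` ST T. \<bar>v\<bar> \<le> M" unfolding bounded_real by blast
  then have M: "\<And>p. snd p < T \<Longrightarrow> \<bar>u p\<bar> \<le> M" by (auto simp: ST_def)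
  have "\<bar>u (y, T)\<bar> \<le> M" for y
  proof -
    have s: "(\<lambda>n. (y, T - 1 / real (Suc n))) \<longlonglongrightarrow> (y, T - 0)"
      using LIMSEQ_inverse_real_of_nat by (intro tendsto_intros) (simp add: inverse_eq_divide)
    have "((\<lambda>n. u (y, T - 1 / real (Suc n))) \<longlonglongrightarrow> u (y, T - 0))"
      by (rule continuous_on_tendsto_compose[OF u_cont s]) auto
    then have "(\<lambda>n. \<bar>u (y, T - 1 / real (Suc n))\<bar>) \<longlonglongrightarrow> \<bar>u (y, T)\<bar>" using tendsto_rabs by fastforce
    then show ?thesis by (rule LIMSEQ_le_const2) (auto intro!: M)
  qed
  then have "\<bar>u p\<bar> \<le> M" if "snd p \<le> T" for p using M[of p] that by (cases "snd p = T") (auto, metis prod.collapse)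
  then show ?thesis by blast
qed

definition Mu :: real where "Mu = (SOME M. \<forall>p. snd p \<le> T \<longrightarrow> \<bar>u p\<bar> \<le> M)"
text \<open>Zero extension makes the slices bounded Borel functions defined for all times. The time
  T is kept for \<open>u\<close>, which is continuous up to it, whereas \<open>f0\<close> is cut off
  to t < T.\<close>

definition u0 where "u0 p = indicator {p. snd p \<le> T} p * u p"
definition f0 where "f0 p = indicator (ST T) p * f p"

lemma Mu: "snd p \<le> T \<Longrightarrow> \<bar>u p\<bar> \<le> Mu"
  using someI_ex[OF u_bounded, folded Mu_def] by blast

lemma Mu_nonneg: "Mu \<ge> 0" using Mu[of "(0, T)"] by simp

lemma u0_le: "\<bar>u0 p\<bar> \<le> Mu" using Mu[of p] Mu_nonneg by (auto simp: u0_def indicator_def)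

lemma u0_eq: "s \<le> T \<Longrightarrow> u0 (y, s) = u (y, s)" by (simp add: u0_def)

lemma u0_borel: "u0 \<in> borel_measurable borel"
proof -
  have "closed {p::(real, 'n) vec \<times> real. snd p \<le> T}" by (intro closed_Collect_le continuous_intros)
  then show ?thesis
    using borel_measurable_continuous_on_indicator[OF _ u_cont] by (simp add: u0_def[abs_def])
qed

lemma f0_borel: "f0 \<in> borel_measurable borel"
  using Df by (simp add: inD_def set_borel_measurable_def f0_def[abs_def])

lemma f_bounded: "\<exists>M\<ge>0. \<forall>p. \<bar>f0 p\<bar> \<le> M"
proof -
  have "bounded (f ` ST T)" using Df by (simp add: inD_def)
  then obtain M where "\<forall>v\<in>f ` ST T. \<bar>v\<bar> \<le> M" unfolding bounded_real by blast
  then have M: "\<And>p. snd p < T \<Longrightarrow> \<bar>f p\<bar> \<le> M" by (auto simp: ST_def)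
  then show ?thesis by (intro exI[of _ "max 0 M"]) (auto simp: f0_def ST_def indicator_def le_max_iff_disj)
qed

definition Mf where "Mf = (SOME M. M \<ge> 0 \<and> (\<forall>p. \<bar>f0 p\<bar> \<le> M))"
lemma Mf: "Mf \<ge> 0" "\<bar>f0 p\<bar> \<le> Mf"
  using someI_ex[OF f_bounded, folded Mf_def] by blast+

lemma slc_cont:
  assumes \<eta>: "bumpy \<eta>" shows "continuous_on {..T} (\<lambda>s. slc u0 \<eta> t s x)"
  unfolding continuous_on_sequentially
proof (intro allI ballI impI, elim conjE)
  fix X s assume s: "s \<in> {..T}" and X: "\<forall>n. X n \<in> {..T}" "X \<longlonglongrightarrow> s"
  obtain C where C: "C \<ge> 0" "bdk 0 (\<lambda>x. C * expn x) \<eta>" using bumpy_bdk[OF \<eta>] by blast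
  have "(\<lambda>n. \<integral>z. u0 (E (X n - t) *v z, X n) * \<eta> (x - z) \<partial>lborel) \<longlonglongrightarrow> (\<integral>z. u0 (E (s - t) *v z, s) * \<eta> (x - z) \<partial>lborel)"
  proof (rule integral_dominated_convergence[where w = "\<lambda>z. Mu * (C * expn (x - z))"])
    show "integrable lborel (\<lambda>z. Mu * (C * expn (x - z)))"
      using integrable_expn by (subst integral_reflect(2)[of "\<lambda>y. Mu * (C * expn y)"]) auto
    have m: "(\<lambda>z. u0 (E (s - t) *v z, s) * \<eta> (x - z)) \<in> borel_measurable lborel" for s
      using borel_measurable_integrable[OF cv_integrable[OF slice_borel[OF u0_borel u0_le] u0_le C(2)]] .
    then show "(\<lambda>z. u0 (E (s - t) *v z, s) * \<eta> (x - z)) \<in> borel_measurable lborel"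
      "\<And>n. (\<lambda>z. u0 (E (X n - t) *v z, X n) * \<eta> (x - z)) \<in> borel_measurable lborel" by blast+
    show "AE z in lborel. norm (u0 (E (X n - t) *v z, X n) * \<eta> (x - z)) \<le> Mu * (C * expn (x - z))" for n
      unfolding real_norm_def abs_mult
      by (intro AE_I2 mult_mono u0_le bdk_le[OF C(2)]) (auto simp: Mu_nonneg)
    show "AE z in lborel. (\<lambda>n. u0 (E (X n - t) *v z, X n) * \<eta> (x - z)) \<longlonglongrightarrow> u0 (E (s - t) *v z, s) * \<eta> (x - z)"
    proof (intro AE_I2 tendsto_mult tendsto_const)
      fix z
      have c: "isCont (\<lambda>s. (E (s - t) *v z, s)) s"
      proof -
        have "continuous_on UNIV (\<lambda>s::real. (z, s))" by (intro continuous_intros)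
        from continuous_on_compose2[OF E_pair_cont'[of t] this]
        have "continuous_on UNIV (\<lambda>s. (E (s - t) *v z, s))" by (intro continuous_intros) auto
        then show ?thesis by (simp add: continuous_on_eq_continuous_at)
      qed
      have "(\<lambda>n. u (E (X n - t) *v z, X n)) \<longlonglongrightarrow> u (E (s - t) *v z, s)"
        by (rule continuous_on_tendsto_compose[OF u_cont isCont_tendsto_compose[OF c X(2)]]) (use s X in auto)
      then show "(\<lambda>n. u0 (E (X n - t) *v z, X n)) \<longlonglongrightarrow> u0 (E (s - t) *v z, s)"
        using s X(1) by (simp add: u0_eq)
    qed
  qed
  then show "((\<lambda>s. slc u0 \<eta> t s x) \<circ> X) \<longlonglongrightarrow> slc u0 \<eta> t s x" by (simp add: slc_def cv_def comp_def)
qed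

lemma Emat_bounded: "\<exists>C\<ge>0. \<forall>s\<in>{c..d}. \<forall>i j. \<bar>E (t - s) $ i $ j\<bar> \<le> C"
proof -
  have "\<exists>C. \<forall>s\<in>{c..d}. \<bar>E (t - s) $ i $ j\<bar> \<le> C" for i j
  proof -
    have "compact ((\<lambda>s. E (t - s) $ i $ j) ` {c..d})"
      by (intro compact_continuous_image continuous_on_compose2[OF Emat_continuous[of UNIV]] continuous_intros) auto
    then show ?thesis using compact_imp_bounded by (force simp: bounded_real)
  qed
  then obtain C where C: "\<And>i j s. s \<in> {c..d} \<Longrightarrow> \<bar>E (t - s) $ i $ j\<bar> \<le> C i j" by metis
  have "\<bar>E (t - s) $ i $ j\<bar> \<le> (\<Sum>i\<in>UNIV. \<Sum>j\<in>UNIV. \<bar>C i j\<bar>)" if "s \<in> {c..d}" for s i j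
  proof -
    have "\<bar>E (t - s) $ i $ j\<bar> \<le> \<bar>C i j\<bar>" using C[OF that, of i j] by linarith
    also have "\<dots> \<le> (\<Sum>j\<in>UNIV. \<bar>C i j\<bar>)" by (rule member_le_sum) auto
    also have "\<dots> \<le> (\<Sum>i\<in>UNIV. \<Sum>j\<in>UNIV. \<bar>C i j\<bar>)"
      by (rule member_le_sum[where f = "\<lambda>i. \<Sum>j\<in>UNIV. \<bar>C i j\<bar>"]) (auto intro: sum_nonneg)
    finally show ?thesis .
  qed
  then show ?thesis by (intro exI[of _ "\<Sum>i\<in>UNIV. \<Sum>j\<in>UNIV. \<bar>C i j\<bar>"]) (auto intro!: sum_nonneg)
qed

text \<open>Entries of E(t - s) A_0(s) E(t - s)^T, the diffusion matrix in the moving coordinates;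
  its rank is at most \<open>card F\<close>.\<close>

definition Amat :: "real \<Rightarrow> real \<Rightarrow> 'n \<Rightarrow> 'n \<Rightarrow> real" where
  "Amat t s l k = (\<Sum>i\<in>F. \<Sum>j\<in>F. a s i j * (E (t - s) $ k $ j * E (t - s) $ l $ i))"

lemma a_borel: "i \<in> F \<Longrightarrow> j \<in> F \<Longrightarrow> (\<lambda>s. a s i j) \<in> borel_measurable borel"
  and a_sym: "i \<in> F \<Longrightarrow> j \<in> F \<Longrightarrow> a s i j = a s j i"
  and a_bdd: "i \<in> F \<Longrightarrow> j \<in> F \<Longrightarrow> bounded (range (\<lambda>s. a s i j))"
  using ell by (auto simp: elliptic_def)

lemma a_bounded: "\<exists>C\<ge>0. \<forall>s. \<forall>i\<in>F. \<forall>j\<in>F. \<bar>a s i j\<bar> \<le> C"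
proof -
  have "\<forall>i j. \<exists>C. i \<in> F \<longrightarrow> j \<in> F \<longrightarrow> (\<forall>s. \<bar>a s i j\<bar> \<le> C)"
    using a_bdd by (fastforce simp: bounded_real)
  then obtain C where C: "\<And>i j s. i \<in> F \<Longrightarrow> j \<in> F \<Longrightarrow> \<bar>a s i j\<bar> \<le> C i j" by metis
  have "\<bar>a s i j\<bar> \<le> (\<Sum>i\<in>UNIV. \<Sum>j\<in>UNIV. \<bar>C i j\<bar>)" if "i \<in> F" "j \<in> F" for s i j
  proof -
    have "\<bar>a s i j\<bar> \<le> \<bar>C i j\<bar>" using C[OF that, of s] by linarith
    also have "\<dots> \<le> (\<Sum>j\<in>UNIV. \<bar>C i j\<bar>)" by (rule member_le_sum) auto
    also have "\<dots> \<le> (\<Sum>i\<in>UNIV. \<Sum>j\<in>UNIV. \<bar>C i j\<bar>)"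
      by (rule member_le_sum[where f = "\<lambda>i. \<Sum>j\<in>UNIV. \<bar>C i j\<bar>"]) (auto intro: sum_nonneg)
    finally show ?thesis .
  qed
  then show ?thesis by (intro exI[of _ "\<Sum>i\<in>UNIV. \<Sum>j\<in>UNIV. \<bar>C i j\<bar>"]) (auto intro!: sum_nonneg)
qed

lemma Emat_borel2: "(\<lambda>s. E (t - s) $ i $ j) \<in> borel_measurable borel"
  by (intro borel_measurable_continuous_onI continuous_on_compose2[OF Emat_continuous[of UNIV]] continuous_intros) auto

lemma Amat_borel: "(\<lambda>s. Amat t s l k) \<in> borel_measurable borel"
  unfolding Amat_def using a_borel Emat_borel2 by (intro borel_measurable_sum borel_measurable_times) auto

text \<open>The weak equations are tested with \<open>ptst \<theta> \<eta> t x\<close>. As \<theta>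
  is arbitrary, each second derivative equation becomes an identity of slices for almost every s,
  and the drift equation becomes a weak ODE in s, which \<open>du_bois_reymond\<close>
  integrates.\<close>

lemma integrated_equation:
  assumes \<eta>: "bumpy \<eta>" and ab: "a0 < b0" "b0 < T"
  shows "slc u0 \<eta> t b0 x - slc u0 \<eta> t a0 x = (\<integral>s. indicator {a0..b0} s *
    ((\<Sum>k\<in>UNIV. \<Sum>l\<in>UNIV. Amat t s l k * slc u0 (dd (axis l 1) (dd (axis k 1) \<eta>)) t s x) - slc f0 \<eta> t s x) \<partial>lborel)"
proof -
  obtain g h where g: "\<And>i j. i \<in> F \<Longrightarrow> j \<in> F \<Longrightarrow> weak_dxx (ST T) u i j (g i j)" and h: "weak_Y B (ST T) u h"
    and fgh: "AE p in lborel. p \<in> ST T \<longrightarrow> f p = (\<Sum>i\<in>F. \<Sum>j\<in>F. a (snd p) i j * g i j p) + h p"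
    using Lu by (auto simp: is_Lu_def)
  have s\<eta>: "smooth \<eta>" using \<eta> by (simp add: bumpy_def)
  define P where "P i j C \<longleftrightarrow> C \<ge> 0 \<and> trunc C (g i j) (ST T) \<in> borel_measurable borel \<and> (\<forall>p. \<bar>trunc C (g i j) (ST T) p\<bar> \<le> C) \<and>
      (AE p in lborel. p \<in> ST T \<longrightarrow> trunc C (g i j) (ST T) p = g i j p)" for i j C
  define Cg where "Cg i j = (SOME C. P i j C)" for i j
  have "P i j (Cg i j)" if "i \<in> F" "j \<in> F" for i j
  proof -
    have "Linf (ST T) (g i j)" using g[OF that] by (simp add: weak_dxx_def)
    from Linf_trunc[OF this] have "\<exists>C. P i j C" unfolding P_def .
    then show ?thesis unfolding Cg_def by (rule someI_ex)
  qed
  then have Cg: "Cg i j \<ge> 0" "trunc (Cg i j) (g i j) (ST T) \<in> borel_measurable borel"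
      "\<bar>trunc (Cg i j) (g i j) (ST T) p\<bar> \<le> Cg i j" "AE p in lborel. p \<in> ST T \<longrightarrow> trunc (Cg i j) (g i j) (ST T) p = g i j p"
    if "i \<in> F" "j \<in> F" for i j p using that unfolding P_def by blast+
  define G where "G i j = trunc (Cg i j) (g i j) (ST T)" for i j
  have G: "G i j \<in> borel_measurable borel" "\<bar>G i j p\<bar> \<le> Cg i j" "AE p in lborel. p \<in> ST T \<longrightarrow> G i j p = g i j p"
    if "i \<in> F" "j \<in> F" for i j p using Cg[OF that] by (auto simp: G_def)
  obtain Ca where Ca: "Ca \<ge> 0" "\<And>s i j. i \<in> F \<Longrightarrow> j \<in> F \<Longrightarrow> \<bar>a s i j\<bar> \<le> Ca" using a_bounded by blast
  obtain C\<eta> where C\<eta>: "C\<eta> \<ge> 0" "bdk 2 (\<lambda>x. C\<eta> * expn x) \<eta>" using bumpy_bdk[OF \<eta>] by blast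
  define I where "I = (\<integral>z. expn (z::(real, 'n) vec) \<partial>lborel)"
  have I: "I \<ge> 0" unfolding I_def by (rule Bochner_Integration.integral_nonneg) simp
  define d2 where "d2 k l = dd (axis l 1) (dd (axis k 1) \<eta>)" for k l
  have d2: "bumpy (d2 k l)" for k l unfolding d2_def by (intro bumpy_dd \<eta>)
  have d2b: "bdk 0 (\<lambda>x. C\<eta> * expn x) (d2 k l)" for k l
    using C\<eta>(2) by (simp add: d2_def numeral_2_eq_2)
  have bumpy_eta: "bdk 0 (\<lambda>x. C\<eta> * expn x) \<eta>" by (rule bdk_antimono[OF C\<eta>(2)]) simp
  have bor: "\<eta> \<in> borel_measurable borel" "d2 k l \<in> borel_measurable borel" for k l
    using \<eta> d2 by (auto simp: bumpy_def smooth_borel)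
  note sb = slc_borel(1)[OF u0_borel bor(1)] slc_borel(1)[OF u0_borel bor(2)] slc_borel(1)[OF f0_borel bor(1)]
  have \<theta>_zero: "\<theta>' s = 0" if "\<And>s. (\<theta> has_real_derivative \<theta>' s) (at s)" "\<And>s. s \<notin> {c..d} \<Longrightarrow> \<theta> s = 0" "s \<notin> {c..d}" for \<theta> \<theta>' :: "real \<Rightarrow> real" and s c d
  proof -
    have "(\<theta> has_real_derivative 0) (at s)"
      by (rule has_field_derivative_transform_within_open[of "\<lambda>_. 0" _ _ "- {c..d}"]) (use that in auto)
    then show ?thesis using that(1) DERIV_unique by blast
  qed
  have \<theta>_bd: "\<exists>C. \<forall>s. \<bar>\<theta> s\<bar> \<le> C" if sm: "smooth \<theta>" and z: "\<And>s. s \<notin> {c..d} \<Longrightarrow> \<theta> s = 0" for \<theta> :: "real \<Rightarrow> real" and c d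
  proof -
    have "\<theta> s = 0" if "norm s > \<bar>c\<bar> + \<bar>d\<bar>" for s by (rule z) (use that in auto)
    then have "bumpy \<theta>" unfolding bumpy_def using sm by blast
    then obtain C where C: "C \<ge> 0" "bdk 0 (\<lambda>x. C * expn x) \<theta>" using bumpy_bdk by blast
    have "\<bar>\<theta> s\<bar> \<le> C" for s using bdk_le[OF C(2), of s] C(1) mult_left_mono[of "expn s" 1 C] by simp
    then show ?thesis by blast
  qed
  \<comment> \<open>The discrepancy between the slice of the weak derivative and the derivatives of
    the slice, to be shown to vanish almost everywhere; \<open>H\<close> then collects the
    right-hand side of the weak ODE.\<close>
  define D where "D i j s = slc (G i j) \<eta> t s x - (\<Sum>k\<in>UNIV. \<Sum>l\<in>UNIV. (E (t - s) $ k $ j * E (t - s) $ l $ i) * slc u0 (d2 k l) t s x)" for i j s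
  define H where "H s = slc f0 \<eta> t s x - (\<Sum>i\<in>F. \<Sum>j\<in>F. a s i j * slc (G i j) \<eta> t s x)" for s
  have Db: "D i j \<in> borel_measurable borel" if "i \<in> F" "j \<in> F" for i j
    unfolding D_def[abs_def] using slc_borel(1)[OF G(1)[OF that] bor(1)] sb Emat_borel2
    by (intro borel_measurable_diff borel_measurable_sum borel_measurable_times) auto
  have Dbd: "\<exists>C. \<forall>s\<in>{c..d}. \<bar>D i j s\<bar> \<le> C" if ij: "i \<in> F" "j \<in> F" for i j c d
  proof -
    obtain CE where CE: "CE \<ge> 0" "\<And>s i j. s \<in> {c..d} \<Longrightarrow> \<bar>E (t - s) $ i $ j\<bar> \<le> CE" using Emat_bounded by blast
    have "\<bar>D i j s\<bar> \<le> C\<eta> * Cg i j * I + (\<Sum>k\<in>(UNIV::'n set). \<Sum>l\<in>(UNIV::'n set). (CE * CE) * (C\<eta> * Mu * I))" if s: "s \<in> {c..d}" for s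
    proof -
      have "\<bar>slc (G i j) \<eta> t s x\<bar> \<le> C\<eta> * Cg i j * I"
        unfolding I_def by (rule slc_le[OF G(1,2)[OF ij] bumpy_eta])
      moreover have "\<bar>\<Sum>k\<in>UNIV. \<Sum>l\<in>UNIV. (E (t - s) $ k $ j * E (t - s) $ l $ i) * slc u0 (d2 k l) t s x\<bar>
          \<le> (\<Sum>k\<in>(UNIV::'n set). \<Sum>l\<in>(UNIV::'n set). (CE * CE) * (C\<eta> * Mu * I))"
      proof (rule order_trans[OF sum_abs], rule sum_mono, rule order_trans[OF sum_abs], rule sum_mono)
        fix k l
        have "\<bar>slc u0 (d2 k l) t s x\<bar> \<le> C\<eta> * Mu * I" unfolding I_def by (rule slc_le[OF u0_borel u0_le d2b])
        then show "\<bar>(E (t - s) $ k $ j * E (t - s) $ l $ i) * slc u0 (d2 k l) t s x\<bar> \<le> (CE * CE) * (C\<eta> * Mu * I)"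
          unfolding abs_mult using CE s by (intro mult_mono) auto
      qed
      ultimately show ?thesis unfolding D_def by linarith
    qed
    then show ?thesis by blast
  qed
  have Dz: "AE s in lborel. s \<in> {a0..b0} \<longrightarrow> D i j s = 0" if ij: "i \<in> F" "j \<in> F" for i j
  proof -
    have int0: "(\<integral>s. indicator {a1..b1} s * D i j s \<partial>lborel) = 0" if ab1: "a1 < b1" "b1 < T" for a1 b1
    proof -
      obtain C where C: "\<And>s. s \<in> {a1 - 1..b1 + 1} \<Longrightarrow> \<bar>D i j s\<bar> \<le> C" using Dbd[OF ij] by blast
      \<comment> \<open>The case w = 0 of \<open>du_bois_reymond\<close>: the integral of \<theta> D
        vanishes for every \<theta>, hence so does every interval integral of
        \<open>D\<close>.\<close>
      have "(0::real) - 0 = - (\<integral>s. indicator {a1..b1} s * D i j s \<partial>lborel)"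
      proof (rule du_bois_reymond[where w = "\<lambda>_. 0" and C = 0 and T = T, OF _ _ _ Db[OF ij] C _ ab1])
        fix \<theta> \<theta>' :: "real \<Rightarrow> real" and c d
        assume \<theta>: "smooth \<theta>" "\<And>s. (\<theta> has_real_derivative \<theta>' s) (at s)" "d < T" "\<And>s. s \<notin> {c..d} \<Longrightarrow> \<theta> s = 0"
        let ?\<phi> = "ptst \<theta> \<eta> t x"
        obtain C0 where C0: "\<And>s. \<bar>\<theta> s\<bar> \<le> C0" using \<theta>_bd[OF \<theta>(1,4)] by blast
        have C0': "C0 \<ge> 0" using C0[of 0] by linarith
        obtain CE where CE: "CE \<ge> 0" "\<And>s i j. s \<in> {c..d} \<Longrightarrow> \<bar>E (t - s) $ i $ j\<bar> \<le> CE" using Emat_bounded by blast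
        note \<theta>b = smooth_borel[OF \<theta>(1)]
        have out: "ptst \<theta> \<eta>' t x p = 0" if "p \<notin> ST T" for \<eta>' p
          using that \<theta>(3) \<theta>(4)[of "snd p"] by (auto simp: ptst_def ST_def)
        have \<phi>b: "?\<phi> \<in> borel_measurable borel"
          using ptst_test[OF \<theta>(1,4,3) \<eta>, where t = t and x = x] by (auto simp: test_fun_def smooth_def[symmetric] intro: smooth_borel)
        have id: "(LINT p:ST T|lborel. u p * dd (xdir i) (dd (xdir j) ?\<phi>) p) = (LINT p:ST T|lborel. g i j p * ?\<phi> p)"
          using g[OF ij] ptst_test[OF \<theta>(1,4,3) \<eta>] by (auto simp: weak_dxx_def)
        let ?\<theta> = "\<lambda>k l s. \<theta> s * (E (t - s) $ k $ j * E (t - s) $ l $ i)"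
        have \<theta>kl: "?\<theta> k l \<in> borel_measurable borel" "\<bar>?\<theta> k l s\<bar> \<le> C0 * (CE * CE)" "s \<notin> {c..d} \<Longrightarrow> ?\<theta> k l s = 0" for k l s
        proof -
          show "?\<theta> k l \<in> borel_measurable borel" using \<theta>b Emat_borel2 by (intro borel_measurable_times) auto
          show "s \<notin> {c..d} \<Longrightarrow> ?\<theta> k l s = 0" using \<theta>(4) by simp
          show "\<bar>?\<theta> k l s\<bar> \<le> C0 * (CE * CE)"
          proof (cases "s \<in> {c..d}")
            case True then show ?thesis unfolding abs_mult using C0 CE C0' by (intro mult_mono) auto
          next
            case False then show ?thesis using \<theta>(4) C0' CE(1) by simp
          qed
        qed
        note sl = slice_integral[OF u0_borel u0_le \<theta>kl d2]
        have "(LINT p:ST T|lborel. u p * dd (xdir i) (dd (xdir j) ?\<phi>) p) = (\<integral>p. (\<Sum>k\<in>UNIV. \<Sum>l\<in>UNIV. u0 p * ptst (?\<theta> k l) (d2 k l) t x p) \<partial>lborel)"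
          unfolding set_lebesgue_integral_def
        proof (rule Bochner_Integration.integral_cong[OF refl])
          fix p :: "(real, 'n) vec \<times> real"
          have "ptst (?\<theta> k l) (d2 k l) t x p = 0" if "p \<notin> ST T" for k l
            using that \<theta>(3) \<theta>(4)[of "snd p"] by (auto simp: ptst_def ST_def)
          then show "indicator (ST T) p *\<^sub>R (u p * dd (xdir i) (dd (xdir j) ?\<phi>) p) = (\<Sum>k\<in>UNIV. \<Sum>l\<in>UNIV. u0 p * ptst (?\<theta> k l) (d2 k l) t x p)"
            unfolding dd_xdir2_ptst[OF s\<eta>] d2_def[symmetric]
            by (cases "p \<in> ST T") (auto simp: u0_def ST_def sum_distrib_left)
        qed
        also have "\<dots> = (\<integral>s. (\<Sum>k\<in>UNIV. \<Sum>l\<in>UNIV. ?\<theta> k l s * slc u0 (d2 k l) t s x) \<partial>lborel)"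
          using sl by simp
        finally have lhs: "(LINT p:ST T|lborel. u p * dd (xdir i) (dd (xdir j) ?\<phi>) p) = (\<integral>s. (\<Sum>k\<in>UNIV. \<Sum>l\<in>UNIV. ?\<theta> k l s * slc u0 (d2 k l) t s x) \<partial>lborel)" .
        note slG = slice_integral[OF G(1,2)[OF ij] \<theta>b C0 \<theta>(4) \<eta>, where x = x and t = t]
        have rhs: "(LINT p:ST T|lborel. g i j p * ?\<phi> p) = (\<integral>p. G i j p * ?\<phi> p \<partial>lborel)"
          unfolding set_lebesgue_integral_def
        proof (rule integral_cong_AE)
          have "(\<lambda>p. indicator (ST T) p * g i j p) \<in> borel_measurable lborel"
            using g[OF ij] by (simp add: weak_dxx_def Linf_def set_borel_measurable_def)
          then have "(\<lambda>p. (indicator (ST T) p * g i j p) * ?\<phi> p) \<in> borel_measurable lborel"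
            by (rule borel_measurable_times) (use \<phi>b in simp)
          then show "(\<lambda>p. indicator (ST T) p *\<^sub>R (g i j p * ?\<phi> p)) \<in> borel_measurable lborel" by (simp add: mult.assoc)
          show "(\<lambda>p. G i j p * ?\<phi> p) \<in> borel_measurable lborel" using slG(1) by auto
          show "AE p in lborel. indicator (ST T) p *\<^sub>R (g i j p * ?\<phi> p) = G i j p * ?\<phi> p"
            using G(3)[OF ij] by eventually_elim (use out in \<open>auto simp: indicator_def\<close>)
        qed
        have "(\<integral>s. \<theta> s * D i j s \<partial>lborel) = (\<integral>s. \<theta> s * slc (G i j) \<eta> t s x - (\<Sum>k\<in>UNIV. \<Sum>l\<in>UNIV. ?\<theta> k l s * slc u0 (d2 k l) t s x) \<partial>lborel)"
          by (simp add: D_def right_diff_distrib sum_distrib_left mult.assoc)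
        also have "\<dots> = (\<integral>s. \<theta> s * slc (G i j) \<eta> t s x \<partial>lborel) - (\<integral>s. (\<Sum>k\<in>UNIV. \<Sum>l\<in>UNIV. ?\<theta> k l s * slc u0 (d2 k l) t s x) \<partial>lborel)"
          using sl(3) slG(3) by (intro Bochner_Integration.integral_diff Bochner_Integration.integrable_sum) auto
        finally show "(\<integral>s. \<theta>' s * 0 \<partial>lborel) = (\<integral>s. \<theta> s * D i j s \<partial>lborel)"
          using id lhs rhs slG(2) by simp
      qed auto
      then show ?thesis by simp
    qed
    obtain C where C: "\<And>s. s \<in> {a0..b0} \<Longrightarrow> \<bar>D i j s\<bar> \<le> C" using Dbd[OF ij] by blast
    show ?thesis by (rule AE_zero_from_intervals[OF Db[OF ij] C int0 ab])
  qed
  have w: "\<bar>slc u0 \<eta> t s x\<bar> \<le> C\<eta> * Mu * I" for s unfolding I_def by (rule slc_le[OF u0_borel u0_le bumpy_eta])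
  have aG: "\<bar>a s i j * slc (G i j) \<eta> t s x\<bar> \<le> Ca * (C\<eta> * Cg i j * I)" if "i \<in> F" "j \<in> F" for i j s
    unfolding abs_mult I_def using Ca that slc_le[OF G(1,2)[OF that] bumpy_eta] by (intro mult_mono) auto
  have Hb: "H \<in> borel_measurable borel"
    unfolding H_def[abs_def] using sb(3) a_borel slc_borel(1)[OF G(1) bor(1)]
    by (intro borel_measurable_diff borel_measurable_sum borel_measurable_times) auto
  have Hbd: "\<bar>H s\<bar> \<le> C\<eta> * Mf * I + (\<Sum>i\<in>F. \<Sum>j\<in>F. Ca * (C\<eta> * Cg i j * I))" for s
  proof -
    have "\<bar>slc f0 \<eta> t s x\<bar> \<le> C\<eta> * Mf * I" unfolding I_def by (rule slc_le[OF f0_borel Mf(2) bumpy_eta])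
    moreover have "\<bar>\<Sum>i\<in>F. \<Sum>j\<in>F. a s i j * slc (G i j) \<eta> t s x\<bar> \<le> (\<Sum>i\<in>F. \<Sum>j\<in>F. Ca * (C\<eta> * Cg i j * I))"
      by (rule order_trans[OF sum_abs], rule sum_mono, rule order_trans[OF sum_abs], rule sum_mono) (rule aG)
    ultimately show ?thesis unfolding H_def by linarith
  qed
  have "slc u0 \<eta> t b0 x - slc u0 \<eta> t a0 x = - (\<integral>s. indicator {a0..b0} s * H s \<partial>lborel)"
  proof (rule du_bois_reymond[OF sb(1) w continuous_on_subset[OF slc_cont[OF \<eta>]] Hb Hbd _ ab])
    fix \<theta> \<theta>' :: "real \<Rightarrow> real" and c d
    assume \<theta>: "smooth \<theta>" "\<And>s. (\<theta> has_real_derivative \<theta>' s) (at s)" "d < T" "\<And>s. s \<notin> {c..d} \<Longrightarrow> \<theta> s = 0"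
    let ?\<phi> = "ptst \<theta> \<eta> t x"
    have e': "\<theta>' = dd 1 \<theta>" using dd_eq[OF \<theta>(2)[unfolded has_field_derivative_def]] by (auto simp: fun_eq_iff)
    have s': "smooth \<theta>'" unfolding e' by (rule smooth_dd[OF \<theta>(1)])
    have z': "\<theta>' s = 0" if "s \<notin> {c..d}" for s by (rule \<theta>_zero[OF \<theta>(2,4) that])
    obtain C0 where C0: "\<And>s. \<bar>\<theta> s\<bar> \<le> C0" using \<theta>_bd[OF \<theta>(1,4)] by blast
    obtain C1 where C1: "\<And>s. \<bar>\<theta>' s\<bar> \<le> C1" using \<theta>_bd[OF s' z'] by blast
    have tf: "test_fun (ST T) ?\<phi>" by (rule ptst_test[OF \<theta>(1,4,3) \<eta>])
    have \<phi>b: "?\<phi> \<in> borel_measurable borel"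
      using tf by (auto simp: test_fun_def smooth_def[symmetric] intro: smooth_borel)
    have out: "p \<notin> ST T \<Longrightarrow> ptst \<theta> \<eta>' t x p = 0" "p \<notin> ST T \<Longrightarrow> ptst \<theta>' \<eta>' t x p = 0" for \<eta>' p
      using \<theta>(3) \<theta>(4)[of "snd p"] z'[of "snd p"] by (auto simp: ptst_def ST_def)
    have hw: "Linf (ST T) h" using h by (simp add: weak_Y_def)
    have id: "(LINT p:ST T|lborel. u p * ptst \<theta>' \<eta> t x p) = (LINT p:ST T|lborel. h p * ?\<phi> p)"
      using h tf unfolding weak_Y_def drift_ptst[OF s\<eta> \<theta>(2), symmetric] by blast
    note slu = slice_integral[OF u0_borel u0_le smooth_borel[OF s'] C1 z' \<eta>, where x = x and t = t]
    note slf = slice_integral[OF f0_borel Mf(2) smooth_borel[OF \<theta>(1)] C0 \<theta>(4) \<eta>, where x = x and t = t]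
    have "(LINT p:ST T|lborel. u p * ptst \<theta>' \<eta> t x p) = (\<integral>p. u0 p * ptst \<theta>' \<eta> t x p \<partial>lborel)"
      unfolding set_lebesgue_integral_def
      by (rule Bochner_Integration.integral_cong[OF refl]) (use out(2) in \<open>auto simp: u0_def ST_def indicator_def\<close>)
    then have lhs: "(LINT p:ST T|lborel. u p * ptst \<theta>' \<eta> t x p) = (\<integral>s. \<theta>' s * slc u0 \<eta> t s x \<partial>lborel)"
      using slu(2) by simp
    have C0n: "C0 \<ge> 0" using C0[of 0] by linarith
    let ?\<theta> = "\<lambda>i j s. \<theta> s * a s i j"
    have slg: "integrable lborel (\<lambda>p. G i j p * ptst (?\<theta> i j) \<eta> t x p)"
      "(\<integral>p. G i j p * ptst (?\<theta> i j) \<eta> t x p \<partial>lborel) = (\<integral>s. ?\<theta> i j s * slc (G i j) \<eta> t s x \<partial>lborel)"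
      "integrable lborel (\<lambda>s. ?\<theta> i j s * slc (G i j) \<eta> t s x)" if ij: "i \<in> F" "j \<in> F" for i j
    proof -
      have "\<bar>?\<theta> i j s\<bar> \<le> C0 * Ca" for s unfolding abs_mult using C0 Ca ij C0n by (intro mult_mono) auto
      moreover have "?\<theta> i j \<in> borel_measurable borel" using smooth_borel[OF \<theta>(1)] a_borel[OF ij] by (intro borel_measurable_times)
      moreover have "s \<notin> {c..d} \<Longrightarrow> ?\<theta> i j s = 0" for s using \<theta>(4) by simp
      ultimately show "integrable lborel (\<lambda>p. G i j p * ptst (?\<theta> i j) \<eta> t x p)"
      "(\<integral>p. G i j p * ptst (?\<theta> i j) \<eta> t x p \<partial>lborel) = (\<integral>s. ?\<theta> i j s * slc (G i j) \<eta> t s x \<partial>lborel)"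
      "integrable lborel (\<lambda>s. ?\<theta> i j s * slc (G i j) \<eta> t s x)"
        using slice_integral[OF G(1,2)[OF ij] _ _ _ \<eta>, of "?\<theta> i j" "C0 * Ca" c d] by blast+
    qed
    have AEG: "AE p in lborel. \<forall>i\<in>F. \<forall>j\<in>F. p \<in> ST T \<longrightarrow> G i j p = g i j p"
      using G(3) by (intro AE_finite_allI) auto
    have "(LINT p:ST T|lborel. h p * ?\<phi> p) = (\<integral>p. f0 p * ?\<phi> p - (\<Sum>i\<in>F. \<Sum>j\<in>F. G i j p * ptst (?\<theta> i j) \<eta> t x p) \<partial>lborel)"
      unfolding set_lebesgue_integral_def
    proof (rule integral_cong_AE)
      have "(\<lambda>p. indicator (ST T) p * h p) \<in> borel_measurable lborel"
        using hw by (simp add: Linf_def set_borel_measurable_def)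
      then have "(\<lambda>p. (indicator (ST T) p * h p) * ?\<phi> p) \<in> borel_measurable lborel"
        by (rule borel_measurable_times) (use \<phi>b in simp)
      then show "(\<lambda>p. indicator (ST T) p *\<^sub>R (h p * ?\<phi> p)) \<in> borel_measurable lborel" by (simp add: mult.assoc)
      show "(\<lambda>p. f0 p * ?\<phi> p - (\<Sum>i\<in>F. \<Sum>j\<in>F. G i j p * ptst (?\<theta> i j) \<eta> t x p)) \<in> borel_measurable lborel"
        using slf(1) slg(1) by (intro borel_measurable_diff borel_measurable_sum) auto
      show "AE p in lborel. indicator (ST T) p *\<^sub>R (h p * ?\<phi> p) = f0 p * ?\<phi> p - (\<Sum>i\<in>F. \<Sum>j\<in>F. G i j p * ptst (?\<theta> i j) \<eta> t x p)"
        using fgh AEG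
      proof eventually_elim
        case (elim p)
        show ?case
        proof (cases "p \<in> ST T")
          case True
          have "(\<Sum>i\<in>F. \<Sum>j\<in>F. G i j p * ptst (?\<theta> i j) \<eta> t x p) = (\<Sum>i\<in>F. \<Sum>j\<in>F. a (snd p) i j * g i j p) * ?\<phi> p"
            unfolding sum_distrib_right
            by (rule sum.cong[OF refl], rule sum.cong[OF refl]) (use elim True in \<open>simp add: ptst_def mult_ac\<close>)
          moreover have "f0 p = f p" using True by (simp add: f0_def)
          ultimately show ?thesis using elim True by (simp add: algebra_simps)
        next
          case False
          have "ptst (?\<theta> i j) \<eta> t x p = 0" for i j using False \<theta>(3) \<theta>(4)[of "snd p"] by (auto simp: ptst_def ST_def)
          then show ?thesis using False by (simp add: f0_def)
        qed
      qed
    qed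
    also have "\<dots> = (\<integral>p. f0 p * ?\<phi> p \<partial>lborel) - (\<integral>p. (\<Sum>i\<in>F. \<Sum>j\<in>F. G i j p * ptst (?\<theta> i j) \<eta> t x p) \<partial>lborel)"
      using slf(1) slg(1) by (intro Bochner_Integration.integral_diff Bochner_Integration.integrable_sum) auto
    also have "(\<integral>p. (\<Sum>i\<in>F. \<Sum>j\<in>F. G i j p * ptst (?\<theta> i j) \<eta> t x p) \<partial>lborel) = (\<integral>s. (\<Sum>i\<in>F. \<Sum>j\<in>F. ?\<theta> i j s * slc (G i j) \<eta> t s x) \<partial>lborel)"
      using slg by (simp add: Bochner_Integration.integral_sum)
    also have "(\<integral>p. f0 p * ?\<phi> p \<partial>lborel) = (\<integral>s. \<theta> s * slc f0 \<eta> t s x \<partial>lborel)" by (rule slf(2))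
    also have "(\<integral>s. \<theta> s * slc f0 \<eta> t s x \<partial>lborel) - (\<integral>s. (\<Sum>i\<in>F. \<Sum>j\<in>F. ?\<theta> i j s * slc (G i j) \<eta> t s x) \<partial>lborel)
      = (\<integral>s. \<theta> s * slc f0 \<eta> t s x - (\<Sum>i\<in>F. \<Sum>j\<in>F. ?\<theta> i j s * slc (G i j) \<eta> t s x) \<partial>lborel)"
      using slf(3) slg(3) by (intro Bochner_Integration.integral_diff[symmetric] Bochner_Integration.integrable_sum) auto
    also have "\<dots> = (\<integral>s. \<theta> s * H s \<partial>lborel)"
      by (simp add: H_def right_diff_distrib sum_distrib_left mult.assoc)
    finally show "(\<integral>s. \<theta>' s * slc u0 \<eta> t s x \<partial>lborel) = (\<integral>s. \<theta> s * H s \<partial>lborel)" using id lhs by simp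
  qed auto
  also have "\<dots> = (\<integral>s. - (indicator {a0..b0} s * H s) \<partial>lborel)" by simp
  also have "\<dots> = (\<integral>s. indicator {a0..b0} s *
    ((\<Sum>k\<in>UNIV. \<Sum>l\<in>UNIV. Amat t s l k * slc u0 (dd (axis l 1) (dd (axis k 1) \<eta>)) t s x) - slc f0 \<eta> t s x) \<partial>lborel)"
  proof (rule integral_cong_AE)
    have "AE s in lborel. \<forall>i\<in>F. \<forall>j\<in>F. s \<in> {a0..b0} \<longrightarrow> D i j s = 0"
      using Dz by (intro AE_finite_allI) auto
    then show "AE s in lborel. - (indicator {a0..b0} s * H s) = indicator {a0..b0} s *
      ((\<Sum>k\<in>UNIV. \<Sum>l\<in>UNIV. Amat t s l k * slc u0 (dd (axis l 1) (dd (axis k 1) \<eta>)) t s x) - slc f0 \<eta> t s x)"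
    proof eventually_elim
      case (elim s)
      show ?case
      proof (cases "s \<in> {a0..b0}")
        case True
        let ?V = "\<lambda>k l. slc u0 (d2 k l) t s x"
        have "(\<Sum>i\<in>F. \<Sum>j\<in>F. a s i j * slc (G i j) \<eta> t s x) = (\<Sum>i\<in>F. \<Sum>j\<in>F. \<Sum>k\<in>UNIV. \<Sum>l\<in>UNIV. a s i j * (E (t - s) $ k $ j * E (t - s) $ l $ i) * ?V k l)"
        proof (intro sum.cong refl)
          fix i j assume "i \<in> F" "j \<in> F"
          then have "D i j s = 0" using elim True by blast
          then show "a s i j * slc (G i j) \<eta> t s x = (\<Sum>k\<in>UNIV. \<Sum>l\<in>UNIV. a s i j * (E (t - s) $ k $ j * E (t - s) $ l $ i) * ?V k l)"
            by (simp add: D_def sum_distrib_left mult.assoc)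
        qed
        also have "\<dots> = (\<Sum>k\<in>UNIV. \<Sum>l\<in>UNIV. Amat t s l k * ?V k l)"
          unfolding Amat_def sum_distrib_right by (rule sum_swap4)
        finally show ?thesis using True by (simp add: H_def d2_def)
      qed simp
    qed
  qed (use Hb sb Amat_borel in \<open>auto simp: d2_def[symmetric] intro!: borel_measurable_times borel_measurable_diff borel_measurable_sum borel_measurable_uminus\<close>)
  finally show ?thesis .
qed

end

section \<open>The maximum principle\<close>

text \<open>With M = sum of r_m r_m^T, the quantity G + M : D^2 G agrees up to third order with the
  mean of \<open>G\<close> over the points x + h m and x - h m, and a mean is bounded by the
  supremum. This takes the place of an argument at a maximum point, which need not exist on the
  whole space.\<close>

lemma psd_shift_bound:
  fixes G :: "real^'n \<Rightarrow> real" and \<tau> :: real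
  assumes G: "bdk 3 (\<lambda>_. C) G" and S: "\<And>x. \<bar>G x\<bar> \<le> S"
    and sym: "\<And>k l. M k l = M l k" and psd: "\<And>\<xi>. 0 \<le> (\<Sum>k\<in>UNIV. \<Sum>l\<in>UNIV. \<xi> k * \<xi> l * M k l)"
    and tr: "(\<Sum>k\<in>UNIV. M k k) \<le> \<tau>"
  shows "\<bar>G x + (\<Sum>k\<in>UNIV. \<Sum>l\<in>UNIV. M k l * dd (axis k 1) (dd (axis l 1) G) x)\<bar> \<le> S + C * (sqrt (2 * real CARD('n) * \<tau>)) ^ 3"
proof -
  let ?N = "real CARD('n)"
  have N: "?N > 0" by simp
  have C: "C \<ge> 0" using bdk_le[OF G, of 0] by simp
  have G2: "bdk (Suc (Suc 0)) (\<lambda>_. C) G" using bdk_antimono[OF G, of 2] by (simp add: numeral_2_eq_2 del: bdk.simps)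
  have d: "G differentiable (at y)" "dd v G differentiable (at y)" for v y
    using G2 bdk_dd[OF G2, of v] by auto
  have "\<exists>r. \<forall>k l. M k l = (\<Sum>m\<in>(UNIV::'n set). r m k * r m l)"
    by (rule psd_decomposition) (use sym psd in auto)
  then obtain r :: "'n \<Rightarrow> 'n \<Rightarrow> real" where r: "\<And>k l. M k l = (\<Sum>m\<in>UNIV. r m k * r m l)" by blast
  \<comment> \<open>The factor sqrt (2 N) compensates for averaging over 2 N points.\<close>
  define h where "h m = sqrt (2 * ?N) *\<^sub>R (\<chi> k. r m k)" for m
  have hn: "norm (h m) \<le> sqrt (2 * ?N * \<tau>)" for m
  proof -
    have "(norm (\<chi> k. r m k))\<^sup>2 = (\<Sum>k\<in>UNIV. r m k * r m k)"
      by (simp add: dot_square_norm[symmetric] inner_vec_def)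
    also have "\<dots> \<le> (\<Sum>m\<in>UNIV. \<Sum>k\<in>UNIV. r m k * r m k)"
      by (rule member_le_sum[where f = "\<lambda>m. \<Sum>k\<in>UNIV. r m k * r m k"]) (auto intro: sum_nonneg)
    also have "\<dots> = (\<Sum>k\<in>UNIV. M k k)" unfolding r by (rule sum.swap)
    finally have "(norm (\<chi> k. r m k))\<^sup>2 \<le> \<tau>" using tr by linarith
    then have "2 * ?N * (norm (\<chi> k. r m k))\<^sup>2 \<le> 2 * ?N * \<tau>" by (intro mult_left_mono) auto
    then show ?thesis unfolding h_def by (intro real_le_rsqrt) (simp add: power_mult_distrib)
  qed
  have ddh: "dd h (dd h G) x = (\<Sum>k\<in>UNIV. \<Sum>l\<in>UNIV. h $ k * h $ l * dd (axis k 1) (dd (axis l 1) G) x)" for h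
  proof -
    have "dd h G = (\<lambda>x. \<Sum>l\<in>UNIV. h $ l * dd (axis l 1) G x)" by (rule ext) (rule dd_axis_sum[OF d(1)])
    then have "dd e (dd h G) x = (\<Sum>l\<in>UNIV. h $ l * dd e (dd (axis l 1) G) x)" for e
      using d(2) by (simp add: dd_sum)
    then show ?thesis by (subst dd_axis_sum[OF d(2)]) (simp add: sum_distrib_left mult_ac)
  qed
  have e: "(\<Sum>m\<in>UNIV. dd (h m) (dd (h m) G) x) = 2 * ?N * (\<Sum>k\<in>UNIV. \<Sum>l\<in>UNIV. M k l * dd (axis k 1) (dd (axis l 1) G) x)"
  proof -
    have "(\<Sum>m\<in>UNIV. dd (h m) (dd (h m) G) x) = (\<Sum>m\<in>UNIV. \<Sum>k\<in>UNIV. \<Sum>l\<in>UNIV. 2 * ?N * (r m k * r m l * dd (axis k 1) (dd (axis l 1) G) x))"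
    proof -
      have q: "(q * x) * (q * y) = (q * q) * (x * y)" for q x y :: real by (simp add: mult_ac)
      have "h m $ k * h m $ l = 2 * ?N * (r m k * r m l)" for m k l
        unfolding h_def vector_scaleR_component vec_lambda_beta q by simp
      then show ?thesis unfolding ddh by (simp only: mult.assoc)
    qed
    also have "\<dots> = (\<Sum>k\<in>UNIV. \<Sum>l\<in>UNIV. \<Sum>m\<in>UNIV. 2 * ?N * (r m k * r m l * dd (axis k 1) (dd (axis l 1) G) x))"
      by (subst sum.swap, rule sum.cong[OF refl], rule sum.swap)
    finally show ?thesis unfolding r by (simp add: sum_distrib_left sum_distrib_right)
  qed
  have "\<bar>\<Sum>m\<in>UNIV. (G (x + h m) + G (x - h m) - 2 * G x - dd (h m) (dd (h m) G) x)\<bar> \<le> (\<Sum>m\<in>(UNIV::'n set). C * sqrt (2 * ?N * \<tau>) ^ 3)"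
  proof (rule order_trans[OF sum_abs], rule sum_mono)
    fix m
    have "\<bar>G (x + h m) + G (x - h m) - 2 * G x - dd (h m) (dd (h m) G) x\<bar> \<le> C * norm (h m) ^ 3" by (rule bdk_second_difference[OF G])
    also have "\<dots> \<le> C * sqrt (2 * ?N * \<tau>) ^ 3" using C hn by (intro mult_left_mono power_mono) auto
    finally show "\<bar>G (x + h m) + G (x - h m) - 2 * G x - dd (h m) (dd (h m) G) x\<bar> \<le> C * sqrt (2 * ?N * \<tau>) ^ 3" .
  qed
  then have 1: "\<bar>(\<Sum>m\<in>UNIV. G (x + h m) + G (x - h m)) - 2 * ?N * (G x + (\<Sum>k\<in>UNIV. \<Sum>l\<in>UNIV. M k l * dd (axis k 1) (dd (axis l 1) G) x))\<bar> \<le> ?N * (C * sqrt (2 * ?N * \<tau>) ^ 3)"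
    by (simp add: sum_subtractf sum.distrib e algebra_simps)
  have "\<bar>\<Sum>m\<in>UNIV. G (x + h m) + G (x - h m)\<bar> \<le> (\<Sum>m\<in>(UNIV::'n set). 2 * S)"
  proof (rule order_trans[OF sum_abs], rule sum_mono)
    fix m show "\<bar>G (x + h m) + G (x - h m)\<bar> \<le> 2 * S" using S[of "x + h m"] S[of "x - h m"] by linarith
  qed
  then have 2: "\<bar>\<Sum>m\<in>UNIV. G (x + h m) + G (x - h m)\<bar> \<le> 2 * ?N * S" by simp
  let ?X = "G x + (\<Sum>k\<in>UNIV. \<Sum>l\<in>UNIV. M k l * dd (axis k 1) (dd (axis l 1) G) x)"
  have "2 * ?N * \<bar>?X\<bar> = \<bar>2 * ?N * ?X\<bar>" by (simp add: abs_mult)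
  also have "\<dots> \<le> 2 * ?N * S + ?N * (C * sqrt (2 * ?N * \<tau>) ^ 3)" using 1 2 by linarith
  also have "\<dots> \<le> 2 * ?N * (S + C * sqrt (2 * ?N * \<tau>) ^ 3)"
  proof -
    have "\<tau> \<ge> 0" using tr sum_nonneg[of UNIV "\<lambda>k. M k k"] unfolding r by (simp add: sum_nonneg order_trans[OF _ tr[unfolded r]])
    then show ?thesis using C by (simp add: algebra_simps)
  qed
  finally show ?thesis using N by simp
qed

lemma bdk_dd_unit: "bdk (Suc n) w f \<Longrightarrow> norm v \<le> 1 \<Longrightarrow> bdk n w (dd v f)"
  by simp

lemma indicator_integrable:
  fixes g :: "real \<Rightarrow> real"
  assumes g: "g \<in> borel_measurable borel" "\<And>s. s \<in> {c..d} \<Longrightarrow> \<bar>g s\<bar> \<le> C" and cd: "c \<le> d"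
  shows "integrable lborel (\<lambda>s. indicator {c..d} s * g s)" "\<bar>\<integral>s. indicator {c..d} s * g s \<partial>lborel\<bar> \<le> C * (d - c)"
proof -
  have C: "C \<ge> 0" using g(2)[of c] cd by auto
  have i: "integrable lborel (\<lambda>s. indicator {c..d} s * C :: real)"
    by (intro integrable_mult_left integrable_real_indicator) (use cd in auto)
  show 1: "integrable lborel (\<lambda>s. indicator {c..d} s * g s)"
    by (rule Bochner_Integration.integrable_bound[OF i]) (use g C in \<open>auto intro!: AE_I2 simp: indicator_def\<close>)
  have "\<bar>\<integral>s. indicator {c..d} s * g s \<partial>lborel\<bar> \<le> (\<integral>s. \<bar>indicator {c..d} s * g s\<bar> \<partial>lborel)" by (rule integral_abs_bound)
  also have "\<dots> \<le> (\<integral>s. indicator {c..d} s * C \<partial>lborel)"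
    by (rule integral_mono[OF integrable_abs[OF 1] i]) (use g(2) in \<open>auto simp: indicator_def\<close>)
  also have "\<dots> = C * (d - c)" using cd by simp
  finally show "\<bar>\<integral>s. indicator {c..d} s * g s \<partial>lborel\<bar> \<le> C * (d - c)" .
qed

section \<open>Gaussian averages as functions of the scale\<close>

context kolmogorov
begin

text \<open>A crude bound, for scales up to R, of the scale derivative in
  \<open>av_dil_deriv\<close> when the averaged second derivatives are at most 1.\<close>

definition KS :: "real \<Rightarrow> real" where
  "KS R = 2 * R * (\<Sum>k\<in>UNIV. \<Sum>l\<in>UNIV. \<nu> * \<bar>Sig k l\<bar> * R ^ (2 * (b k + b l)))"

lemma KS_bound:
  assumes r: "0 \<le> r" "r \<le> R" and J: "\<And>k l. \<bar>J k l\<bar> \<le> L" and L: "0 \<le> L"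
  shows "\<bar>2 * r * (\<Sum>k\<in>UNIV. \<Sum>l\<in>UNIV. \<nu> * Sig k l * r ^ (2 * (b k + b l)) * J k l)\<bar> \<le> KS R * L"
proof -
  have "\<bar>\<Sum>k\<in>UNIV. \<Sum>l\<in>UNIV. \<nu> * Sig k l * r ^ (2 * (b k + b l)) * J k l\<bar> \<le> (\<Sum>k\<in>UNIV. \<Sum>l\<in>UNIV. \<nu> * \<bar>Sig k l\<bar> * R ^ (2 * (b k + b l)) * L)"
  proof (rule order_trans[OF sum_abs], rule sum_mono, rule order_trans[OF sum_abs], rule sum_mono)
    fix k l
    show "\<bar>\<nu> * Sig k l * r ^ (2 * (b k + b l)) * J k l\<bar> \<le> \<nu> * \<bar>Sig k l\<bar> * R ^ (2 * (b k + b l)) * L"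
      unfolding abs_mult using J nu_pos r by (intro mult_mono power_mono) (auto simp: power_abs intro!: power_mono)
  qed
  then have "\<bar>2 * r\<bar> * \<bar>\<Sum>k\<in>UNIV. \<Sum>l\<in>UNIV. \<nu> * Sig k l * r ^ (2 * (b k + b l)) * J k l\<bar> \<le> (2 * R) * (\<Sum>k\<in>UNIV. \<Sum>l\<in>UNIV. \<nu> * \<bar>Sig k l\<bar> * R ^ (2 * (b k + b l)) * L)"
    using r by (intro mult_mono) auto
  moreover have "(2 * R) * (\<Sum>k\<in>UNIV. \<Sum>l\<in>UNIV. \<nu> * \<bar>Sig k l\<bar> * R ^ (2 * (b k + b l)) * L) = KS R * L"
    by (simp add: KS_def sum_distrib_right mult.assoc)
  ultimately show ?thesis unfolding abs_mult[of "2 * r"] by (simp only:)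
qed

lemma av_dil_lipschitz:
  assumes G: "bdk 3 (\<lambda>_. L) G" and r: "0 \<le> r" "r \<le> r'" "r' \<le> R"
  shows "\<bar>av ker (dil r') G x - av ker (dil r) G x\<bar> \<le> KS R * L * (r' - r)"
proof (cases "r = r'")
  case False
  have G3: "bdk (Suc (Suc (Suc 0))) (\<lambda>_. L) G" using G by (simp add: numeral_3_eq_3 del: bdk.simps)
  have L: "L \<ge> 0" using bdk_le[OF G, of 0] by simp
  have J: "\<bar>av ker (dil s) (dd (axis k 1) (dd (axis l 1) G)) y\<bar> \<le> L" for s k l y
  proof -
    have "bdk 1 (\<lambda>_. L) (dd (axis k 1) (dd (axis l 1) G))" using G3 by simp
    then show ?thesis by (intro av_le[OF ker_integrable ker_nonneg ker_one dil_borel] bdk_borel bdk_le)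
  qed
  obtain z where z: "r < z" "z < r'" "av ker (dil r') G x - av ker (dil r) G x = (r' - r) *
    (2 * z * (\<Sum>k\<in>UNIV. \<Sum>l\<in>UNIV. \<nu> * Sig k l * z ^ (2 * (b k + b l)) * av ker (dil z) (dd (axis k 1) (dd (axis l 1) G)) x))"
    using MVT2[OF _ av_dil_deriv[OF G3], of r r' x] False r by auto
  have "\<bar>2 * z * (\<Sum>k\<in>UNIV. \<Sum>l\<in>UNIV. \<nu> * Sig k l * z ^ (2 * (b k + b l)) * av ker (dil z) (dd (axis k 1) (dd (axis l 1) G)) x)\<bar> \<le> KS R * L"
    using z r by (intro KS_bound J L) auto
  from mult_right_mono[OF this, of "r' - r"] show ?thesis
    unfolding z(3) using r by (simp add: abs_mult mult_ac)
qed simp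

text \<open>The diffusion of the model accumulated over the elapsed time \<sigma>. At \<sigma> = 1
  it is a quarter of \<open>Smat\<close>.\<close>

definition cS :: "'n \<Rightarrow> 'n \<Rightarrow> real \<Rightarrow> real" where
  "cS k l \<sigma> = \<nu> * Sig k l / real (b k + b l + 1) * \<sigma> ^ (b k + b l + 1)"

lemma cS_deriv: "((\<lambda>\<sigma>. cS k l \<sigma>) has_real_derivative \<nu> * Sig k l * \<sigma> ^ (b k + b l)) (at \<sigma>)"
proof -
  have "((\<lambda>\<sigma>. \<sigma> ^ (b k + b l + 1)) has_real_derivative real (b k + b l + 1) * \<sigma> ^ (b k + b l)) (at \<sigma>)"
    using DERIV_pow[of "b k + b l + 1" \<sigma>] by simp
  from DERIV_cmult[OF this, of "\<nu> * Sig k l / real (b k + b l + 1)"] show ?thesis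
    unfolding cS_def by (rule DERIV_cong) simp
qed

text \<open>The first-order term is expressed through increments of \<open>cS\<close>, so that it
  can be combined with the integrated coefficients, and through second derivatives at the single
  scale r1. The remainder is quadratic because the corrected function has zero derivative at
  r1.\<close>

lemma av_dil_expansion:
  assumes G: "bdk 5 (\<lambda>_. L) G" and r: "0 \<le> r2" "r2 \<le> r1" "r1 \<le> R"
  shows "\<bar>av ker (dil r1) G x - av ker (dil r2) G x -
     (\<Sum>k\<in>UNIV. \<Sum>l\<in>UNIV. (cS k l (r1\<^sup>2) - cS k l (r2\<^sup>2)) * av ker (dil r1) (dd (axis k 1) (dd (axis l 1) G)) x)\<bar> \<le> (KS R)\<^sup>2 * L * (r1 - r2)\<^sup>2"
proof (cases "r1 = r2")
  case False
  have G5: "bdk (Suc (Suc 3)) (\<lambda>_. L) G" using G by (rule bdk_antimono) simp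
  have G3: "bdk (Suc (Suc (Suc 0))) (\<lambda>_. L) G" using G by (rule bdk_antimono) simp
  have L: "L \<ge> 0" using bdk_le[OF G, of 0] by simp
  have K0: "KS R \<ge> 0" using r nu_pos by (auto simp: KS_def intro!: mult_nonneg_nonneg sum_nonneg)
  let ?J = "\<lambda>k l r. av ker (dil r) (dd (axis k 1) (dd (axis l 1) G)) x"
  let ?\<chi> = "\<lambda>r. av ker (dil r) G x - (\<Sum>k\<in>UNIV. \<Sum>l\<in>UNIV. cS k l (r\<^sup>2) * ?J k l r1)"
  have "(?\<chi> has_real_derivative (2 * r * (\<Sum>k\<in>UNIV. \<Sum>l\<in>UNIV. \<nu> * Sig k l * r ^ (2 * (b k + b l)) * (?J k l r - ?J k l r1)))) (at r)" for r
  proof -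
    have 1: "((\<lambda>r. cS k l (r\<^sup>2)) has_real_derivative \<nu> * Sig k l * r ^ (2 * (b k + b l)) * (2 * r)) (at r)" for k l
    proof -
      have "((\<lambda>r::real. r\<^sup>2) has_real_derivative 2 * r) (at r)" using DERIV_pow[of 2 r] by simp
      from DERIV_chain2[where f = "cS k l", OF cS_deriv this] show ?thesis
        by (rule DERIV_cong) (simp flip: power_mult)
    qed
    have "(?\<chi> has_real_derivative (2 * r * (\<Sum>k\<in>UNIV. \<Sum>l\<in>UNIV. \<nu> * Sig k l * r ^ (2 * (b k + b l)) * ?J k l r))
      - (\<Sum>k\<in>UNIV. \<Sum>l\<in>UNIV. \<nu> * Sig k l * r ^ (2 * (b k + b l)) * (2 * r) * ?J k l r1)) (at r)"
      by (intro DERIV_diff av_dil_deriv[OF G3] DERIV_sum DERIV_cmult_right 1)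
    then show ?thesis
      by (simp add: sum_distrib_left sum_subtractf right_diff_distrib mult_ac)
  qed
  then obtain z where z: "r2 < z" "z < r1" "?\<chi> r1 - ?\<chi> r2 = (r1 - r2) * (2 * z * (\<Sum>k\<in>UNIV. \<Sum>l\<in>UNIV. \<nu> * Sig k l * z ^ (2 * (b k + b l)) * (?J k l z - ?J k l r1)))"
    using MVT2[of r2 r1 ?\<chi>] False r by force
  have "\<bar>?J k l z - ?J k l r1\<bar> \<le> KS R * L * (r1 - r2)" for k l
  proof -
    have "bdk 3 (\<lambda>_. L) (dd (axis k 1) (dd (axis l 1) G))"
      by (intro bdk_dd_unit[OF bdk_dd_unit[OF G5]]) simp_all
    from av_dil_lipschitz[OF this, of z r1 R x] z r
    have "\<bar>?J k l r1 - ?J k l z\<bar> \<le> KS R * L * (r1 - z)" by simp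
    also have "\<dots> \<le> KS R * L * (r1 - r2)" using z K0 L by (intro mult_left_mono) auto
    finally show ?thesis by linarith
  qed
  then have "\<bar>2 * z * (\<Sum>k\<in>UNIV. \<Sum>l\<in>UNIV. \<nu> * Sig k l * z ^ (2 * (b k + b l)) * (?J k l z - ?J k l r1))\<bar> \<le> KS R * (KS R * L * (r1 - r2))"
    using z r K0 L by (intro KS_bound) auto
  from mult_left_mono[OF this, of "r1 - r2"] have "\<bar>?\<chi> r1 - ?\<chi> r2\<bar> \<le> (KS R)\<^sup>2 * L * (r1 - r2)\<^sup>2"
    unfolding z(3) using r by (simp add: abs_mult power2_eq_square mult_ac)
  moreover have "?\<chi> r1 - ?\<chi> r2 = av ker (dil r1) G x - av ker (dil r2) G x - (\<Sum>k\<in>UNIV. \<Sum>l\<in>UNIV. (cS k l (r1\<^sup>2) - cS k l (r2\<^sup>2)) * ?J k l r1)"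
    by (simp add: left_diff_distrib sum_subtractf)
  ultimately show ?thesis by simp
qed simp

end

section \<open>One time step of the averaged solution and its iteration\<close>

context kolmogorov_solution
begin

lemma Amat_sym: "Amat t s l k = Amat t s k l"
proof -
  have "Amat t s l k = (\<Sum>i\<in>F. \<Sum>j\<in>F. a s j i * (E (t - s) $ l $ i * E (t - s) $ k $ j))"
    unfolding Amat_def by (intro sum.cong refl) (simp add: a_sym mult_ac)
  also have "\<dots> = Amat t s k l" unfolding Amat_def by (rule sum.swap)
  finally show ?thesis .
qed

lemma Amat_bounded: "\<exists>C\<ge>0. \<forall>s\<in>{c..d}. \<forall>k l. \<bar>Amat t s l k\<bar> \<le> C"
proof -
  obtain Ca where Ca: "Ca \<ge> 0" "\<And>s i j. i \<in> F \<Longrightarrow> j \<in> F \<Longrightarrow> \<bar>a s i j\<bar> \<le> Ca" using a_bounded by blast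
  obtain CE where CE: "CE \<ge> 0" "\<And>s i j. s \<in> {c..d} \<Longrightarrow> \<bar>E (t - s) $ i $ j\<bar> \<le> CE" using Emat_bounded by blast
  have "\<bar>Amat t s l k\<bar> \<le> (\<Sum>i\<in>F. \<Sum>j\<in>F. Ca * (CE * CE))" if "s \<in> {c..d}" for s k l
    unfolding Amat_def
  proof (rule order_trans[OF sum_abs], rule sum_mono, rule order_trans[OF sum_abs], rule sum_mono)
    fix i j assume "i \<in> F" "j \<in> F"
    then show "\<bar>a s i j * (E (t - s) $ k $ j * E (t - s) $ l $ i)\<bar> \<le> Ca * (CE * CE)"
      unfolding abs_mult using Ca CE that by (intro mult_mono) auto
  qed
  then show ?thesis using Ca CE by (intro exI[of _ "\<Sum>i\<in>F. \<Sum>j\<in>F. Ca * (CE * CE)"]) (auto intro!: sum_nonneg)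
qed

definition Abar :: "real \<Rightarrow> real \<Rightarrow> real \<Rightarrow> 'n \<Rightarrow> 'n \<Rightarrow> real" where
  "Abar t s1 s2 k l = (\<integral>s. indicator {s1..s2} s * Amat t s l k \<partial>lborel)"

lemma Amat_integrable: "s1 \<le> s2 \<Longrightarrow> integrable lborel (\<lambda>s. indicator {s1..s2} s * Amat t s l k)"
  using Amat_bounded[of s1 s2 t] indicator_integrable(1)[OF Amat_borel] by metis

text \<open>For almost every s the integrand is the form of A_0(s) - \<nu> at the \<open>F\<close>
  components of E(t - s)^T \<xi>, which ellipticity makes nonnegative. So the true diffusion
  dominates the model between any two times.\<close>

lemma Abar_dominates:
  assumes s: "s1 \<le> s2" "s2 \<le> t"
  shows "0 \<le> (\<Sum>k\<in>UNIV. \<Sum>l\<in>UNIV. \<xi> k * \<xi> l * (Abar t s1 s2 k l - (cS k l (t - s1) - cS k l (t - s2))))"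
proof -
  have cb: "has_bochner_integral lborel (\<lambda>s. (\<nu> * Sig k l * (t - s) ^ (b k + b l)) * indicator {s1..s2} s) (- cS k l (t - s2) - - cS k l (t - s1))" for k l
  proof (rule has_bochner_integral_FTC_Icc_real[OF s(1)])
    fix s
    have "((\<lambda>s. cS k l (t - s)) has_real_derivative (\<nu> * Sig k l * (t - s) ^ (b k + b l)) * (- 1)) (at s)"
      by (rule DERIV_chain2[OF cS_deriv]) (auto intro!: derivative_eq_intros)
    from DERIV_minus[OF this]
    show "((\<lambda>s. - cS k l (t - s)) has_real_derivative \<nu> * Sig k l * (t - s) ^ (b k + b l)) (at s)" by simp
    show "isCont (\<lambda>s. \<nu> * Sig k l * (t - s) ^ (b k + b l)) s" by (intro continuous_intros)
  qed
  have ci: "integrable lborel (\<lambda>s. indicator {s1..s2} s * (\<nu> * Sig k l * (t - s) ^ (b k + b l)))"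
    and ce: "cS k l (t - s1) - cS k l (t - s2) = (\<integral>s. indicator {s1..s2} s * (\<nu> * Sig k l * (t - s) ^ (b k + b l)) \<partial>lborel)" for k l
    using cb[of k l] by (simp_all add: has_bochner_integral_iff mult.commute)
  let ?q = "\<lambda>s. \<Sum>k\<in>UNIV. \<Sum>l\<in>UNIV. \<xi> k * \<xi> l * (Amat t s l k - \<nu> * Sig k l * (t - s) ^ (b k + b l))"
  have "(\<Sum>k\<in>UNIV. \<Sum>l\<in>UNIV. \<xi> k * \<xi> l * (Abar t s1 s2 k l - (cS k l (t - s1) - cS k l (t - s2))))
    = (\<Sum>k\<in>UNIV. \<Sum>l\<in>UNIV. \<integral>s. \<xi> k * \<xi> l * (indicator {s1..s2} s * Amat t s l k - indicator {s1..s2} s * (\<nu> * Sig k l * (t - s) ^ (b k + b l))) \<partial>lborel)"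
    unfolding Abar_def ce using Amat_integrable[OF s(1)] ci by (simp add: Bochner_Integration.integral_diff)
  also have "\<dots> = (\<integral>s. (\<Sum>k\<in>UNIV. \<Sum>l\<in>UNIV. \<xi> k * \<xi> l * (indicator {s1..s2} s * Amat t s l k - indicator {s1..s2} s * (\<nu> * Sig k l * (t - s) ^ (b k + b l)))) \<partial>lborel)"
    using Amat_integrable[OF s(1)] ci by simp
  also have "\<dots> = (\<integral>s. indicator {s1..s2} s * ?q s \<partial>lborel)"
    by (simp add: sum_distrib_left algebra_simps)
  also have "\<dots> \<ge> 0"
  proof (rule integral_nonneg_AE)
    have "AE s in lborel. \<forall>\<zeta>::'n \<Rightarrow> real. \<nu> * (\<Sum>i\<in>F. (\<zeta> i)\<^sup>2) \<le> (\<Sum>i\<in>F. \<Sum>j\<in>F. a s i j * \<zeta> i * \<zeta> j)"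
      using ell unfolding elliptic_def by (auto elim: eventually_mono)
    then show "AE s in lborel. 0 \<le> indicator {s1..s2} s * ?q s"
    proof eventually_elim
      case (elim s)
      show ?case
      proof (cases "s \<in> {s1..s2}")
        case True
        define \<zeta> where "\<zeta> i = (\<Sum>l\<in>UNIV. \<xi> l * E (t - s) $ l $ i)" for i
        have "(\<Sum>k\<in>UNIV. \<Sum>l\<in>UNIV. \<xi> k * \<xi> l * Amat t s l k) = (\<Sum>i\<in>F. \<Sum>j\<in>F. a s i j * \<zeta> i * \<zeta> j)"
        proof -
          have "(\<Sum>i\<in>F. \<Sum>j\<in>F. a s i j * \<zeta> i * \<zeta> j) = (\<Sum>i\<in>F. \<Sum>j\<in>F. \<Sum>k\<in>UNIV. \<Sum>l\<in>UNIV. \<xi> k * \<xi> l * (a s i j * (E (t - s) $ k $ j * E (t - s) $ l $ i)))"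
            unfolding \<zeta>_def
            by (intro sum.cong refl) (subst sum.swap, simp add: sum_distrib_left sum_distrib_right mult_ac)
          also have "\<dots> = (\<Sum>k\<in>UNIV. \<Sum>l\<in>UNIV. \<Sum>i\<in>F. \<Sum>j\<in>F. \<xi> k * \<xi> l * (a s i j * (E (t - s) $ k $ j * E (t - s) $ l $ i)))"
            by (rule sum_swap4)
          finally show ?thesis by (simp add: Amat_def sum_distrib_left)
        qed
        moreover have "(\<Sum>k\<in>UNIV. \<Sum>l\<in>UNIV. \<xi> k * \<xi> l * (\<nu> * Sig k l * (t - s) ^ (b k + b l))) = \<nu> * (\<Sum>i\<in>F. (\<zeta> i)\<^sup>2)"
        proof -
          have Es: "E (t - s) $ k $ i = (t - s) ^ b k * E 1 $ k $ i" if "i \<in> F" for k i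
            using that by (subst Emat_homogeneous) (simp add: first_vars_b)
          have "(\<Sum>k\<in>UNIV. \<Sum>l\<in>UNIV. \<xi> k * \<xi> l * (\<nu> * Sig k l * (t - s) ^ (b k + b l)))
            = (\<Sum>k\<in>UNIV. \<Sum>l\<in>UNIV. \<Sum>i\<in>F. \<nu> * ((\<xi> k * E (t - s) $ k $ i) * (\<xi> l * E (t - s) $ l $ i)))"
            unfolding Sig_def by (intro sum.cong refl) (simp add: Es sum_distrib_left sum_distrib_right power_add mult_ac)
          also have "\<dots> = (\<Sum>i\<in>F. \<Sum>k\<in>UNIV. \<Sum>l\<in>UNIV. \<nu> * ((\<xi> k * E (t - s) $ k $ i) * (\<xi> l * E (t - s) $ l $ i)))"
            by (subst (2) sum.swap, subst sum.swap, rule sum.cong[OF refl], rule refl)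
          also have "\<dots> = \<nu> * (\<Sum>i\<in>F. (\<zeta> i)\<^sup>2)"
          proof -
            have "(\<zeta> i)\<^sup>2 = (\<Sum>k\<in>UNIV. \<Sum>l\<in>UNIV. (\<xi> k * E (t - s) $ k $ i) * (\<xi> l * E (t - s) $ l $ i))" for i
              unfolding \<zeta>_def power2_eq_square by (rule sum_product)
            then show ?thesis by (simp only: sum_distrib_left)
          qed
          finally show ?thesis .
        qed
        ultimately have "?q s = (\<Sum>i\<in>F. \<Sum>j\<in>F. a s i j * \<zeta> i * \<zeta> j) - \<nu> * (\<Sum>i\<in>F. (\<zeta> i)\<^sup>2)"
          by (simp only: right_diff_distrib sum_subtractf)
        then show ?thesis using elim True by simp
      qed simp
    qed
  qed
  finally show ?thesis .
qed

lemma integrated_equation':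
  assumes \<eta>: "bumpy \<eta>" and ab: "s1 < s2" "s2 < T"
  shows "slc u0 \<eta> t s2 y - slc u0 \<eta> t s1 y = (\<integral>s. indicator {s1..s2} s *
    ((\<Sum>k\<in>UNIV. \<Sum>l\<in>UNIV. Amat t s l k * slc u0 (dd (axis k 1) (dd (axis l 1) \<eta>)) t s y) - slc f0 \<eta> t s y) \<partial>lborel)"
proof -
  have "(\<Sum>k\<in>UNIV. \<Sum>l\<in>UNIV. Amat t s l k * slc u0 (dd (axis l 1) (dd (axis k 1) \<eta>)) t s y)
     = (\<Sum>k\<in>UNIV. \<Sum>l\<in>UNIV. Amat t s l k * slc u0 (dd (axis k 1) (dd (axis l 1) \<eta>)) t s y)" for s
    by (subst sum.swap, intro sum.cong refl) (simp only: Amat_sym[of t s _ _, symmetric] Amat_sym)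
  then show ?thesis using integrated_equation[OF \<eta> ab] by simp
qed

text \<open>The bound depends on \<eta>; it serves integrability and error terms that disappear in
  the limit of small steps or small scales.\<close>

lemma bumpy_slc_bounds:
  assumes \<eta>: "bumpy \<eta>"
  shows "\<exists>L\<ge>0. (\<forall>s. bdk n (\<lambda>_. L) (slc u0 \<eta> t s)) \<and> (\<forall>s y. \<bar>slc f0 \<eta> t s y\<bar> \<le> L)"
proof -
  obtain C where C: "C \<ge> 0" "bdk (Suc n) (\<lambda>x. C * expn x) \<eta>" using bumpy_bdk[OF \<eta>] by blast
  define I where "I = (\<integral>z. expn (z::(real, 'n) vec) \<partial>lborel)"
  have I: "I \<ge> 0" unfolding I_def by (rule Bochner_Integration.integral_nonneg) simp
  have "bdk n (\<lambda>_. C * Mu * I + C * Mf * I) (slc u0 \<eta> t s)" for s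
    by (rule bdk_weight[OF bdk_slc[OF u0_borel u0_le C(2), folded I_def]]) (use C Mf I in auto)
  moreover have "\<bar>slc f0 \<eta> t s y\<bar> \<le> C * Mu * I + C * Mf * I" for s y
  proof -
    have "\<bar>slc f0 \<eta> t s y\<bar> \<le> C * Mf * I" unfolding I_def by (rule slc_le[OF f0_borel Mf(2) C(2)])
    moreover have "0 \<le> C * Mu * I" using C(1) Mu_nonneg I by simp
    ultimately show ?thesis by linarith
  qed
  ultimately show ?thesis using C Mu_nonneg Mf I by (intro exI[of _ "C * Mu * I + C * Mf * I"]) auto
qed

lemma dd_slc_bumpy: "bumpy \<eta> \<Longrightarrow> dd v (slc u0 \<eta> t s) = slc u0 (dd v \<eta>) t s"
  using bumpy_bdk[of \<eta> "Suc 0"] dd_slc[OF u0_borel u0_le] by blast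

lemma slc_bumpy_borel:
  assumes \<eta>: "bumpy \<eta>" and g: "g \<in> borel_measurable borel"
  shows "(\<lambda>s. slc g \<eta> t s y) \<in> borel_measurable borel" "(\<lambda>q. slc g \<eta> t (fst q) (snd q)) \<in> borel_measurable borel"
  using slc_borel[OF g smooth_borel] \<eta> by (auto simp: bumpy_def)

text \<open>The integrand of the integrated equation is bounded on [a0, b0], which gives Lipschitz
  dependence on time although the coefficients are only measurable.\<close>

lemma slc_lipschitz:
  assumes \<eta>: "bumpy \<eta>" and T: "b0 < T"
  shows "\<exists>C\<ge>0. \<forall>s1 s2 y. a0 \<le> s1 \<longrightarrow> s1 \<le> s2 \<longrightarrow> s2 \<le> b0 \<longrightarrow> \<bar>slc u0 \<eta> t s2 y - slc u0 \<eta> t s1 y\<bar> \<le> C * (s2 - s1)"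
proof -
  obtain CA where CA: "CA \<ge> 0" "\<And>s k l. s \<in> {a0..b0} \<Longrightarrow> \<bar>Amat t s l k\<bar> \<le> CA" using Amat_bounded by blast
  obtain L where L: "L \<ge> 0" "\<And>s. bdk 2 (\<lambda>_. L) (slc u0 \<eta> t s)" "\<And>s y. \<bar>slc f0 \<eta> t s y\<bar> \<le> L" using bumpy_slc_bounds[OF \<eta>] by blast
  define C where "C = (\<Sum>k\<in>(UNIV::'n set). \<Sum>l\<in>(UNIV::'n set). CA * L) + L"
  have C: "C \<ge> 0" using CA L by (auto simp: C_def intro!: add_nonneg_nonneg sum_nonneg)
  have d2: "\<bar>slc u0 (dd (axis k 1) (dd (axis l 1) \<eta>)) t s y\<bar> \<le> L" for k l s y
  proof -
    have "bdk 0 (\<lambda>_. L) (dd (axis k 1) (dd (axis l 1) (slc u0 \<eta> t s)))" using L(2)[of s] by (simp add: numeral_2_eq_2)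
    then show ?thesis unfolding dd_slc_bumpy[OF \<eta>] dd_slc_bumpy[OF bumpy_dd[OF \<eta>]] by (rule bdk_le)
  qed
  have "\<bar>slc u0 \<eta> t s2 y - slc u0 \<eta> t s1 y\<bar> \<le> C * (s2 - s1)" if s: "a0 \<le> s1" "s1 \<le> s2" "s2 \<le> b0" for s1 s2 y
  proof (cases "s1 = s2")
    case False
    then have s12: "s1 < s2" using s by simp
    let ?g = "\<lambda>s. (\<Sum>k\<in>UNIV. \<Sum>l\<in>UNIV. Amat t s l k * slc u0 (dd (axis k 1) (dd (axis l 1) \<eta>)) t s y) - slc f0 \<eta> t s y"
    have "\<bar>?g s\<bar> \<le> C" if "s \<in> {s1..s2}" for s
    proof -
      have "\<bar>\<Sum>k\<in>UNIV. \<Sum>l\<in>UNIV. Amat t s l k * slc u0 (dd (axis k 1) (dd (axis l 1) \<eta>)) t s y\<bar> \<le> (\<Sum>k\<in>(UNIV::'n set). \<Sum>l\<in>(UNIV::'n set). CA * L)"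
        by (rule order_trans[OF sum_abs], rule sum_mono, rule order_trans[OF sum_abs], rule sum_mono)
          (use CA d2 that s in \<open>auto simp: abs_mult intro!: mult_mono\<close>)
      then show ?thesis using L(3)[of s y] unfolding C_def by linarith
    qed
    moreover have "?g \<in> borel_measurable borel"
      using Amat_borel slc_bumpy_borel(1)[OF bumpy_dd[OF bumpy_dd[OF \<eta>]] u0_borel] slc_bumpy_borel(1)[OF \<eta> f0_borel]
      by (intro borel_measurable_diff borel_measurable_sum borel_measurable_times) auto
    ultimately have "\<bar>\<integral>s. indicator {s1..s2} s * ?g s \<partial>lborel\<bar> \<le> C * (s2 - s1)" using s by (intro indicator_integrable(2)) auto
    then show ?thesis using integrated_equation'[OF \<eta> s12, of t y] s T by simp
  qed simp
  then show ?thesis using C by blast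
qed

definition Fint where "Fint \<eta> t s1 s2 y = (\<integral>s. indicator {s1..s2} s * slc f0 \<eta> t s y \<partial>lborel)"

lemma Fint_borel: "bumpy \<eta> \<Longrightarrow> Fint \<eta> t s1 s2 \<in> borel_measurable borel"
proof -
  assume \<eta>: "bumpy \<eta>"
  have [measurable]: "(\<lambda>q. slc f0 \<eta> t (fst q) (snd q)) \<in> borel_measurable (borel \<Otimes>\<^sub>M borel)"
    using slc_bumpy_borel(2)[OF \<eta> f0_borel] by (simp add: borel_prod)
  have "(\<lambda>q::(real, 'n) vec \<times> real. (snd q, fst q)) \<in> (borel \<Otimes>\<^sub>M lborel) \<rightarrow>\<^sub>M (borel \<Otimes>\<^sub>M borel)" by measurable
  from measurable_compose[OF this, of "\<lambda>q. slc f0 \<eta> t (fst q) (snd q)" borel]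
  have "(\<lambda>q. slc f0 \<eta> t (snd q) (fst q)) \<in> borel_measurable (borel \<Otimes>\<^sub>M lborel)" by simp
  then have "(\<lambda>(y, s). indicator {s1..s2} s * slc f0 \<eta> t s y) \<in> borel_measurable (borel \<Otimes>\<^sub>M lborel)"
    unfolding case_prod_beta by measurable
  then show ?thesis unfolding Fint_def[abs_def] by (rule lborel.borel_measurable_lebesgue_integral)
qed

text \<open>Fubini: the Gaussian average of a time integral is the time integral of the averages, so
  a bound of the averaged source at each time suffices.\<close>

lemma av_Fint:
  assumes \<eta>: "bumpy \<eta>" and s: "s1 \<le> s2" and m: "m \<in> borel_measurable borel"
    and H: "\<And>s. s \<in> {s1..s2} \<Longrightarrow> \<bar>av ker m (slc f0 \<eta> t s) x\<bar> \<le> H"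
  shows "\<bar>av ker m (Fint \<eta> t s1 s2) x\<bar> \<le> H * (s2 - s1)"
proof -
  obtain L where L: "L \<ge> 0" "\<And>s y. \<bar>slc f0 \<eta> t s y\<bar> \<le> L" using bumpy_slc_bounds[OF \<eta>] by blast
  let ?f = "\<lambda>z s. ker z * (indicator {s1..s2} s * slc f0 \<eta> t s (x - m z))"
  note [measurable] = m ker_borel
  have [measurable]: "(\<lambda>q. slc f0 \<eta> t (fst q) (snd q)) \<in> borel_measurable (borel \<Otimes>\<^sub>M borel)"
    using slc_bumpy_borel(2)[OF \<eta> f0_borel] by (simp add: borel_prod)
  have "(\<lambda>q. (snd q, x - m (fst q))) \<in> (lborel \<Otimes>\<^sub>M lborel) \<rightarrow>\<^sub>M (borel \<Otimes>\<^sub>M borel)" by measurable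
  from measurable_compose[OF this, of "\<lambda>q. slc f0 \<eta> t (fst q) (snd q)" borel]
  have [measurable]: "(\<lambda>q. slc f0 \<eta> t (snd q) (x - m (fst q))) \<in> borel_measurable (lborel \<Otimes>\<^sub>M lborel)" by simp
  have meas: "(\<lambda>q. ?f (fst q) (snd q)) \<in> borel_measurable (lborel \<Otimes>\<^sub>M lborel)" by measurable
  have sb: "(\<lambda>s. slc f0 \<eta> t s y) \<in> borel_measurable borel" for y by (rule slc_bumpy_borel(1)[OF \<eta> f0_borel])
  have inner: "integrable lborel (\<lambda>s. ?f z s)" for z
    by (intro integrable_mult_right indicator_integrable(1)[OF sb L(2) s])
  have int: "integrable (lborel \<Otimes>\<^sub>M lborel) (\<lambda>q. ?f (fst q) (snd q))"
  proof (rule lborel_pair.Fubini_integrable[OF meas])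
    show "integrable lborel (\<lambda>z. \<integral>s. norm (?f (fst (z, s)) (snd (z, s))) \<partial>lborel)"
    proof (rule Bochner_Integration.integrable_bound[OF integrable_mult_right[OF ker_integrable, of "L * (s2 - s1)"]])
      show "(\<lambda>z. \<integral>s. norm (?f (fst (z, s)) (snd (z, s))) \<partial>lborel) \<in> borel_measurable lborel"
        using meas by (intro lborel.borel_measurable_lebesgue_integral) (simp add: case_prod_beta)
      have "\<bar>\<integral>s. norm (?f z s) \<partial>lborel\<bar> \<le> L * (s2 - s1) * ker z" for z
      proof -
        have "(\<integral>s. norm (?f z s) \<partial>lborel) = ker z * (\<integral>s. indicator {s1..s2} s * \<bar>slc f0 \<eta> t s (x - m z)\<bar> \<partial>lborel)"
          using ker_nonneg[of z] by (simp add: abs_mult)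
        moreover have "\<bar>\<integral>s. indicator {s1..s2} s * \<bar>slc f0 \<eta> t s (x - m z)\<bar> \<partial>lborel\<bar> \<le> L * (s2 - s1)"
          by (rule indicator_integrable(2)[OF _ _ s]) (use L(2) sb in auto)
        ultimately show ?thesis using ker_nonneg[of z] by (simp add: abs_mult mult.commute[of _ "ker z"] mult_left_mono)
      qed
      then show "AE z in lborel. norm (\<integral>s. norm (?f (fst (z, s)) (snd (z, s))) \<partial>lborel) \<le> norm (L * (s2 - s1) * ker z)"
        by (intro AE_I2) (auto intro: order_trans[OF _ abs_ge_self])
    qed
    show "AE z in lborel. integrable lborel (\<lambda>s. ?f (fst (z, s)) (snd (z, s)))" using inner by (intro AE_I2) simp
  qed
  have "av ker m (Fint \<eta> t s1 s2) x = (\<integral>z. \<integral>s. ?f z s \<partial>lborel \<partial>lborel)"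
    unfolding av_def Fint_def integral_mult_right_zero[symmetric] ..
  also have "\<dots> = (\<integral>s. \<integral>z. ?f z s \<partial>lborel \<partial>lborel)"
  proof -
    have "integrable (lborel \<Otimes>\<^sub>M lborel) (case_prod ?f)" using int by (simp add: case_prod_beta')
    then show ?thesis by (rule lborel_pair.Fubini_integral[symmetric])
  qed
  also have "\<dots> = (\<integral>s. indicator {s1..s2} s * av ker m (slc f0 \<eta> t s) x \<partial>lborel)"
    unfolding av_def integral_mult_right_zero[symmetric] by (simp add: mult_ac)
  finally have e: "av ker m (Fint \<eta> t s1 s2) x = (\<integral>s. indicator {s1..s2} s * av ker m (slc f0 \<eta> t s) x \<partial>lborel)" .
  have "(\<lambda>s. av ker m (slc f0 \<eta> t s) x) \<in> borel_measurable borel"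
  proof -
    have "(\<lambda>q. (fst q, x - m (snd q))) \<in> (borel \<Otimes>\<^sub>M lborel) \<rightarrow>\<^sub>M (borel \<Otimes>\<^sub>M borel)" by measurable
    from measurable_compose[OF this, of "\<lambda>q. slc f0 \<eta> t (fst q) (snd q)" borel]
    have "(\<lambda>q. slc f0 \<eta> t (fst q) (x - m (snd q))) \<in> borel_measurable (borel \<Otimes>\<^sub>M lborel)" by simp
    then have "(\<lambda>(s, z). ker z * slc f0 \<eta> t s (x - m z)) \<in> borel_measurable (borel \<Otimes>\<^sub>M lborel)"
      unfolding case_prod_beta by measurable
    then show ?thesis unfolding av_def by (rule lborel.borel_measurable_lebesgue_integral)
  qed
  then show ?thesis unfolding e using H by (intro indicator_integrable(2)[OF _ _ s])
qed

text \<open>Second derivatives of the slice are frozen at s1, at a quadratic cost by their Lipschitz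
  dependence on time. The coefficients cannot be frozen, being only measurable, and enter through
  their integral \<open>Abar\<close>.\<close>

lemma slc_expansion:
  assumes \<eta>: "bumpy \<eta>" and T: "b0 < T"
  shows "\<exists>C\<ge>0. \<forall>s1 s2 y. a0 \<le> s1 \<longrightarrow> s1 < s2 \<longrightarrow> s2 \<le> b0 \<longrightarrow>
    \<bar>slc u0 \<eta> t s2 y - slc u0 \<eta> t s1 y - (\<Sum>k\<in>UNIV. \<Sum>l\<in>UNIV. Abar t s1 s2 k l * dd (axis k 1) (dd (axis l 1) (slc u0 \<eta> t s1)) y)
      + Fint \<eta> t s1 s2 y\<bar> \<le> C * (s2 - s1)\<^sup>2"
proof -
  obtain CA where CA: "CA \<ge> 0" "\<And>s k l. s \<in> {a0..b0} \<Longrightarrow> \<bar>Amat t s l k\<bar> \<le> CA" using Amat_bounded by blast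
  obtain L where L: "L \<ge> 0" "\<And>s y. \<bar>slc f0 \<eta> t s y\<bar> \<le> L" using bumpy_slc_bounds[OF \<eta>] by blast
  let ?d = "\<lambda>k l. dd (axis k 1) (dd (axis l 1) \<eta>)"
  have bd: "bumpy (?d k l)" for k l by (intro bumpy_dd \<eta>)
  have dsl: "dd (axis k 1) (dd (axis l 1) (slc u0 \<eta> t s)) = slc u0 (?d k l) t s" for k l s
    unfolding dd_slc_bumpy[OF \<eta>] dd_slc_bumpy[OF bumpy_dd[OF \<eta>]] ..
  have "\<exists>C\<ge>0. \<forall>s1 s2 y. a0 \<le> s1 \<longrightarrow> s1 \<le> s2 \<longrightarrow> s2 \<le> b0 \<longrightarrow> \<bar>slc u0 (?d k l) t s2 y - slc u0 (?d k l) t s1 y\<bar> \<le> C * (s2 - s1)" for k l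
    by (rule slc_lipschitz[OF bd T])
  then obtain Cl where Cl: "\<And>k l. Cl k l \<ge> 0" "\<And>k l s1 s2 y. a0 \<le> s1 \<Longrightarrow> s1 \<le> s2 \<Longrightarrow> s2 \<le> b0 \<Longrightarrow> \<bar>slc u0 (?d k l) t s2 y - slc u0 (?d k l) t s1 y\<bar> \<le> Cl k l * (s2 - s1)"
    by metis
  define C where "C = (\<Sum>k\<in>UNIV. \<Sum>l\<in>UNIV. CA * Cl k l)"
  have C: "C \<ge> 0" using CA Cl by (auto simp: C_def intro!: sum_nonneg)
  have "\<bar>slc u0 \<eta> t s2 y - slc u0 \<eta> t s1 y - (\<Sum>k\<in>UNIV. \<Sum>l\<in>UNIV. Abar t s1 s2 k l * dd (axis k 1) (dd (axis l 1) (slc u0 \<eta> t s1)) y)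
      + Fint \<eta> t s1 s2 y\<bar> \<le> C * (s2 - s1)\<^sup>2" if s: "a0 \<le> s1" "s1 < s2" "s2 \<le> b0" for s1 s2 y
  proof -
    note sb = slc_bumpy_borel(1)[OF bd u0_borel, of _ _ t y] slc_bumpy_borel(1)[OF \<eta> f0_borel, of t y]
    let ?w = "\<lambda>k l s. slc u0 (?d k l) t s y"
    let ?g1 = "\<lambda>s. \<Sum>k\<in>UNIV. \<Sum>l\<in>UNIV. Amat t s l k * ?w k l s"
    have s': "s1 \<le> s2" using s by simp
    have le: "\<bar>?w k l s - ?w k l s1\<bar> \<le> Cl k l * (s2 - s1)" if "s \<in> {s1..s2}" for k l s
    proof -
      have "\<bar>?w k l s - ?w k l s1\<bar> \<le> Cl k l * (s - s1)" using Cl(2) that s by auto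
      also have "\<dots> \<le> Cl k l * (s2 - s1)" using Cl(1) that by (intro mult_left_mono) auto
      finally show ?thesis .
    qed
    have "\<exists>L. \<forall>s. \<bar>?w k l s\<bar> \<le> L" for k l
      using bumpy_slc_bounds[OF bd[of k l], where n = 0 and t = t] bdk_le by blast
    then obtain L2 where L2: "\<And>k l s. \<bar>?w k l s\<bar> \<le> L2 k l" by metis
    have A: "\<bar>Amat t s l k * v\<bar> \<le> CA * w" if "s \<in> {s1..s2}" "\<bar>v\<bar> \<le> w" for s k l v w
      unfolding abs_mult using CA that s by (intro mult_mono) auto
    have i1: "integrable lborel (\<lambda>s. indicator {s1..s2} s * (Amat t s l k * ?w k l s))" for k l
      using Amat_borel sb by (intro indicator_integrable(1)[OF _ A[OF _ L2] s']) auto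
    have i2: "integrable lborel (\<lambda>s. indicator {s1..s2} s * slc f0 \<eta> t s y)"
      by (intro indicator_integrable(1)[OF sb(2) L(2) s'])
    have "slc u0 \<eta> t s2 y - slc u0 \<eta> t s1 y = (\<integral>s. (\<Sum>k\<in>UNIV. \<Sum>l\<in>UNIV. indicator {s1..s2} s * (Amat t s l k * ?w k l s)) - indicator {s1..s2} s * slc f0 \<eta> t s y \<partial>lborel)"
      using integrated_equation'[OF \<eta> s(2), of t y] s T by (simp add: right_diff_distrib sum_distrib_left)
    also have "\<dots> = (\<Sum>k\<in>UNIV. \<Sum>l\<in>UNIV. \<integral>s. indicator {s1..s2} s * (Amat t s l k * ?w k l s) \<partial>lborel) - Fint \<eta> t s1 s2 y"
    proof -
      have "(\<integral>s. (\<Sum>k\<in>UNIV. \<Sum>l\<in>UNIV. indicator {s1..s2} s * (Amat t s l k * ?w k l s)) \<partial>lborel) = (\<Sum>k\<in>UNIV. \<Sum>l\<in>UNIV. \<integral>s. indicator {s1..s2} s * (Amat t s l k * ?w k l s) \<partial>lborel)"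
        by (subst Bochner_Integration.integral_sum, intro Bochner_Integration.integrable_sum i1, rule sum.cong[OF refl], rule Bochner_Integration.integral_sum, rule i1)
      then show ?thesis unfolding Fint_def
        by (subst Bochner_Integration.integral_diff[OF _ i2]) (intro Bochner_Integration.integrable_sum i1, simp only:)
    qed
    finally have e: "slc u0 \<eta> t s2 y - slc u0 \<eta> t s1 y + Fint \<eta> t s1 s2 y = (\<Sum>k\<in>UNIV. \<Sum>l\<in>UNIV. \<integral>s. indicator {s1..s2} s * (Amat t s l k * ?w k l s) \<partial>lborel)" by simp
    have e2: "(\<integral>s. indicator {s1..s2} s * (Amat t s l k * ?w k l s) \<partial>lborel) - Abar t s1 s2 k l * ?w k l s1
       = (\<integral>s. indicator {s1..s2} s * (Amat t s l k * (?w k l s - ?w k l s1)) \<partial>lborel)" for k l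
    proof -
      have "(\<integral>s. indicator {s1..s2} s * (Amat t s l k * (?w k l s - ?w k l s1)) \<partial>lborel) =
        (\<integral>s. indicator {s1..s2} s * (Amat t s l k * ?w k l s) - indicator {s1..s2} s * Amat t s l k * ?w k l s1 \<partial>lborel)"
        by (simp add: algebra_simps)
      then show ?thesis using i1 Amat_integrable[OF s'] by (simp add: Abar_def)
    qed
    have "\<bar>\<Sum>k\<in>UNIV. \<Sum>l\<in>UNIV. \<integral>s. indicator {s1..s2} s * (Amat t s l k * (?w k l s - ?w k l s1)) \<partial>lborel\<bar> \<le> (\<Sum>k\<in>UNIV. \<Sum>l\<in>UNIV. (CA * (Cl k l * (s2 - s1))) * (s2 - s1))"
      by (rule order_trans[OF sum_abs], rule sum_mono, rule order_trans[OF sum_abs], rule sum_mono,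
          rule indicator_integrable(2)[OF _ A[OF _ le] s'])
        (use Amat_borel sb in \<open>auto intro!: borel_measurable_times borel_measurable_diff\<close>)
    also have "\<dots> = C * (s2 - s1)\<^sup>2" unfolding C_def sum_distrib_right by (simp add: power2_eq_square mult_ac)
    finally have f: "\<bar>\<Sum>k\<in>UNIV. \<Sum>l\<in>UNIV. \<integral>s. indicator {s1..s2} s * (Amat t s l k * (?w k l s - ?w k l s1)) \<partial>lborel\<bar> \<le> C * (s2 - s1)\<^sup>2" .
    have "slc u0 \<eta> t s2 y - slc u0 \<eta> t s1 y - (\<Sum>k\<in>UNIV. \<Sum>l\<in>UNIV. Abar t s1 s2 k l * ?w k l s1) + Fint \<eta> t s1 s2 y
      = (\<Sum>k\<in>UNIV. \<Sum>l\<in>UNIV. \<integral>s. indicator {s1..s2} s * (Amat t s l k * (?w k l s - ?w k l s1)) \<partial>lborel)"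
      using e by (simp add: e2[symmetric] sum_subtractf)
    then show ?thesis unfolding dsl using f by simp
  qed
  then show ?thesis using C by blast
qed

text \<open>If the diffusion were exactly the model and the source zero, this would not depend on s.
  As s increases to t the Gaussian shrinks and the slice at time t is recovered.\<close>

definition Th where "Th \<eta> t s = av ker (dil (sqrt (t - s))) (slc u0 \<eta> t s)"

lemma av_ker_integrable: "G \<in> borel_measurable borel \<Longrightarrow> (\<And>x. \<bar>G x\<bar> \<le> C) \<Longrightarrow> integrable lborel (\<lambda>z. ker z * G (x - dil r z))"
  by (rule av_integrable[OF ker_integrable ker_nonneg ker_one dil_borel])

text \<open>Up to errors, Th(s2) is Th(s1) + M : D^2 Th(s1) minus the averaged source, where M, the
  integrated defect of the diffusion matrices, is positive semidefinite and of size s2 - s1;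
  \<open>psd_shift_bound\<close> then controls the supremum. The constant may depend on \<eta> and
  on the gap t - b0, since its term vanishes for small steps.\<close>

lemma max_principle_step:
  assumes \<eta>: "bumpy \<eta>" and t: "b0 < t" "t \<le> T" and ab: "a0 < b0"
  shows "\<exists>C\<ge>0. \<forall>s1 s2 S H. a0 \<le> s1 \<longrightarrow> s1 < s2 \<longrightarrow> s2 \<le> b0 \<longrightarrow> (\<forall>x. \<bar>Th \<eta> t s1 x\<bar> \<le> S) \<longrightarrow>
    (\<forall>s\<in>{s1..s2}. \<forall>x. \<bar>av ker (dil (sqrt (t - s2))) (slc f0 \<eta> t s) x\<bar> \<le> H) \<longrightarrow>
    (\<forall>x. \<bar>Th \<eta> t s2 x\<bar> \<le> S + H * (s2 - s1) + C * sqrt (s2 - s1) ^ 3)"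
proof -
  let ?N = "real CARD('n)"
  have T: "b0 < T" using t by simp
  obtain L where L: "L \<ge> 0" "\<And>s. bdk 6 (\<lambda>_. L) (slc u0 \<eta> t s)" "\<And>s y. \<bar>slc f0 \<eta> t s y\<bar> \<le> L" using bumpy_slc_bounds[OF \<eta>] by blast
  obtain CA where CA: "CA \<ge> 0" "\<And>s k l. s \<in> {a0..b0} \<Longrightarrow> \<bar>Amat t s l k\<bar> \<le> CA" using Amat_bounded by blast
  obtain C1 where C1: "C1 \<ge> 0" and ex: "\<And>s1 s2 y. a0 \<le> s1 \<Longrightarrow> s1 < s2 \<Longrightarrow> s2 \<le> b0 \<Longrightarrow>
    \<bar>slc u0 \<eta> t s2 y - slc u0 \<eta> t s1 y - (\<Sum>k\<in>UNIV. \<Sum>l\<in>UNIV. Abar t s1 s2 k l * dd (axis k 1) (dd (axis l 1) (slc u0 \<eta> t s1)) y)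
      + Fint \<eta> t s1 s2 y\<bar> \<le> C1 * (s2 - s1)\<^sup>2" using slc_expansion[OF \<eta> T] by blast
  define R where "R = sqrt (t - a0)"
  \<comment> \<open>A lower bound for all scales that occur; dividing by it is harmless because b0 <
    t stays fixed while the step tends to 0.\<close>
  define \<rho> where "\<rho> = sqrt (t - b0)"
  have \<rho>: "\<rho> > 0" using t by (simp add: \<rho>_def)
  have K0: "KS R \<ge> 0" using ab t nu_pos by (auto simp: KS_def R_def intro!: mult_nonneg_nonneg sum_nonneg)
  \<comment> \<open>Three quadratic errors: freezing in time, expansion of the average in the scale,
    and replacing the scale r2 by r1 in the second derivatives.\<close>
  define C2 where "C2 = C1 + (KS R)\<^sup>2 * L / \<rho>\<^sup>2 + ?N * ?N * CA * (KS R * L / \<rho>)"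
  define C where "C = C2 * sqrt (b0 - a0) + L * (sqrt (2 * ?N * (?N * CA))) ^ 3"
  have C2: "C2 \<ge> 0" using C1 K0 L CA \<rho> by (auto simp: C2_def intro!: add_nonneg_nonneg mult_nonneg_nonneg)
  have C: "C \<ge> 0" using C2 L CA ab by (auto simp: C_def intro!: add_nonneg_nonneg mult_nonneg_nonneg)
  have "\<bar>Th \<eta> t s2 x\<bar> \<le> S + H * (s2 - s1) + C * sqrt (s2 - s1) ^ 3"
    if s: "a0 \<le> s1" "s1 < s2" "s2 \<le> b0" and S: "\<And>x. \<bar>Th \<eta> t s1 x\<bar> \<le> S"
      and H: "\<And>s x. s \<in> {s1..s2} \<Longrightarrow> \<bar>av ker (dil (sqrt (t - s2))) (slc f0 \<eta> t s) x\<bar> \<le> H" for s1 s2 S H x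
  proof -
    define \<delta> where "\<delta> = s2 - s1"
    have \<delta>: "\<delta> > 0" "\<delta> \<le> b0 - a0" using s by (auto simp: \<delta>_def)
    define r1 where "r1 = sqrt (t - s1)"
    define r2 where "r2 = sqrt (t - s2)"
    have r: "0 \<le> r2" "r2 \<le> r1" "r1 \<le> R" "\<rho> \<le> r2" using s t by (auto simp: r1_def r2_def R_def \<rho>_def)
    have sq: "r1\<^sup>2 = t - s1" "r2\<^sup>2 = t - s2" using s t by (auto simp: r1_def r2_def)
    have rd: "r1 - r2 \<le> \<delta> / \<rho>"
    proof -
      have "(r1 - r2) * \<rho> \<le> (r1 - r2) * (r1 + r2)" using r \<rho> by (intro mult_left_mono) auto
      also have "\<dots> = \<delta>" using sq by (simp add: \<delta>_def power2_eq_square algebra_simps)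
      finally show ?thesis using \<rho> by (simp add: field_simps)
    qed
    let ?V = "slc u0 \<eta> t s1"
    let ?W = "\<lambda>k l. dd (axis k 1) (dd (axis l 1) ?V)"
    have V6: "bdk (Suc (Suc 4)) (\<lambda>_. L) ?V" using L(2)[of s1] by (rule bdk_antimono) simp
    have V5: "bdk 5 (\<lambda>_. L) ?V" and V3: "bdk 3 (\<lambda>_. L) ?V" and V4: "bdk (Suc 3) (\<lambda>_. L) ?V" using bdk_antimono[OF L(2)[of s1]] by auto
    have W: "bdk 4 (\<lambda>_. L) (?W k l)" for k l by (intro bdk_dd_unit[OF bdk_dd_unit[OF V6]]) simp_all
    have W3: "bdk 3 (\<lambda>_. L) (?W k l)" for k l by (rule bdk_antimono[OF W]) simp
    define e where "e y = slc u0 \<eta> t s2 y - ?V y - (\<Sum>k\<in>UNIV. \<Sum>l\<in>UNIV. Abar t s1 s2 k l * ?W k l y) + Fint \<eta> t s1 s2 y" for y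
    have eb: "\<bar>e y\<bar> \<le> C1 * \<delta>\<^sup>2" for y unfolding e_def \<delta>_def by (rule ex[OF s])
    have Fb: "\<bar>Fint \<eta> t s1 s2 y\<bar> \<le> L * (s2 - s1)" for y
      unfolding Fint_def by (rule indicator_integrable(2)[OF slc_bumpy_borel(1)[OF \<eta> f0_borel] L(3)]) (use s in simp)
    note ii = av_ker_integrable[OF bdk_borel[OF L(2)] bdk_le[OF L(2)]] av_ker_integrable[OF bdk_borel[OF W] bdk_le[OF W]] av_ker_integrable[OF Fint_borel[OF \<eta>] Fb]
    have ebor: "e \<in> borel_measurable borel"
      unfolding e_def[abs_def] using bdk_borel[OF L(2)] bdk_borel[OF W] Fint_borel[OF \<eta>]
      by (intro borel_measurable_add borel_measurable_diff borel_measurable_sum borel_measurable_times) auto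
    have ave: "av ker (dil r2) e x = Th \<eta> t s2 x - av ker (dil r2) ?V x - (\<Sum>k\<in>UNIV. \<Sum>l\<in>UNIV. Abar t s1 s2 k l * av ker (dil r2) (?W k l) x) + av ker (dil r2) (Fint \<eta> t s1 s2) x"
    proof -
      have "av ker (dil r2) e x = (\<integral>z. ker z * slc u0 \<eta> t s2 (x - dil r2 z) - ker z * ?V (x - dil r2 z)
         - (\<Sum>k\<in>UNIV. \<Sum>l\<in>UNIV. Abar t s1 s2 k l * (ker z * ?W k l (x - dil r2 z))) + ker z * Fint \<eta> t s1 s2 (x - dil r2 z) \<partial>lborel)"
        unfolding av_def e_def by (simp add: algebra_simps sum_distrib_left)
      then show ?thesis using ii by (simp add: Th_def av_def r2_def)
    qed
    have e1: "\<bar>av ker (dil r2) e x\<bar> \<le> C1 * \<delta>\<^sup>2"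
      by (rule av_le[OF ker_integrable ker_nonneg ker_one dil_borel ebor eb])
    have e2: "\<bar>av ker (dil r2) (Fint \<eta> t s1 s2) x\<bar> \<le> H * \<delta>"
      unfolding \<delta>_def r2_def by (rule av_Fint[OF \<eta> _ dil_borel H]) (use s in auto)
    let ?J = "\<lambda>k l. av ker (dil r1) (?W k l) x"
    define M where "M k l = Abar t s1 s2 k l - (cS k l (t - s1) - cS k l (t - s2))" for k l
    have Ab: "\<bar>Abar t s1 s2 k l\<bar> \<le> CA * \<delta>" for k l
      unfolding Abar_def \<delta>_def by (rule indicator_integrable(2)[OF Amat_borel CA(2)]) (use s in auto)
    have e3: "\<bar>\<Sum>k\<in>UNIV. \<Sum>l\<in>UNIV. Abar t s1 s2 k l * (av ker (dil r2) (?W k l) x - ?J k l)\<bar> \<le> ?N * ?N * CA * (KS R * L / \<rho>) * \<delta>\<^sup>2"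
    proof -
      have "\<bar>Abar t s1 s2 k l * (av ker (dil r2) (?W k l) x - ?J k l)\<bar> \<le> (CA * \<delta>) * (KS R * L * (\<delta> / \<rho>))" for k l
      proof -
        have "\<bar>?J k l - av ker (dil r2) (?W k l) x\<bar> \<le> KS R * L * (r1 - r2)" by (rule av_dil_lipschitz[OF W3 r(1-3)])
        also have "\<dots> \<le> KS R * L * (\<delta> / \<rho>)" using rd K0 L by (intro mult_left_mono) auto
        finally have "\<bar>av ker (dil r2) (?W k l) x - ?J k l\<bar> \<le> KS R * L * (\<delta> / \<rho>)" by linarith
        then show ?thesis unfolding abs_mult using Ab CA \<delta> by (intro mult_mono) auto
      qed
      then have "\<bar>\<Sum>k\<in>UNIV. \<Sum>l\<in>UNIV. Abar t s1 s2 k l * (av ker (dil r2) (?W k l) x - ?J k l)\<bar> \<le> (\<Sum>k\<in>(UNIV::'n set). \<Sum>l\<in>(UNIV::'n set). (CA * \<delta>) * (KS R * L * (\<delta> / \<rho>)))"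
        by (intro order_trans[OF sum_abs] sum_mono)
      then show ?thesis by (simp add: power2_eq_square mult_ac)
    qed
    have e4: "\<bar>av ker (dil r1) ?V x - av ker (dil r2) ?V x - (\<Sum>k\<in>UNIV. \<Sum>l\<in>UNIV. (cS k l (t - s1) - cS k l (t - s2)) * ?J k l)\<bar> \<le> (KS R)\<^sup>2 * L / \<rho>\<^sup>2 * \<delta>\<^sup>2"
    proof -
      have "\<bar>av ker (dil r1) ?V x - av ker (dil r2) ?V x - (\<Sum>k\<in>UNIV. \<Sum>l\<in>UNIV. (cS k l (r1\<^sup>2) - cS k l (r2\<^sup>2)) * ?J k l)\<bar> \<le> (KS R)\<^sup>2 * L * (r1 - r2)\<^sup>2"
        by (rule av_dil_expansion[OF V5 r(1-3)])
      also have "\<dots> \<le> (KS R)\<^sup>2 * L * (\<delta> / \<rho>)\<^sup>2" using rd r L by (intro mult_left_mono power_mono) auto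
      finally show ?thesis unfolding sq by (simp add: power_divide)
    qed
    have Th1: "Th \<eta> t s1 = av ker (dil r1) ?V" by (simp add: Th_def r1_def)
    have ddTh: "dd (axis k 1) (dd (axis l 1) (Th \<eta> t s1)) = av ker (dil r1) (?W k l)" for k l
    proof -
      note da = dd_av[OF ker_integrable ker_nonneg ker_one dil_borel]
      have "bdk (Suc 4) (\<lambda>_. L) (dd (axis l 1) ?V)" by (rule bdk_dd_unit[OF V6]) simp
      then show ?thesis unfolding Th1 da[OF V6] by (rule da)
    qed
    have e5: "\<bar>Th \<eta> t s1 x + (\<Sum>k\<in>UNIV. \<Sum>l\<in>UNIV. M k l * ?J k l)\<bar> \<le> S + L * sqrt (2 * ?N * (?N * (CA * \<delta>))) ^ 3"
    proof -
      have g1: "bdk 3 (\<lambda>_. L) (Th \<eta> t s1)" unfolding Th1 by (rule bdk_av[OF ker_integrable ker_nonneg ker_one dil_borel V4])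
      have g2: "M k l = M l k" for k l
        unfolding M_def Abar_def cS_def by (simp add: Amat_sym[of t _ k l] Sig_sym[of k l] add.commute)
      have g3: "0 \<le> (\<Sum>k\<in>UNIV. \<Sum>l\<in>UNIV. \<xi> k * \<xi> l * M k l)" for \<xi>
        unfolding M_def by (rule Abar_dominates) (use s t in auto)
      have "M k k \<le> CA * \<delta>" for k
      proof -
        have "Sig k k \<ge> 0" by (simp add: Sig_def sum_nonneg)
        moreover have "(t - s2) ^ (b k + b k + 1) \<le> (t - s1) ^ (b k + b k + 1)" using s t by (intro power_mono) auto
        ultimately have "cS k k (t - s2) \<le> cS k k (t - s1)" unfolding cS_def using nu_pos by (intro mult_left_mono) auto
        then show ?thesis using Ab[of k k] unfolding M_def by linarith
      qed
      then have "(\<Sum>k\<in>UNIV. M k k) \<le> (\<Sum>k\<in>(UNIV::'n set). CA * \<delta>)" by (intro sum_mono)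
      then have g4: "(\<Sum>k\<in>UNIV. M k k) \<le> ?N * (CA * \<delta>)" by simp
      show ?thesis using psd_shift_bound[OF g1 S g2 g3 g4, of x] unfolding ddTh by simp
    qed
    have MJ: "(\<Sum>k\<in>UNIV. \<Sum>l\<in>UNIV. M k l * ?J k l) = (\<Sum>k\<in>UNIV. \<Sum>l\<in>UNIV. Abar t s1 s2 k l * ?J k l) - (\<Sum>k\<in>UNIV. \<Sum>l\<in>UNIV. (cS k l (t - s1) - cS k l (t - s2)) * ?J k l)"
      by (simp only: M_def left_diff_distrib sum_subtractf)
    have AJ: "(\<Sum>k\<in>UNIV. \<Sum>l\<in>UNIV. Abar t s1 s2 k l * (av ker (dil r2) (?W k l) x - ?J k l)) = (\<Sum>k\<in>UNIV. \<Sum>l\<in>UNIV. Abar t s1 s2 k l * av ker (dil r2) (?W k l) x) - (\<Sum>k\<in>UNIV. \<Sum>l\<in>UNIV. Abar t s1 s2 k l * ?J k l)"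
      by (simp only: right_diff_distrib sum_subtractf)
    have "\<bar>Th \<eta> t s2 x\<bar> \<le> S + L * sqrt (2 * ?N * (?N * (CA * \<delta>))) ^ 3 + (KS R)\<^sup>2 * L / \<rho>\<^sup>2 * \<delta>\<^sup>2 + ?N * ?N * CA * (KS R * L / \<rho>) * \<delta>\<^sup>2 + H * \<delta> + C1 * \<delta>\<^sup>2"
      using e1 e2 e3 e4 e5 ave MJ AJ unfolding Th1[THEN fun_cong] by linarith
    also have "\<dots> = S + H * \<delta> + L * sqrt (2 * ?N * (?N * (CA * \<delta>))) ^ 3 + C2 * \<delta>\<^sup>2"
      by (simp add: C2_def distrib_right)
    also have "L * sqrt (2 * ?N * (?N * (CA * \<delta>))) ^ 3 = L * sqrt (2 * ?N * (?N * CA)) ^ 3 * sqrt \<delta> ^ 3"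
    proof -
      have "2 * ?N * (?N * (CA * \<delta>)) = (2 * ?N * (?N * CA)) * \<delta>" by simp
      then show ?thesis by (simp only: real_sqrt_mult power_mult_distrib mult.assoc)
    qed
    also have "C2 * \<delta>\<^sup>2 \<le> C2 * sqrt (b0 - a0) * sqrt \<delta> ^ 3"
    proof -
      have "\<delta>\<^sup>2 = sqrt \<delta> * sqrt \<delta> ^ 3" using \<delta>(1) by (simp add: power2_eq_square power3_eq_cube)
      also have "\<dots> \<le> sqrt (b0 - a0) * sqrt \<delta> ^ 3" using \<delta> by (intro mult_right_mono) auto
      finally show ?thesis using C2 by (simp add: mult_left_mono mult.assoc)
    qed
    finally show ?thesis by (simp add: C_def \<delta>_def distrib_right)
  qed
  then show ?thesis using C by blast
qed

text \<open>Equal steps of length d n accumulate an error of order (b0 - a0) sqrt (d n), which tends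
  to 0. Within one step the source at time s is averaged with the slightly smaller \<sigma> = t -
  s2; once d n < t - b0 this satisfies \<sigma> \<le> t - s \<le> 2 \<sigma>, which explains the
  pairs for which \<open>H\<close> is required.\<close>

lemma max_principle:
  assumes \<eta>: "bumpy \<eta>" and t: "b0 < t" "t \<le> T" and ab: "a0 < b0" and S: "\<And>x. \<bar>Th \<eta> t a0 x\<bar> \<le> S"
    and H: "\<And>s \<sigma> x. a0 \<le> s \<Longrightarrow> s \<le> b0 \<Longrightarrow> t - b0 \<le> \<sigma> \<Longrightarrow> \<sigma> \<le> t - a0 \<Longrightarrow> \<sigma> \<le> t - s \<Longrightarrow> t - s \<le> 2 * \<sigma> \<Longrightarrow>
      \<bar>av ker (dil (sqrt \<sigma>)) (slc f0 \<eta> t s) x\<bar> \<le> H"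
  shows "\<bar>Th \<eta> t b0 x\<bar> \<le> S + H * (b0 - a0)"
proof -
  obtain C where C: "C \<ge> 0" and st: "\<And>s1 s2 S H x. a0 \<le> s1 \<Longrightarrow> s1 < s2 \<Longrightarrow> s2 \<le> b0 \<Longrightarrow> (\<And>x. \<bar>Th \<eta> t s1 x\<bar> \<le> S) \<Longrightarrow>
    (\<And>s x. s \<in> {s1..s2} \<Longrightarrow> \<bar>av ker (dil (sqrt (t - s2))) (slc f0 \<eta> t s) x\<bar> \<le> H) \<Longrightarrow>
    \<bar>Th \<eta> t s2 x\<bar> \<le> S + H * (s2 - s1) + C * sqrt (s2 - s1) ^ 3"
    using max_principle_step[OF \<eta> t ab] by blast
  define d where "d n = (b0 - a0) / real (Suc n)" for n
  have d: "d n > 0" "real (Suc n) * d n = b0 - a0" for n using ab by (auto simp: d_def)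
  have d0: "d \<longlonglongrightarrow> 0"
    unfolding d_def using tendsto_mult_right_zero[OF LIMSEQ_inverse_real_of_nat, of "b0 - a0"] by (simp add: divide_inverse)
  have main: "\<bar>Th \<eta> t b0 x\<bar> \<le> S + H * (b0 - a0) + C * (b0 - a0) * sqrt (d n)" if small: "d n < t - b0" for n
  proof -
    have "\<bar>Th \<eta> t (a0 + real j * d n) x\<bar> \<le> S + H * (real j * d n) + real j * (C * sqrt (d n) ^ 3)" if "j \<le> Suc n" for j x
      using that
    proof (induction j arbitrary: x)
      case 0 then show ?case using S by simp
    next
      case (Suc j)
      define s1 where "s1 = a0 + real j * d n"
      define s2 where "s2 = a0 + real (Suc j) * d n"
      have s12: "s2 - s1 = d n" by (simp add: s1_def s2_def algebra_simps)
      have "real (Suc j) * d n \<le> real (Suc n) * d n" using Suc.prems d(1)[of n] by (intro mult_right_mono) auto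
      then have s2: "s2 \<le> b0" using d(2)[of n] by (simp add: s2_def)
      have s1: "a0 \<le> s1" using d(1)[of n] by (simp add: s1_def)
      have "\<bar>Th \<eta> t s2 x\<bar> \<le> (S + H * (real j * d n) + real j * (C * sqrt (d n) ^ 3)) + H * (s2 - s1) + C * sqrt (s2 - s1) ^ 3"
      proof (rule st[OF s1 _ s2])
        show "s1 < s2" using s12 d(1)[of n] by linarith
        show "\<bar>Th \<eta> t s1 x\<bar> \<le> S + H * (real j * d n) + real j * (C * sqrt (d n) ^ 3)" for x
          unfolding s1_def using Suc by simp
        fix s x assume "s \<in> {s1..s2}"
        then show "\<bar>av ker (dil (sqrt (t - s2))) (slc f0 \<eta> t s) x\<bar> \<le> H"
          using s1 s2 s12 small d(1)[of n] by (intro H) auto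
      qed
      then show ?case unfolding s12 by (simp add: s2_def algebra_simps)
    qed
    from this[of "Suc n" x] have m1: "\<bar>Th \<eta> t b0 x\<bar> \<le> S + H * (b0 - a0) + real (Suc n) * (C * sqrt (d n) ^ 3)"
      unfolding d(2) by simp
    have "sqrt (d n) ^ 3 = d n * sqrt (d n)" using d(1)[of n] by (simp add: power3_eq_cube)
    then have "real (Suc n) * (C * sqrt (d n) ^ 3) = C * (real (Suc n) * d n) * sqrt (d n)" by (simp only: mult_ac)
    then show ?thesis using m1 unfolding d(2) by (simp only:)
  qed
  have "(\<lambda>n. S + H * (b0 - a0) + C * (b0 - a0) * sqrt (d n)) \<longlonglongrightarrow> S + H * (b0 - a0) + C * (b0 - a0) * sqrt 0"
    by (intro tendsto_intros d0)
  moreover have "\<forall>\<^sub>F n in sequentially. \<bar>Th \<eta> t b0 x\<bar> \<le> S + H * (b0 - a0) + C * (b0 - a0) * sqrt (d n)"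
    using order_tendstoD(2)[OF d0, of "t - b0"] t by (auto elim!: eventually_mono intro: main)
  ultimately show ?thesis by (intro tendsto_lowerbound[where F = sequentially]) auto
qed

end

section \<open>The modulus of continuity of the right-hand side\<close>

context kolmogorov
begin

abbreviation qn :: "(real, 'n) vec \<Rightarrow> real" where "qn \<equiv> qnorm ms"

lemma qn_def: "qn x = (\<Sum>i\<in>UNIV. \<bar>x $ i\<bar> powr (1 / real (2 * b i + 1)))"
  by (simp add: qnorm_def kqexp_def)

lemma qn_nonneg: "qn x \<ge> 0"
  by (simp add: qn_def sum_nonneg)

lemma qn_dil: assumes "r \<ge> 0" shows "qn (dil r z) = r * qn z"
proof -
  have "(r ^ n) powr (1 / real n) = r" if "n > 0" for n
    using assms that by (cases "r = 0") (simp_all add: powr_powr flip: powr_realpow)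
  from this[of "2 * b i + 1" for i] have 1: "\<bar>r ^ (2 * b i + 1)\<bar> powr (1 / real (2 * b i + 1)) = r" for i
    using assms by (simp del: power_Suc)
  have "\<bar>dil r z $ i\<bar> powr (1 / real (2 * b i + 1)) = r * \<bar>z $ i\<bar> powr (1 / real (2 * b i + 1))" for i
  proof -
    have "dil r z $ i = r ^ (2 * b i + 1) * z $ i" by (simp add: dil_nth)
    then show ?thesis by (simp only: abs_mult powr_mult abs_ge_zero 1)
  qed
  then show ?thesis unfolding qn_def by (simp only: sum_distrib_left)
qed

lemma qn_le: "qn z \<le> real CARD('n) * (1 + norm z)"
proof -
  have "\<bar>z $ i\<bar> powr (1 / real (2 * b i + 1)) \<le> 1 + norm z" for i
  proof (cases "\<bar>z $ i\<bar> \<le> 1")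
    case True
    then have "\<bar>z $ i\<bar> powr (1 / real (2 * b i + 1)) \<le> 1" by (intro powr_le1) auto
    then show ?thesis using norm_ge_zero[of z] by linarith
  next
    case False
    then have "\<bar>z $ i\<bar> powr (1 / real (2 * b i + 1)) \<le> \<bar>z $ i\<bar> powr 1" by (intro powr_mono) auto
    then show ?thesis using False component_le_norm_cart[of z i] by simp
  qed
  then have "qn z \<le> (\<Sum>i\<in>(UNIV::'n set). 1 + norm z)" unfolding qn_def by (intro sum_mono)
  then show ?thesis by simp
qed

text \<open>An upper bound for all exponents 2 b i + 1, serving as the polynomial growth order of
  the modulus.\<close>

definition qN :: nat where "qN = 2 * length ms + 1"

text \<open>Every exponent 2 b i + 1 is at most \<open>qN\<close>, so division of all coordinates by
  n^qN shrinks at least as much as the dilation by 1 / n. An isotropic factor is needed to walk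
  along a straight segment.\<close>

lemma qn_scaleR: assumes "n > 0" shows "qn ((1 / real n ^ qN) *\<^sub>R z) \<le> qn z / real n"
proof -
  have n: "real n \<ge> 1" using assms by simp
  have "\<bar>((1 / real n ^ qN) *\<^sub>R z) $ i\<bar> powr (1 / real (2 * b i + 1)) \<le> (1 / real n) * \<bar>z $ i\<bar> powr (1 / real (2 * b i + 1))" for i
  proof -
    have "1 / real n ^ qN \<le> (1 / real n) ^ (2 * b i + 1)"
      using n b_less[of i] by (simp add: power_one_over qN_def frac_le power_increasing)
    then have "(1 / real n ^ qN) powr (1 / real (2 * b i + 1)) \<le> ((1 / real n) ^ (2 * b i + 1)) powr (1 / real (2 * b i + 1))"
      by (intro powr_mono2) auto
    also have "\<dots> = 1 / real n" using n by (subst powr_realpow[symmetric]) (simp_all add: powr_powr del: power_Suc)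
    finally have "(1 / real n ^ qN) powr (1 / real (2 * b i + 1)) * \<bar>z $ i\<bar> powr (1 / real (2 * b i + 1)) \<le> (1 / real n) * \<bar>z $ i\<bar> powr (1 / real (2 * b i + 1))"
      by (rule mult_right_mono) simp
    moreover have "\<bar>((1 / real n ^ qN) *\<^sub>R z) $ i\<bar> powr p = (1 / real n ^ qN) powr p * \<bar>z $ i\<bar> powr p" for p
      unfolding vector_scaleR_component real_scaleR_def abs_mult by (subst powr_mult) auto
    ultimately show ?thesis by simp
  qed
  then have "qn ((1 / real n ^ qN) *\<^sub>R z) \<le> (\<Sum>i\<in>UNIV. (1 / real n) * \<bar>z $ i\<bar> powr (1 / real (2 * b i + 1)))"
    unfolding qn_def by (intro sum_mono)
  then show ?thesis by (simp add: qn_def sum_divide_distrib)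
qed

end

section \<open>The modulus w and the integrals built from it\<close>

context kolmogorov_solution
begin

abbreviation w :: "real \<Rightarrow> real" where "w \<equiv> omega ms T f"

lemma f_diff_le: assumes "t < T" shows "\<bar>f (x, t) - f (y, t)\<bar> \<le> 2 * Mf"
proof -
  have "\<bar>f0 (x, t)\<bar> \<le> Mf" "\<bar>f0 (y, t)\<bar> \<le> Mf" by (rule Mf)+
  then show ?thesis using assms by (simp add: f0_def ST_def)
qed

lemma w_bdd: "bdd_above {\<bar>f (x, t) - f (y, t)\<bar> | x y t. t < T \<and> qn (x - y) \<le> r}"
  using f_diff_le by (intro bdd_aboveI[of _ "2 * Mf"]) auto

lemma w_ge: "t < T \<Longrightarrow> qn (x - y) \<le> r \<Longrightarrow> \<bar>f (x, t) - f (y, t)\<bar> \<le> w r"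
  unfolding omega_def by (rule cSup_upper[OF _ w_bdd]) auto

lemma w_leI: assumes "r \<ge> 0" "\<And>x y t. t < T \<Longrightarrow> qn (x - y) \<le> r \<Longrightarrow> \<bar>f (x, t) - f (y, t)\<bar> \<le> C" shows "w r \<le> C"
  unfolding omega_def
proof (rule cSup_least)
  have "qn (0 - 0) \<le> r" using assms(1) by (simp add: qn_def)
  then show "{\<bar>f (x, t) - f (y, t)\<bar> | x y t. t < T \<and> qn (x - y) \<le> r} \<noteq> {}"
    using \<tau>T by blast
qed (use assms in auto)

lemma w_nonneg: "r \<ge> 0 \<Longrightarrow> w r \<ge> 0"
  using w_ge[of \<tau> 0 0 r] \<tau>T by (simp add: qn_def)

lemma w_bound: "r \<ge> 0 \<Longrightarrow> w r \<le> 2 * Mf"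
  by (rule w_leI) (auto intro: f_diff_le)

lemma w_mono: "0 \<le> r \<Longrightarrow> r \<le> s \<Longrightarrow> w r \<le> w s"
  by (rule w_leI) (auto intro: w_ge)

text \<open>The segment from y to x is cut into n^qN equal pieces, each of homogeneous norm at most
  r. The resulting polynomial growth of the modulus can be absorbed by moments of the
  kernel.\<close>

lemma w_scale: assumes r: "r \<ge> 0" and n: "n > 0" shows "w (real n * r) \<le> real n ^ qN * w r"
proof (rule w_leI)
  fix x y t assume t: "t < T" and q: "qn (x - y) \<le> real n * r"
  define m where "m = n ^ qN"
  define h where "h = (1 / real n ^ qN) *\<^sub>R (x - y)"
  have m: "m > 0" using n by (simp add: m_def)
  have h: "qn h \<le> r"
  proof -
    have "qn h \<le> qn (x - y) / real n" unfolding h_def by (rule qn_scaleR[OF n])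
    also have "\<dots> \<le> r" using q n by (simp add: field_simps)
    finally show ?thesis .
  qed
  have "\<bar>f (y + real j *\<^sub>R h, t) - f (y, t)\<bar> \<le> real j * w r" for j
  proof (induction j)
    case (Suc j)
    have "\<bar>f (y + real (Suc j) *\<^sub>R h, t) - f (y + real j *\<^sub>R h, t)\<bar> \<le> w r"
      by (rule w_ge[OF t]) (use h in \<open>simp add: scaleR_left_distrib\<close>)
    then show ?case using Suc by (simp add: algebra_simps)
  qed simp
  from this[of m] have "\<bar>f (y + real m *\<^sub>R h, t) - f (y, t)\<bar> \<le> real m * w r" .
  moreover have "real m *\<^sub>R h = x - y" using n by (simp add: m_def h_def)
  ultimately show "\<bar>f (x, t) - f (y, t)\<bar> \<le> real n ^ qN * w r" by (simp add: m_def)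
qed (use r in simp)

lemma w_scale': assumes "r \<ge> 0" "c \<ge> 0" shows "w (c * r) \<le> (1 + c) ^ qN * w r"
proof -
  define n where "n = nat \<lceil>c\<rceil>"
  have n: "c \<le> real n" "real n \<le> 1 + c" using assms unfolding n_def by linarith+
  show ?thesis
  proof (cases "n = 0")
    case True
    then have "c = 0" using n assms by simp
    then show ?thesis using w_mono[of 0 r] assms w_nonneg[of r] by simp
  next
    case False
    have "w (c * r) \<le> w (real n * r)" using n assms by (intro w_mono mult_right_mono) auto
    also have "\<dots> \<le> real n ^ qN * w r" using False assms by (intro w_scale) auto
    also have "\<dots> \<le> (1 + c) ^ qN * w r" using n assms w_nonneg by (intro mult_right_mono power_mono) auto
    finally show ?thesis .
  qed
qed

definition wi :: "real \<Rightarrow> real" where "wi s = w s / s\<^sup>2"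
definition wo :: "real \<Rightarrow> real" where "wo s = w s / s"
definition NN :: "real \<Rightarrow> real" where "NN r = r * integral {r..} wi"
definition Ph :: "real \<Rightarrow> real" where "Ph r = integral {0..r} wo + NN r"

lemma Mfun_Ph: "Mfun ms T f r = w r + Ph r"
  by (simp add: Mfun_def Ph_def NN_def wi_def[abs_def] wo_def[abs_def])

text \<open>At negative radii \<open>omega\<close> is a supremum over the empty set. Cutting the
  argument off at 0 gives a function monotone on the whole line, hence Borel.\<close>

lemma w_borel: "(\<lambda>s. w (max 0 s)) \<in> borel_measurable borel"
  by (rule borel_measurable_mono) (auto intro!: monoI w_mono)

lemma wi_integrable: assumes "r > 0" shows "wi integrable_on {r..}"
proof -
  have g: "(\<lambda>s. 2 * Mf * (1 / s ^ 2)) integrable_on {r..}"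
    using has_integral_mult_right[OF has_integral_inverse_power_to_inf[of 2 r], of "2 * Mf"] assms
    unfolding integrable_on_def by auto
  have "(\<lambda>s. w (max 0 s) / s\<^sup>2) integrable_on {r..}"
  proof (rule measurable_bounded_by_integrable_imp_integrable[OF _ g])
    have "(\<lambda>s. w (max 0 s) / s\<^sup>2) \<in> borel_measurable borel" using w_borel by measurable
    then show "(\<lambda>s. w (max 0 s) / s\<^sup>2) \<in> borel_measurable (lebesgue_on {r..})"
      by (intro measurable_restrict_space1 measurable_completion) simp
    show "norm (w (max 0 s) / s\<^sup>2) \<le> 2 * Mf * (1 / s ^ 2)" if "s \<in> {r..}" for s
      using w_bound[of "max 0 s"] w_nonneg[of "max 0 s"] by (simp add: divide_right_mono)
  qed simp
  then show ?thesis by (rule integrable_eq) (use assms in \<open>auto simp: wi_def\<close>)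
qed

lemma wi_integrable': "r > 0 \<Longrightarrow> wi integrable_on {r..s}"
  by (rule integrable_on_subinterval[OF wi_integrable]) auto

text \<open>The Dini condition covers the unit interval; beyond 1 the integrand is measurable and
  bounded.\<close>

lemma wo_integrable: "wo integrable_on {0..r}"
proof -
  have 1: "wo integrable_on {0..1}" using Df by (simp add: inD_def wo_def[abs_def])
  show ?thesis
  proof (cases "r \<le> 1")
    case True then show ?thesis by (intro integrable_on_subinterval[OF 1]) auto
  next
    case False
    have "(\<lambda>s. w (max 0 s) / s) integrable_on {1..r}"
    proof (rule measurable_bounded_by_integrable_imp_integrable[of _ _ "\<lambda>_. 2 * Mf"])
      have "(\<lambda>s. w (max 0 s) / s) \<in> borel_measurable borel" using w_borel by measurable
      then show "(\<lambda>s. w (max 0 s) / s) \<in> borel_measurable (lebesgue_on {1..r})"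
        by (intro measurable_restrict_space1 measurable_completion) simp
      show "norm (w (max 0 s) / s) \<le> 2 * Mf" if "s \<in> {1..r}" for s
      proof -
        have "w (max 0 s) / s \<le> 2 * Mf / 1" using w_bound[of "max 0 s"] that Mf(1) by (intro frac_le) auto
        then show ?thesis using that w_nonneg[of "max 0 s"] by simp
      qed
    qed auto
    then have "wo integrable_on {1..r}" by (rule integrable_eq) (auto simp: wo_def)
    then show ?thesis using Henstock_Kurzweil_Integration.integrable_combine[OF _ _ 1] False by auto
  qed
qed

lemma wo_integrable': "0 \<le> r \<Longrightarrow> wo integrable_on {r..s}"
  by (rule integrable_on_subinterval[OF wo_integrable[of s]]) auto

lemma wi_split: assumes "0 < r" "r \<le> s" shows "integral {r..} wi = integral {r..s} wi + integral {s..} wi"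
proof -
  have "{r..s} \<union> {s..} = {r..}" "{r..s} \<inter> {s..} = {s}" using assms by auto
  then show ?thesis
    using integral_Un[of wi "{r..s}" "{s..}"] wi_integrable[of s] wi_integrable'[of r s] assms by auto
qed

lemma wi_nonneg: "0 < r \<Longrightarrow> integral {r..} wi \<ge> 0" "0 < r \<Longrightarrow> integral {r..s} wi \<ge> 0"
  by (intro integral_nonneg wi_integrable wi_integrable'; auto simp: wi_def w_nonneg)+

text \<open>The modulus is monotone, and the integral of 1 / s^2 over [r, 2 r] is 1 / (2 r).\<close>

lemma w_le_integral: assumes r: "r > 0" shows "w r \<le> 2 * r * integral {r..2 * r} wi"
proof -
  have c: "((\<lambda>s. w r * (1 / s\<^sup>2)) has_integral w r * (- (1 / (2 * r)) - - (1 / r))) {r..2 * r}"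
  proof (intro has_integral_mult_right fundamental_theorem_of_calculus)
    fix s assume "s \<in> {r..2 * r}"
    then have "((\<lambda>s. - (1 / s)) has_real_derivative 1 / s\<^sup>2) (at s)"
      using r by (auto intro!: derivative_eq_intros simp: power2_eq_square field_simps)
    then show "((\<lambda>s. - (1 / s)) has_vector_derivative 1 / s\<^sup>2) (at s within {r..2 * r})"
      by (auto simp: has_real_derivative_iff_has_vector_derivative intro: has_vector_derivative_at_within)
  qed (use r in auto)
  have "w r * (- (1 / (2 * r)) - - (1 / r)) \<le> integral {r..2 * r} wi"
    using c by (rule has_integral_le[OF _ integrable_integral[OF wi_integrable'[OF r]]])
      (use r in \<open>auto simp: wi_def intro!: divide_right_mono w_mono\<close>)
  then have "w r / (2 * r) \<le> integral {r..2 * r} wi" using r by (simp add: field_simps)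
  then show ?thesis using r by (simp add: field_simps)
qed

lemma w_le_NN: assumes r: "r > 0" shows "w r \<le> 2 * NN r"
proof -
  have "w r \<le> 2 * r * integral {r..2 * r} wi" by (rule w_le_integral[OF r])
  also have "\<dots> \<le> 2 * r * integral {r..} wi"
    using r wi_split[of r "2 * r"] wi_nonneg(1)[of "2 * r"] by (intro mult_left_mono) auto
  finally show ?thesis by (simp add: NN_def)
qed

lemma NN_nonneg: "r > 0 \<Longrightarrow> NN r \<ge> 0"
  using wi_nonneg(1) by (simp add: NN_def)

lemma wo_split: "0 \<le> r \<Longrightarrow> r \<le> s \<Longrightarrow> integral {0..s} wo = integral {0..r} wo + integral {r..s} wo"
  using Henstock_Kurzweil_Integration.integral_combine[of 0 r s wo] wo_integrable by simp

lemma wo_ge_wi: assumes r: "0 < r" "r \<le> s" shows "r * integral {r..s} wi \<le> integral {r..s} wo"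
proof -
  have "integral {r..s} (\<lambda>x. r * wi x) \<le> integral {r..s} wo"
  proof (rule integral_le)
    show "(\<lambda>x. r * wi x) integrable_on {r..s}" using wi_integrable'[OF r(1)] by (rule integrable_on_cmult_left[where 'b = real, simplified])
    show "wo integrable_on {r..s}" using r by (intro wo_integrable') auto
    fix x assume x: "x \<in> {r..s}"
    then have "r * w x \<le> x * w x" using r w_nonneg[of x] by (intro mult_right_mono) auto
    then show "r * wi x \<le> wo x" using x r by (simp add: wi_def wo_def power2_eq_square field_simps)
  qed
  then show ?thesis by simp
qed

text \<open>Formally the derivative of \<open>Ph\<close> at r is NN r / r, since the two
  contributions w r / r cancel. The integrated form over [r, 2 r] lets dyadic sums of
  \<open>NN\<close> be replaced by increments of \<open>Ph\<close>.\<close>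

lemma Ph_double: assumes r: "r > 0" shows "NN (2 * r) \<le> 2 * (Ph (2 * r) - Ph r)"
proof -
  have "Ph (2 * r) - Ph r = integral {r..2 * r} wo + 2 * r * integral {2 * r..} wi - r * (integral {r..2 * r} wi + integral {2 * r..} wi)"
    using r wo_split[of r "2 * r"] wi_split[of r "2 * r"] by (simp add: Ph_def NN_def)
  also have "\<dots> \<ge> r * integral {2 * r..} wi" using wo_ge_wi[of r "2 * r"] r by (simp add: algebra_simps)
  finally show ?thesis by (simp add: NN_def)
qed

lemma Ph_mono: assumes r: "0 < r" "r \<le> s" shows "Ph r \<le> Ph s"
proof -
  have "Ph s - Ph r = integral {r..s} wo - r * integral {r..s} wi + (s - r) * integral {s..} wi"
    using r wo_split[of r s] wi_split[of r s] by (simp add: Ph_def NN_def algebra_simps)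
  also have "\<dots> \<ge> 0" using wo_ge_wi[OF r] wi_nonneg(1)[of s] r by simp
  finally show ?thesis by simp
qed

lemma NN_le_Ph: "r > 0 \<Longrightarrow> NN r \<le> Ph r"
  unfolding Ph_def by (simp, intro integral_nonneg wo_integrable) (auto simp: wo_def w_nonneg)

lemma Ph_nonneg: "r > 0 \<Longrightarrow> Ph r \<ge> 0"
  using NN_le_Ph NN_nonneg by force

end

section \<open>Iterated differences of the solution\<close>

primrec difs :: "'a::ab_group_add list \<Rightarrow> ('a \<Rightarrow> real) \<Rightarrow> 'a \<Rightarrow> real" where
  "difs [] G = G"
| "difs (h # hs) G = dif h (difs hs G)"

lemma dif_commute: "dif h (dif k G) = dif k (dif h G)"
  by (rule ext) (simp add: dif_def add.assoc add.commute[of h k])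

lemma difs_dif: "difs hs (dif h G) = dif h (difs hs G)"
  by (induction hs) (simp_all add: dif_commute)

lemma difs_le: "(\<And>x. \<bar>G x\<bar> \<le> C) \<Longrightarrow> \<bar>difs hs G x\<bar> \<le> 2 ^ length hs * C"
proof (induction hs arbitrary: x)
  case (Cons h hs)
  have "\<bar>difs hs G (x + h)\<bar> \<le> 2 ^ length hs * C" "\<bar>difs hs G x\<bar> \<le> 2 ^ length hs * C"
    using Cons by blast+
  then show ?case by (simp add: dif_def)
qed simp

lemma dif_borel:
  assumes [measurable]: "G \<in> borel_measurable borel" shows "dif (h :: 'a::euclidean_space) G \<in> borel_measurable borel"
  unfolding dif_def[abs_def] by measurable

lemma difs_borel: "G \<in> borel_measurable borel \<Longrightarrow> difs (hs :: 'a::euclidean_space list) G \<in> borel_measurable borel"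
  by (induction hs) (auto intro: dif_borel)

lemma difs_tendsto: "(\<And>x. (\<lambda>n. G n x) \<longlonglongrightarrow> g x) \<Longrightarrow> (\<lambda>n. difs hs (G n) x) \<longlonglongrightarrow> difs hs g x"
  by (induction hs arbitrary: x) (auto simp: dif_def intro!: tendsto_diff)

text \<open>The factor gained when differences with these shifts are moved onto a kernel with weight
  \<open>expn\<close>, one factor per shift as in \<open>bdk_dif\<close>.\<close>

definition shift_weight :: "'a::euclidean_space list \<Rightarrow> real" where
  "shift_weight hs = (\<Prod>h\<leftarrow>hs. norm h * exp (norm h))"

lemma shift_weight_Nil [simp]: "shift_weight [] = 1" and shift_weight_Cons: "shift_weight (h # hs) = (norm h * exp (norm h)) * shift_weight hs"
  by (simp_all add: shift_weight_def)

lemma shift_weight_nonneg: "shift_weight hs \<ge> 0"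
  by (induction hs) (auto simp: shift_weight_Cons)

lemma bdk_difs:
  fixes \<kappa> :: "'a::euclidean_space \<Rightarrow> real"
  shows "bdk (length hs) (\<lambda>x. C * expn x) \<kappa> \<Longrightarrow> bdk 0 (\<lambda>x. (C * shift_weight hs) * expn x) (difs hs \<kappa>)"
proof (induction hs arbitrary: \<kappa> C)
  case Nil then show ?case by simp
next
  case (Cons h hs)
  have "bdk (Suc (length hs)) (\<lambda>x. C * expn x) \<kappa>" using Cons.prems by (simp del: bdk.simps)
  from Cons.IH[OF bdk_dif[OF this, of h]] show ?case by (simp add: difs_dif shift_weight_Cons mult.assoc del: bdk.simps)
qed

lemma bdk_expn_integrable: "bdk n (\<lambda>x. C * expn x) (\<kappa> :: 'a::euclidean_space \<Rightarrow> real) \<Longrightarrow> integrable lborel \<kappa>"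
  by (rule Bochner_Integration.integrable_bound[OF integrable_mult_right[OF integrable_expn, of C]])
     (auto intro!: AE_I2 order_trans[OF _ abs_ge_self] bdk_borel[of n] dest: bdk_le)

lemma integral_difs_transfer:
  fixes \<kappa> G :: "'a::euclidean_space \<Rightarrow> real" and m m' :: "'a \<Rightarrow> 'a"
  assumes m: "bounded_linear m" and hs: "\<And>h. h \<in> set hs \<Longrightarrow> m (m' h) = h"
    and \<kappa>: "bdk (length hs) (\<lambda>x. C' * expn x) \<kappa>"
    and G: "G \<in> borel_measurable borel" "\<And>x. \<bar>G x\<bar> \<le> C"
  shows "(\<integral>z. \<kappa> z * difs hs G (x - m z) \<partial>lborel) = (\<integral>z. difs (map m' hs) \<kappa> z * G (x - m z) \<partial>lborel)"
  using hs \<kappa>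
proof (induction hs arbitrary: \<kappa> C')
  case (Cons h hs)
  have b: "bdk (Suc (length hs)) (\<lambda>x. C' * expn x) \<kappa>" using Cons.prems by (simp del: bdk.simps)
  have "(\<integral>z. \<kappa> z * difs (h # hs) G (x - m z) \<partial>lborel) = (\<integral>z. dif (m' h) \<kappa> z * difs hs G (x - m z) \<partial>lborel)"
    using integral_dif_transfer[OF m _ bdk_borel[OF b] bdk_expn_integrable[OF b] difs_borel[of G hs] difs_le[of G C hs], of "m' h" h x] G
      Cons.prems(1) by simp
  also have "\<dots> = (\<integral>z. difs (map m' hs) (dif (m' h) \<kappa>) z * G (x - m z) \<partial>lborel)"
    by (rule Cons.IH[OF _ bdk_dif[OF b]]) (use Cons.prems in auto)
  finally show ?case by (simp add: difs_dif)
qed simp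

lemma integral_dif_zero:
  fixes \<kappa> :: "'a::euclidean_space \<Rightarrow> real"
  assumes "\<kappa> \<in> borel_measurable borel" "integrable lborel \<kappa>"
  shows "(\<integral>z. dif h \<kappa> z \<partial>lborel) = 0" "integrable lborel (dif h \<kappa>)"
  using integral_translate[OF assms(1), of h] assms(2) by (simp_all add: dif_def[abs_def] add.commute[of _ h])

text \<open>Differencing destroys the mean of the kernel, so a constant may be subtracted from the
  function it is integrated against.\<close>

lemma integral_difs_zero:
  fixes \<kappa> :: "'a::euclidean_space \<Rightarrow> real"
  assumes "bdk (length hs) (\<lambda>x. C * expn x) \<kappa>" "hs \<noteq> []"
  shows "(\<integral>z. difs hs \<kappa> z \<partial>lborel) = 0"
proof -
  obtain h hs' where hs: "hs = h # hs'" using assms(2) by (cases hs) auto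
  have "bdk (length hs') (\<lambda>x. C * expn x) \<kappa>" using assms(1) bdk_Suc by (simp add: hs del: bdk.simps)
  from bdk_difs[OF this] have "integrable lborel (difs hs' \<kappa>)" "difs hs' \<kappa> \<in> borel_measurable borel"
    using bdk_expn_integrable bdk_borel by blast+
  then show ?thesis using integral_dif_zero(1)[of "difs hs' \<kappa>" h] by (simp add: hs)
qed

lemma smooth_shift: "smooth f \<Longrightarrow> smooth (\<lambda>x. f (x + h :: 'a::euclidean_space))"
  by (rule smooth_compose[of f "\<lambda>x. x + h"])
     (simp_all add: inner_add_left, intro smooth_add smooth_const, intro smooth_linear bounded_linear_inner_left)

lemma bumpy_dif: assumes "bumpy (\<eta> :: 'a::euclidean_space \<Rightarrow> real)" shows "bumpy (dif h \<eta>)"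
proof -
  obtain R where R: "\<And>x. norm x > R \<Longrightarrow> \<eta> x = 0" and s: "smooth \<eta>" using assms by (auto simp: bumpy_def)
  have "dif h \<eta> x = 0" if "norm x > R + norm h" for x
  proof -
    have "norm (x + h) > R" "norm x > R" using that norm_triangle_ineq4[of "x + h" h] norm_ge_zero[of h] unfolding add_diff_cancel_right' by linarith+
    then show ?thesis using R by (simp add: dif_def)
  qed
  then show ?thesis using s by (auto simp: bumpy_def dif_def[abs_def] intro!: smooth_diff smooth_shift)
qed

lemma bumpy_difs: "bumpy (\<eta> :: 'a::euclidean_space \<Rightarrow> real) \<Longrightarrow> bumpy (difs hs \<eta>)"
  by (induction hs) (auto intro: bumpy_dif)

section \<open>Averages of differences at a given scale\<close>

context kolmogorov
begin

definition KE :: real where "KE = (SOME C. C \<ge> 0 \<and> (\<forall>\<theta>\<in>{-2..2}. \<forall>z. norm (E \<theta> *v z) \<le> C * norm z))"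

lemma KE: "KE \<ge> 0" "\<theta> \<in> {-2..2} \<Longrightarrow> norm (E \<theta> *v z) \<le> KE * norm z"
proof -
  have "compact ((\<lambda>\<theta>. \<Sum>i\<in>UNIV. \<Sum>l\<in>UNIV. \<bar>E \<theta> $ i $ l\<bar>) ` {-2..2})"
    by (intro compact_continuous_image continuous_intros) auto
  then obtain C where "\<forall>r\<in>(\<lambda>\<theta>. \<Sum>i\<in>UNIV. \<Sum>l\<in>UNIV. \<bar>E \<theta> $ i $ l\<bar>) ` {-2..2}. \<bar>r\<bar> \<le> C"
    using compact_imp_bounded bounded_real by metis
  then have C: "(\<Sum>i\<in>UNIV. \<Sum>l\<in>UNIV. \<bar>E \<theta> $ i $ l\<bar>) \<le> C" if "\<theta> \<in> {-2..2}" for \<theta>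
    using that by (meson abs_le_D1 imageI)
  have "norm (E \<theta> *v z) \<le> C * norm z" if "\<theta> \<in> {-2..2}" for \<theta> z
  proof -
    have "norm (E \<theta> *v z) \<le> (\<Sum>i\<in>UNIV. \<bar>(E \<theta> *v z) $ i\<bar>)" by (rule norm_le_l1_cart)
    also have "\<dots> \<le> (\<Sum>i\<in>UNIV. \<Sum>l\<in>UNIV. \<bar>E \<theta> $ i $ l\<bar> * norm z)"
      unfolding matrix_vector_mult_def vec_lambda_beta
      by (intro sum_mono order_trans[OF sum_abs]) (auto simp: abs_mult intro!: mult_left_mono component_le_norm_cart)
    also have "\<dots> = (\<Sum>i\<in>UNIV. \<Sum>l\<in>UNIV. \<bar>E \<theta> $ i $ l\<bar>) * norm z" by (simp add: sum_distrib_right)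
    also have "\<dots> \<le> C * norm z" using C[OF that] by (intro mult_right_mono) auto
    finally show ?thesis .
  qed
  moreover have "C \<ge> 0" using C[of 0] by (auto intro: order_trans[OF sum_nonneg[OF sum_nonneg]])
  ultimately have "\<exists>C. C \<ge> 0 \<and> (\<forall>\<theta>\<in>{-2..2}. \<forall>z. norm (E \<theta> *v z) \<le> C * norm z)" by blast
  from someI_ex[OF this, folded KE_def] show "KE \<ge> 0" "\<theta> \<in> {-2..2} \<Longrightarrow> norm (E \<theta> *v z) \<le> KE * norm z" by blast+
qed

definition KQ :: real where "KQ = real CARD('n) * (1 + KE)"

lemma KQ_nonneg: "KQ \<ge> 0" using KE(1) by (simp add: KQ_def)

text \<open>Rescaling turns the time s into s / r^2 in [-2, 2], where \<open>KE\<close> applies;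
  over such times the drift keeps displacements of size r at size r.\<close>

lemma qn_E_dil:
  assumes "r \<ge> 0" "\<bar>s\<bar> \<le> 2 * r\<^sup>2"
  shows "qn (E s *v dil r z) \<le> (KQ * (1 + norm z)) * r"
proof (cases "r = 0")
  case True
  then have "dil r z = 0" by (simp add: vec_eq_iff)
  then show ?thesis using True by (simp add: qn_def)
next
  case False
  define \<theta> where "\<theta> = s / r\<^sup>2"
  have th: "\<theta> \<in> {-2..2}" using assms False by (auto simp: \<theta>_def abs_le_iff field_simps)
  have "E s *v dil r z = dil r (E \<theta> *v z)" using False by (simp add: \<theta>_def flip: Emat_dil)
  then have "qn (E s *v dil r z) = r * qn (E \<theta> *v z)" using qn_dil[OF assms(1)] by simp
  also have "\<dots> \<le> r * (real CARD('n) * (1 + KE * norm z))"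
    using assms KE(2)[OF th, of z] by (intro mult_left_mono order_trans[OF qn_le]) auto
  also have "\<dots> \<le> r * (real CARD('n) * ((1 + KE) * (1 + norm z)))"
    using assms KE(1) by (intro mult_left_mono) (auto simp: algebra_simps)
  finally show ?thesis by (simp add: KQ_def mult_ac)
qed

text \<open>Product of the derivative bound of the kernel, the growth constant of the modulus and
  the moment of order \<open>qN\<close> of the weight.\<close>

definition CH :: real where "CH = CK * (1 + KQ) ^ qN * (\<integral>z. (1 + norm z) ^ qN * expn (z::(real, 'n) vec) \<partial>lborel)"

lemma CH_nonneg: "CH \<ge> 0"
  unfolding CH_def using CK(1) KQ_nonneg by (intro mult_nonneg_nonneg Bochner_Integration.integral_nonneg zero_le_power) auto

text \<open>The differences are moved onto the kernel, which at unit scale sees the shifts dil (1 /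
  r) h. The differenced kernel has mean zero, so \<open>G\<close> may be replaced by its oscillation
  around x, whose polynomial growth is integrable against the weight.\<close>

lemma av_difs_le:
  assumes r: "r > 0" and hs: "hs \<noteq> []" "length hs \<le> 3"
    and G: "G \<in> borel_measurable borel" "\<And>x. \<bar>G x\<bar> \<le> C"
    and om: "\<And>z. \<bar>G (x - dil r z) - G x\<bar> \<le> ((1 + KQ) * (1 + norm z)) ^ qN * W"
  shows "\<bar>av ker (dil r) (difs hs G) x\<bar> \<le> CH * shift_weight (map (dil (1 / r)) hs) * W"
proof -
  let ?hs = "map (dil (1 / r)) hs" and ?I = "\<integral>z. (1 + norm z) ^ qN * expn (z::(real, 'n) vec) \<partial>lborel"
  have bk: "bdk (length hs) (\<lambda>x. CK * expn x) ker" using bdk_antimono[OF CK(2) hs(2)] .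
  then have bk': "bdk (length ?hs) (\<lambda>x. CK * expn x) ker" by (simp del: bdk.simps)
  define \<kappa> where "\<kappa> = difs ?hs ker"
  have \<kappa>: "bdk 0 (\<lambda>x. (CK * shift_weight ?hs) * expn x) \<kappa>" unfolding \<kappa>_def by (rule bdk_difs[OF bk'])
  have [measurable]: "\<kappa> \<in> borel_measurable borel" using bdk_borel[OF \<kappa>] .
  have z: "(\<integral>z. \<kappa> z \<partial>lborel) = 0" unfolding \<kappa>_def using integral_difs_zero[OF bk'] hs by simp
  have i\<kappa>: "integrable lborel \<kappa>" using bdk_expn_integrable[OF \<kappa>] .
  note [measurable] = G(1)
  have iG: "integrable lborel (\<lambda>z. \<kappa> z * G (x - dil r z))"
  proof (rule Bochner_Integration.integrable_bound)
    show "integrable lborel (\<lambda>z. \<bar>\<kappa> z\<bar> * C)" using i\<kappa> by simp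
    show "AE z in lborel. norm (\<kappa> z * G (x - dil r z)) \<le> norm (\<bar>\<kappa> z\<bar> * C)"
      using mult_left_mono[OF order_trans[OF G(2) abs_ge_self] abs_ge_zero] by (intro AE_I2) (simp add: abs_mult)
  qed measurable
  have "av ker (dil r) (difs hs G) x = (\<integral>z. \<kappa> z * G (x - dil r z) \<partial>lborel)"
    unfolding av_def \<kappa>_def using r
    by (intro integral_difs_transfer[OF bounded_linear_dil _ bk G]) (auto simp: dil_inverse)
  also have "\<dots> = (\<integral>z. \<kappa> z * (G (x - dil r z) - G x) \<partial>lborel)"
    using iG i\<kappa> z by (simp add: right_diff_distrib)
  finally have "\<bar>av ker (dil r) (difs hs G) x\<bar> \<le> (\<integral>z. \<bar>\<kappa> z * (G (x - dil r z) - G x)\<bar> \<partial>lborel)"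
    using integral_abs_bound by metis
  also have "\<dots> \<le> (\<integral>z. (CK * shift_weight ?hs * (1 + KQ) ^ qN * W) * ((1 + norm z) ^ qN * expn (z::(real, 'n) vec)) \<partial>lborel)"
  proof (rule Bochner_Integration.integral_mono)
    show "integrable lborel (\<lambda>z. \<bar>\<kappa> z * (G (x - dil r z) - G x)\<bar>)"
      using iG i\<kappa> by (simp add: right_diff_distrib)
    show "integrable lborel (\<lambda>z. (CK * shift_weight ?hs * (1 + KQ) ^ qN * W) * ((1 + norm z) ^ qN * expn (z::(real, 'n) vec)))"
      by (intro integrable_mult_right integrable_power_expn)
    fix z :: "(real, 'n) vec"
    have "\<bar>\<kappa> z\<bar> * \<bar>G (x - dil r z) - G x\<bar> \<le> (CK * shift_weight ?hs * expn z) * (((1 + KQ) * (1 + norm z)) ^ qN * W)"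
      using bdk_le[OF \<kappa>, of z] om[of z] by (intro mult_mono) (auto intro: order_trans[OF abs_ge_zero])
    then show "\<bar>\<kappa> z * (G (x - dil r z) - G x)\<bar> \<le> (CK * shift_weight ?hs * (1 + KQ) ^ qN * W) * ((1 + norm z) ^ qN * expn z)"
      by (simp add: abs_mult power_mult_distrib mult_ac)
  qed
  also have "\<dots> = CH * shift_weight ?hs * W" unfolding integral_mult_right_zero CH_def by (simp only: mult_ac)
  finally show ?thesis .
qed

end

section \<open>Differences of the solution, estimated through dyadic time slabs\<close>

context kolmogorov_solution
begin

lemma f0_diff_le: "s < T \<Longrightarrow> \<bar>f0 (y, s) - f0 (x, s)\<bar> \<le> w (qn (y - x))"
  using w_ge[of s y x "qn (y - x)"] by (simp add: f0_def ST_def)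

lemma slc_dif:
  assumes \<eta>: "bumpy \<eta>" and g: "g \<in> borel_measurable borel" "\<And>p. \<bar>g p\<bar> \<le> M"
  shows "slc g (dif h \<eta>) t s = dif h (slc g \<eta> t s)"
proof (rule ext)
  fix x
  obtain C where C: "bdk 0 (\<lambda>x. C * expn x) \<eta>" using bumpy_bdk[OF \<eta>] by blast
  have i: "integrable lborel (\<lambda>z. g (E (s - t) *v z, s) * \<eta> (x - z))" for x
    by (rule cv_integrable[OF slice_borel[OF g] g(2) C])
  show "slc g (dif h \<eta>) t s x = dif h (slc g \<eta> t s) x"
    using Bochner_Integration.integral_diff[OF i[of "x + h"] i[of x]]
    by (simp add: slc_def cv_def dif_def right_diff_distrib diff_add_eq)
qed

lemma slc_difs:
  assumes \<eta>: "bumpy \<eta>" and g: "g \<in> borel_measurable borel" "\<And>p. \<bar>g p\<bar> \<le> M"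
  shows "slc g (difs hs \<eta>) t s = difs hs (slc g \<eta> t s)"
  by (induction hs) (simp_all add: slc_dif[OF bumpy_difs[OF \<eta>] g])

lemma slc_reflect:
  assumes g: "g \<in> borel_measurable borel" "\<And>p. \<bar>g p\<bar> \<le> M" and [measurable]: "\<eta> \<in> borel_measurable borel"
  shows "slc g \<eta> t s x = (\<integral>z. \<eta> z * g (E (s - t) *v (x - z), s) \<partial>lborel)"
proof -
  have [measurable]: "(\<lambda>z. g (E (s - t) *v z, s)) \<in> borel_measurable borel" by (rule slice_borel[OF g])
  have [measurable]: "(\<lambda>z. \<eta> (x - z)) \<in> borel_measurable borel" by (rule measurable_compose[of "\<lambda>z. x - z" _ borel]) measurable
  have "(\<integral>z. (\<lambda>z. g (E (s - t) *v z, s) * \<eta> (x - z)) (x - z) \<partial>lborel) = (\<integral>z. g (E (s - t) *v z, s) * \<eta> (x - z) \<partial>lborel)"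
    by (rule integral_reflect(1)) measurable
  then show ?thesis by (simp add: slc_def cv_def mult.commute)
qed

definition mollifier where
  "mollifier \<eta> \<longleftrightarrow> bumpy \<eta> \<and> (\<forall>x. \<eta> x \<ge> 0) \<and> integrable lborel \<eta> \<and> (\<integral>x. \<eta> x \<partial>lborel) = (1 :: real)"

lemma slc_mollifier_integrable:
  assumes \<eta>: "mollifier \<eta>" and g: "g \<in> borel_measurable borel" "\<And>p. \<bar>g p\<bar> \<le> M"
  shows "integrable lborel (\<lambda>z. \<eta> z * g (E (s - t) *v (x - z), s))"
proof (rule Bochner_Integration.integrable_bound)
  have i: "integrable lborel \<eta>" and p: "\<And>x. \<eta> x \<ge> 0" using \<eta> by (auto simp: mollifier_def)
  show "integrable lborel (\<lambda>z. \<eta> z * M)" using i by simp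
  have [measurable]: "(\<lambda>z. g (E (s - t) *v (x - z), s)) \<in> borel_measurable borel"
    using measurable_compose[OF _ slice_borel[OF g], of "\<lambda>z. x - z"] by simp
  have [measurable]: "\<eta> \<in> borel_measurable borel" using \<eta> smooth_borel by (auto simp: mollifier_def bumpy_def)
  show "(\<lambda>z. \<eta> z * g (E (s - t) *v (x - z), s)) \<in> borel_measurable lborel" by measurable
  show "AE z in lborel. norm (\<eta> z * g (E (s - t) *v (x - z), s)) \<le> norm (\<eta> z * M)"
    using p order_trans[OF g(2) abs_ge_self] by (intro AE_I2) (simp add: abs_mult mult_left_mono)
qed

lemma mollifier_average_diff:
  assumes \<eta>: "mollifier \<eta>" and i: "integrable lborel (\<lambda>z. \<eta> z * g z)" "integrable lborel (\<lambda>z. \<eta> z * g' z)"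
    and le: "\<And>z. \<eta> z \<noteq> 0 \<Longrightarrow> \<bar>g z - g' z\<bar> \<le> W"
  shows "\<bar>(\<integral>z. \<eta> z * g z \<partial>lborel) - (\<integral>z. \<eta> z * g' z \<partial>lborel)\<bar> \<le> W"
proof -
  have p: "\<And>x. \<eta> x \<ge> 0" and i\<eta>: "integrable lborel \<eta>" and one: "(\<integral>x. \<eta> x \<partial>lborel) = 1" using \<eta> by (auto simp: mollifier_def)
  have "(\<integral>z. \<eta> z * g z \<partial>lborel) - (\<integral>z. \<eta> z * g' z \<partial>lborel) = (\<integral>z. \<eta> z * (g z - g' z) \<partial>lborel)"
    using i by (simp add: right_diff_distrib)
  also have "\<bar>\<dots>\<bar> \<le> (\<integral>z. \<bar>\<eta> z * (g z - g' z)\<bar> \<partial>lborel)" by (rule integral_abs_bound)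
  also have "\<dots> \<le> (\<integral>z. \<eta> z * W \<partial>lborel)"
  proof (rule Bochner_Integration.integral_mono)
    show "\<bar>\<eta> z * (g z - g' z)\<bar> \<le> \<eta> z * W" for z
      using le[of z] p[of z] by (cases "\<eta> z = 0") (auto simp: abs_mult intro!: mult_left_mono)
  qed (use i i\<eta> in \<open>simp_all add: right_diff_distrib\<close>)
  finally show ?thesis using one i\<eta> by simp
qed

text \<open>The points y - z and x - z keep the displacement E(s - t)(y - x) in the original
  coordinates for every z, so mollification does not enlarge the modulus.\<close>

lemma slc_f0_diff:
  assumes \<eta>: "mollifier \<eta>" and s: "s < T"
  shows "\<bar>slc f0 \<eta> t s y - slc f0 \<eta> t s x\<bar> \<le> w (qn (E (s - t) *v (y - x)))"
proof -
  have b: "\<eta> \<in> borel_measurable borel" using \<eta> smooth_borel by (auto simp: mollifier_def bumpy_def)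
  have e: "E (s - t) *v (y - z) - E (s - t) *v (x - z) = E (s - t) *v (y - x)" for z
    by (simp flip: matrix_vector_mult_diff_distrib)
  show ?thesis unfolding slc_reflect[OF f0_borel Mf(2) b]
    using f0_diff_le[OF s] e
    by (intro mollifier_average_diff[OF \<eta> slc_mollifier_integrable[OF \<eta> f0_borel Mf(2)] slc_mollifier_integrable[OF \<eta> f0_borel Mf(2)]]) metis
qed

text \<open>The sign c covers both uses: the averaging point x - dil r z and the difference shift x
  + dil \<rho> k.\<close>

lemma slc_f0_diff_dil:
  assumes \<eta>: "mollifier \<eta>" and s: "s < T" and r: "r > 0" "\<bar>s - t\<bar> \<le> 2 * r\<^sup>2" and yx: "y - x = c *\<^sub>R dil r z" "\<bar>c\<bar> = 1"
  shows "\<bar>slc f0 \<eta> t s y - slc f0 \<eta> t s x\<bar> \<le> ((1 + KQ) * (1 + norm z)) ^ qN * w r"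
proof -
  have c: "y - x = dil r (c *\<^sub>R z)" using yx by (simp add: vec_eq_iff)
  have "\<bar>slc f0 \<eta> t s y - slc f0 \<eta> t s x\<bar> \<le> w (qn (E (s - t) *v (y - x)))" by (rule slc_f0_diff[OF \<eta> s])
  also have "\<dots> \<le> w ((KQ * (1 + norm z)) * r)"
    unfolding c using qn_E_dil[of r "s - t" "c *\<^sub>R z"] r yx(2) by (intro w_mono qn_nonneg) auto
  also have "\<dots> \<le> (1 + KQ * (1 + norm z)) ^ qN * w r"
    using r KQ_nonneg by (intro w_scale' mult_nonneg_nonneg) auto
  also have "\<dots> \<le> ((1 + KQ) * (1 + norm z)) ^ qN * w r"
    using r KQ_nonneg w_nonneg[of r] by (intro mult_right_mono power_mono add_nonneg_nonneg) (auto simp: algebra_simps)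
  finally show ?thesis .
qed

lemma slc_f0_space_borel: assumes "bumpy \<eta>" shows "slc f0 \<eta> t s \<in> borel_measurable borel"
proof -
  have "(\<lambda>y. (s, y)) \<in> borel_measurable borel" by (intro borel_measurable_continuous_onI continuous_intros)
  from measurable_compose[OF this slc_bumpy_borel(2)[OF assms f0_borel]] show ?thesis by simp
qed

lemma Th_zero: "s \<le> \<tau> \<Longrightarrow> Th \<eta> t s x = 0"
proof -
  assume s: "s \<le> \<tau>"
  have "u0 (y, s) = 0" for y using S0 s by (auto simp: S0tau_def u0_def)
  then show ?thesis by (simp add: Th_def av_def slc_def cv_def)
qed

text \<open>The hypothesis on \<open>D\<close> is made for two situations: three arbitrary shifts,
  and a single shift without components in the first block. Both have weight of order l^3 when
  dilated by l between 0 and 1.\<close>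

context
  fixes \<eta> :: "(real, 'n) vec \<Rightarrow> real" and t \<rho> D K0 :: real and ks :: "(real, 'n) vec list"
  assumes \<eta>: "mollifier \<eta>" and t: "t \<le> T" and \<rho>: "\<rho> > 0" and ks: "ks \<noteq> []" "length ks \<le> 3"
    and K0: "\<And>k. k \<in> set ks \<Longrightarrow> norm k \<le> K0" and D: "\<And>l. 0 \<le> l \<Longrightarrow> l \<le> 1 \<Longrightarrow> shift_weight (map (dil l) ks) \<le> D * l ^ 3"
begin

lemma bumpy_eta: "bumpy \<eta>" using \<eta> by (simp add: mollifier_def)

lemma D_nonneg: "D \<ge> 0" using D[of 1] shift_weight_nonneg[of "map (dil 1) ks"] by simp

text \<open>At scale r the shifts of size \<rho> become shifts of size \<rho> / r, and the cubic
  weight gives the gain. Up to a factor 2, r^2 is the time distance to t.\<close>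

lemma source_far:
  assumes r: "r \<ge> \<rho>" and s: "s < t" "r\<^sup>2 \<le> t - s" "t - s \<le> 2 * r\<^sup>2"
  shows "\<bar>av ker (dil r) (slc f0 (difs (map (dil \<rho>) ks) \<eta>) t s) x\<bar> \<le> CH * (D * (\<rho> / r) ^ 3) * w r"
proof -
  have r0: "r > 0" using r \<rho> by simp
  obtain L where L: "\<And>s y. \<bar>slc f0 \<eta> t s y\<bar> \<le> L" using bumpy_slc_bounds[OF bumpy_eta] by blast
  have "\<bar>av ker (dil r) (difs (map (dil \<rho>) ks) (slc f0 \<eta> t s)) x\<bar> \<le> CH * shift_weight (map (dil (1 / r)) (map (dil \<rho>) ks)) * w r"
  proof (rule av_difs_le[OF r0])
    show "\<bar>slc f0 \<eta> t s x\<bar> \<le> L" for x by (rule L)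
    show "slc f0 \<eta> t s \<in> borel_measurable borel" by (rule slc_f0_space_borel[OF bumpy_eta])
    show "\<bar>slc f0 \<eta> t s (x - dil r z) - slc f0 \<eta> t s x\<bar> \<le> ((1 + KQ) * (1 + norm z)) ^ qN * w r" for x z
      by (rule slc_f0_diff_dil[OF \<eta> _ r0, where c = "-1"]) (use s t in auto)
  qed (use ks in auto)
  also have "\<dots> \<le> CH * (D * (\<rho> / r) ^ 3) * w r"
  proof -
    have e: "map (dil (1 / r)) (map (dil \<rho>) ks) = map (dil (\<rho> / r)) ks" by (simp add: dil_mult)
    have "shift_weight (map (dil (1 / r)) (map (dil \<rho>) ks)) \<le> D * (\<rho> / r) ^ 3" unfolding e using D[of "\<rho> / r"] r r0 \<rho> by simp
    then show ?thesis using CH_nonneg w_nonneg r0 by (intro mult_right_mono mult_left_mono) auto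
  qed
  finally show ?thesis by (simp add: slc_difs[OF bumpy_eta f0_borel Mf(2)])
qed

text \<open>For times closer to t than \<rho>^2 the kernel gives no gain. One difference is measured
  by the modulus; the at most two others cost the factor 4.\<close>

lemma source_near:
  assumes s: "s < t" "t - s \<le> \<rho>\<^sup>2"
  shows "\<bar>av ker (dil r) (slc f0 (difs (map (dil \<rho>) ks) \<eta>) t s) x\<bar> \<le> 4 * ((1 + KQ) * (1 + K0)) ^ qN * w \<rho>"
proof -
  obtain k ks' where kk: "ks = k # ks'" using ks by (cases ks) auto
  have l: "length ks' \<le> 2" using ks kk by simp
  let ?W = "((1 + KQ) * (1 + K0)) ^ qN * w \<rho>"
  have K00: "K0 \<ge> 0" using order_trans[OF norm_ge_zero K0[of k]] kk by simp
  have "\<bar>slc f0 \<eta> t s (y + dil \<rho> k) - slc f0 \<eta> t s y\<bar> \<le> ((1 + KQ) * (1 + norm k)) ^ qN * w \<rho>" for y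
    by (rule slc_f0_diff_dil[OF \<eta> _ \<rho>, where c = 1]) (use s t in auto)
  also have "((1 + KQ) * (1 + norm k)) ^ qN * w \<rho> \<le> ?W"
    using KQ_nonneg K0[of k] kk w_nonneg \<rho> by (intro mult_right_mono power_mono mult_left_mono) auto
  finally have "\<bar>dif (dil \<rho> k) (slc f0 \<eta> t s) y\<bar> \<le> ?W" for y by (simp add: dif_def)
  then have "\<bar>difs (map (dil \<rho>) ks') (dif (dil \<rho> k) (slc f0 \<eta> t s)) y\<bar> \<le> 2 ^ length ks' * ?W" for y
    using difs_le[of _ ?W "map (dil \<rho>) ks'"] by simp
  moreover have "2 ^ length ks' * ?W \<le> 2 ^ 2 * ?W"
    using l KQ_nonneg K00 w_nonneg[of \<rho>] \<rho> by (intro mult_right_mono power_increasing mult_nonneg_nonneg) auto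
  ultimately have le: "\<bar>difs (map (dil \<rho>) ks) (slc f0 \<eta> t s) y\<bar> \<le> 4 * ?W" for y
    by (simp add: kk difs_dif) (meson order_trans)
  have "\<bar>av ker (dil r) (difs (map (dil \<rho>) ks) (slc f0 \<eta> t s)) x\<bar> \<le> 4 * ?W"
    by (rule av_le[OF ker_integrable ker_nonneg ker_one dil_borel difs_borel[OF slc_f0_space_borel[OF bumpy_eta]] le])
  then show ?thesis by (simp add: slc_difs[OF bumpy_eta f0_borel Mf(2)])
qed

lemma bumpy_shifted_eta: "bumpy (difs (map (dil \<rho>) ks) \<eta>)" by (rule bumpy_difs[OF bumpy_eta])

text \<open>Induction on m from the far past, where \<open>Th\<close> is zero. Between t - 4^(n+1)
  \<rho>^2 and t - 4^n \<rho>^2 the scale is at least 2^n \<rho>, so the gain is 8^(-n); times the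
  length 3 * 4^n \<rho>^2 of the slab this leaves 2^(-n) w(R), bounded by a piece of \<rho> times
  the integral of \<open>wi\<close>. The pieces add up to a tail integral.\<close>

lemma Th_dyadic: "t - 4 ^ (n + m) * \<rho>\<^sup>2 \<le> \<tau> \<Longrightarrow>
    \<bar>Th (difs (map (dil \<rho>) ks) \<eta>) t (t - 4 ^ n * \<rho>\<^sup>2) x\<bar> \<le> 12 * CH * D * \<rho> ^ 3 * integral {2 ^ (n + 1) * \<rho>..} wi"
proof (induction m arbitrary: n x)
  case 0
  then show ?case using Th_zero CH_nonneg D_nonneg \<rho> wi_nonneg(1)[of "2 ^ (n + 1) * \<rho>"] by simp
next
  case (Suc m)
  define R where "R = 2 ^ (n + 1) * \<rho>"
  define H where "H = CH * (D * (1 / 2 ^ n) ^ 3) * w R"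
  have p: "(2 ^ n)\<^sup>2 = (4::real) ^ n" by (simp add: power2_eq_square flip: power_mult_distrib)
  have R: "R > 0" "R = 2 * (2 ^ n * \<rho>)" using \<rho> by (simp_all add: R_def)
  have r2: "R\<^sup>2 = 4 ^ Suc n * \<rho>\<^sup>2" "(2 ^ n * \<rho>)\<^sup>2 = 4 ^ n * \<rho>\<^sup>2" using p by (simp_all add: R(2) power_mult_distrib)
  have S: "\<bar>Th (difs (map (dil \<rho>) ks) \<eta>) t (t - 4 ^ Suc n * \<rho>\<^sup>2) x\<bar> \<le> 12 * CH * D * \<rho> ^ 3 * integral {2 * R..} wi" for x
    using Suc.IH[of "Suc n" x] Suc.prems by (simp add: R(2) mult_ac)
  have "\<bar>Th (difs (map (dil \<rho>) ks) \<eta>) t (t - 4 ^ n * \<rho>\<^sup>2) x\<bar> \<le> 12 * CH * D * \<rho> ^ 3 * integral {2 * R..} wi + H * ((t - 4 ^ n * \<rho>\<^sup>2) - (t - 4 ^ Suc n * \<rho>\<^sup>2))"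
  proof (rule max_principle[OF bumpy_shifted_eta _ t _ S])
    fix s \<sigma> x
    assume s: "s \<le> t - 4 ^ n * \<rho>\<^sup>2" and \<sigma>: "t - (t - 4 ^ n * \<rho>\<^sup>2) \<le> \<sigma>" "\<sigma> \<le> t - (t - 4 ^ Suc n * \<rho>\<^sup>2)" "\<sigma> \<le> t - s" "t - s \<le> 2 * \<sigma>"
    define r where "r = sqrt \<sigma>"
    have n0: "4 ^ n * \<rho>\<^sup>2 > 0" using \<rho> by simp
    then have \<sigma>0: "\<sigma> > 0" using \<sigma>(1) by simp
    have r: "2 ^ n * \<rho> \<le> r" "r \<le> R" "r\<^sup>2 = \<sigma>"
      unfolding r_def using \<sigma> \<sigma>0 R r2 \<rho> by (auto intro: real_le_rsqrt real_le_lsqrt)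
    have \<rho>n: "\<rho> \<le> 2 ^ n * \<rho>" using \<rho> by simp
    have "\<bar>av ker (dil r) (slc f0 (difs (map (dil \<rho>) ks) \<eta>) t s) x\<bar> \<le> CH * (D * (\<rho> / r) ^ 3) * w r"
      using r \<sigma> s n0 \<rho>n by (intro source_far) auto
    also have "\<dots> \<le> H"
    proof -
      have r0: "r > 0" using r \<rho> \<rho>n by linarith
      then have "\<rho> / r \<le> 1 / 2 ^ n" using r(1) by (simp add: field_simps)
      then have "(\<rho> / r) ^ 3 \<le> (1 / 2 ^ n) ^ 3" using r0 \<rho> by (intro power_mono) auto
      then have 1: "CH * (D * (\<rho> / r) ^ 3) \<le> CH * (D * (1 / 2 ^ n) ^ 3)"
        using CH_nonneg D_nonneg by (intro mult_left_mono)
      have "w r \<le> w R" "0 \<le> w r" using r0 r by (auto intro: w_mono w_nonneg)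
      then show ?thesis unfolding H_def using CH_nonneg D_nonneg by (intro mult_mono[OF 1]) auto
    qed
    finally show "\<bar>av ker (dil (sqrt \<sigma>)) (slc f0 (difs (map (dil \<rho>) ks) \<eta>) t s) x\<bar> \<le> H" by (simp add: r_def)
  qed (use \<rho> in auto)
  also have "H * ((t - 4 ^ n * \<rho>\<^sup>2) - (t - 4 ^ Suc n * \<rho>\<^sup>2)) = 3 * CH * D * \<rho>\<^sup>2 * (w R / 2 ^ n)"
  proof -
    have "(1 / 2 ^ n) ^ 3 * (4::real) ^ n = 1 / 2 ^ n"
      unfolding p[symmetric] by (simp add: power2_eq_square power3_eq_cube)
    moreover have "H * ((t - 4 ^ n * \<rho>\<^sup>2) - (t - 4 ^ Suc n * \<rho>\<^sup>2)) = 3 * CH * D * \<rho>\<^sup>2 * w R * ((1 / 2 ^ n) ^ 3 * 4 ^ n)"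
      by (simp add: H_def algebra_simps)
    ultimately show ?thesis by simp
  qed
  also have "\<dots> \<le> 3 * CH * D * \<rho>\<^sup>2 * (4 * \<rho> * integral {R..2 * R} wi)"
  proof (rule mult_left_mono)
    have "w R / 2 ^ n \<le> 2 * R * integral {R..2 * R} wi / 2 ^ n" using w_le_integral[OF R(1)] by (intro divide_right_mono) auto
    then show "w R / 2 ^ n \<le> 4 * \<rho> * integral {R..2 * R} wi" by (simp add: R(2))
  qed (use CH_nonneg D_nonneg \<rho> in auto)
  \<comment> \<open>The constant 12 = 3 * 4 reproduces itself: the slab contributes the part of the
    integral over [R, 2 R].\<close>
  also have "12 * CH * D * \<rho> ^ 3 * integral {2 * R..} wi + 3 * CH * D * \<rho>\<^sup>2 * (4 * \<rho> * integral {R..2 * R} wi) =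
      12 * CH * D * \<rho> ^ 3 * integral {R..} wi"
    using wi_split[of R "2 * R"] R(1) by (simp add: algebra_simps power2_eq_square power3_eq_cube)
  finally show ?case by (simp add: R_def)
qed

lemma Th_near:
  assumes b: "t - \<rho>\<^sup>2 < c" "c < t"
  shows "\<bar>Th (difs (map (dil \<rho>) ks) \<eta>) t c x\<bar> \<le> (12 * CH * D + 8 * ((1 + KQ) * (1 + K0)) ^ qN) * \<rho>\<^sup>2 * NN \<rho>"
proof -
  let ?P = "((1 + KQ) * (1 + K0)) ^ qN"
  \<comment> \<open>The number of slabs needed to get below \<tau> depends on t - \<tau>, but the
    bound of \<open>Th_dyadic\<close> does not depend on m; this is why \<tau> enters no
    constant.\<close>
  obtain m where "(t - \<tau>) / \<rho>\<^sup>2 < 4 ^ m" using real_arch_pow[of 4] by auto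
  then have m: "t - 4 ^ (0 + m) * \<rho>\<^sup>2 \<le> \<tau>" using \<rho> by (simp add: field_simps)
  have "integral {2 * \<rho>..} wi \<le> integral {\<rho>..} wi"
    using wi_split[of \<rho> "2 * \<rho>"] wi_nonneg(2)[of \<rho> "2 * \<rho>"] \<rho> by simp
  then have "12 * CH * D * \<rho> ^ 3 * integral {2 * \<rho>..} wi \<le> 12 * CH * D * \<rho> ^ 3 * integral {\<rho>..} wi"
    using CH_nonneg D_nonneg \<rho> by (intro mult_left_mono) auto
  then have S: "\<bar>Th (difs (map (dil \<rho>) ks) \<eta>) t (t - \<rho>\<^sup>2) x\<bar> \<le> 12 * CH * D * \<rho>\<^sup>2 * NN \<rho>" for x
    using Th_dyadic[OF m, of x] by (simp add: NN_def power2_eq_square power3_eq_cube mult_ac)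
  have P: "?P \<ge> 0"
  proof -
    obtain k where "k \<in> set ks" using ks by (cases ks) auto
    then have "K0 \<ge> 0" using order_trans[OF norm_ge_zero K0[of k]] by simp
    then show ?thesis using KQ_nonneg by simp
  qed
  have "\<bar>Th (difs (map (dil \<rho>) ks) \<eta>) t c x\<bar> \<le> 12 * CH * D * \<rho>\<^sup>2 * NN \<rho> + (4 * ?P * w \<rho>) * (c - (t - \<rho>\<^sup>2))"
  proof (rule max_principle[OF bumpy_shifted_eta b(2) t b(1) S])
    fix s \<sigma> x assume "s \<le> c" "\<sigma> \<le> t - (t - \<rho>\<^sup>2)" "t - \<rho>\<^sup>2 \<le> s"
    then show "\<bar>av ker (dil (sqrt \<sigma>)) (slc f0 (difs (map (dil \<rho>) ks) \<eta>) t s) x\<bar> \<le> 4 * ?P * w \<rho>"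
      using b by (intro source_near) auto
  qed
  also have "(4 * ?P * w \<rho>) * (c - (t - \<rho>\<^sup>2)) \<le> (4 * ?P * (2 * NN \<rho>)) * \<rho>\<^sup>2"
    using P w_nonneg[of \<rho>] w_le_NN[OF \<rho>] NN_nonneg[OF \<rho>] \<rho> b by (intro mult_mono mult_nonneg_nonneg) auto
  finally show ?thesis by (simp add: algebra_simps)
qed

lemma slc_difs_le: "\<bar>slc u0 (difs (map (dil \<rho>) ks) \<eta>) t t x\<bar> \<le> (12 * CH * D + 8 * ((1 + KQ) * (1 + K0)) ^ qN) * \<rho>\<^sup>2 * NN \<rho>" (is "_ \<le> ?C")
proof -
  obtain L where L: "L \<ge> 0" "\<And>s. bdk 3 (\<lambda>_. L) (slc u0 (difs (map (dil \<rho>) ks) \<eta>) t s)" using bumpy_slc_bounds[OF bumpy_shifted_eta] by blast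
  have le: "\<bar>slc u0 (difs (map (dil \<rho>) ks) \<eta>) t c x\<bar> \<le> ?C + KS \<rho> * L * sqrt (t - c)" if c: "t - \<rho>\<^sup>2 < c" "c < t" for c
  proof -
    \<comment> \<open>At scale 0 the average is the function itself, since \<open>ker\<close> has
      integral 1; Lipschitz dependence on the scale then compares \<open>Th\<close> at time c with
      the slice.\<close>
    have "dil 0 z = 0" for z by (simp add: vec_eq_iff)
    then have "av ker (dil 0) (slc u0 (difs (map (dil \<rho>) ks) \<eta>) t c) x = slc u0 (difs (map (dil \<rho>) ks) \<eta>) t c x" using ker_one by (simp add: av_def)
    moreover have "sqrt (t - c) \<le> \<rho>" using c \<rho> by (intro real_le_lsqrt) auto
    ultimately have "\<bar>Th (difs (map (dil \<rho>) ks) \<eta>) t c x - slc u0 (difs (map (dil \<rho>) ks) \<eta>) t c x\<bar> \<le> KS \<rho> * L * sqrt (t - c)"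
      using av_dil_lipschitz[OF L(2), of 0 "sqrt (t - c)" \<rho> c x] c by (simp add: Th_def)
    then show ?thesis using Th_near[OF c, of x] by linarith
  qed
  have 1: "((\<lambda>c. \<bar>slc u0 (difs (map (dil \<rho>) ks) \<eta>) t c x\<bar>) \<longlongrightarrow> \<bar>slc u0 (difs (map (dil \<rho>) ks) \<eta>) t t x\<bar>) (at_left t)"
  proof (intro tendsto_rabs)
    have "((\<lambda>c. slc u0 (difs (map (dil \<rho>) ks) \<eta>) t c x) \<longlongrightarrow> slc u0 (difs (map (dil \<rho>) ks) \<eta>) t t x) (at t within {..T})"
      using slc_cont[OF bumpy_shifted_eta] t by (auto simp: continuous_on_def)
    then show "((\<lambda>c. slc u0 (difs (map (dil \<rho>) ks) \<eta>) t c x) \<longlongrightarrow> slc u0 (difs (map (dil \<rho>) ks) \<eta>) t t x) (at_left t)"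
      by (rule tendsto_within_subset) (use t in auto)
  qed
  have 2: "((\<lambda>c. ?C + KS \<rho> * L * sqrt (t - c)) \<longlongrightarrow> ?C + KS \<rho> * L * sqrt (t - t)) (at_left t)"
    by (intro tendsto_intros)
  have "\<forall>\<^sub>F c in at_left t. \<bar>slc u0 (difs (map (dil \<rho>) ks) \<eta>) t c x\<bar> \<le> ?C + KS \<rho> * L * sqrt (t - c)"
    using eventually_at_left_real[of "t - \<rho>\<^sup>2" t] \<rho> by (auto elim!: eventually_mono intro: le)
  from tendsto_le[OF _ 2 1 this] show ?thesis by simp
qed

end

text \<open>One sequence of mollifiers serves all times and points; pointwise convergence holds up
  to s = T because \<open>u\<close> is continuous there.\<close>

lemma mollified_u_tendsto:
  "\<exists>\<eta>. (\<forall>n::nat. mollifier (\<eta> n)) \<and> (\<forall>t s x. s \<le> T \<longrightarrow> (\<lambda>n. slc u0 (\<eta> n) t s x) \<longlonglongrightarrow> u (E (s - t) *v x, s))"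
proof -
  have "\<exists>\<eta> :: (real, 'n) vec \<Rightarrow> real. mollifier \<eta> \<and> (\<forall>x. norm x \<ge> 1 / real (Suc n) \<longrightarrow> \<eta> x = 0)" for n
  proof -
    obtain \<eta> :: "(real, 'n) vec \<Rightarrow> real" where \<eta>: "smooth \<eta>" "\<And>x. norm x \<ge> 1 / real (Suc n) \<Longrightarrow> \<eta> x = 0" "\<And>x. \<eta> x \<ge> 0"
      "integrable lborel \<eta>" "(\<integral>x. \<eta> x \<partial>lborel) = 1" using ex_mollifier[of "1 / real (Suc n)"] by auto
    then have "mollifier \<eta>" unfolding mollifier_def bumpy_def by (intro conjI exI[of _ "1 / real (Suc n)"]) auto
    then show ?thesis using \<eta>(2) by blast
  qed
  then obtain \<eta> :: "nat \<Rightarrow> (real, 'n) vec \<Rightarrow> real" where \<eta>: "\<And>n. mollifier (\<eta> n)" "\<And>n x. norm x \<ge> 1 / real (Suc n) \<Longrightarrow> \<eta> n x = 0" by metis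
  have "(\<lambda>n. slc u0 (\<eta> n) t s x) \<longlonglongrightarrow> u (E (s - t) *v x, s)" if s: "s \<le> T" for t s x
  proof (rule LIMSEQ_I)
    fix e :: real assume e: "e > 0"
    let ?v = "\<lambda>y. u (E (s - t) *v y, s)"
    have "continuous_on UNIV ?v"
      by (rule continuous_on_compose2[OF u_cont])
         (use s in \<open>auto intro!: continuous_intros matrix_vector_mult_linear_continuous_on\<close>)
    then obtain d where d: "d > 0" "\<And>y. dist y x < d \<Longrightarrow> dist (?v y) (?v x) < e / 2"
      unfolding continuous_on_iff using e by (metis UNIV_I half_gt_zero)
    obtain n0 where n0: "1 / real (Suc n0) < d" using nat_approx_posE[OF d(1)] by (metis inverse_eq_divide)
    have "norm (slc u0 (\<eta> n) t s x - ?v x) < e" if n: "n \<ge> n0" for n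
    proof -
      have b: "\<eta> n \<in> borel_measurable borel" and i: "integrable lborel (\<eta> n)" and one: "(\<integral>x. \<eta> n x \<partial>lborel) = 1"
        using \<eta>(1)[of n] smooth_borel by (auto simp: mollifier_def bumpy_def)
      have "\<bar>(\<integral>z. \<eta> n z * u0 (E (s - t) *v (x - z), s) \<partial>lborel) - (\<integral>z. \<eta> n z * ?v x \<partial>lborel)\<bar> \<le> e / 2"
      proof (rule mollifier_average_diff[OF \<eta>(1) slc_mollifier_integrable[OF \<eta>(1) u0_borel u0_le]])
        show "integrable lborel (\<lambda>z. \<eta> n z * ?v x)" using i by simp
        fix z assume "\<eta> n z \<noteq> 0"
        then have "norm z < 1 / real (Suc n)" using \<eta>(2)[of n z] by force
        also have "\<dots> \<le> 1 / real (Suc n0)" using n by (simp add: field_simps)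
        finally have "dist (x - z) x < d" using n0 by (simp add: dist_norm)
        from d(2)[OF this] show "\<bar>u0 (E (s - t) *v (x - z), s) - ?v x\<bar> \<le> e / 2"
          using s by (simp add: u0_eq dist_real_def)
      qed
      then show ?thesis using one e slc_reflect[OF u0_borel u0_le b] by simp
    qed
    then show "\<exists>no. \<forall>n\<ge>no. norm (slc u0 (\<eta> n) t s x - ?v x) < e" by blast
  qed
  then show ?thesis using \<eta>(1) by blast
qed

text \<open>The bound for slices does not depend on the mollifier, so it passes to the pointwise
  limit.\<close>

lemma difs_u_le:
  assumes t: "t \<le> T" and \<rho>: "\<rho> > 0" and ks: "ks \<noteq> []" "length ks \<le> 3"
    and K0: "\<And>k. k \<in> set ks \<Longrightarrow> norm k \<le> K0" and D: "\<And>l. 0 \<le> l \<Longrightarrow> l \<le> 1 \<Longrightarrow> shift_weight (map (dil l) ks) \<le> D * l ^ 3"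
  shows "\<bar>difs (map (dil \<rho>) ks) (\<lambda>y. u (y, t)) x\<bar> \<le> (12 * CH * D + 8 * ((1 + KQ) * (1 + K0)) ^ qN) * \<rho>\<^sup>2 * NN \<rho>"
proof -
  obtain \<eta> where \<eta>: "\<And>n::nat. mollifier (\<eta> n)" "\<And>x. (\<lambda>n. slc u0 (\<eta> n) t t x) \<longlonglongrightarrow> u (x, t)"
    using mollified_u_tendsto t by (metis Emat_0 diff_self matrix_vector_mul_lid)
  have 1: "(\<lambda>n. \<bar>difs (map (dil \<rho>) ks) (slc u0 (\<eta> n) t t) x\<bar>) \<longlonglongrightarrow> \<bar>difs (map (dil \<rho>) ks) (\<lambda>y. u (y, t)) x\<bar>"
    by (intro tendsto_rabs difs_tendsto \<eta>)
  have 2: "\<bar>difs (map (dil \<rho>) ks) (slc u0 (\<eta> n) t t) x\<bar> \<le> (12 * CH * D + 8 * ((1 + KQ) * (1 + K0)) ^ qN) * \<rho>\<^sup>2 * NN \<rho>" for n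
    using slc_difs_le[OF \<eta>(1) t \<rho> ks K0 D, of n x] \<eta>(1)[of n] by (simp add: slc_difs[OF _ u0_borel u0_le] mollifier_def)
  show ?thesis using LIMSEQ_le_const2[OF 1] 2 by blast
qed

end

section \<open>Second derivatives as limits of difference quotients\<close>

text \<open>With the shift operator S, S^2 - 1 = 2 (S - 1) + (S - 1)^2 in each variable. After
  division by (2 r)^2 the leading term is the old quotient, and all other terms contain at least
  three differences.\<close>

lemma dif_dif_double:
  "dif (h + h) (dif (k + k) G) x =
    4 * dif h (dif k G) x + 2 * dif h (dif k (dif k G)) x + 2 * dif h (dif h (dif k G)) x + dif h (dif h (dif k (dif k G))) x"
  by (simp add: dif_def add.assoc)

lemma dif_le: "(\<And>x. \<bar>G x\<bar> \<le> C) \<Longrightarrow> \<bar>dif h G x\<bar> \<le> 2 * C"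
  using difs_le[of G C "[h]"] by simp

context kolmogorov
begin

lemma qn_zeroD: "qn z = 0 \<Longrightarrow> z = 0"
  unfolding qn_def vec_eq_iff by (subst (asm) sum_nonneg_eq_0_iff) auto

lemma dil_axis: "i \<in> F \<Longrightarrow> dil r (axis i 1) = r *\<^sub>R axis i 1"
  by (auto simp: vec_eq_iff axis_def first_vars_b)

lemma norm_dil_le: "0 \<le> l \<Longrightarrow> l \<le> 1 \<Longrightarrow> norm (dil l k) \<le> l * norm k"
proof -
  assume l: "0 \<le> l" "l \<le> 1"
  have "norm (dil l k) \<le> norm (l *\<^sub>R k)"
  proof (rule norm_le_componentwise_cart)
    fix i
    have "l ^ (2 * b i + 1) \<le> l ^ 1" using l by (intro power_decreasing) auto
    then show "norm (dil l k $ i) \<le> norm ((l *\<^sub>R k) $ i)" using l by (simp add: abs_mult mult_right_mono)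
  qed
  then show ?thesis using l by simp
qed

text \<open>Outside the first block all dilation exponents are at least 3.\<close>

lemma norm_dil_le_cube:
  assumes l: "0 \<le> l" "l \<le> 1" and k: "\<And>i. i \<in> F \<Longrightarrow> k $ i = 0"
  shows "norm (dil l k) \<le> l ^ 3 * norm k"
proof -
  have "norm (dil l k) \<le> norm (l ^ 3 *\<^sub>R k)"
  proof (rule norm_le_componentwise_cart)
    fix i
    show "norm (dil l k $ i) \<le> norm ((l ^ 3 *\<^sub>R k) $ i)"
    proof (cases "i \<in> F")
      case False
      then have "b i \<ge> 1" by (simp add: first_vars_b)
      then have "l ^ (2 * b i + 1) \<le> l ^ 3" using l by (intro power_decreasing) auto
      then show ?thesis using l by (simp add: abs_mult mult_right_mono)
    qed (simp add: k)
  qed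
  then show ?thesis using l by simp
qed

text \<open>Two cases in one constant: (K exp K)^3 is the weight of three shifts of size K, and K
  exp K that of one shift outside the first block.\<close>

definition CE :: "real \<Rightarrow> real" where
  "CE K = 12 * CH * ((K * exp K) ^ 3 + K * exp K) + 8 * ((1 + KQ) * (1 + K)) ^ qN"

lemma CE_nonneg: "K \<ge> 0 \<Longrightarrow> CE K \<ge> 0"
  unfolding CE_def using CH_nonneg KQ_nonneg by (intro add_nonneg_nonneg mult_nonneg_nonneg) auto

end

context kolmogorov_solution
begin

definition V where "V t = (\<lambda>y. u (y, t))"

lemma dif3_le:
  assumes t: "t \<le> T" and \<rho>: "\<rho> > 0" and k: "norm k1 \<le> K" "norm k2 \<le> K" "norm k3 \<le> K"
  shows "\<bar>dif (dil \<rho> k1) (dif (dil \<rho> k2) (dif (dil \<rho> k3) (V t))) x\<bar> \<le> CE K * \<rho>\<^sup>2 * NN \<rho>"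
proof -
  have K: "K \<ge> 0" using k(1) norm_ge_zero order_trans by blast
  let ?D = "(K * exp K) ^ 3 + K * exp K"
  have "\<bar>difs (map (dil \<rho>) [k1, k2, k3]) (\<lambda>y. u (y, t)) x\<bar> \<le> (12 * CH * ?D + 8 * ((1 + KQ) * (1 + K)) ^ qN) * \<rho>\<^sup>2 * NN \<rho>"
  proof (rule difs_u_le[OF t \<rho>])
    fix l :: real assume l: "0 \<le> l" "l \<le> 1"
    have f: "norm (dil l k) * exp (norm (dil l k)) \<le> l * (K * exp K)" if "norm k \<le> K" for k
    proof -
      have a: "norm (dil l k) \<le> l * K" using norm_dil_le[OF l, of k] that l by (meson mult_left_mono order_trans)
      then have "norm (dil l k) \<le> K" using l K mult_left_le_one_le[of K l] by linarith
      with a have "norm (dil l k) * exp (norm (dil l k)) \<le> (l * K) * exp K" using l K by (intro mult_mono) auto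
      then show ?thesis by simp
    qed
    have "shift_weight (map (dil l) [k1, k2, k3]) \<le> (l * (K * exp K)) * ((l * (K * exp K)) * (l * (K * exp K)))"
      using f[OF k(1)] f[OF k(2)] f[OF k(3)] l K unfolding list.map shift_weight_Cons shift_weight_Nil mult_1_right
      by (intro mult_mono[OF f[OF k(1)] mult_mono[OF f[OF k(2)] f[OF k(3)]]]) auto
    also have "\<dots> = (K * exp K) ^ 3 * l ^ 3" by (simp add: power_mult_distrib power3_eq_cube mult_ac)
    also have "\<dots> \<le> ?D * l ^ 3" using l K by (intro mult_right_mono) auto
    finally show "shift_weight (map (dil l) [k1, k2, k3]) \<le> ?D * l ^ 3" .
  qed (use k in auto)
  then show ?thesis by (simp add: V_def CE_def)
qed

lemma dif1_le:
  assumes t: "t \<le> T" and \<rho>: "\<rho> > 0" and k: "norm k \<le> K" "\<And>i. i \<in> F \<Longrightarrow> k $ i = 0"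
  shows "\<bar>dif (dil \<rho> k) (V t) x\<bar> \<le> CE K * \<rho>\<^sup>2 * NN \<rho>"
proof -
  have K: "K \<ge> 0" using k(1) norm_ge_zero order_trans by blast
  let ?D = "(K * exp K) ^ 3 + K * exp K"
  have "\<bar>difs (map (dil \<rho>) [k]) (\<lambda>y. u (y, t)) x\<bar> \<le> (12 * CH * ?D + 8 * ((1 + KQ) * (1 + K)) ^ qN) * \<rho>\<^sup>2 * NN \<rho>"
  proof (rule difs_u_le[OF t \<rho>])
    fix l :: real assume l: "0 \<le> l" "l \<le> 1"
    have a: "norm (dil l k) \<le> l ^ 3 * K" using norm_dil_le_cube[OF l k(2)] k(1) l by (meson mult_left_mono order_trans zero_le_power)
    moreover have "l ^ 3 * K \<le> K" using l K by (intro mult_left_le_one_le power_le_one) auto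
    ultimately have "norm (dil l k) \<le> K" by linarith
    with a have "norm (dil l k) * exp (norm (dil l k)) \<le> (l ^ 3 * K) * exp K" using l K by (intro mult_mono) auto
    also have "\<dots> \<le> ?D * l ^ 3" using l K by (simp add: algebra_simps)
    finally show "shift_weight (map (dil l) [k]) \<le> ?D * l ^ 3" by (simp add: shift_weight_Cons)
  qed (use k in auto)
  then show ?thesis by (simp add: V_def CE_def)
qed

text \<open>The difference quotients whose limit along \<^term>\<open>r = 1 / 2 ^ n\<close> is the second derivative.\<close>

definition Q where "Q r i j t x = dif (r *\<^sub>R axis i 1) (dif (r *\<^sub>R axis j 1) (V t)) x / r\<^sup>2"

lemma Q_double:
  assumes t: "t \<le> T" and r: "r > 0" and ij: "i \<in> F" "j \<in> F"
  shows "\<bar>Q (2 * r) i j t x - Q r i j t x\<bar> \<le> 2 * CE 1 * NN r"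
proof -
  let ?h = "r *\<^sub>R axis i 1" and ?k = "r *\<^sub>R axis j (1::real)" and ?B = "CE 1 * r\<^sup>2 * NN r"
  have d: "(2 * r) *\<^sub>R axis l (1::real) = r *\<^sub>R axis l 1 + r *\<^sub>R axis l 1" for l :: 'n by (simp flip: scaleR_left_distrib)
  have 3: "\<bar>dif (r *\<^sub>R axis a 1) (dif (r *\<^sub>R axis c 1) (dif (r *\<^sub>R axis d 1) (V t))) x\<bar> \<le> ?B" if "a \<in> F" "c \<in> F" "d \<in> F" for a c d x
    using dif3_le[OF t r, of "axis a 1" 1 "axis c 1" "axis d 1" x] that by (simp add: dil_axis)
  have 1: "\<bar>dif ?h (dif ?k (dif ?k (V t))) x\<bar> \<le> ?B" "\<bar>dif ?h (dif ?h (dif ?k (V t))) x\<bar> \<le> ?B" "\<bar>dif ?h (dif ?h (dif ?k (dif ?k (V t)))) x\<bar> \<le> 2 * ?B"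
    using 3 ij by (auto intro: dif_le)
  define n where "n = 2 * dif ?h (dif ?k (dif ?k (V t))) x + 2 * dif ?h (dif ?h (dif ?k (V t))) x + dif ?h (dif ?h (dif ?k (dif ?k (V t)))) x"
  \<comment> \<open>The coefficients 2 and 2 of the third differences, and 2 for the fourth
    difference as a difference of third ones; division by 4 r^2 gives 3 / 2.\<close>
  have "\<bar>n\<bar> \<le> 6 * ?B" unfolding n_def using 1 by linarith
  moreover have "Q (2 * r) i j t x - Q r i j t x = n / (4 * r\<^sup>2)"
    unfolding Q_def d dif_dif_double n_def using r by (simp add: field_simps power2_eq_square)
  moreover have "\<bar>n / (4 * r\<^sup>2)\<bar> = \<bar>n\<bar> / (4 * r\<^sup>2)" by simp
  ultimately have "\<bar>Q (2 * r) i j t x - Q r i j t x\<bar> \<le> (6 * ?B) / (4 * r\<^sup>2)"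
    using divide_right_mono[of "\<bar>n\<bar>" "6 * ?B" "4 * r\<^sup>2"] by (simp only:) simp
  also have "\<dots> = (3 / 2) * CE 1 * NN r" using r by simp
  also have "\<dots> \<le> 2 * CE 1 * NN r" using CE_nonneg[of 1] NN_nonneg[OF r] by (simp add: mult_right_mono)
  finally show ?thesis .
qed

text \<open>Each halving costs \<open>NN\<close> at the new scale, which \<open>Ph_double\<close>
  bounds by an increment of \<open>Ph\<close>; the increments telescope.\<close>

lemma Q_dyadic:
  assumes t: "t \<le> T" and r: "r > 0" and ij: "i \<in> F" "j \<in> F"
  shows "\<bar>Q r i j t x - Q (r / 2 ^ n) i j t x\<bar> \<le> 4 * CE 1 * (Ph (r / 2) - Ph (r / 2 ^ n / 2))"
proof (induction n)
  case (Suc n)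
  let ?s = "r / 2 ^ Suc n"
  have s: "?s > 0" using r by simp
  have "\<bar>Q (2 * ?s) i j t x - Q ?s i j t x\<bar> \<le> 2 * CE 1 * NN ?s" by (rule Q_double[OF t s ij])
  also have "\<dots> \<le> 2 * CE 1 * (2 * (Ph ?s - Ph (?s / 2)))"
    using Ph_double[of "?s / 2"] s CE_nonneg[of 1] by (intro mult_left_mono) auto
  finally show ?case using Suc by (simp add: algebra_simps)
qed simp

text \<open>The errors are increments of the sequence Ph (r / 2^n / 2), which is decreasing and
  bounded below, hence Cauchy.\<close>

lemma Q_cauchy:
  assumes t: "t \<le> T" and r: "r > 0" and ij: "i \<in> F" "j \<in> F"
  shows "convergent (\<lambda>n. Q (r / 2 ^ n) i j t x)"
proof -
  let ?p = "\<lambda>n. Ph (r / 2 ^ n / 2)"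
  have "decseq ?p" using r by (intro decseq_SucI Ph_mono) (auto simp: field_simps)
  moreover have "0 \<le> ?p n" for n using r by (intro Ph_nonneg) auto
  then have "\<forall>n. 0 \<le> ?p n" by blast
  ultimately have "convergent ?p" by (intro Bseq_monoseq_convergent decseq_bounded[of _ 0] decseq_imp_monoseq)
  then have p: "Cauchy ?p" by (simp add: Cauchy_convergent_iff)
  have le: "\<bar>Q (r / 2 ^ m) i j t x - Q (r / 2 ^ n) i j t x\<bar> \<le> 4 * CE 1 * \<bar>?p m - ?p n\<bar>" if "m \<le> n" for m n
  proof -
    have e: "r / 2 ^ m / 2 ^ (n - m) = r / 2 ^ n" using that by (simp flip: power_add)
    have "\<bar>Q (r / 2 ^ m) i j t x - Q (r / 2 ^ m / 2 ^ (n - m)) i j t x\<bar> \<le> 4 * CE 1 * (Ph (r / 2 ^ m / 2) - Ph (r / 2 ^ m / 2 ^ (n - m) / 2))"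
      using r by (intro Q_dyadic t ij) auto
    also have "\<dots> \<le> 4 * CE 1 * \<bar>?p m - ?p n\<bar>" unfolding e using CE_nonneg[of 1] by (intro mult_left_mono) auto
    finally show ?thesis unfolding e .
  qed
  have le': "\<bar>Q (r / 2 ^ m) i j t x - Q (r / 2 ^ n) i j t x\<bar> \<le> 4 * CE 1 * \<bar>?p m - ?p n\<bar>" for m n
    using le[of m n] le[of n m] by (cases "m \<le> n") (auto simp: abs_minus_commute)
  have "Cauchy (\<lambda>n. Q (r / 2 ^ n) i j t x)"
  proof (rule CauchyI)
    fix e :: real assume e: "e > 0"
    obtain M where M: "\<And>m n. m \<ge> M \<Longrightarrow> n \<ge> M \<Longrightarrow> norm (?p m - ?p n) < e / (4 * CE 1 + 1)"
      using CauchyD[OF p, of "e / (4 * CE 1 + 1)"] e CE_nonneg[of 1] by auto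
    show "\<exists>M. \<forall>m\<ge>M. \<forall>n\<ge>M. norm (Q (r / 2 ^ m) i j t x - Q (r / 2 ^ n) i j t x) < e"
    proof (intro exI allI impI)
      fix m n assume mn: "m \<ge> M" "n \<ge> M"
      have "norm (Q (r / 2 ^ m) i j t x - Q (r / 2 ^ n) i j t x) \<le> (4 * CE 1) * \<bar>?p m - ?p n\<bar>" using le' by simp
      also have "\<dots> \<le> (4 * CE 1 + 1) * \<bar>?p m - ?p n\<bar>" by (intro mult_right_mono) auto
      also have "\<dots> < e" using M[OF mn] CE_nonneg[of 1] by (simp add: field_simps)
      finally show "norm (Q (r / 2 ^ m) i j t x - Q (r / 2 ^ n) i j t x) < e" .
    qed
  qed
  then show ?thesis by (simp add: Cauchy_convergent_iff)
qed

definition dxx where "dxx i j p = lim (\<lambda>n. Q (1 / 2 ^ n) i j (snd p) (fst p))"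

lemma Q_tendsto: "t \<le> T \<Longrightarrow> i \<in> F \<Longrightarrow> j \<in> F \<Longrightarrow> (\<lambda>n. Q (1 / 2 ^ n) i j t x) \<longlonglongrightarrow> dxx i j (x, t)"
  using Q_cauchy[of t 1] by (simp add: dxx_def convergent_LIMSEQ_iff)

text \<open>A scale of the form 2^m / 2^k has all its later halvings among the scales 1 / 2^n that
  define \<open>dxx\<close>, so letting n tend to infinity in \<open>Q_dyadic\<close> gives the
  distance from Q r to the limit.\<close>

lemma dxx_Q:
  assumes t: "t \<le> T" and ij: "i \<in> F" "j \<in> F" and r: "r = 2 ^ m / 2 ^ k"
  shows "\<bar>dxx i j (x, t) - Q r i j t x\<bar> \<le> 4 * CE 1 * Ph r"
proof -
  have r0: "r > 0" using r by simp
  have "(\<lambda>n. Q (1 / 2 ^ (n + k)) i j t x) \<longlonglongrightarrow> dxx i j (x, t)"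
    using LIMSEQ_ignore_initial_segment[OF Q_tendsto[OF t ij]] .
  moreover have "1 / 2 ^ (n + k) = r / 2 ^ (n + m)" for n by (simp add: r power_add)
  ultimately have l: "(\<lambda>n. \<bar>Q (r / 2 ^ (n + m)) i j t x - Q r i j t x\<bar>) \<longlonglongrightarrow> \<bar>dxx i j (x, t) - Q r i j t x\<bar>"
    by (intro tendsto_intros) simp
  have "\<bar>Q (r / 2 ^ n) i j t x - Q r i j t x\<bar> \<le> 4 * CE 1 * Ph r" for n
  proof -
    have "\<bar>Q r i j t x - Q (r / 2 ^ n) i j t x\<bar> \<le> 4 * CE 1 * (Ph (r / 2) - Ph (r / 2 ^ n / 2))" by (rule Q_dyadic[OF t r0 ij])
    also have "\<dots> \<le> 4 * CE 1 * Ph r"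
      using Ph_mono[of "r / 2" r] Ph_nonneg[of "r / 2 ^ n / 2"] r0 CE_nonneg[of 1] by (intro mult_left_mono) auto
    finally show ?thesis by (simp add: abs_minus_commute)
  qed
  then show ?thesis using LIMSEQ_le_const2[OF l] by blast
qed

lemma norm_le_of_qn:
  assumes r: "r > 0" and q: "qn z \<le> r"
  shows "\<exists>k. z = dil r k \<and> norm k \<le> real CARD('n)"
proof (intro exI conjI)
  show "z = dil r (dil (1 / r) z)" using r dil_inverse(1)[of r z] by simp
  let ?k = "dil (1 / r) z"
  have "qn ?k \<le> 1" using qn_dil[of "1 / r" z] r q by simp
  have "\<bar>?k $ i\<bar> \<le> 1" for i
  proof (rule ccontr)
    assume "\<not> \<bar>?k $ i\<bar> \<le> 1"
    then have "1 < \<bar>?k $ i\<bar> powr (1 / real (2 * b i + 1))" by (simp add: gr_one_powr del: dil_nth)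
    also have "\<dots> \<le> qn ?k" unfolding qn_def by (intro member_le_sum) auto
    finally show False using \<open>qn ?k \<le> 1\<close> by simp
  qed
  then have "(\<Sum>i\<in>UNIV. \<bar>?k $ i\<bar>) \<le> (\<Sum>i\<in>(UNIV::'n set). 1)" by (intro sum_mono)
  then show "norm ?k \<le> real CARD('n)" using norm_le_l1_cart[of ?k] by (simp del: dil_nth)
qed

text \<open>The variation of a second difference quotient under the shift x - y is a third
  difference; division by r^2 leaves \<open>NN r\<close>.\<close>

lemma Q_space:
  assumes t: "t \<le> T" and ij: "i \<in> F" "j \<in> F" and r: "r > 0" and q: "qn (x - y) \<le> r"
  shows "\<bar>Q r i j t x - Q r i j t y\<bar> \<le> CE (real CARD('n)) * NN r"
proof -
  obtain k where k: "x - y = dil r k" "norm k \<le> real CARD('n)" using norm_le_of_qn[OF r q] by blast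
  have N: "real CARD('n) \<ge> 1" by (simp add: Suc_leI)
  have "Q r i j t x - Q r i j t y = dif (dil r k) (dif (dil r (axis i 1)) (dif (dil r (axis j 1)) (V t))) y / r\<^sup>2"
    using ij by (simp add: Q_def dil_axis dif_def[of "x - y"] k(1)[symmetric] diff_divide_distrib)
  also have "\<bar>\<dots>\<bar> \<le> (CE (real CARD('n)) * r\<^sup>2 * NN r) / r\<^sup>2"
    unfolding abs_divide using dif3_le[OF t r k(2), of "axis i 1" "axis j 1" y] N r by (intro frac_le) auto
  finally show ?thesis using r by simp
qed

end

section \<open>Continuity in time\<close>

text \<open>Two mean value steps make the quotient equal to a mixed derivative at a nearby point. It
  is applied to slices and, in the proof of \<open>dxx_weak\<close>, to test functions.\<close>

lemma mixed_difference_quotient: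
  fixes G :: "'a::euclidean_space \<Rightarrow> real"
  assumes G: "bdk (Suc (Suc 0)) wt G" and \<epsilon>: "\<epsilon> \<longlonglongrightarrow> 0" "\<And>n. \<epsilon> n \<noteq> 0"
  shows "(\<lambda>n. dif (\<epsilon> n *\<^sub>R v) (dif (\<epsilon> n *\<^sub>R v') G) x / (\<epsilon> n)\<^sup>2) \<longlonglongrightarrow> dd v' (dd v G) x"
proof -
  have G1: "bdk (Suc 0) (\<lambda>x. norm v * wt x) (dd v G)" by (rule bdk_dd[OF G])
  have G2: "continuous_on UNIV (dd v' (dd v G))" using bdk_cont[OF bdk_dd[OF G1]] .
  have dG: "G differentiable (at y)" "dd v G differentiable (at y)" for y using G G1 by (auto simp del: bdk.simps dest: bdk_diff)
  have "\<exists>s s'. 0 < s \<and> s < 1 \<and> 0 < s' \<and> s' < 1 \<and>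
      dif (\<epsilon> n *\<^sub>R v) (dif (\<epsilon> n *\<^sub>R v') G) x / (\<epsilon> n)\<^sup>2 = dd v' (dd v G) (x + \<epsilon> n *\<^sub>R (s *\<^sub>R v + s' *\<^sub>R v'))" for n
  proof -
    let ?h = "\<epsilon> n *\<^sub>R v" and ?k = "\<epsilon> n *\<^sub>R v'"
    have dH: "dif ?k G differentiable (at y)" for y
      unfolding dif_def[abs_def] using dG by (intro differentiable_diff differentiable_shift)
    obtain s where s: "0 < s" "s < 1" "dif ?h (dif ?k G) x = dd ?h (dif ?k G) (x + s *\<^sub>R ?h)" using mvt_dif[OF dH] by blast
    have "dd ?h (dif ?k G) y = \<epsilon> n * dif ?k (dd v G) y" for y
    proof -
      have "dd ?h (dif ?k G) y = dd ?h (\<lambda>x. G (x + ?k)) y - dd ?h G y"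
        unfolding dif_def[abs_def] using dG by (intro dd_diff differentiable_shift)
      then show ?thesis using dG by (simp add: dd_shift dd_scaleR dif_def right_diff_distrib)
    qed
    moreover obtain s' where s': "0 < s'" "s' < 1" "dif ?k (dd v G) (x + s *\<^sub>R ?h) = dd ?k (dd v G) ((x + s *\<^sub>R ?h) + s' *\<^sub>R ?k)"
      using mvt_dif[OF dG(2)] by blast
    ultimately have "dif ?h (dif ?k G) x / (\<epsilon> n)\<^sup>2 = dd v' (dd v G) (x + s *\<^sub>R ?h + s' *\<^sub>R ?k)"
      using s \<epsilon>(2)[of n] dG by (simp add: dd_scaleR power2_eq_square)
    moreover have "x + s *\<^sub>R ?h + s' *\<^sub>R ?k = x + \<epsilon> n *\<^sub>R (s *\<^sub>R v + s' *\<^sub>R v')" by (simp add: algebra_simps)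
    ultimately have "dif ?h (dif ?k G) x / (\<epsilon> n)\<^sup>2 = dd v' (dd v G) (x + \<epsilon> n *\<^sub>R (s *\<^sub>R v + s' *\<^sub>R v'))" by (simp only:)
    with s(1,2) s'(1,2) show ?thesis by blast
  qed
  then obtain s s' where s: "\<And>n. 0 < s n" "\<And>n. s n < 1" "\<And>n. 0 < s' n" "\<And>n. s' n < 1"
    and e: "\<And>n. dif (\<epsilon> n *\<^sub>R v) (dif (\<epsilon> n *\<^sub>R v') G) x / (\<epsilon> n)\<^sup>2 = dd v' (dd v G) (x + \<epsilon> n *\<^sub>R (s n *\<^sub>R v + s' n *\<^sub>R v'))"
    by metis
  have "(\<lambda>n. \<epsilon> n *\<^sub>R (s n *\<^sub>R v + s' n *\<^sub>R v')) \<longlonglongrightarrow> 0"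
  proof (rule Lim_null_comparison[OF always_eventually])
    show "\<forall>n. norm (\<epsilon> n *\<^sub>R (s n *\<^sub>R v + s' n *\<^sub>R v')) \<le> \<bar>\<epsilon> n\<bar> * (norm v + norm v')"
    proof
      fix n
      have "norm (s n *\<^sub>R v + s' n *\<^sub>R v') \<le> s n * norm v + s' n * norm v'"
        using norm_triangle_ineq[of "s n *\<^sub>R v" "s' n *\<^sub>R v'"] s[of n] by simp
      also have "\<dots> \<le> norm v + norm v'" using s[of n] by (intro add_mono mult_left_le_one_le) auto
      finally show "norm (\<epsilon> n *\<^sub>R (s n *\<^sub>R v + s' n *\<^sub>R v')) \<le> \<bar>\<epsilon> n\<bar> * (norm v + norm v')" by (simp add: mult_left_mono)
    qed
    show "(\<lambda>n. \<bar>\<epsilon> n\<bar> * (norm v + norm v')) \<longlonglongrightarrow> 0" using tendsto_mult_right[OF tendsto_rabs[OF \<epsilon>(1)]] by simp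
  qed
  then have "(\<lambda>n. x + \<epsilon> n *\<^sub>R (s n *\<^sub>R v + s' n *\<^sub>R v')) \<longlonglongrightarrow> x" using tendsto_add[OF tendsto_const] by fastforce
  with G2 have "(\<lambda>n. dd v' (dd v G) (x + \<epsilon> n *\<^sub>R (s n *\<^sub>R v + s' n *\<^sub>R v'))) \<longlonglongrightarrow> dd v' (dd v G) x"
    by (intro isCont_tendsto_compose[of x "dd v' (dd v G)"]) (simp_all add: continuous_on_eq_continuous_at)
  then show ?thesis by (simp add: e)
qed

lemma difs_av:
  fixes K :: "'a::euclidean_space \<Rightarrow> real"
  assumes K: "integrable lborel K" "\<And>z. K z \<ge> 0" "(\<integral>z. K z \<partial>lborel) = 1" and m: "m \<in> borel_measurable borel"
    and G: "G \<in> borel_measurable borel" "\<And>x. \<bar>G x\<bar> \<le> C"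
  shows "difs hs (av K m G) = av K m (difs hs G)"
proof (induction hs)
  case (Cons h hs)
  have i: "integrable lborel (\<lambda>z. K z * difs hs G (x - m z))" for x
    by (rule av_integrable[OF K m difs_borel[OF G(1)] difs_le[OF G(2)]])
  have "dif h (av K m (difs hs G)) x = av K m (dif h (difs hs G)) x" for x
    using Bochner_Integration.integral_diff[OF i[of "x + h"] i[of x]] by (simp add: av_def dif_def right_diff_distrib diff_add_eq)
  then show ?case by (auto simp: Cons)
qed simp

lemma difs_linear_arg:
  assumes "\<And>x y. l (x + y) = l x + l y"
  shows "difs hs (\<lambda>y. G (l y)) y = difs (map l hs) G (l y)"
  by (induction hs arbitrary: y) (simp_all add: dif_def assms)

section \<open>Estimates over a time interval of length r^2\<close>

context kolmogorov
begin

text \<open>The first summand counts the entries of the coefficient matrix, each at most 1 / \<nu>,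
  times the bound of \<open>fourth_difference_le\<close> with K = 1 + KE; the second bounds the
  source.\<close>

definition CT :: real where
  "CT = (real (card F))\<^sup>2 * ((1 / \<nu>) * (16 * CE 1 + 2 * CE (1 + KE))) + 4 * ((1 + KQ) * 2) ^ qN"

lemma CT_nonneg: "CT \<ge> 0"
  unfolding CT_def using CE_nonneg KE(1) KQ_nonneg nu_pos by (intro add_nonneg_nonneg mult_nonneg_nonneg) auto

end

context kolmogorov_solution
begin

text \<open>Testing the form with e_i, e_i + e_j and e_i - e_j bounds all entries by the upper
  ellipticity constant; the diagonal entries are positive by the lower one.\<close>

lemma a_le: "AE s in lborel. \<forall>i\<in>F. \<forall>j\<in>F. \<bar>a s i j\<bar> \<le> 1 / \<nu>"
proof -
  let ?S = "\<lambda>s \<zeta>. \<Sum>i\<in>F. \<Sum>j\<in>F. a s i j * \<zeta> i * \<zeta> j"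
  have *: "\<bar>a s i j\<bar> \<le> 1 / \<nu>" if ij: "i \<in> F" "j \<in> F"
    and el: "\<And>\<zeta>::'n \<Rightarrow> real. \<nu> * (\<Sum>i\<in>F. (\<zeta> i)\<^sup>2) \<le> ?S s \<zeta>" "\<And>\<zeta>::'n \<Rightarrow> real. ?S s \<zeta> \<le> (1 / \<nu>) * (\<Sum>i\<in>F. (\<zeta> i)\<^sup>2)" for s i j
  proof -
    define \<zeta> :: "'n \<Rightarrow> 'n \<Rightarrow> real \<Rightarrow> 'n \<Rightarrow> real" where "\<zeta> p q c k = of_bool (k = p) + c * of_bool (k = q)" for p q c k
    have d: "(\<Sum>k\<in>F. \<Sum>l\<in>F. a s k l * (of_bool (k = p) * of_bool (l = q))) = a s p q" if "p \<in> F" "q \<in> F" for p q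
    proof -
      have "(\<Sum>k\<in>F. \<Sum>l\<in>F. a s k l * (of_bool (k = p) * of_bool (l = q))) = (\<Sum>k\<in>F. if k = p then (\<Sum>l\<in>F. if l = q then a s k l else 0) else 0)"
        by (intro sum.cong refl) (auto intro!: sum.cong sum.neutral)
      then show ?thesis using that by simp
    qed
    have S: "?S s (\<zeta> p q c) = a s p p + c * a s p q + c * a s q p + c\<^sup>2 * a s q q" if "p \<in> F" "q \<in> F" for p q c
    proof -
      have "?S s (\<zeta> p q c) = (\<Sum>k\<in>F. \<Sum>l\<in>F. a s k l * (of_bool (k = p) * of_bool (l = p)) + c * (a s k l * (of_bool (k = p) * of_bool (l = q)))
          + c * (a s k l * (of_bool (k = q) * of_bool (l = p))) + c\<^sup>2 * (a s k l * (of_bool (k = q) * of_bool (l = q))))"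
        unfolding \<zeta>_def power2_eq_square by (intro sum.cong refl) (simp only: algebra_simps)
      then show ?thesis by (simp only: sum.distrib sum_distrib_left[symmetric] d that)
    qed
    have Z: "(\<Sum>k\<in>F. (\<zeta> p q c k)\<^sup>2) = 1 + 2 * c * of_bool (p = q) + c\<^sup>2" if "p \<in> F" "q \<in> F" for p q c
    proof -
      have "(\<Sum>k\<in>F. (\<zeta> p q c k)\<^sup>2) = (\<Sum>k\<in>F. (if k = p then 1 + 2 * c * of_bool (p = q) else 0) + (if k = q then c\<^sup>2 else 0))"
        unfolding \<zeta>_def by (intro sum.cong refl) (auto simp: algebra_simps power2_eq_square)
      then show ?thesis using that by (simp add: sum.distrib)
    qed
    have sym: "a s j i = a s i j" using ell ij by (simp add: elliptic_def)
    have d0: "\<nu> \<le> a s p p" if "p \<in> F" for p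
      using el(1)[of "\<zeta> p p 0"] unfolding S[OF that that] Z[OF that that] by simp
    show ?thesis
    proof (cases "i = j")
      case True
      then show ?thesis using el(2)[of "\<zeta> i i 0"] d0[OF ij(1)] nu_pos unfolding S[OF ij(1) ij(1)] Z[OF ij(1) ij(1)] by simp
    next
      case False
      then show ?thesis using el(2)[of "\<zeta> i j 1"] el(2)[of "\<zeta> i j (-1)"] d0[OF ij(1)] d0[OF ij(2)] nu_pos
        unfolding S[OF ij] Z[OF ij] sym by (simp add: abs_le_iff)
    qed
  qed
  have "AE s in lborel. \<forall>\<zeta>::'n \<Rightarrow> real. \<nu> * (\<Sum>i\<in>F. (\<zeta> i)\<^sup>2) \<le> ?S s \<zeta> \<and> ?S s \<zeta> \<le> (1 / \<nu>) * (\<Sum>i\<in>F. (\<zeta> i)\<^sup>2)"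
    using ell by (simp add: elliptic_def)
  then show ?thesis by (rule AE_mp) (use * in \<open>intro AE_I2, blast\<close>)
qed

text \<open>The quotients at the small scale r / 2^n differ from those at scale r by at most a
  multiple of \<open>Ph r\<close>, uniformly in n, and at scale r one further difference already
  gives a third difference.\<close>

lemma fourth_difference_le:
  assumes t: "t \<le> T" and r: "r > 0" and ij: "i \<in> F" "j \<in> F" and k: "norm k1 \<le> K" "norm k2 \<le> K" "1 \<le> K"
  shows "\<bar>dif (dil r k1) (dif (dil r k2) (Q (r / 2 ^ n) i j t)) x\<bar> \<le> (16 * CE 1 + 2 * CE K) * Ph r"
proof -
  define P where "P x = Q (r / 2 ^ n) i j t x - Q r i j t x" for x
  have P: "\<bar>P x\<bar> \<le> 4 * CE 1 * Ph r" for x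
  proof -
    have "\<bar>Q r i j t x - Q (r / 2 ^ n) i j t x\<bar> \<le> 4 * CE 1 * (Ph (r / 2) - Ph (r / 2 ^ n / 2))" by (rule Q_dyadic[OF t r ij])
    also have "\<dots> \<le> 4 * CE 1 * Ph r"
      using Ph_mono[of "r / 2" r] Ph_nonneg[of "r / 2 ^ n / 2"] r CE_nonneg[of 1] by (intro mult_left_mono) auto
    finally show ?thesis by (simp add: P_def abs_minus_commute)
  qed
  have 1: "\<bar>dif (dil r k1) (dif (dil r k2) P) x\<bar> \<le> 2 * (2 * (4 * CE 1 * Ph r))" by (intro dif_le P)
  have "\<bar>dif (dil r k2) (Q r i j t) y\<bar> \<le> CE K * NN r" for y
  proof -
    have "dif (dil r k2) (Q r i j t) y = dif (dil r k2) (dif (dil r (axis i 1)) (dif (dil r (axis j 1)) (V t))) y / r\<^sup>2"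
      using ij by (simp add: Q_def dil_axis dif_def[of "dil r k2"] diff_divide_distrib)
    also have "\<bar>\<dots>\<bar> \<le> (CE K * r\<^sup>2 * NN r) / r\<^sup>2"
      unfolding abs_divide using dif3_le[OF t r k(2), of "axis i 1" "axis j 1" y] k r by (intro frac_le) auto
    finally show ?thesis using r by simp
  qed
  then have "\<bar>dif (dil r k1) (dif (dil r k2) (Q r i j t)) x\<bar> \<le> 2 * (CE K * NN r)" by (intro dif_le)
  also have "\<dots> \<le> 2 * (CE K * Ph r)" using NN_le_Ph[OF r] CE_nonneg[of K] k(3) by (intro mult_left_mono) auto
  finally have 2: "\<bar>dif (dil r k1) (dif (dil r k2) (Q r i j t)) x\<bar> \<le> 2 * (CE K * Ph r)" .
  have "dif (dil r k1) (dif (dil r k2) (Q (r / 2 ^ n) i j t)) x = dif (dil r k1) (dif (dil r k2) P) x + dif (dil r k1) (dif (dil r k2) (Q r i j t)) x"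
    by (simp add: dif_def P_def)
  then show ?thesis using 1 2 by (simp add: algebra_simps)
qed

text \<open>In the original coordinates the shift h becomes E(s - t) h; averaging over the mollifier
  preserves the bound.\<close>

lemma difs_slc_u0_le:
  assumes \<eta>: "mollifier \<eta>" and s: "s \<le> T" and C: "\<And>x. \<bar>difs (map (\<lambda>h. E (s - t) *v h) hs) (V s) x\<bar> \<le> C"
  shows "\<bar>difs hs (slc u0 \<eta> t s) y\<bar> \<le> C"
proof -
  have b: "\<eta> \<in> borel_measurable borel" using \<eta> smooth_borel by (auto simp: mollifier_def bumpy_def)
  have m: "integrable lborel \<eta>" "\<And>z. \<eta> z \<ge> 0" "(\<integral>z. \<eta> z \<partial>lborel) = 1" using \<eta> by (auto simp: mollifier_def)
  let ?G = "\<lambda>y. u0 (E (s - t) *v y, s)"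
  have e: "slc u0 \<eta> t s = av \<eta> (\<lambda>z. z) ?G"
    by (rule ext) (simp add: slc_reflect[OF u0_borel u0_le b] av_def)
  have G: "?G \<in> borel_measurable borel" "\<And>x. \<bar>?G x\<bar> \<le> Mu" using slice_borel[OF u0_borel u0_le] u0_le by auto
  have "difs hs ?G y = difs (map (\<lambda>h. E (s - t) *v h) hs) (V s) (E (s - t) *v y)" for y
    using difs_linear_arg[of "\<lambda>h. E (s - t) *v h" hs "V s"] u0_eq[OF s] by (simp add: V_def matrix_vector_right_distrib)
  then have le: "\<bar>difs hs ?G y\<bar> \<le> C" for y using C by simp
  show ?thesis unfolding e difs_av[OF m measurable_ident_sets[OF refl] G]
    by (rule av_le[OF m measurable_ident_sets[OF refl] difs_borel[OF G(1)] le])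
qed

text \<open>The diagonal blocks of \<open>E\<close> are identities, so over times up to r^2 the
  drift displaces a shift in the first block only into higher blocks, by an amount of anisotropic
  size r.\<close>

lemma E_dil_shift:
  assumes r: "r > 0" and s: "\<bar>s\<bar> \<le> r\<^sup>2" and i: "i \<in> F"
  shows "\<exists>k. E s *v (r *\<^sub>R axis i 1) = dil r k \<and> norm k \<le> 1 + KE"
    "\<exists>k. E s *v (r *\<^sub>R axis i 1) = r *\<^sub>R axis i 1 + dil r k \<and> norm k \<le> 1 + KE \<and> (\<forall>l\<in>F. k $ l = 0)"
proof -
  define \<theta> where "\<theta> = s / r\<^sup>2"
  define k where "k = E \<theta> *v axis i 1"
  have th: "\<theta> \<in> {-2..2}" using r s by (auto simp: \<theta>_def abs_le_iff field_simps)
  have n: "norm k \<le> KE" using KE(2)[OF th, of "axis i 1"] by (simp add: k_def)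
  have e: "E s *v (r *\<^sub>R axis i 1) = dil r k"
    using r Emat_dil[of r \<theta> "axis i 1"] by (simp add: \<theta>_def k_def dil_axis[OF i])
  then show "\<exists>k. E s *v (r *\<^sub>R axis i 1) = dil r k \<and> norm k \<le> 1 + KE" using n by (intro exI[of _ k]) auto
  have "norm (k - axis i 1) \<le> 1 + KE" using norm_triangle_ineq4[of k "axis i 1"] n by simp
  moreover have "(k - axis i 1) $ l = 0" if "l \<in> F" for l
  proof -
    have "k $ l = E \<theta> $ l $ i" by (simp add: k_def matrix_vector_mult_def axis_def if_distrib cong: if_cong)
    then show ?thesis using Emat_same_block[of l i \<theta>] that i by (simp add: first_vars_b axis_def)
  qed
  moreover have "dil r k = r *\<^sub>R axis i 1 + dil r (k - axis i 1)"
    using dil_axis[OF i, of r] by (simp add: vec_eq_iff algebra_simps)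
  ultimately show "\<exists>k. E s *v (r *\<^sub>R axis i 1) = r *\<^sub>R axis i 1 + dil r k \<and> norm k \<le> 1 + KE \<and> (\<forall>l\<in>F. k $ l = 0)"
    using e by metis
qed

context
  fixes \<eta> :: "(real, 'n) vec \<Rightarrow> real" and t r :: real and i0 j0 :: 'n
  assumes \<eta>: "mollifier \<eta>" and t: "t \<le> T" and r: "r > 0" and ij0: "i0 \<in> F" "j0 \<in> F"
begin

abbreviation "hs2 \<equiv> [r *\<^sub>R axis i0 1, r *\<^sub>R axis j0 (1::real)]"

lemma bumpy_shifted2_eta: "bumpy (difs hs2 \<eta>)" using \<eta> by (intro bumpy_difs) (simp add: mollifier_def)

text \<open>Derivatives along E(t - s) e_i in the moving coordinates are derivatives along e_i in
  the original ones. As limits of quotients they inherit the bound for fourth differences.\<close>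

lemma second_derivative_slc_le:
  assumes s: "s \<le> t" "t - s \<le> r\<^sup>2" and ij: "i \<in> F" "j \<in> F"
  shows "\<bar>dd (E (t - s) *v axis j 1) (dd (E (t - s) *v axis i 1) (slc u0 (difs hs2 \<eta>) t s)) y\<bar> \<le> (16 * CE 1 + 2 * CE (1 + KE)) * Ph r"
proof -
  let ?v = "E (t - s) *v axis i 1" and ?v' = "E (t - s) *v axis j (1::real)" and ?G = "slc u0 (difs hs2 \<eta>) t s"
  have bumpy_eta: "bumpy \<eta>" using \<eta> by (simp add: mollifier_def)
  have sT: "s \<le> T" using s t by simp
  obtain L where L: "bdk (Suc (Suc 0)) (\<lambda>_. L) ?G" using bumpy_slc_bounds[OF bumpy_shifted2_eta, of "Suc (Suc 0)" t] by blast
  \<comment> \<open>Chosen so that the quotients in the original coordinates are exactly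
    \<open>Q (r / 2 ^ n)\<close>, for which the bound is uniform in n.\<close>
  define \<epsilon> where "\<epsilon> n = r / 2 ^ n" for n :: nat
  have "(\<lambda>n. r * (1 / 2) ^ n) \<longlonglongrightarrow> r * 0" by (rule tendsto_mult_left[OF LIMSEQ_realpow_zero]) auto
  then have \<epsilon>: "\<epsilon> \<longlonglongrightarrow> 0" "\<And>n. \<epsilon> n \<noteq> 0" using r by (simp_all add: \<epsilon>_def[abs_def] power_divide)
  obtain k1 where k1: "E (s - t) *v (r *\<^sub>R axis i0 1) = dil r k1" "norm k1 \<le> 1 + KE" using E_dil_shift(1)[OF r, of "s - t" i0] s ij0 by auto
  obtain k2 where k2: "E (s - t) *v (r *\<^sub>R axis j0 1) = dil r k2" "norm k2 \<le> 1 + KE" using E_dil_shift(1)[OF r, of "s - t" j0] s ij0 by auto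
  have "\<bar>dif (\<epsilon> n *\<^sub>R ?v) (dif (\<epsilon> n *\<^sub>R ?v') ?G) y / (\<epsilon> n)\<^sup>2\<bar> \<le> (16 * CE 1 + 2 * CE (1 + KE)) * Ph r" for n
  proof -
    let ?hs = "[\<epsilon> n *\<^sub>R ?v, \<epsilon> n *\<^sub>R ?v', r *\<^sub>R axis i0 1, r *\<^sub>R axis j0 1]"
    have "dif (\<epsilon> n *\<^sub>R ?v) (dif (\<epsilon> n *\<^sub>R ?v') ?G) y = difs ?hs (slc u0 \<eta> t s) y"
      by (simp add: slc_difs[OF bumpy_eta u0_borel u0_le] del: difs.simps) simp
    moreover have "\<bar>difs ?hs (slc u0 \<eta> t s) y\<bar> \<le> (\<epsilon> n)\<^sup>2 * ((16 * CE 1 + 2 * CE (1 + KE)) * Ph r)"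
    proof (rule difs_slc_u0_le[OF \<eta> sT])
      fix x
      have m: "map (\<lambda>h. E (s - t) *v h) ?hs = [\<epsilon> n *\<^sub>R axis i 1, \<epsilon> n *\<^sub>R axis j 1, dil r k1, dil r k2]"
        by (simp add: matrix_vector_mult_scaleR Emat_mv k1(1)[symmetric] k2(1)[symmetric])
      have "difs (map (\<lambda>h. E (s - t) *v h) ?hs) (V s) x = dif (dil r k1) (dif (dil r k2) (dif (\<epsilon> n *\<^sub>R axis i 1) (dif (\<epsilon> n *\<^sub>R axis j 1) (V s)))) x"
        unfolding m by (simp add: dif_commute[of "\<epsilon> n *\<^sub>R axis j 1"] dif_commute[of "\<epsilon> n *\<^sub>R axis i 1" "dil r _"])
      also have "dif (\<epsilon> n *\<^sub>R axis i 1) (dif (\<epsilon> n *\<^sub>R axis j 1) (V s)) = (\<lambda>x. (\<epsilon> n)\<^sup>2 * Q (r / 2 ^ n) i j s x)"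
        using \<epsilon>(2)[of n] by (simp add: Q_def \<epsilon>_def fun_eq_iff)
      also have "dif (dil r k1) (dif (dil r k2) \<dots>) x = (\<epsilon> n)\<^sup>2 * dif (dil r k1) (dif (dil r k2) (Q (r / 2 ^ n) i j s)) x"
        by (simp add: dif_def algebra_simps)
      finally show "\<bar>difs (map (\<lambda>h. E (s - t) *v h) ?hs) (V s) x\<bar> \<le> (\<epsilon> n)\<^sup>2 * ((16 * CE 1 + 2 * CE (1 + KE)) * Ph r)"
        using fourth_difference_le[OF sT r ij k1(2) k2(2), of n x] KE(1) by (simp add: abs_mult mult_left_mono)
    qed
    ultimately show ?thesis using \<epsilon>(2)[of n] by (simp add: abs_divide field_simps)
  qed
  moreover have "(\<lambda>n. \<bar>dif (\<epsilon> n *\<^sub>R ?v) (dif (\<epsilon> n *\<^sub>R ?v') ?G) y / (\<epsilon> n)\<^sup>2\<bar>) \<longlonglongrightarrow> \<bar>dd ?v' (dd ?v ?G) y\<bar>"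
    by (intro tendsto_rabs mixed_difference_quotient[OF L] \<epsilon>)
  ultimately show ?thesis using LIMSEQ_le_const2 by blast
qed

lemma sum_Amat_second_derivative:
  assumes G: "bdk (Suc (Suc 0)) wt G"
  shows "(\<Sum>k\<in>UNIV. \<Sum>l\<in>UNIV. Amat t s l k * dd (axis k 1) (dd (axis l 1) G) y) =
    (\<Sum>i\<in>F. \<Sum>j\<in>F. a s i j * dd (E (t - s) *v axis j 1) (dd (E (t - s) *v axis i 1) G) y)"
proof -
  have c: "(E (t - s) *v axis i 1) $ k = E (t - s) $ k $ i" for i k
    by (simp add: matrix_vector_mult_def axis_def if_distrib cong: if_cong)
  have dG: "G differentiable (at x)" for x using G by simp
  have ddG: "dd v G differentiable (at x)" for v x using bdk_diff[OF bdk_dd[OF G]] .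
  have "dd (E (t - s) *v axis j 1) (dd (E (t - s) *v axis i 1) G) y =
      (\<Sum>k\<in>UNIV. \<Sum>l\<in>UNIV. (E (t - s) $ k $ j * E (t - s) $ l $ i) * dd (axis k 1) (dd (axis l 1) G) y)" for i j
  proof -
    have 1: "dd (E (t - s) *v axis i 1) G = (\<lambda>x. \<Sum>l\<in>UNIV. E (t - s) $ l $ i * dd (axis l 1) G x)"
      by (rule ext) (subst dd_axis_sum[OF dG], simp only: c)
    have 2: "dd v (\<lambda>x. \<Sum>l\<in>UNIV. E (t - s) $ l $ i * dd (axis l 1) G x) y = (\<Sum>l\<in>UNIV. E (t - s) $ l $ i * dd v (dd (axis l 1) G) y)" for v
      by (rule dd_sum) (simp_all add: ddG)
    show ?thesis
      by (subst dd_axis_sum[OF ddG]) (simp only: c 1 2 sum_distrib_left mult.assoc)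
  qed
  then have "(\<Sum>i\<in>F. \<Sum>j\<in>F. a s i j * dd (E (t - s) *v axis j 1) (dd (E (t - s) *v axis i 1) G) y) =
      (\<Sum>i\<in>F. \<Sum>j\<in>F. \<Sum>k\<in>UNIV. \<Sum>l\<in>UNIV. a s i j * (E (t - s) $ k $ j * E (t - s) $ l $ i) * dd (axis k 1) (dd (axis l 1) G) y)"
    by (simp only: sum_distrib_left mult.assoc)
  also have "\<dots> = (\<Sum>k\<in>UNIV. \<Sum>l\<in>UNIV. Amat t s l k * dd (axis k 1) (dd (axis l 1) G) y)"
    by (subst sum_swap4) (simp only: Amat_def sum_distrib_right)
  finally show ?thesis by simp
qed

text \<open>The bound on \<open>g\<close> is only almost everywhere, as the bound on the
  coefficients is. A nonintegrable integrand has integral 0 by convention, which settles the second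
  case.\<close>

lemma abs_indicator_integral_le:
  fixes g :: "real \<Rightarrow> real"
  assumes s: "s1 \<le> s2" and C: "C \<ge> 0" and g: "AE s in lborel. s \<in> {s1..s2} \<longrightarrow> \<bar>g s\<bar> \<le> C"
  shows "\<bar>\<integral>s. indicator {s1..s2} s * g s \<partial>lborel\<bar> \<le> C * (s2 - s1)"
proof (cases "integrable lborel (\<lambda>s. indicator {s1..s2} s * g s)")
  case True
  have "\<bar>\<integral>s. indicator {s1..s2} s * g s \<partial>lborel\<bar> \<le> (\<integral>s. \<bar>indicator {s1..s2} s * g s\<bar> \<partial>lborel)" by (rule integral_abs_bound)
  also have "\<dots> \<le> (\<integral>s. indicator {s1..s2} s * C \<partial>lborel)"
  proof (rule integral_mono_AE)
    show "integrable lborel (\<lambda>s. \<bar>indicator {s1..s2} s * g s\<bar>)" using True by simp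
    show "integrable lborel (\<lambda>s. indicator {s1..s2} s * C)"
      by (intro integrable_mult_left integrable_real_indicator) (auto simp: emeasure_lborel_Icc_eq)
    show "AE s in lborel. \<bar>indicator {s1..s2} s * g s\<bar> \<le> indicator {s1..s2} s * C"
      using g by (rule AE_mp) (auto simp: indicator_def)
  qed
  also have "\<dots> = C * (s2 - s1)" using s by simp
  finally show ?thesis .
next
  case False
  then show ?thesis using s C by (simp add: not_integrable_integral_eq)
qed

text \<open>The integrated equation for the twice differenced slice. Both terms of its integrand are
  at most a multiple of \<open>Ph r\<close>: the diffusion by the fourth difference bound, the
  source by the modulus at r, which is at most 2 Ph r.\<close>

lemma slc_increment_le:
  assumes s: "s1 < s2" "s2 < t" "t - s1 \<le> r\<^sup>2"
  shows "\<bar>slc u0 (difs hs2 \<eta>) t s2 y - slc u0 (difs hs2 \<eta>) t s1 y\<bar> \<le> CT * Ph r * (s2 - s1)"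
proof -
  have sT: "s2 < T" using s t by simp
  have bumpy_eta: "bumpy \<eta>" using \<eta> by (simp add: mollifier_def)
  let ?G = "slc u0 (difs hs2 \<eta>) t" and ?C = "(16 * CE 1 + 2 * CE (1 + KE)) * Ph r"
  let ?g = "\<lambda>s. (\<Sum>k\<in>UNIV. \<Sum>l\<in>UNIV. Amat t s l k * slc u0 (dd (axis k 1) (dd (axis l 1) (difs hs2 \<eta>))) t s y) - slc f0 (difs hs2 \<eta>) t s y"
  have Ph: "Ph r \<ge> 0" "w r \<le> 2 * Ph r" using Ph_nonneg[OF r] w_le_NN[OF r] NN_le_Ph[OF r] by auto
  have C: "?C \<ge> 0" using Ph CE_nonneg[of 1] CE_nonneg[of "1 + KE"] KE(1) by simp
  have g: "\<bar>?g s\<bar> \<le> CT * Ph r" if s': "s \<in> {s1..s2}" and a: "\<forall>i\<in>F. \<forall>j\<in>F. \<bar>a s i j\<bar> \<le> 1 / \<nu>" for s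
  proof -
    obtain L where L: "bdk (Suc (Suc 0)) (\<lambda>_. L) (?G s)" using bumpy_slc_bounds[OF bumpy_shifted2_eta, of "Suc (Suc 0)" t] by blast
    have e1: "(\<Sum>k\<in>UNIV. \<Sum>l\<in>UNIV. Amat t s l k * slc u0 (dd (axis k 1) (dd (axis l 1) (difs hs2 \<eta>))) t s y) =
        (\<Sum>k\<in>UNIV. \<Sum>l\<in>UNIV. Amat t s l k * dd (axis k 1) (dd (axis l 1) (?G s)) y)"
      by (simp only: dd_slc_bumpy[OF bumpy_shifted2_eta] dd_slc_bumpy[OF bumpy_dd[OF bumpy_shifted2_eta]])
    note e2 = sum_Amat_second_derivative[OF L]
    have "\<bar>\<Sum>i\<in>F. \<Sum>j\<in>F. a s i j * dd (E (t - s) *v axis j 1) (dd (E (t - s) *v axis i 1) (?G s)) y\<bar> \<le> (\<Sum>i\<in>F. \<Sum>j\<in>F. \<bar>a s i j * dd (E (t - s) *v axis j 1) (dd (E (t - s) *v axis i 1) (?G s)) y\<bar>)"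
      by (rule order_trans[OF sum_abs]) (rule sum_mono, rule sum_abs)
    also have "\<dots> \<le> (\<Sum>i\<in>F. \<Sum>j\<in>F. (1 / \<nu>) * ?C)"
    proof (rule sum_mono, rule sum_mono)
      fix i j assume ij: "i \<in> F" "j \<in> F"
      have 1: "\<bar>a s i j\<bar> \<le> 1 / \<nu>" using a ij by blast
      have 2: "\<bar>dd (E (t - s) *v axis j 1) (dd (E (t - s) *v axis i 1) (?G s)) y\<bar> \<le> ?C"
        by (rule second_derivative_slc_le[OF _ _ ij]) (use s s' in \<open>auto simp del: difs.simps\<close>)
      show "\<bar>a s i j * dd (E (t - s) *v axis j 1) (dd (E (t - s) *v axis i 1) (?G s)) y\<bar> \<le> (1 / \<nu>) * ?C"
        unfolding abs_mult by (rule mult_mono[OF 1 2 _ abs_ge_zero]) (use nu_pos in simp)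
    qed
    also have "\<dots> = (real (card F))\<^sup>2 * ((1 / \<nu>) * ?C)" by (simp only: sum_constant power2_eq_square mult.assoc)
    finally have 1: "\<bar>\<Sum>k\<in>UNIV. \<Sum>l\<in>UNIV. Amat t s l k * slc u0 (dd (axis k 1) (dd (axis l 1) (difs hs2 \<eta>))) t s y\<bar> \<le> (real (card F))\<^sup>2 * ((1 / \<nu>) * ?C)" unfolding e1 e2 .
    have "\<bar>dif (r *\<^sub>R axis j0 1) (slc f0 \<eta> t s) y\<bar> \<le> ((1 + KQ) * (1 + norm (axis j0 (1::real)))) ^ qN * w r" for y
      unfolding dif_def by (rule slc_f0_diff_dil[OF \<eta> _ r, where c = 1]) (use s s' t sT r in \<open>auto simp: dil_axis ij0\<close>)
    then have "\<bar>dif (r *\<^sub>R axis i0 1) (dif (r *\<^sub>R axis j0 1) (slc f0 \<eta> t s)) y\<bar> \<le> 2 * (((1 + KQ) * (1 + norm (axis j0 (1::real)))) ^ qN * w r)"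
      by (rule dif_le)
    also have "\<dots> \<le> 2 * (((1 + KQ) * 2) ^ qN * (2 * Ph r))" using Ph KQ_nonneg by (intro mult_left_mono) (auto intro!: mult_mono)
    finally have 2: "\<bar>slc f0 (difs hs2 \<eta>) t s y\<bar> \<le> 4 * ((1 + KQ) * 2) ^ qN * Ph r"
      by (simp add: slc_difs[OF bumpy_eta f0_borel Mf(2)] del: difs.simps) simp
    have "CT * Ph r = (real (card F))\<^sup>2 * ((1 / \<nu>) * ?C) + 4 * ((1 + KQ) * 2) ^ qN * Ph r" unfolding CT_def by (simp add: algebra_simps)
    then show ?thesis using 1 2 by linarith
  qed
  have ae: "AE s in lborel. s \<in> {s1..s2} \<longrightarrow> \<bar>?g s\<bar> \<le> CT * Ph r"
    using a_le by (rule AE_mp) (use g in \<open>intro AE_I2, blast\<close>)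
  have "0 \<le> CT * Ph r" using CT_nonneg Ph(1) by (rule mult_nonneg_nonneg)
  from abs_indicator_integral_le[OF less_imp_le[OF s(1)] this ae]
  show ?thesis unfolding integrated_equation'[OF bumpy_shifted2_eta s(1) sT] .
qed

lemma slc_increment_le':
  assumes s: "s1 < t" "t - s1 \<le> r\<^sup>2"
  shows "\<bar>slc u0 (difs hs2 \<eta>) t t y - slc u0 (difs hs2 \<eta>) t s1 y\<bar> \<le> CT * Ph r * r\<^sup>2"
proof -
  have "((\<lambda>c. slc u0 (difs hs2 \<eta>) t c y) \<longlongrightarrow> slc u0 (difs hs2 \<eta>) t t y) (at t within {..T})"
    using slc_cont[OF bumpy_shifted2_eta] t by (auto simp: continuous_on_def)
  then have l: "((\<lambda>c. slc u0 (difs hs2 \<eta>) t c y) \<longlongrightarrow> slc u0 (difs hs2 \<eta>) t t y) (at_left t)"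
    by (rule tendsto_within_subset) (use t in auto)
  have "\<bar>slc u0 (difs hs2 \<eta>) t c y - slc u0 (difs hs2 \<eta>) t s1 y\<bar> \<le> CT * Ph r * r\<^sup>2" if c: "s1 < c" "c < t" for c
  proof -
    have "CT * Ph r * (c - s1) \<le> CT * Ph r * r\<^sup>2" using c s CT_nonneg Ph_nonneg[OF r] by (intro mult_left_mono) auto
    then show ?thesis using slc_increment_le[OF c s(2), of y] by linarith
  qed
  then have "\<forall>\<^sub>F c in at_left t. \<bar>slc u0 (difs hs2 \<eta>) t c y - slc u0 (difs hs2 \<eta>) t s1 y\<bar> \<le> CT * Ph r * r\<^sup>2"
    using eventually_at_left_real[OF s(1)] by (auto elim!: eventually_mono)
  then show ?thesis
    by (intro tendsto_upperbound[OF tendsto_rabs[OF tendsto_diff[OF l tendsto_const]]]) auto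
qed

end

text \<open>In the moving coordinates the shifts stay fixed; at time s they appear as E(s - t)
  applied to r e_i and r e_j. Returning to undisplaced shifts costs single differences in higher
  blocks, which \<open>dif1_le\<close> bounds by a multiple of r^2 NN r.\<close>

lemma Q_time:
  assumes t: "t \<le> T" and r: "r > 0" and ij: "i \<in> F" "j \<in> F" and s: "s \<le> t" "t - s \<le> r\<^sup>2"
  shows "\<bar>Q r i j t y - Q r i j s (E (s - t) *v y)\<bar> \<le> (CT + 4 * CE (1 + KE)) * Ph r"
proof (cases "s = t")
  case True
  then show ?thesis using CT_nonneg CE_nonneg[of "1 + KE"] KE(1) Ph_nonneg[OF r] by simp
next
  case False
  then have st: "s < t" "s \<le> T" using s t by auto
  let ?h = "r *\<^sub>R axis i 1" and ?k = "r *\<^sub>R axis j (1::real)"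
  let ?hs = "[?h, ?k]" and ?z = "E (s - t) *v y" and ?A = "\<lambda>h. E (s - t) *v h"
  obtain \<eta> where \<eta>: "\<And>n::nat. mollifier (\<eta> n)" "\<And>t s x. s \<le> T \<Longrightarrow> (\<lambda>n. slc u0 (\<eta> n) t s x) \<longlonglongrightarrow> u (E (s - t) *v x, s)"
    using mollified_u_tendsto by blast
  have bumpy_eta: "bumpy (\<eta> n)" for n using \<eta>(1) by (simp add: mollifier_def)
  have l: "(\<lambda>n. difs ?hs (slc u0 (\<eta> n) t s') y) \<longlonglongrightarrow> difs (map (\<lambda>h. E (s' - t) *v h) ?hs) (V s') (E (s' - t) *v y)" if "s' \<le> T" for s'
  proof -
    have "(\<lambda>n. difs ?hs (slc u0 (\<eta> n) t s') y) \<longlonglongrightarrow> difs ?hs (\<lambda>y. V s' (E (s' - t) *v y)) y"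
      by (rule difs_tendsto) (use \<eta>(2)[OF that] in \<open>simp add: V_def\<close>)
    then show ?thesis by (subst difs_linear_arg[symmetric]) (simp_all add: matrix_vector_right_distrib)
  qed
  have "(\<lambda>n. \<bar>difs ?hs (slc u0 (\<eta> n) t t) y - difs ?hs (slc u0 (\<eta> n) t s) y\<bar>) \<longlonglongrightarrow> \<bar>difs ?hs (V t) y - difs (map ?A ?hs) (V s) ?z\<bar>"
    using l[OF t] l[OF st(2)] by (intro tendsto_rabs tendsto_diff) simp_all
  moreover have "\<bar>difs ?hs (slc u0 (\<eta> n) t t) y - difs ?hs (slc u0 (\<eta> n) t s) y\<bar> \<le> CT * Ph r * r\<^sup>2" for n
    using slc_increment_le'[OF \<eta>(1) t r ij st(1) s(2), of n y] by (simp only: slc_difs[OF bumpy_eta u0_borel u0_le])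
  ultimately have 1: "\<bar>difs ?hs (V t) y - difs (map ?A ?hs) (V s) ?z\<bar> \<le> CT * Ph r * r\<^sup>2"
    using LIMSEQ_le_const2 by blast
  let ?B = "CE (1 + KE) * r\<^sup>2 * NN r"
  have a: "\<bar>s - t\<bar> \<le> r\<^sup>2" using s by simp
  obtain h' where h': "?A ?h = ?h + dil r h'" "norm h' \<le> 1 + KE" "\<forall>l\<in>F. h' $ l = 0" using E_dil_shift(2)[OF r a ij(1)] by blast
  obtain k' where k': "?A ?k = ?k + dil r k'" "norm k' \<le> 1 + KE" "\<forall>l\<in>F. k' $ l = 0" using E_dil_shift(2)[OF r a ij(2)] by blast
  have d: "\<bar>dif (dil r h') (V s) x\<bar> \<le> ?B" "\<bar>dif (dil r k') (V s) x\<bar> \<le> ?B" for x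
    using dif1_le[OF st(2) r] h' k' by blast+
  \<comment> \<open>The two displaced shifts are replaced one after the other; each replacement is a
    difference of a quantity bounded by \<open>?B\<close>, whence the total 4
    \<open>?B\<close>.\<close>
  have "difs (map ?A ?hs) (V s) ?z - difs ?hs (V s) ?z = dif (?k + dil r k') (dif (dil r h') (V s)) (?z + ?h) + dif ?h (\<lambda>x. dif (dil r k') (V s) (x + ?k)) ?z"
    using h'(1) k'(1) by (simp add: dif_def algebra_simps)
  moreover have "\<bar>dif (?k + dil r k') (dif (dil r h') (V s)) (?z + ?h)\<bar> \<le> 2 * ?B" "\<bar>dif ?h (\<lambda>x. dif (dil r k') (V s) (x + ?k)) ?z\<bar> \<le> 2 * ?B"
    by (intro dif_le d)+
  ultimately have 2: "\<bar>difs (map ?A ?hs) (V s) ?z - difs ?hs (V s) ?z\<bar> \<le> 4 * ?B" by linarith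
  have "?B \<le> CE (1 + KE) * r\<^sup>2 * Ph r" using NN_le_Ph[OF r] CE_nonneg[of "1 + KE"] KE(1) by (intro mult_left_mono) auto
  with 1 2 have "\<bar>difs ?hs (V t) y - difs ?hs (V s) ?z\<bar> \<le> CT * Ph r * r\<^sup>2 + 4 * (CE (1 + KE) * r\<^sup>2 * Ph r)" by linarith
  then have "\<bar>difs ?hs (V t) y - difs ?hs (V s) ?z\<bar> \<le> ((CT + 4 * CE (1 + KE)) * Ph r) * r\<^sup>2" by (simp add: algebra_simps)
  then have "\<bar>difs ?hs (V t) y - difs ?hs (V s) ?z\<bar> / r\<^sup>2 \<le> (CT + 4 * CE (1 + KE)) * Ph r" using r by (simp add: divide_le_eq)
  moreover have "Q r i j t y - Q r i j s ?z = (difs ?hs (V t) y - difs ?hs (V s) ?z) / r\<^sup>2" by (simp add: Q_def diff_divide_distrib)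
  ultimately show ?thesis by (simp add: abs_divide)
qed

end

section \<open>The joint modulus of continuity\<close>

text \<open>Rounds a distance up to a dyadic scale, as required by \<open>dxx_Q\<close>.\<close>

lemma dyadic_between:
  assumes "d > 0" shows "\<exists>m k. d \<le> 2 ^ m / 2 ^ k \<and> 2 ^ m / 2 ^ k \<le> 2 * (d :: real)"
proof -
  obtain k where "1 / d < 2 ^ k" using real_arch_pow[of 2] by auto
  then have k: "1 / 2 ^ k < d" using assms by (simp add: field_simps)
  define P where "P m \<longleftrightarrow> d \<le> 2 ^ m / 2 ^ k" for m :: nat
  obtain m where "d * 2 ^ k < 2 ^ m" using real_arch_pow[of 2] by auto
  then have "P m" by (simp add: P_def field_simps)
  then have P: "P (Least P)" by (rule LeastI)
  \<comment> \<open>The least exponent is positive because 1 / 2^k < d, so its predecessor fails the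
    condition and gives the upper bound.\<close>
  obtain m' where m': "Least P = Suc m'"
    using P k by (cases "Least P") (auto simp: P_def)
  then have "\<not> P m'" using not_less_Least[of m' P] by simp
  then have "2 ^ Suc m' / 2 ^ k \<le> 2 * d" by (simp add: P_def)
  then show ?thesis using P m' unfolding P_def by metis
qed

context kolmogorov
begin

text \<open>The sum of the space and time constants; each of the two uses two comparisons of
  \<open>dxx\<close> with \<open>Q\<close> at cost 4 CE 1, hence 16 CE 1.\<close>

definition CM :: real where "CM = 16 * CE 1 + CE (real CARD('n)) + CT + 4 * CE (1 + KE)"

lemma CM_nonneg: "CM \<ge> 0"
  unfolding CM_def using CE_nonneg[of 1] CE_nonneg[of "real CARD('n)"] CE_nonneg[of "1 + KE"] KE(1) CT_nonneg by simp

end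

context kolmogorov_solution
begin

lemma dxx_space:
  assumes t: "t \<le> T" and ij: "i \<in> F" "j \<in> F" and r: "r = 2 ^ m / 2 ^ k" and q: "qn (x - y) \<le> r"
  shows "\<bar>dxx i j (x, t) - dxx i j (y, t)\<bar> \<le> (8 * CE 1 + CE (real CARD('n))) * Ph r"
proof -
  have r0: "r > 0" using r by simp
  have "CE (real CARD('n)) * NN r \<le> CE (real CARD('n)) * Ph r" by (intro mult_left_mono NN_le_Ph r0 CE_nonneg) simp
  then show ?thesis
    using dxx_Q[OF t ij r, of x] dxx_Q[OF t ij r, of y] Q_space[OF t ij r0 q] by (simp add: algebra_simps)
qed

lemma dxx_time:
  assumes t: "t \<le> T" and ij: "i \<in> F" "j \<in> F" and r: "r = 2 ^ m / 2 ^ k" and s: "s \<le> t" "t - s \<le> r\<^sup>2"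
  shows "\<bar>dxx i j (y, t) - dxx i j (E (s - t) *v y, s)\<bar> \<le> (8 * CE 1 + CT + 4 * CE (1 + KE)) * Ph r"
proof -
  have r0: "r > 0" and sT: "s \<le> T" using r s t by simp_all
  show ?thesis
    using dxx_Q[OF t ij r, of y] dxx_Q[OF sT ij r, of "E (s - t) *v y"] Q_time[OF t r0 ij s, of y] by (simp add: algebra_simps)
qed

text \<open>The intermediate point (E(t1 - t2) x2, t1) lies on the drift line through (x2, t2). It
  is compared with (x1, t1) in space and with (x2, t2) along the drift, matching the two terms of
  \<open>qdist\<close>.\<close>

lemma dxx_estimate:
  assumes t: "t1 \<le> T" "t2 \<le> T" and ij: "i \<in> F" "j \<in> F" and d: "d = qdist ms B (x1, t1) (x2, t2)" "d > 0"
  shows "\<bar>dxx i j (x1, t1) - dxx i j (x2, t2)\<bar> \<le> CM * Ph (2 * d)"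
proof -
  obtain m k where r: "d \<le> 2 ^ m / 2 ^ k" "2 ^ m / 2 ^ k \<le> 2 * d" using dyadic_between[OF d(2)] by blast
  define r where "r = (2 ^ m / 2 ^ k :: real)"
  have r': "d \<le> r" "r \<le> 2 * d" "r > 0" using r d(2) by (simp_all add: r_def)
  let ?y = "E (t1 - t2) *v x2"
  have D: "d = qn (x1 - ?y) + sqrt \<bar>t1 - t2\<bar>" by (simp add: d qdist_def)
  have "sqrt \<bar>t1 - t2\<bar> \<le> r" using D r' qn_nonneg[of "x1 - ?y"] by linarith
  then have tt: "\<bar>t1 - t2\<bar> \<le> r\<^sup>2" using real_le_lsqrt sqrt_le_D by blast
  have "qn (x1 - ?y) \<le> r" using D r' real_sqrt_ge_zero[of "\<bar>t1 - t2\<bar>"] by linarith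
  then have 1: "\<bar>dxx i j (x1, t1) - dxx i j (?y, t1)\<bar> \<le> (8 * CE 1 + CE (real CARD('n))) * Ph r"
    by (rule dxx_space[OF t(1) ij r_def])
  have 2: "\<bar>dxx i j (?y, t1) - dxx i j (x2, t2)\<bar> \<le> (8 * CE 1 + CT + 4 * CE (1 + KE)) * Ph r"
  \<comment> \<open>\<open>dxx_time\<close> starts from the later of the two times. For t1 > t2 it
    starts at the intermediate point, which the flow carries back to x2.\<close>
  proof (cases "t1 \<le> t2")
    case True
    then show ?thesis using dxx_time[OF t(2) ij r_def True, of x2] tt by (simp add: abs_minus_commute)
  next
    case False
    then show ?thesis using dxx_time[OF t(1) ij r_def, of t2 ?y] tt by (simp add: Emat_mv)
  qed
  have "\<bar>dxx i j (x1, t1) - dxx i j (x2, t2)\<bar> \<le> CM * Ph r" using 1 2 by (simp add: CM_def algebra_simps)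
  also have "\<dots> \<le> CM * Ph (2 * d)" using r' CM_nonneg by (intro mult_left_mono Ph_mono)
  finally show ?thesis .
qed

text \<open>Nonnegativity is what allows this term to be added on the right-hand side. Where the
  integrand is not integrable, \<open>integral\<close> is 0 by convention.\<close>

lemma Ufun_nonneg: "r \<ge> 0 \<Longrightarrow> Ufun ms T \<mu> f r \<ge> 0"
proof -
  assume r: "r \<ge> 0"
  let ?g = "\<lambda>z::(real, 'n) vec. exp (- \<mu> * (norm z)\<^sup>2) * integral {0..r * qn z} wo"
  have U: "Ufun ms T \<mu> f r = integral UNIV ?g" by (simp add: Ufun_def wo_def[abs_def])
  have "integral {0..s} wo \<ge> 0" for s
    by (intro integral_nonneg wo_integrable) (auto simp: wo_def w_nonneg)
  then have g: "?g z \<ge> 0" for z by simp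
  show ?thesis
  proof (cases "?g integrable_on UNIV")
    case True
    then show ?thesis unfolding U using g by (intro integral_nonneg) auto
  next
    case False
    then show ?thesis unfolding U by (simp add: not_integrable_integral)
  qed
qed

text \<open>The extension vanishes also at time T, because weak derivatives are tested on the open
  set \<open>ST T\<close>. Shifts in space keep the time, so difference quotients commute with this
  cut-off.\<close>

definition uT where "uT p = indicator (ST T) p * u p"

lemma uT_borel: "uT \<in> borel_measurable borel" and uT_le: "\<bar>uT p\<bar> \<le> Mu"
proof -
  have e: "uT = (\<lambda>p. indicator (ST T) p * u0 p)" by (auto simp: uT_def u0_def ST_def indicator_def)
  have "open (ST T :: ((real, 'n) vec \<times> real) set)" unfolding ST_def by (intro open_Collect_less continuous_intros)
  then show "uT \<in> borel_measurable borel" unfolding e using u0_borel by (intro borel_measurable_times) auto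
  show "\<bar>uT p\<bar> \<le> Mu" unfolding e using u0_le[of p] Mu_nonneg by (auto simp: indicator_def)
qed

lemma difference_quotient_uT:
  "dif (r *\<^sub>R xdir i) (dif (r *\<^sub>R xdir j) uT) p / r\<^sup>2 = indicator (ST T) p * Q r i j (snd p) (fst p)"
  by (cases p) (simp add: dif_def uT_def Q_def V_def xdir_def indicator_def ST_def)

text \<open>The bound at scale 1 is trivial, and \<open>Q_dyadic\<close> carries it to all smaller
  scales; it supplies the dominating constant in \<open>dxx_weak\<close>.\<close>

lemma Q_bounded:
  assumes t: "t \<le> T" and ij: "i \<in> F" "j \<in> F"
  shows "\<bar>Q (1 / 2 ^ n) i j t x\<bar> \<le> 4 * Mu + 4 * CE 1 * Ph 1"
proof -
  have "\<bar>V t y\<bar> \<le> Mu" for y using Mu t by (simp add: V_def)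
  then have "\<bar>dif (1 *\<^sub>R axis i 1) (dif (1 *\<^sub>R axis j 1) (V t)) x\<bar> \<le> 2 * (2 * Mu)" by (intro dif_le)
  then have "\<bar>Q 1 i j t x\<bar> \<le> 4 * Mu" by (simp add: Q_def)
  moreover have "\<bar>Q 1 i j t x - Q (1 / 2 ^ n) i j t x\<bar> \<le> 4 * CE 1 * (Ph (1 / 2) - Ph (1 / 2 ^ n / 2))" by (rule Q_dyadic[OF t _ ij]) simp
  moreover have "4 * CE 1 * (Ph (1 / 2) - Ph (1 / 2 ^ n / 2)) \<le> 4 * CE 1 * Ph 1"
    using Ph_mono[of "1 / 2" 1] Ph_nonneg[of "1 / 2 ^ n / 2"] CE_nonneg[of 1] by (intro mult_left_mono) auto
  ultimately show ?thesis by linarith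
qed

text \<open>The quotients are uniformly bounded and converge pointwise, so they pass to the limit
  against a test function; moved onto the test function by translation, they converge to its second
  derivative. Equating the limits identifies the pointwise limit with the weak derivative.\<close>

lemma dxx_weak:
  assumes ij: "i \<in> F" "j \<in> F"
  shows "weak_dxx (ST T) u i j (dxx i j)"
proof -
  let ?I = "indicator (ST T) :: (real, 'n) vec \<times> real \<Rightarrow> real"
  define q where "q n p = ?I p * Q (1 / 2 ^ n) i j (snd p) (fst p)" for n p
  have q: "q n p = dif ((1 / 2 ^ n) *\<^sub>R xdir i) (dif ((1 / 2 ^ n) *\<^sub>R xdir j) uT) p / (1 / 2 ^ n)\<^sup>2" for n p
    unfolding q_def difference_quotient_uT ..
  let ?C = "4 * Mu + 4 * CE 1 * Ph 1"
  have C: "?C \<ge> 0" using Mu_nonneg CE_nonneg[of 1] Ph_nonneg[of 1] by simp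
  have q_borel: "q n \<in> borel_measurable borel" for n
    using dif_borel[OF dif_borel[OF uT_borel]] by (subst q[abs_def]) (intro borel_measurable_divide, auto)
  have q_le: "\<bar>q n p\<bar> \<le> ?C" for n p
    using Q_bounded[OF _ ij, of "snd p" n "fst p"] C by (auto simp: q_def indicator_def ST_def)
  have q_lim: "(\<lambda>n. q n p) \<longlonglongrightarrow> ?I p * dxx i j p" for p
    using Q_tendsto[OF _ ij, of "snd p" "fst p"] by (auto simp: q_def indicator_def ST_def)
  have g_borel: "(\<lambda>p. ?I p * dxx i j p) \<in> borel_measurable borel"
    by (rule borel_measurable_LIMSEQ_metric[OF q_borel q_lim])
  have g_le: "\<bar>?I p * dxx i j p\<bar> \<le> ?C" for p
    using LIMSEQ_le_const2[OF tendsto_rabs[OF q_lim]] q_le by blast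
  have "Linf (ST T) (dxx i j)"
    unfolding Linf_def set_borel_measurable_def
  proof (intro conjI exI[of _ ?C] AE_I2 impI)
    show "(\<lambda>p. ?I p *\<^sub>R dxx i j p) \<in> borel_measurable lborel" using g_borel by simp
    show "\<bar>dxx i j p\<bar> \<le> ?C" if "p \<in> ST T" for p using g_le[of p] that by simp
  qed
  moreover have "(LINT p:ST T|lborel. u p * dd (xdir i) (dd (xdir j) \<phi>) p) = (LINT p:ST T|lborel. dxx i j p * \<phi> p)"
    if \<phi>: "test_fun (ST T) \<phi>" for \<phi>
  proof -
    have "bounded {p. \<phi> p \<noteq> 0}" using \<phi> compact_imp_bounded bounded_closure_image bounded_subset closure_subset unfolding test_fun_def by metis
    then obtain R where "\<And>p. \<phi> p \<noteq> 0 \<Longrightarrow> norm p \<le> R" unfolding bounded_iff by blast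
    then have \<phi>b: "bumpy \<phi>" using \<phi> unfolding bumpy_def smooth_def test_fun_def by (metis not_le)
    obtain K where K: "K \<ge> 0" "bdk (Suc (Suc 0)) (\<lambda>x. K * expn x) \<phi>" using bumpy_bdk[OF \<phi>b] by blast
    have K2: "bdk 2 (\<lambda>x. K * expn x) \<phi>" using K(2) by (simp add: numeral_2_eq_2 del: bdk.simps)
    have \<phi>_borel [measurable]: "\<phi> \<in> borel_measurable borel" using bdk_borel[OF K(2)] .
    note [measurable] = uT_borel q_borel g_borel
    \<comment> \<open>The shifts change sign when they are moved onto \<phi>.\<close>
    let ?h = "\<lambda>n::nat. - ((1 / 2 ^ n) *\<^sub>R xdir i :: (real, 'n) vec \<times> real)" and ?k = "\<lambda>n::nat. - ((1 / 2 ^ n) *\<^sub>R xdir j :: (real, 'n) vec \<times> real)"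
    define \<phi>q where "\<phi>q n p = dif (?k n) (dif (?h n) \<phi>) p / (1 / 2 ^ n)\<^sup>2" for n p
    have n: "norm (xdir l :: (real, 'n) vec \<times> real) = 1" for l by (simp add: xdir_def norm_Pair)
    have transfer: "(\<integral>p. \<phi> p * q n p \<partial>lborel) = (\<integral>p. uT p * \<phi>q n p \<partial>lborel)" for n
    proof -
      let ?hs = "[(1 / 2 ^ n) *\<^sub>R xdir i, (1 / 2 ^ n) *\<^sub>R xdir j] :: ((real, 'n) vec \<times> real) list"
      \<comment> \<open>The transfer lemma with m = uminus and x = 0, for which x - m z is
        z.\<close>
      have "(\<integral>z. \<phi> z * difs ?hs uT (0 - - z) \<partial>lborel) = (\<integral>z. difs (map uminus ?hs) \<phi> z * uT (0 - - z) \<partial>lborel)"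
        by (rule integral_difs_transfer[OF _ _ _ uT_borel uT_le, where C' = K])
           (use K(2) in \<open>auto intro: bounded_linear_minus bounded_linear_ident simp del: bdk.simps\<close>)
      then have e: "(\<integral>z. \<phi> z * dif (- ?h n) (dif (- ?k n) uT) z \<partial>lborel) = (\<integral>z. uT z * dif (?k n) (dif (?h n) \<phi>) z \<partial>lborel)"
        by (simp add: dif_commute[of "?h n" "?k n"] mult.commute)
      have "(\<integral>p. \<phi> p * q n p \<partial>lborel) = (\<integral>z. \<phi> z * dif (- ?h n) (dif (- ?k n) uT) z / (1 / 2 ^ n)\<^sup>2 \<partial>lborel)"
        by (simp add: q)
      also have "\<dots> = (\<integral>z. uT z * dif (?k n) (dif (?h n) \<phi>) z / (1 / 2 ^ n)\<^sup>2 \<partial>lborel)"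
        unfolding integral_divide_zero e ..
      finally show ?thesis by (simp add: \<phi>q_def)
    qed
    have "(\<lambda>n. \<integral>p. \<phi> p * q n p \<partial>lborel) \<longlonglongrightarrow> (\<integral>p. \<phi> p * (?I p * dxx i j p) \<partial>lborel)"
    proof (rule integral_dominated_convergence[where w = "\<lambda>p. \<bar>\<phi> p\<bar> * ?C"])
      show "integrable lborel (\<lambda>p. \<bar>\<phi> p\<bar> * ?C)" using bdk_expn_integrable[OF K(2)] by simp
      show "AE p in lborel. (\<lambda>n. \<phi> p * q n p) \<longlonglongrightarrow> \<phi> p * (?I p * dxx i j p)" by (intro AE_I2 tendsto_mult_left q_lim)
      show "AE p in lborel. norm (\<phi> p * q n p) \<le> \<bar>\<phi> p\<bar> * ?C" for n
        by (intro AE_I2) (simp only: real_norm_def abs_mult, intro mult_left_mono q_le abs_ge_zero)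
    qed measurable
    moreover have "(\<lambda>n. \<integral>p. uT p * \<phi>q n p \<partial>lborel) \<longlonglongrightarrow> (\<integral>p. uT p * dd (xdir i) (dd (xdir j) \<phi>) p \<partial>lborel)"
    proof (rule integral_dominated_convergence[where w = "\<lambda>p. Mu * ((K * exp 2) * expn p)"])
      have bd: "bdk 0 (\<lambda>p. (norm (xdir i :: (real, 'n) vec \<times> real) * (norm (xdir j :: (real, 'n) vec \<times> real) * (K * expn p)))) (dd (xdir i) (dd (xdir j) \<phi>))"
        by (rule bdk_dd[OF bdk_dd[OF K(2)]])
      show "(\<lambda>p. uT p * dd (xdir i) (dd (xdir j) \<phi>) p) \<in> borel_measurable lborel" using bdk_borel[OF bd] by simp
      have "dif h (dif k \<phi>) \<in> borel_measurable borel" for h k using dif_borel[OF dif_borel[OF \<phi>_borel]] .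
      then show "(\<lambda>p. uT p * \<phi>q n p) \<in> borel_measurable lborel" for n unfolding \<phi>q_def[abs_def] by simp
      show "integrable lborel (\<lambda>p::(real, 'n) vec \<times> real. Mu * ((K * exp 2) * expn p))" using integrable_expn by (intro integrable_mult_right)
      have lim: "(\<lambda>n. \<phi>q n p) \<longlonglongrightarrow> dd (xdir i) (dd (xdir j) \<phi>) p" for p
      proof -
        have "(\<lambda>n. - ((1 / 2 :: real) ^ n)) \<longlonglongrightarrow> - 0" by (intro tendsto_minus LIMSEQ_realpow_zero) auto
        then have "(\<lambda>n. - (1 / 2 ^ n :: real)) \<longlonglongrightarrow> 0" by (simp add: power_divide)
        from mixed_difference_quotient[OF K(2) this, of "xdir j" "xdir i" p] show ?thesis by (simp add: \<phi>q_def)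
      qed
      show "AE p in lborel. (\<lambda>n. uT p * \<phi>q n p) \<longlonglongrightarrow> uT p * dd (xdir i) (dd (xdir j) \<phi>) p" by (intro AE_I2 tendsto_mult_left lim)
      have "\<bar>\<phi>q n p\<bar> \<le> (K * exp 2) * expn p" for n p
      proof -
        have "bdk (length [?k n, ?h n]) (\<lambda>x. K * expn x) \<phi>" using K(2) by (simp del: bdk.simps)
        from bdk_le[OF bdk_difs[OF this], of p]
        have "\<bar>dif (?k n) (dif (?h n) \<phi>) p\<bar> \<le> K * ((1 / 2 ^ n)\<^sup>2 * (exp (1 / 2 ^ n) * exp (1 / 2 ^ n))) * expn p"
          by (simp add: shift_weight_Cons n power2_eq_square mult_ac)
        also have "\<dots> \<le> K * ((1 / 2 ^ n)\<^sup>2 * (exp 1 * exp 1)) * expn p"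
          using K(1) by (intro mult_right_mono mult_left_mono mult_mono) auto
        also have "\<dots> = (K * exp 2 * expn p) * (1 / 2 ^ n)\<^sup>2" by (simp flip: exp_add)
        finally have "\<bar>dif (?k n) (dif (?h n) \<phi>) p\<bar> / (1 / 2 ^ n)\<^sup>2 \<le> K * exp 2 * expn p"
          by (subst pos_divide_le_eq) auto
        then show ?thesis unfolding \<phi>q_def abs_divide by simp
      qed
      then show "AE p in lborel. norm (uT p * \<phi>q n p) \<le> Mu * ((K * exp 2) * expn p)" for n
        using Mu_nonneg by (intro AE_I2) (simp only: real_norm_def abs_mult, intro mult_mono uT_le abs_ge_zero)
    qed
    ultimately have "(\<integral>p. uT p * dd (xdir i) (dd (xdir j) \<phi>) p \<partial>lborel) = (\<integral>p. \<phi> p * (?I p * dxx i j p) \<partial>lborel)"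
      unfolding transfer using LIMSEQ_unique by blast
    then show ?thesis by (simp add: set_lebesgue_integral_def uT_def mult_ac)
  qed
  ultimately show ?thesis unfolding weak_dxx_def by blast
qed

lemma Mfun_nonneg: assumes "r \<ge> 0" shows "Mfun ms T f r \<ge> 0"
proof -
  have "NN r \<ge> 0" using assms NN_nonneg[of r] by (cases "r = 0") (auto simp: NN_def)
  moreover have "integral {0..r} wo \<ge> 0"
    by (intro integral_nonneg wo_integrable) (auto simp: wo_def w_nonneg)
  ultimately show ?thesis using w_nonneg[OF assms] by (simp add: Mfun_Ph Ph_def)
qed

text \<open>Coinciding points are treated separately because \<open>Ph\<close> is estimated at
  positive radii. The constant 2 + CM serves both places: inside it gives 2 d \<le> R, so that
  monotonicity of \<open>Ph\<close> applies, and outside it exceeds CM.\<close>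

lemma dxx_modulus:
  assumes t: "t1 \<le> T" "t2 \<le> T" and ij: "i \<in> F" "j \<in> F"
  shows "\<bar>dxx i j (x1, t1) - dxx i j (x2, t2)\<bar> \<le>
    (2 + CM) * (Mfun ms T f ((2 + CM) * (qdist ms B (x1, t1) (x2, t2) + \<bar>t1 - t2\<bar> powr p)) + Ufun ms T \<mu> f (sqrt \<bar>t2 - t1\<bar>))"
proof -
  define d where "d = qdist ms B (x1, t1) (x2, t2)"
  define R where "R = (2 + CM) * (d + \<bar>t1 - t2\<bar> powr p)"
  have D: "d = qn (x1 - E (t1 - t2) *v x2) + sqrt \<bar>t1 - t2\<bar>" by (simp add: d_def qdist_def)
  have d0: "d \<ge> 0" unfolding D using qn_nonneg by simp
  have R: "2 * d \<le> R" unfolding R_def using d0 CM_nonneg by (intro mult_mono) auto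
  have M: "Mfun ms T f R \<ge> 0" using R d0 by (intro Mfun_nonneg) auto
  have U: "Ufun ms T \<mu> f (sqrt \<bar>t2 - t1\<bar>) \<ge> 0" by (rule Ufun_nonneg) simp
  have "\<bar>dxx i j (x1, t1) - dxx i j (x2, t2)\<bar> \<le> CM * Mfun ms T f R"
  proof (cases "d = 0")
    case True
    have "qn (x1 - E (t1 - t2) *v x2) = 0" "sqrt \<bar>t1 - t2\<bar> = 0"
      using True D qn_nonneg[of "x1 - E (t1 - t2) *v x2"] real_sqrt_ge_zero[of "\<bar>t1 - t2\<bar>"] by linarith+
    then have "x1 = x2" "t1 = t2" using qn_zeroD by fastforce+
    then show ?thesis using M CM_nonneg by simp
  next
    case False
    then have d: "d > 0" using d0 by simp
    have "\<bar>dxx i j (x1, t1) - dxx i j (x2, t2)\<bar> \<le> CM * Ph (2 * d)" by (rule dxx_estimate[OF t ij d_def d])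
    also have "\<dots> \<le> CM * Mfun ms T f R"
      using Ph_mono[of "2 * d" R] w_nonneg[of R] R d CM_nonneg by (intro mult_left_mono) (auto simp: Mfun_Ph)
    finally show ?thesis .
  qed
  also have "\<dots> \<le> (2 + CM) * (Mfun ms T f R + Ufun ms T \<mu> f (sqrt \<bar>t2 - t1\<bar>))"
    using M U CM_nonneg by (intro mult_mono) auto
  finally show ?thesis by (simp add: R_def d_def)
qed

end

theorem mainTheorem15:
  fixes ms :: "nat list" and B :: "((real, 'n::{finite,linorder}) vec, 'n) vec" and \<nu> :: real
  assumes "block_structure ms B" and "\<nu> > 0"
  shows "\<exists>\<mu>>0. \<forall>\<tau> T (K :: ((real, 'n) vec) set). \<tau> < T \<and> compact K \<longrightarrow>
    (\<exists>c>0. \<forall>a u f. elliptic ms \<nu> a \<and> S0tau ms B \<tau> T u \<and> is_Lu ms B T a u f \<and> inD ms T f \<longrightarrow>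
      (\<forall>i\<in>first_vars ms. \<forall>j\<in>first_vars ms. \<exists>g. weak_dxx (ST T) u i j g \<and>
        (\<forall>x1\<in>K. \<forall>x2\<in>K. \<forall>t1\<in>{\<tau>..T}. \<forall>t2\<in>{\<tau>..T}.
           \<bar>g (x1, t1) - g (x2, t2)\<bar> \<le>
             c * (Mfun ms T f (c * (qdist ms B (x1, t1) (x2, t2) + \<bar>t1 - t2\<bar> powr (1 / real (kqN ms))))
                  + Ufun ms T \<mu> f (sqrt \<bar>t2 - t1\<bar>)))))"
proof -
  interpret K: kolmogorov ms B \<nu> using assms by unfold_locales
  have "\<exists>c>0. \<forall>a u f. elliptic ms \<nu> a \<and> S0tau ms B \<tau> T u \<and> is_Lu ms B T a u f \<and> inD ms T f \<longrightarrow>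
      (\<forall>i\<in>first_vars ms. \<forall>j\<in>first_vars ms. \<exists>g. weak_dxx (ST T) u i j g \<and>
        (\<forall>x1\<in>K. \<forall>x2\<in>K. \<forall>t1\<in>{\<tau>..T}. \<forall>t2\<in>{\<tau>..T}.
           \<bar>g (x1, t1) - g (x2, t2)\<bar> \<le>
             c * (Mfun ms T f (c * (qdist ms B (x1, t1) (x2, t2) + \<bar>t1 - t2\<bar> powr (1 / real (kqN ms))))
                  + Ufun ms T 1 f (sqrt \<bar>t2 - t1\<bar>))))"
    if \<tau>T: "\<tau> < T" for \<tau> T and K :: "((real, 'n) vec) set"
  \<comment> \<open>The witness depends on \<open>ms\<close>, \<open>B\<close> and \<nu> alone, as
    \<open>CM\<close> is defined before any solution is fixed.\<close>
  proof (intro exI[of _ "2 + K.CM"] conjI allI impI)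
    show "2 + K.CM > 0" using K.CM_nonneg by simp
    fix a and u f :: "(real, 'n) vec \<times> real \<Rightarrow> real"
    assume "elliptic ms \<nu> a \<and> S0tau ms B \<tau> T u \<and> is_Lu ms B T a u f \<and> inD ms T f"
    then interpret S: kolmogorov_solution ms B \<nu> \<tau> T a u f
      using \<tau>T by unfold_locales auto
    show "\<forall>i\<in>first_vars ms. \<forall>j\<in>first_vars ms. \<exists>g. weak_dxx (ST T) u i j g \<and>
        (\<forall>x1\<in>K. \<forall>x2\<in>K. \<forall>t1\<in>{\<tau>..T}. \<forall>t2\<in>{\<tau>..T}.
           \<bar>g (x1, t1) - g (x2, t2)\<bar> \<le>
             (2 + K.CM) * (Mfun ms T f ((2 + K.CM) * (qdist ms B (x1, t1) (x2, t2) + \<bar>t1 - t2\<bar> powr (1 / real (kqN ms))))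
                  + Ufun ms T 1 f (sqrt \<bar>t2 - t1\<bar>)))"
      using S.dxx_weak S.dxx_modulus by (metis atLeastAtMost_iff)
  qed
  \<comment> \<open>\<open>dxx_modulus\<close> holds for every \<mu>; the value 1 is positive and
    depends on nothing.\<close>
  then show ?thesis by (intro exI[of _ 1]) auto
qed

end
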